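(* Let $p$ be an odd prime, $n\ge p$, with $n_2>1$. Let $\mathfrak t\in[\mathfrak t_n]$ and $\mathfrak s:=f(\mathfrak t)\in\mathrm{Std}(\mathrm{Par}_{n_2}^{\le2})$. Then in $\mathsf{TL}_n^{\mathbb Q}$ $$\mathfrak L_i\mathbb E_{\mathfrak t}=\mathbb E_{\mathfrak t}\mathfrak L_i=c_{\mathfrak s}(i)\mathbb E_{\mathfrak t}\qquad\text{for } i=1,2,\dots,n_2.$$
   Context: **Algebra and tableaux.** $\mathsf{TL}_n^{\Bbbk}$ is the unital $\Bbbk$-algebra on $u_1,\dots,u_{n-1}$ with $u_i^2=2u_i$, $u_iu_ju_i=u_i$ for $|i-j|=1$, $u_iu_j=u_ju_i$ for $|i-j|>1$; equivalently, the algebra with basis non-crossing matchings of $n$ top and $n$ bottom points, $D_1D_2$ being $D_1$ on top of $D_2$ with loops replaced by $2$. $\mathrm{Par}_n^{\le2}$: partitions of $n$ with at most two columns; $\mathrm{Std}(\lambda)$: standard $\lambda$-tableaux; $\mathrm{Std}(\mathrm{Par}_n^{\le2})=\bigcup_\lambda\mathrm{Std}(\lambda)$. Content: $c_{\mathfrak t}(i)=c-r$ if $i$ is in row $r$, column $c$ of $\mathfrak t$. $\mathfrak s\trianglelefteq\mathfrak t$ means that for each $m$ the shape of $\mathfrak s$ restricted to entries $\le m$ is dominated by that of $\mathfrak t$ restricted to entries $\le m$. $\mathfrak S_n$ acts on tableaux by permuting entries; $s_k=(k,k+1)$. **Idempotents.** $\Phi:\mathbb Q\mathfrak S_n\to\mathsf{TL}_n^{\mathbb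 Q}$ is the homomorphism $s_i\mapsto u_i-1$; $L_1=0$, $L_i=\sum_{j<i}(j,i)$, $\mathbf L_i=\Phi(L_i)$. With $\mathcal C$ the set of all contents $c_{\mathfrak s}(i)$ ($\mathfrak s\in\mathrm{Std}(\mathrm{Par}_n^{\le2})$, $1\le i\le n$), $\mathbb E_{\mathfrak t}=\prod_{c\in\mathcal C}\prod_{i:\,c\ne c_{\mathfrak t}(i)}\frac{\mathbf L_i-c}{c_{\mathfrak t}(i)-c}\in\mathsf{TL}_n^{\mathbb Q}$; these form a complete set of orthogonal primitive idempotents. **Basis $f_{\mathfrak s\mathfrak t}$.** For $\mathfrak t\in\mathrm{Std}(\lambda)$, $\lambda\in\mathrm{Par}_n^{\le2}$, the half-diagram $C_{\mathfrak t}$ has $n$ bottom points: going through $1,\dots,n$ in increasing order, raise a vertical line from $i$ if $i$ is in the first column of $\mathfrak t$, and join $i$ to the nearest still vacant line to its left if $i$ is in the second column. For $\mathfrak s,\mathfrak t\in\mathrm{Std}(\lambda)$, $C_{\mathfrak s\mathfrak t}$ is the diagram obtained by placing the horizontal reflection of $C_{\mathfrak s}$ on top of $C_{\mathfrak t}$. Put $f_{\mathfrak s\mathfrak t}:=\mathbb E_{\mathfrak s}C_{\mathfrak s\mathfrak t}\mathbb E_{\mathfrak t}$; these form a $\mathbb Q$-basis of $\mathsf{TL}_n^{\mathbb Q}$. **Classes.** $p$ is an odd prime, $n\ge p$, and $n=(p-1)+n_1$, $n_1=pn_2+r_0$ with $0\le r_0<p$. $\mathfrak t_n$ is the one-column standard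 tableau with $n$ boxes; $[\mathfrak t_n]=\{\mathfrak s\in\mathrm{Std}(\mathrm{Par}_n^{\le2})\mid c_{\mathfrak s}(i)\equiv c_{\mathfrak t_n}(i)\bmod p\ \forall i\}$; $\mathbf e:=\sum_{\mathfrak s\in[\mathfrak t_n]}\mathbb E_{\mathfrak s}$, which lies in $\mathsf{TL}_n^{\mathbb Z_{(p)}}$ ($\mathbb Z_{(p)}$ is the localization of $\mathbb Z$ at $p$). **Blocks and $f$.** For $1\le j\le n_2$, $B_j=\{jp,jp+1,\dots,(j+1)p-1\}$. For $\mathfrak s\in[\mathfrak t_n]$ the numbers of each $B_j$ all lie in one column of $\mathfrak s$, and $f(\mathfrak s)\in\mathrm{Std}(\mathrm{Par}_{n_2}^{\le2})$ is the tableau having $j$ in the first column iff $B_j$ lies in the first column of $\mathfrak s$. **KLR elements.** For $1\le k<n$, $\psi_k\in\mathsf{TL}_n^{\mathbb Z_{(p)}}$ is the image under $\Phi$ of the KLR generator $\psi_k$ of $\mathbb Z_{(p)}\mathfrak S_n$ given by the Hu–Mathas isomorphism; it is the unique element of $\mathsf{TL}_n^{\mathbb Q}$ whose left multiplication is as follows. For $\mathfrak s,\mathfrak a\in\mathrm{Std}(\lambda)$, $\lambda\in\mathrm{Par}_n^{\le2}$, put $\mathfrak t=\mathfrak ss_k$, $r=c_{\mathfrak s}(k)-c_{\mathfrak s}(k+1)$, and let $\alpha=1$ if $\mathfrak t$ is standard with $\mathfrak t\lhd\mathfrak s$, $\alpha=(r^2-1)/r^2$ if $\mathfrak t$ is standard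 with $\mathfrak t\rhd\mathfrak s$. Let $\beta=0$ if $\mathfrak t$ is not standard; otherwise $\beta=\frac{\alpha}{1-r}$ if $r\equiv0$, $\beta=\alpha r$ if $r\equiv1$, $\beta=\frac{\alpha r}{1-r}$ otherwise (congruences mod $p$). Then $\psi_kf_{\mathfrak s\mathfrak a}=\beta f_{\mathfrak t\mathfrak a}-\delta\frac1rf_{\mathfrak s\mathfrak a}$, where $\delta=1$ if $r\equiv0\bmod p$ and $\delta=0$ otherwise (the term $\beta f_{\mathfrak t\mathfrak a}$ is $0$ if $\mathfrak t$ is not standard). **$\mathbb U_i$, $\iota_{KLR}$, $\mathfrak L_i$.** For $1\le i<n_2$ let $I=(i+1)p-1$, $\Psi_j=\psi_{I-j+1}\psi_{I-j+3}\cdots\psi_{I+j-3}\psi_{I+j-1}$ ($j$ factors) for $1\le j\le p$, and $\mathbb U_i=\mathbf e\,\Psi_1\cdots\Psi_{p-1}\Psi_p\Psi_{p-1}\cdots\Psi_1\,\mathbf e$. Assume $n_2>1$. There is an injective (non-unital) algebra homomorphism $\iota_{KLR}:\mathsf{TL}_{n_2}^{\mathbb Z_{(p)}}\to\mathsf{TL}_n^{\mathbb Z_{(p)}}$ with $1\mapsto\mathbf e$, $u_i\mapsto\mathbb U_i$. The Jucys-Murphy elements of the small algebra, $\Phi(L_i)\in\mathsf{TL}_{n_2}^{\mathbb Z_{(p)}}$ (where now $\Phi:\mathbb Z_{(p)}\mathfrak S_{n_2}\to\mathsf{TL}_{n_2}^{\mathbb Z_{(p)}}$, $s_i\mapsto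 u_i-1$, and $L_1=0$, $L_i=\sum_{j<i}(j,i)$, $1\le i\le n_2$), are viewed in $\mathsf{TL}_n^{\mathbb Q}$ via $\iota_{KLR}$; the resulting elements are denoted $\mathfrak L_i$. Explicitly $\mathfrak L_1=0$, $\mathfrak L_{i+1}=(\mathbb U_i-\mathbf e)\mathfrak L_i(\mathbb U_i-\mathbf e)+\mathbb U_i-\mathbf e$. *)

theory Defs
  imports
    Complex_Main
    "HOL-Library.Poly_Mapping"
    "HOL-Library.Disjoint_Sets"
    "HOL-Library.FuncSet"
    "HOL-Combinatorics.Permutations"
    "HOL-Number_Theory.Cong"
begin

section \<open>The Temperley--Lieb algebra over the rationals with loop parameter 2\<close>

text \<open>A point \<open>(l, i)\<close> is the \<open>i\<close>-th point (\<open>i \<ge> 1\<close>) on level \<open>l\<close>; level 0 is the top line and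
  level 1 the bottom line of a diagram.  A diagram is the set of its edges.\<close>

type_synonym point = "nat \<times> nat"
type_synonym diagram = "point set set"
type_synonym tl = "diagram \<Rightarrow>\<^sub>0 rat"

definition points :: "nat \<Rightarrow> point set" where
  "points n = {0, 1} \<times> {1..n}"

text \<open>The position of a point when the boundary of the rectangle is traversed clockwise, starting
  at the top left corner.\<close>

definition circle_pos :: "nat \<Rightarrow> point \<Rightarrow> nat" where
  "circle_pos n x = (if fst x = 0 then snd x else 2 * n + 1 - snd x)"

definition noncrossing :: "nat \<Rightarrow> diagram \<Rightarrow> bool" where
  "noncrossing n D \<longleftrightarrow>
     \<not> (\<exists>a b c d. {a, c} \<in> D \<and> {b, d} \<in> D \<and>
          circle_pos n a < circle_pos n b \<and> circle_pos n b < circle_pos n c \<and>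
          circle_pos n c < circle_pos n d)"

definition diagrams :: "nat \<Rightarrow> diagram set" where
  "diagrams n = {D. partition_on (points n) D \<and> (\<forall>e\<in>D. card e = 2) \<and> noncrossing n D}"

definition TL :: "nat \<Rightarrow> tl set" where
  "TL n = {x. Poly_Mapping.keys x \<subseteq> diagrams n}"

text \<open>\<open>D1\<close> on top of \<open>D2\<close>: the levels of \<open>D2\<close> are moved down by one, so that the bottom line of
  \<open>D1\<close> and the top line of \<open>D2\<close> both become level 1.\<close>

definition stack :: "diagram \<Rightarrow> diagram \<Rightarrow> diagram" where
  "stack D1 D2 = D1 \<union> (`) (map_prod Suc id) ` D2"

definition linked :: "diagram \<Rightarrow> (point \<times> point) set" where
  "linked E = {(x, y). {x, y} \<in> E}\<^sup>*"

text \<open>In the following, \<open>map_prod (\<lambda>l. l div 2) id\<close> renames the outer levels 0 and 2 of a stack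
  to 0 and 1.\<close>

definition diag_comp :: "diagram \<Rightarrow> diagram \<Rightarrow> diagram" where
  "diag_comp D1 D2 =
     {map_prod (\<lambda>l. l div 2) id ` {x, y} | x y.
        x \<in> \<Union>(stack D1 D2) \<and> y \<in> \<Union>(stack D1 D2) \<and> x \<noteq> y \<and> fst x \<noteq> 1 \<and> fst y \<noteq> 1 \<and>
        (x, y) \<in> linked (stack D1 D2)}"

definition loops :: "diagram \<Rightarrow> diagram \<Rightarrow> nat" where
  "loops D1 D2 = card {C \<in> \<Union>(stack D1 D2) // linked (stack D1 D2). fst ` C \<subseteq> {1}}"

definition tl_mult :: "tl \<Rightarrow> tl \<Rightarrow> tl" (infixl "\<cdot>" 70) where
  "x \<cdot> y = (\<Sum>D1\<in>Poly_Mapping.keys x. \<Sum>D2\<in>Poly_Mapping.keys y.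
      Poly_Mapping.single (diag_comp D1 D2)
        (Poly_Mapping.lookup x D1 * Poly_Mapping.lookup y D2 * 2 ^ loops D1 D2))"

definition tl_scale :: "rat \<Rightarrow> tl \<Rightarrow> tl" (infixr "\<odot>" 75) where
  "c \<odot> x = Poly_Mapping.map ((*) c) x"

definition tl_one :: "nat \<Rightarrow> tl" where
  "tl_one n = Poly_Mapping.single {{(0, j), (1, j)} | j. j \<in> {1..n}} 1"

definition tl_u :: "nat \<Rightarrow> nat \<Rightarrow> tl" where
  "tl_u n i = Poly_Mapping.single
     ({{(0, i), (0, i + 1)}, {(1, i), (1, i + 1)}} \<union>
      {{(0, j), (1, j)} | j. j \<in> {1..n} - {i, i + 1}}) 1"

definition tl_prod :: "nat \<Rightarrow> tl list \<Rightarrow> tl" where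
  "tl_prod n xs = foldr (\<cdot>) xs (tl_one n)"


section \<open>The homomorphism \<open>\<Phi>\<close> and the Jucys--Murphy elements\<close>

text \<open>\<open>is_Phi n \<phi>\<close>: \<open>\<phi>\<close> is the restriction to the group \<open>S\<^sub>n\<close> (the permutations of \<open>{1..n}\<close>) of
  the unital algebra homomorphism from the group algebra that sends \<open>s\<^sub>i\<close> to \<open>u\<^sub>i - 1\<close>.  Since the
  \<open>s\<^sub>i\<close> generate \<open>S\<^sub>n\<close>, it determines \<open>\<phi>\<close> on \<open>S\<^sub>n\<close>.\<close>

definition is_Phi :: "nat \<Rightarrow> ((nat \<Rightarrow> nat) \<Rightarrow> tl) \<Rightarrow> bool" where
  "is_Phi n \<phi> \<longleftrightarrow>
     (\<forall>w. w permutes {1..n} \<longrightarrow> \<phi> w \<in> TL n) \<and>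
     \<phi> id = tl_one n \<and>
     (\<forall>v w. v permutes {1..n} \<longrightarrow> w permutes {1..n} \<longrightarrow> \<phi> (v \<circ> w) = \<phi> v \<cdot> \<phi> w) \<and>
     (\<forall>i. 1 \<le> i \<longrightarrow> i < n \<longrightarrow> \<phi> (transpose i (i + 1)) = tl_u n i - tl_one n)"

definition linear_ext :: "((nat \<Rightarrow> nat) \<Rightarrow> tl) \<Rightarrow> ((nat \<Rightarrow> nat) \<Rightarrow>\<^sub>0 rat) \<Rightarrow> tl" where
  "linear_ext \<phi> x = (\<Sum>w\<in>Poly_Mapping.keys x. Poly_Mapping.lookup x w \<odot> \<phi> w)"

definition Phi :: "nat \<Rightarrow> ((nat \<Rightarrow> nat) \<Rightarrow>\<^sub>0 rat) \<Rightarrow> tl" where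
  "Phi n = linear_ext (SOME \<phi>. is_Phi n \<phi>)"

definition jm :: "nat \<Rightarrow> ((nat \<Rightarrow> nat) \<Rightarrow>\<^sub>0 rat)" where
  "jm i = (\<Sum>j\<in>{1..<i}. Poly_Mapping.single (transpose j i) 1)"

definition tl_jm :: "nat \<Rightarrow> nat \<Rightarrow> tl" where
  "tl_jm n i = Phi n (jm i)"


section \<open>Tableaux\<close>

text \<open>A box is a pair (row, column), both counted from 1; partitions are given by their Young
  diagrams.  A tableau is the map sending an entry to its box.\<close>

type_synonym box = "nat \<times> nat"
type_synonym tableau = "nat \<Rightarrow> box"

definition Par2 :: "nat \<Rightarrow> box set set" where
  "Par2 n = {\<nu>. finite \<nu> \<and> card \<nu> = n \<and> \<nu> \<subseteq> {1..} \<times> {1..2} \<and>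
     (\<forall>r c r' c'. (r, c) \<in> \<nu> \<longrightarrow> 1 \<le> r' \<longrightarrow> r' \<le> r \<longrightarrow> 1 \<le> c' \<longrightarrow> c' \<le> c \<longrightarrow> (r', c') \<in> \<nu>)}"

definition Std :: "nat \<Rightarrow> box set \<Rightarrow> tableau set" where
  "Std n \<nu> = {t \<in> extensional {1..n}. bij_betw t {1..n} \<nu> \<and>
     (\<forall>i\<in>{1..n}. \<forall>j\<in>{1..n}.
        fst (t i) = fst (t j) \<and> snd (t i) < snd (t j) \<or>
        snd (t i) = snd (t j) \<and> fst (t i) < fst (t j) \<longrightarrow> i < j)}"

definition Std2 :: "nat \<Rightarrow> tableau set" where
  "Std2 n = (\<Union>\<nu>\<in>Par2 n. Std n \<nu>)"

definition content :: "tableau \<Rightarrow> nat \<Rightarrow> int" where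
  "content t i = int (snd (t i)) - int (fst (t i))"

definition shape_le :: "box set \<Rightarrow> box set \<Rightarrow> bool" where
  "shape_le \<nu> \<mu> \<longleftrightarrow> (\<forall>r. card {b \<in> \<nu>. fst b \<le> r} \<le> card {b \<in> \<mu>. fst b \<le> r})"

definition tab_le :: "nat \<Rightarrow> tableau \<Rightarrow> tableau \<Rightarrow> bool" where
  "tab_le n s t \<longleftrightarrow> (\<forall>m\<in>{1..n}. shape_le (s ` {1..m}) (t ` {1..m}))"

definition tab_less :: "nat \<Rightarrow> tableau \<Rightarrow> tableau \<Rightarrow> bool" where
  "tab_less n s t \<longleftrightarrow> tab_le n s t \<and> s \<noteq> t"

definition tab_swap :: "tableau \<Rightarrow> nat \<Rightarrow> tableau" where
  "tab_swap s k = s \<circ> transpose k (k + 1)"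


section \<open>Idempotents and the seminormal basis\<close>

definition contents :: "nat \<Rightarrow> int set" where
  "contents n = {content s i | s i. s \<in> Std2 n \<and> i \<in> {1..n}}"

text \<open>The factors commute, so the order in which they are listed does not matter.\<close>

definition idem :: "nat \<Rightarrow> tableau \<Rightarrow> tl" where
  "idem n t = tl_prod n
     [(1 / of_int (content t i - c)) \<odot> (tl_jm n i - of_int c \<odot> tl_one n).
        c \<leftarrow> sorted_list_of_set (contents n), i \<leftarrow> [1..<n + 1], c \<noteq> content t i]"

text \<open>The state \<open>(A, V)\<close> consists of the arcs \<open>{a, b}\<close> drawn so far and the list of the bottom points
  of the still vacant lines, from right to left.\<close>

definition half_step :: "tableau \<Rightarrow> nat \<Rightarrow> nat set set \<times> nat list \<Rightarrow> nat set set \<times> nat list" where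
  "half_step t i = (\<lambda>(A, V). if snd (t i) = 1 then (A, i # V) else (insert {hd V, i} A, tl V))"

definition half_diagram :: "nat \<Rightarrow> tableau \<Rightarrow> nat set set \<times> nat list" where
  "half_diagram n t = fold (half_step t) [1..<n + 1] ({}, [])"

text \<open>The vertical lines of the reflected half-diagram of \<open>s\<close> and of the half-diagram of \<open>t\<close> are
  glued together in order.\<close>

definition cell_diagram :: "nat \<Rightarrow> tableau \<Rightarrow> tableau \<Rightarrow> diagram" where
  "cell_diagram n s t =
     (`) (Pair 0) ` fst (half_diagram n s) \<union>
     (`) (Pair 1) ` fst (half_diagram n t) \<union>
     {{(0, a), (1, b)} | a b. (a, b) \<in> set (zip (snd (half_diagram n s)) (snd (half_diagram n t)))}"

definition sn_basis :: "nat \<Rightarrow> tableau \<Rightarrow> tableau \<Rightarrow> tl" where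
  "sn_basis n s t = idem n s \<cdot> Poly_Mapping.single (cell_diagram n s t) 1 \<cdot> idem n t"


section \<open>The class of the one-column tableau\<close>

definition n2 :: "nat \<Rightarrow> nat \<Rightarrow> nat" where
  "n2 p n = (n - (p - 1)) div p"

definition one_col :: "nat \<Rightarrow> tableau" where
  "one_col n = restrict (\<lambda>i. (i, 1)) {1..n}"

definition tab_class :: "nat \<Rightarrow> nat \<Rightarrow> tableau set" where
  "tab_class p n =
     {s \<in> Std2 n. \<forall>i\<in>{1..n}. [content s i = content (one_col n) i] (mod int p)}"

definition e_class :: "nat \<Rightarrow> nat \<Rightarrow> tl" where
  "e_class p n = (\<Sum>s\<in>tab_class p n. idem n s)"

definition block :: "nat \<Rightarrow> nat \<Rightarrow> nat set" where
  "block p j = {j * p..(j + 1) * p - 1}"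

definition f_tab :: "nat \<Rightarrow> nat \<Rightarrow> tableau \<Rightarrow> tableau" where
  "f_tab p n s = (THE t. t \<in> Std2 (n2 p n) \<and>
     (\<forall>j\<in>{1..n2 p n}. snd (t j) = 1 \<longleftrightarrow> (\<forall>b\<in>block p j. snd (s b) = 1)))"


section \<open>KLR elements and the embedded small algebra\<close>

text \<open>If \<open>s\<close> and \<open>t = s s\<^sub>k\<close> are standard, they are comparable, so the last alternative in the
  definition of \<open>\<alpha>\<close> is the case that \<open>t\<close> strictly dominates \<open>s\<close>.\<close>

definition klr_alpha :: "nat \<Rightarrow> nat \<Rightarrow> tableau \<Rightarrow> rat" where
  "klr_alpha n k s = (let r = of_int (content s k - content s (k + 1)) in
     if tab_less n (tab_swap s k) s then 1 else (r\<^sup>2 - 1) / r\<^sup>2)"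

definition klr_beta :: "nat \<Rightarrow> nat \<Rightarrow> nat \<Rightarrow> tableau \<Rightarrow> rat" where
  "klr_beta p n k s =
     (let r = content s k - content s (k + 1); \<alpha> = klr_alpha n k s in
      if tab_swap s k \<notin> Std2 n then 0
      else if [r = 0] (mod int p) then \<alpha> / of_int (1 - r)
      else if [r = 1] (mod int p) then \<alpha> * of_int r
      else \<alpha> * of_int r / of_int (1 - r))"

definition klr_delta :: "nat \<Rightarrow> nat \<Rightarrow> tableau \<Rightarrow> rat" where
  "klr_delta p k s = (if [content s k - content s (k + 1) = 0] (mod int p) then 1 else 0)"

definition is_psi :: "nat \<Rightarrow> nat \<Rightarrow> nat \<Rightarrow> tl \<Rightarrow> bool" where
  "is_psi p n k x \<longleftrightarrow> x \<in> TL n \<and>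
     (\<forall>\<nu>\<in>Par2 n. \<forall>s\<in>Std n \<nu>. \<forall>a\<in>Std n \<nu>.
        x \<cdot> sn_basis n s a =
          (if tab_swap s k \<in> Std n \<nu> then klr_beta p n k s \<odot> sn_basis n (tab_swap s k) a else 0)
          - (klr_delta p k s / of_int (content s k - content s (k + 1))) \<odot> sn_basis n s a)"

definition psi :: "nat \<Rightarrow> nat \<Rightarrow> nat \<Rightarrow> tl" where
  "psi p n k = (THE x. is_psi p n k x)"

text \<open>\<open>Psi p n i j\<close> is the product of the \<open>j\<close> elements \<open>\<psi>\<^bsub>I-j+1\<^esub>, \<psi>\<^bsub>I-j+3\<^esub>, \<dots>, \<psi>\<^bsub>I+j-1\<^esub>\<close>, where
  \<open>I = (i + 1) p - 1\<close>.\<close>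

definition Psi :: "nat \<Rightarrow> nat \<Rightarrow> nat \<Rightarrow> nat \<Rightarrow> tl" where
  "Psi p n i j = (let I = (i + 1) * p - 1 in
     tl_prod n (map (\<lambda>m. psi p n (I - j + 1 + 2 * m)) [0..<j]))"

definition klr_U :: "nat \<Rightarrow> nat \<Rightarrow> nat \<Rightarrow> tl" where
  "klr_U p n i =
     e_class p n \<cdot> tl_prod n (map (Psi p n i) ([1..<p + 1] @ rev [1..<p])) \<cdot> e_class p n"

text \<open>The Jucys--Murphy elements of the small algebra, viewed in the large one; index 0 is a dummy.
  The lemma \<open>klr_jm_eq_image\<close> below shows that these elements are the images of the Jucys--Murphy
  elements under every algebra homomorphism sending \<open>1\<close> to \<open>e\<close> and \<open>u\<^sub>i\<close> to \<open>U\<^sub>i\<close>.\<close>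

fun klr_jm :: "nat \<Rightarrow> nat \<Rightarrow> nat \<Rightarrow> tl" where
  "klr_jm p n 0 = 0"
| "klr_jm p n (Suc 0) = 0"
| "klr_jm p n (Suc (Suc i)) =
     (klr_U p n (Suc i) - e_class p n) \<cdot> klr_jm p n (Suc i) \<cdot> (klr_U p n (Suc i) - e_class p n)
     + klr_U p n (Suc i) - e_class p n"

definition tl_hom :: "nat \<Rightarrow> nat \<Rightarrow> (tl \<Rightarrow> tl) \<Rightarrow> bool" where
  "tl_hom m n \<iota> \<longleftrightarrow>
     (\<forall>x\<in>TL m. \<iota> x \<in> TL n) \<and>
     (\<forall>x\<in>TL m. \<forall>y\<in>TL m. \<iota> (x + y) = \<iota> x + \<iota> y) \<and>
     (\<forall>c. \<forall>x\<in>TL m. \<iota> (c \<odot> x) = c \<odot> \<iota> x) \<and>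
     (\<forall>x\<in>TL m. \<forall>y\<in>TL m. \<iota> (x \<cdot> y) = \<iota> x \<cdot> \<iota> y)"

lemma tl_mult_superset:
  assumes "finite A" "finite B" "Poly_Mapping.keys x \<subseteq> A" "Poly_Mapping.keys y \<subseteq> B"
  shows "x \<cdot> y = (\<Sum>D1\<in>A. \<Sum>D2\<in>B. Poly_Mapping.single (diag_comp D1 D2)
        (Poly_Mapping.lookup x D1 * Poly_Mapping.lookup y D2 * 2 ^ loops D1 D2))"
proof -
  have "x \<cdot> y = (\<Sum>D1\<in>A. \<Sum>D2\<in>Poly_Mapping.keys y. Poly_Mapping.single (diag_comp D1 D2)
        (Poly_Mapping.lookup x D1 * Poly_Mapping.lookup y D2 * 2 ^ loops D1 D2))"
    unfolding tl_mult_def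
    by (rule sum.mono_neutral_left) (use assms in \<open>auto simp: in_keys_iff\<close>)
  also have "\<dots> = (\<Sum>D1\<in>A. \<Sum>D2\<in>B. Poly_Mapping.single (diag_comp D1 D2)
        (Poly_Mapping.lookup x D1 * Poly_Mapping.lookup y D2 * 2 ^ loops D1 D2))"
    by (rule sum.cong[OF refl], rule sum.mono_neutral_left)
      (use assms in \<open>auto simp: in_keys_iff\<close>)
  finally show ?thesis .
qed

lemma tl_mult_add_left: "(x + y) \<cdot> z = x \<cdot> z + y \<cdot> z"
proof -
  let ?A = "Poly_Mapping.keys x \<union> Poly_Mapping.keys y \<union> Poly_Mapping.keys (x + y)"
  let ?B = "Poly_Mapping.keys z"
  note s = tl_mult_superset[of ?A ?B _ z]
  have "x \<cdot> z + y \<cdot> z = (\<Sum>D1\<in>?A. \<Sum>D2\<in>?B. Poly_Mapping.single (diag_comp D1 D2)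
        (Poly_Mapping.lookup (x + y) D1 * Poly_Mapping.lookup z D2 * 2 ^ loops D1 D2))"
    by (subst s[of x], simp, simp, blast, simp, subst s[of y], simp, simp, blast, simp)
      (simp only: lookup_add distrib_right single_add sum.distrib)
  also have "\<dots> = (x + y) \<cdot> z"
    by (rule s[symmetric]) auto
  finally show ?thesis by (rule sym)
qed

lemma tl_mult_add_right: "z \<cdot> (x + y) = z \<cdot> x + z \<cdot> y"
proof -
  let ?A = "Poly_Mapping.keys x \<union> Poly_Mapping.keys y \<union> Poly_Mapping.keys (x + y)"
  let ?B = "Poly_Mapping.keys z"
  note s = tl_mult_superset[of ?B ?A z]
  have "z \<cdot> x + z \<cdot> y = (\<Sum>D1\<in>?B. \<Sum>D2\<in>?A. Poly_Mapping.single (diag_comp D1 D2)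
        (Poly_Mapping.lookup z D1 * Poly_Mapping.lookup (x + y) D2 * 2 ^ loops D1 D2))"
    by (subst s[of x], simp, simp, simp, blast, subst s[of y], simp, simp, simp, blast)
      (simp only: lookup_add distrib_right distrib_left single_add sum.distrib)
  also have "\<dots> = z \<cdot> (x + y)"
    by (rule s[symmetric]) auto
  finally show ?thesis by (rule sym)
qed

lemma tl_mult_sum_left: "(\<Sum>i\<in>I. f i) \<cdot> z = (\<Sum>i\<in>I. f i \<cdot> z)"
  by (induction I rule: infinite_finite_induct) (auto simp: tl_mult_add_left, auto simp: tl_mult_def)

lemma tl_mult_sum_right: "z \<cdot> (\<Sum>i\<in>I. f i) = (\<Sum>i\<in>I. z \<cdot> f i)"
  by (induction I rule: infinite_finite_induct) (auto simp: tl_mult_add_right, auto simp: tl_mult_def)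

lemma tl_scale_1: "1 \<odot> x = x"
  by (rule poly_mapping_eqI) (simp add: tl_scale_def map.rep_eq when_def)

lemma transpose_eq_iff_left: "transpose j i = transpose j' i \<longleftrightarrow> j = j'"
proof
  assume "transpose j i = transpose j' i"
  then have "transpose j i i = transpose j' i i" by (rule fun_cong)
  then show "j = j'" by (simp only: transpose_apply_second)
qed simp

lemma lookup_jm: "Poly_Mapping.lookup (jm i) w = (\<Sum>j\<in>{1..<i}. if transpose j i = w then 1 else 0)"
  by (simp add: jm_def lookup_sum lookup_single when_def)

lemma linear_ext_jm: "linear_ext \<phi> (jm i) = (\<Sum>j\<in>{1..<i}. \<phi> (transpose j i))"
proof -
  have inj: "inj_on (\<lambda>j. transpose j i) {1..<i}"
    by (rule inj_onI) (simp only: transpose_eq_iff_left)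
  have l1: "Poly_Mapping.lookup (jm i) (transpose j i) = 1" if "j \<in> {1..<i}" for j
  proof -
    have "Poly_Mapping.lookup (jm i) (transpose j i) = (\<Sum>j'\<in>{1..<i}. if j' = j then 1 else 0)"
      unfolding lookup_jm by (simp only: transpose_eq_iff_left)
    then show ?thesis using that by simp
  qed
  have keys: "Poly_Mapping.keys (jm i) = (\<lambda>j. transpose j i) ` {1..<i}"
  proof (intro equalityI subsetI)
    fix w assume "w \<in> Poly_Mapping.keys (jm i)"
    then have "Poly_Mapping.lookup (jm i) w \<noteq> 0" by (simp add: in_keys_iff)
    then obtain j where "j \<in> {1..<i}" "(if transpose j i = w then 1 else (0::rat)) \<noteq> 0"
      unfolding lookup_jm by (rule sum.not_neutral_contains_not_neutral)
    then show "w \<in> (\<lambda>j. transpose j i) ` {1..<i}"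
      by (auto split: if_splits)
  qed (use l1 in \<open>auto simp: in_keys_iff\<close>)
  show ?thesis
    unfolding linear_ext_def keys sum.reindex[OF inj] comp_def
    by (rule sum.cong[OF refl]) (simp only: l1 tl_scale_1)
qed

lemma TL_zero: "0 \<in> TL n" and TL_add: "x \<in> TL n \<Longrightarrow> y \<in> TL n \<Longrightarrow> x + y \<in> TL n"
  using Poly_Mapping.keys_add[of x y] by (auto simp: TL_def)

lemma klr_jm_eq_image:
  assumes phi: "is_Phi (n2 p n) \<phi>"
    and hom: "tl_hom (n2 p n) n \<iota>"
    and one: "\<iota> (tl_one (n2 p n)) = e_class p n"
    and gen: "\<And>i. 1 \<le> i \<Longrightarrow> i < n2 p n \<Longrightarrow> \<iota> (tl_u (n2 p n) i) = klr_U p n i"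
    and i: "1 \<le> i" "i \<le> n2 p n"
  shows "\<iota> (linear_ext \<phi> (jm i)) = klr_jm p n i"
proof -
  define m where "m = n2 p n"
  have phiTL: "\<phi> w \<in> TL m" if "w permutes {1..m}" for w
    using phi that by (auto simp: is_Phi_def m_def)
  have phimult: "\<phi> (v \<circ> w) = \<phi> v \<cdot> \<phi> w" if "v permutes {1..m}" "w permutes {1..m}" for v w
    using phi that by (auto simp: is_Phi_def m_def)
  have phiid: "\<phi> id = tl_one m" using phi by (simp add: is_Phi_def m_def)
  have phis: "\<phi> (transpose k (k + 1)) = tl_u m k - tl_one m" if "1 \<le> k" "k < m" for k
    using phi that by (auto simp: is_Phi_def m_def)
  have iadd: "\<iota> (x + y) = \<iota> x + \<iota> y" if "x \<in> TL m" "y \<in> TL m" for x y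
    using hom that by (auto simp: tl_hom_def m_def)
  have imult: "\<iota> (x \<cdot> y) = \<iota> x \<cdot> \<iota> y" if "x \<in> TL m" "y \<in> TL m" for x y
    using hom that by (auto simp: tl_hom_def m_def)
  have i0: "\<iota> 0 = 0" using iadd[of 0 0] by (simp add: TL_zero)
  have isum: "finite J \<Longrightarrow> (\<And>j. j \<in> J \<Longrightarrow> g j \<in> TL m) \<Longrightarrow>
      \<iota> (sum g J) = (\<Sum>j\<in>J. \<iota> (g j)) \<and> sum g J \<in> TL m" for J :: "nat set" and g
    by (induction J rule: finite_induct) (auto simp: i0 TL_zero iadd TL_add)
  have perm: "transpose a b permutes {1..m}" if "a \<in> {1..m}" "b \<in> {1..m}" for a b
    using that by (rule permutes_swap_id)
  have i_s: "\<iota> (\<phi> (transpose k (k + 1))) = klr_U p n k - e_class p n" if "1 \<le> k" "k < m" for k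
  proof -
    have "\<phi> (transpose k (k + 1)) \<in> TL m" "tl_one m \<in> TL m"
      using phiTL[OF perm, of k "k + 1"] phiTL[OF permutes_id] that phiid by auto
    from iadd[OF this] have "\<iota> (tl_u m k) = \<iota> (\<phi> (transpose k (k + 1))) + \<iota> (tl_one m)"
      using phis[OF that] by simp
    then show ?thesis using gen[of k] one that by (simp add: m_def eq_diff_eq)
  qed
  have image: "\<iota> (linear_ext \<phi> (jm k)) = (\<Sum>j\<in>{1..<k}. \<iota> (\<phi> (transpose j k)))" if "k \<le> m" for k
    unfolding linear_ext_jm using that by (intro conjunct1[OF isum]) (auto intro!: phiTL perm)
  have "k \<le> m \<Longrightarrow> \<iota> (linear_ext \<phi> (jm k)) = klr_jm p n k" if "1 \<le> k" for k
    using that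
  proof (induction k rule: dec_induct)
    case base
    then show ?case by (simp add: image)
  next
    case (step k)
    let ?g = "klr_U p n k - e_class p n"
    let ?s = "transpose k (k + 1)"
    have k: "1 \<le> k" "k < m" using step by auto
    have conj: "\<iota> (\<phi> (transpose j (Suc k))) = ?g \<cdot> \<iota> (\<phi> (transpose j k)) \<cdot> ?g"
      if j: "j \<in> {1..<k}" for j
    proof -
      have ps: "?s permutes {1..m}" and pj: "transpose j k permutes {1..m}"
        by (rule perm; use k j in simp)+
      have "transpose j (Suc k) = ?s \<circ> transpose j k \<circ> ?s"
        using j by (auto simp: fun_eq_iff transpose_def)
      then have "\<phi> (transpose j (Suc k)) = \<phi> (?s \<circ> transpose j k) \<cdot> \<phi> ?s"
        using phimult[OF permutes_compose[OF pj ps] ps] by simp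
      then have "\<iota> (\<phi> (transpose j (Suc k))) = \<iota> (\<phi> (?s \<circ> transpose j k)) \<cdot> \<iota> (\<phi> ?s)"
        using imult[OF phiTL[OF permutes_compose[OF pj ps]] phiTL[OF ps]] by simp
      then show ?thesis
        using imult[OF phiTL[OF ps] phiTL[OF pj]] phimult[OF ps pj] i_s[OF k] by simp
    qed
    have "\<iota> (linear_ext \<phi> (jm (Suc k))) =
        (\<Sum>j\<in>{1..<k}. \<iota> (\<phi> (transpose j (Suc k)))) + \<iota> (\<phi> ?s)"
      using k by (subst image) (auto simp: sum.atLeastLessThan_Suc)
    also have "(\<Sum>j\<in>{1..<k}. \<iota> (\<phi> (transpose j (Suc k)))) =
        ?g \<cdot> (\<Sum>j\<in>{1..<k}. \<iota> (\<phi> (transpose j k))) \<cdot> ?g"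
      unfolding tl_mult_sum_left tl_mult_sum_right by (rule sum.cong[OF refl]) (rule conj)
    also have "(\<Sum>j\<in>{1..<k}. \<iota> (\<phi> (transpose j k))) = klr_jm p n k"
      using step k image[of k] by simp
    finally have "\<iota> (linear_ext \<phi> (jm (Suc k))) = ?g \<cdot> klr_jm p n k \<cdot> ?g + ?g"
      using i_s[OF k] by simp
    moreover obtain k' where "k = Suc k'" using k by (cases k) auto
    ultimately show ?case by simp
  qed
  then show ?thesis using i by (simp add: m_def)
qed

end

theory Submission
  imports Defs "HOL-Library.Function_Algebras"
begin

text \<open>The Temperley--Lieb algebra acts faithfully on functions on words in two letters, and iterated
  Clebsch--Gordan embeddings give a basis of joint eigenvectors \<open>v\<^sub>t\<close> of the Jucys--Murphy elements,
  indexed by the standard tableaux \<open>t\<close> with at most two columns (and a weight); every identity can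
  be tested on them.  After rescaling, \<open>\<psi>\<^sub>k v\<^sub>t\<close> is given by the coefficients \<open>\<beta>\<close> and \<open>\<delta>\<close>.  On the class
  of the one-column tableau, \<open>\<Psi>\<^sub>1, \<dots>, \<Psi>\<^bsub>p-1\<^esub>\<close> shuffle two adjacent blocks into each other, and in
  \<open>\<Psi>\<^sub>p\<close> either no entries or all pairs of entries are exchanged, since \<open>\<Psi>\<^bsub>p-1\<^esub>\<close> annihilates
  everything in between.  Multiplying the coefficients shows that \<open>U\<^sub>i - e\<close> maps \<open>v\<^sub>t\<close> to
  \<open>- v\<^sub>t / \<rho> + b v\<^bsub>t'\<^esub>\<close>, where \<open>\<rho>\<close> is the content difference of \<open>i\<close> and \<open>i + 1\<close> in the tableau
  \<open>f t\<close>, \<open>t'\<close> arises from \<open>t\<close> by exchanging the two blocks, and \<open>b b' = 1 - 1 / \<rho>\<^sup>2\<close>: this is the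
  seminormal form of a simple transposition, and the contents follow by induction on \<open>i\<close> from
  \<open>L\<^bsub>i+1\<^esub> = s\<^sub>i L\<^sub>i s\<^sub>i + s\<^sub>i\<close>.\<close>

section \<open>Colourings of diagrams\<close>

text \<open>Almost nothing in the statement can be evaluated directly: \<open>Phi\<close> is a
  choice, \<open>psi\<close> a definite description, and \<open>sn_basis\<close> puts a diagram
  between two long products. What identifies \<open>psi\<close> is that each
  \<open>sn_basis n s a\<close>, with \<open>s\<close> and \<open>a\<close> of one shape, acts as a
  nonzero rank-one operator from the line of \<open>v_a\<close> to that of \<open>v_s\<close>, with
  a scalar \<open>g s * h a\<close>; this product form, a consequence of triangularity for
  dominance, is why one rescaling of the \<open>v_t\<close> absorbs all scalars. The representation
  comes from colouring the lines of a diagram with two colours: a closed loop has two colourings,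
  which is the loop parameter.

  The value \<open>- 1 / \<rho>\<close> has this origin. In \<open>\<Psi>_j\<close> exactly
  \<open>j\<close> pairs are exchanged, of content difference
  \<open>r = p * (\<rho> - 1) + j\<close>, on the way up and again on the way down. The product of
  the two coefficients \<open>\<beta>\<close> is 1 unless \<open>r\<close> is 0, 1 or -1 modulo
  \<open>p\<close>. So below \<open>\<Psi>_p\<close> only \<open>j = 1\<close> and
  \<open>j = p - 1\<close> contribute, together
  \<open>p * (1 - \<rho>) * (p * \<rho>) ^ (p - 1)\<close>; the \<open>p\<close> factors
  \<open>- 1 / (p * \<rho>)\<close> of \<open>\<Psi>_p\<close> reduce this to
  \<open>1 - 1 / \<rho>\<close>, the diagonal entry of \<open>U_i\<close>.\<close>

definition colour :: "nat set \<Rightarrow> nat set \<Rightarrow> point \<Rightarrow> bool" where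
  "colour X Y p \<longleftrightarrow> snd p \<in> (if fst p = 0 then X else Y)"

definition coloured :: "diagram \<Rightarrow> nat set \<Rightarrow> nat set \<Rightarrow> bool" where
  "coloured D X Y \<longleftrightarrow> (\<forall>p q. {p, q} \<in> D \<longrightarrow> colour X Y p = colour X Y q)"

definition covers :: "nat \<Rightarrow> diagram \<Rightarrow> bool" where
  "covers n D \<longleftrightarrow> \<Union>D = points n \<and> (\<forall>e\<in>D. card e = 2)"

definition perfect :: "nat \<Rightarrow> diagram \<Rightarrow> bool" where
  "perfect n D \<longleftrightarrow> partition_on (points n) D \<and> (\<forall>e\<in>D. card e = 2)"

lemma perfect_covers: "perfect n D \<Longrightarrow> covers n D"
  by (auto simp: perfect_def covers_def partition_on_def)

lemma sym_linked: "(x, y) \<in> linked E \<Longrightarrow> (y, x) \<in> linked E"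
proof -
  have "sym {(x, y). {x, y} \<in> E}" by (auto simp: sym_def insert_commute)
  then show "(x, y) \<in> linked E \<Longrightarrow> (y, x) \<in> linked E"
    unfolding linked_def by (meson sym_rtrancl symD)
qed

lemma refl_linked [simp]: "(x, x) \<in> linked E"
  by (simp add: linked_def)

lemma trans_linked: "(x, y) \<in> linked E \<Longrightarrow> (y, z) \<in> linked E \<Longrightarrow> (x, z) \<in> linked E"
  unfolding linked_def by (rule rtrancl_trans)

lemma linked_edge: "{x, y} \<in> E \<Longrightarrow> (x, y) \<in> linked E"
  by (auto simp: linked_def)

lemma linked_class_eq: "(x, y) \<in> linked E \<Longrightarrow> linked E `` {x} = linked E `` {y}"
  by (auto intro: trans_linked sym_linked)

lemma linked_invariant:
  assumes "(x, y) \<in> linked E" and "\<And>p q. {p, q} \<in> E \<Longrightarrow> f p = f q"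
  shows "f x = f y"
  using assms(1) unfolding linked_def by induction (auto dest: assms(2))

lemma stack_edge_iff:
  assumes "covers n D1" "covers n D2"
  shows "{p, q} \<in> stack D1 D2 \<longleftrightarrow> {p, q} \<in> D1 \<or>
    (\<exists>a b. {a, b} \<in> D2 \<and> p = map_prod Suc id a \<and> q = map_prod Suc id b)"
proof -
  have "\<exists>a b. {a, b} \<in> D2 \<and> p = map_prod Suc id a \<and> q = map_prod Suc id b"
    if e: "e \<in> D2" "{p, q} = map_prod Suc id ` e" for e
  proof -
    obtain a b where ab: "e = {a, b}"
      using e assms(2) by (auto simp: covers_def card_2_iff)
    then have "{p, q} = {map_prod Suc id a, map_prod Suc id b}" using e by simp
    then have "p = map_prod Suc id a \<and> q = map_prod Suc id b \<or>
        p = map_prod Suc id b \<and> q = map_prod Suc id a"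
      by (simp only: doubleton_eq_iff)
    moreover have *: "{a, b} \<in> D2" "{b, a} \<in> D2" using e(1) ab by (simp_all add: insert_commute)
    ultimately show ?thesis using * by metis
  qed
  moreover have "{map_prod Suc id a, map_prod Suc id b} \<in> stack D1 D2" if "{a, b} \<in> D2" for a b
    using that unfolding stack_def by (metis UnI2 image_empty image_eqI image_insert)
  ultimately show ?thesis
    unfolding stack_def by blast
qed

lemma Union_stack:
  assumes "covers n D1" "covers n D2"
  shows "\<Union>(stack D1 D2) = {0, 1, 2} \<times> {1..n}"
proof -
  have "\<Union>(stack D1 D2) = \<Union>D1 \<union> map_prod Suc id ` \<Union>D2"
    by (auto simp: stack_def)
  also have "\<dots> = points n \<union> map_prod Suc id ` points n"
    using assms by (simp add: covers_def)
  also have "\<dots> = {0, 1, 2} \<times> {1..n}"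
    by (force simp: points_def image_iff)
  finally show ?thesis .
qed

lemma linked_in_Union:
  assumes "(x, y) \<in> linked E" "x \<in> \<Union>E" shows "y \<in> \<Union>E"
  using assms unfolding linked_def by induction auto

lemma diag_comp_edgeE:
  assumes "covers n D1" "covers n D2" "{p, q} \<in> diag_comp D1 D2"
  shows "p \<in> points n" "q \<in> points n" "p \<noteq> q"
    "((2 * fst p, snd p), (2 * fst q, snd q)) \<in> linked (stack D1 D2)"
proof -
  obtain x y where xy: "{p, q} = map_prod (\<lambda>l. l div 2) id ` {x, y}"
    "x \<in> {0, 1, 2} \<times> {1..n}" "y \<in> {0, 1, 2} \<times> {1..n}" "x \<noteq> y" "fst x \<noteq> 1" "fst y \<noteq> 1"
    "(x, y) \<in> linked (stack D1 D2)"
    using assms(3) unfolding diag_comp_def Union_stack[OF assms(1,2)] by blast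
  have x: "x = (2 * (fst x div 2), snd x)" and y: "y = (2 * (fst y div 2), snd y)"
    using xy(2-) by (auto simp: prod_eq_iff)
  have *: "(p = map_prod (\<lambda>l. l div 2) id x \<and> q = map_prod (\<lambda>l. l div 2) id y) \<or>
     (p = map_prod (\<lambda>l. l div 2) id y \<and> q = map_prod (\<lambda>l. l div 2) id x)"
    using xy(1) by (auto simp: doubleton_eq_iff)
  have **: "(x, y) \<in> linked (stack D1 D2)" "(y, x) \<in> linked (stack D1 D2)"
    using xy(7) sym_linked by auto
  show "((2 * fst p, snd p), (2 * fst q, snd q)) \<in> linked (stack D1 D2)"
    using * ** x y by (auto simp: prod_eq_iff)
  show "p \<in> points n" "q \<in> points n"
    using * xy(2,3) by (auto simp: points_def)
  show "p \<noteq> q" using * x y xy(4) by (auto simp: prod_eq_iff)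
qed

lemma diag_comp_edge_iff:
  assumes "covers n D1" "covers n D2"
  shows "{p, q} \<in> diag_comp D1 D2 \<longleftrightarrow> p \<in> points n \<and> q \<in> points n \<and> p \<noteq> q \<and>
    ((2 * fst p, snd p), (2 * fst q, snd q)) \<in> linked (stack D1 D2)" (is "?L \<longleftrightarrow> ?R")
proof
  assume R: ?R
  let ?x = "(2 * fst p, snd p)" and ?y = "(2 * fst q, snd q)"
  have "{p, q} = map_prod (\<lambda>l. l div 2) id ` {?x, ?y}" by simp
  moreover have "?x \<in> {0, 1, 2} \<times> {1..n}" "?y \<in> {0, 1, 2} \<times> {1..n}" "?x \<noteq> ?y"
    "fst ?x \<noteq> 1" "fst ?y \<noteq> 1" "(?x, ?y) \<in> linked (stack D1 D2)"
    using R by (auto simp: points_def prod_eq_iff)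
  ultimately show ?L
    unfolding diag_comp_def Union_stack[OF assms] by blast
next
  show "?L \<Longrightarrow> ?R" using diag_comp_edgeE[OF assms] by blast
qed

lemma diag_comp_elem:
  assumes "covers n D1" "covers n D2" "e \<in> diag_comp D1 D2"
  obtains p q where "e = {p, q}" "p \<in> points n" "q \<in> points n" "p \<noteq> q"
proof -
  obtain x y where "e = map_prod (\<lambda>l. l div 2) id ` {x, y}"
    using assms(3) unfolding diag_comp_def by blast
  then have e: "e = {map_prod (\<lambda>l. l div 2) id x, map_prod (\<lambda>l. l div 2) id y}" by simp
  then show ?thesis using that diag_comp_edgeE[OF assms(1,2)] assms(3) by metis
qed

text \<open>A set \<open>Y\<close> fits both diagrams iff the resulting colouring of the three
  levels is constant on each component of the stack. A component that reaches an outer level has its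
  colour prescribed by \<open>X\<close> and \<open>Z\<close>; a closed component takes either
  colour, whence the power of 2. So composition of diagrams is multiplication of 0-1-matrices up to
  the loop factor.\<close>

lemma coloured_diag_comp_sum:
  assumes D: "covers n D1" "covers n D2" and XZ: "X \<subseteq> {1..n}" "Z \<subseteq> {1..n}"
  shows "(\<Sum>Y\<in>Pow {1..n}. of_bool (coloured D1 X Y) * of_bool (coloured D2 Y Z)) =
    (2 ^ loops D1 D2 * of_bool (coloured (diag_comp D1 D2) X Z) :: rat)"
proof -
  define E where "E = stack D1 D2"
  define N where "N = ({0, 1, 2} \<times> {1..n} :: point set)"
  have UE: "\<Union>E = N" unfolding E_def N_def by (rule Union_stack[OF D])
  define c where "c Y p = (snd p \<in> (if fst p = 0 then X else if fst p = 1 then Y else Z))"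
    for Y and p :: point
  define good where "good Y \<longleftrightarrow> coloured D1 X Y \<and> coloured D2 Y Z" for Y
  have c_outer: "c Y p = c {} p" if "fst p \<noteq> 1" for Y p
    using that by (simp add: c_def)
  have D1pt: "fst p = 0 \<or> fst p = 1" if "{p, q} \<in> D1" for p q
  proof -
    have "p \<in> \<Union>D1" using that by blast
    then have "p \<in> points n" using D(1) unfolding covers_def by blast
    then show ?thesis by (auto simp: points_def)
  qed
  have good_iff: "good Y \<longleftrightarrow> (\<forall>p q. {p, q} \<in> E \<longrightarrow> c Y p = c Y q)" for Y
  proof -
    have "coloured D1 X Y \<longleftrightarrow> (\<forall>p q. {p, q} \<in> D1 \<longrightarrow> c Y p = c Y q)"
    proof -
      have "colour X Y p = c Y p \<and> colour X Y q = c Y q" if "{p, q} \<in> D1" for p q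
      proof -
        have "{q, p} \<in> D1" using that by (simp add: insert_commute)
        from D1pt[OF that] D1pt[OF this] show ?thesis by (auto simp: colour_def c_def)
      qed
      then show ?thesis unfolding coloured_def by blast
    qed
    moreover have "coloured D2 Y Z \<longleftrightarrow>
        (\<forall>a b. {a, b} \<in> D2 \<longrightarrow> c Y (map_prod Suc id a) = c Y (map_prod Suc id b))"
      by (simp add: coloured_def colour_def c_def)
    ultimately show ?thesis
      unfolding good_def E_def stack_edge_iff[OF D] by blast
  qed
  have good_linked: "c Y p = c Y q" if "good Y" "(p, q) \<in> linked E" for Y p q
    using that(2) by (rule linked_invariant) (use that(1) good_iff in blast)
  define QL where "QL = {C \<in> N // linked E. fst ` C \<subseteq> {1}}"
  have loops: "loops D1 D2 = card QL"
    unfolding loops_def QL_def using UE E_def by simp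
  have finQL: "finite QL"
  proof -
    have "N // linked E = (\<lambda>x. linked E `` {x}) ` N" by (auto simp: quotient_def)
    moreover have "finite N" by (simp add: N_def)
    ultimately show ?thesis by (simp add: QL_def)
  qed
  have cardsum: "(\<Sum>Y\<in>Pow {1..n}. of_bool (coloured D1 X Y) * of_bool (coloured D2 Y Z)) =
      (of_nat (card (Pow {1..n} \<inter> {Y. good Y})) :: rat)"
    by (simp add: good_def flip: of_bool_conj)
  show ?thesis
  proof (cases "coloured (diag_comp D1 D2) X Z")
    \<comment> \<open>A violated edge of the composite comes from two outer points of one component
      with different prescribed colours, so no \<open>Y\<close> fits and both sides are 0.\<close>
    case False
    then obtain p q where pq: "{p, q} \<in> diag_comp D1 D2" "colour X Z p \<noteq> colour X Z q"
      by (auto simp: coloured_def)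
    note e = diag_comp_edgeE[OF D pq(1), folded E_def]
    have "c Y (2 * fst p, snd p) \<noteq> c Y (2 * fst q, snd q)" for Y
      using pq(2) e(1,2) by (auto simp: c_def colour_def points_def)
    with good_linked[OF _ e(4)] have "\<not> good Y" for Y by blast
    then show ?thesis using False cardsum by simp
  next
    case True
    have outer_eq: "c {} p = c {} q"
      if "p \<in> N" "q \<in> N" "fst p \<noteq> 1" "fst q \<noteq> 1" "(p, q) \<in> linked E" for p q
    proof (cases "p = q")
      case False
      let ?p = "(fst p div 2, snd p)" and ?q = "(fst q div 2, snd q)"
      have "(2 * (fst p div 2), snd p) = p" "(2 * (fst q div 2), snd q) = q"
        using that by (auto simp: N_def prod_eq_iff)
      then have "{?p, ?q} \<in> diag_comp D1 D2"
        unfolding diag_comp_edge_iff[OF D] using that False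
        by (auto simp: N_def points_def E_def)
      with True have "colour X Z ?p = colour X Z ?q" by (auto simp: coloured_def)
      then show ?thesis using that by (auto simp: colour_def c_def N_def)
    qed simp
    \<comment> \<open>\<open>h\<close> colours the middle points of the chosen closed components and
      of the components containing a coloured outer point; \<open>g\<close> recovers the choice. The
      fitting \<open>Y\<close> are thus counted by the subsets of \<open>QL\<close>.\<close>
    define h where "h T = {i \<in> {1..n}. linked E `` {(1, i)} \<in> T \<or>
        (\<exists>q\<in>N. fst q \<noteq> 1 \<and> ((1, i), q) \<in> linked E \<and> c {} q)}" for T
    define g where "g Y = {C \<in> QL. \<exists>i\<in>Y. (1, i) \<in> C}" for Y
    have bij: "bij_betw h (Pow QL) (Pow {1..n} \<inter> {Y. good Y})"
    proof (rule bij_betw_byWitness[where f' = g])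
      show "\<forall>T\<in>Pow QL. g (h T) = T"
      proof (intro ballI equalityI subsetI)
        fix T C assume T: "T \<in> Pow QL" and C: "C \<in> g (h T)"
        then obtain i where i: "C \<in> QL" "i \<in> h T" "(1, i) \<in> C" by (auto simp: g_def)
        then obtain x where x: "C = linked E `` {x}" "fst ` C \<subseteq> {1}"
          by (auto simp: QL_def quotient_def)
        then have C': "C = linked E `` {(1, i)}" using i(3) linked_class_eq by auto
        have "linked E `` {(1, i)} \<in> T \<or> (\<exists>q\<in>N. fst q \<noteq> 1 \<and> ((1, i), q) \<in> linked E \<and> c {} q)"
          using i(2) by (simp add: h_def)
        moreover have "\<not> (\<exists>q\<in>N. fst q \<noteq> 1 \<and> ((1, i), q) \<in> linked E \<and> c {} q)"
          using x(2) C' by auto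
        ultimately show "C \<in> T" using C' by metis
      next
        fix T C assume T: "T \<in> Pow QL" and C: "C \<in> T"
        then have "C \<in> QL" by auto
        then obtain x where x: "x \<in> N" "C = linked E `` {x}" "fst ` C \<subseteq> {1}"
          by (auto simp: QL_def quotient_def)
        moreover have "x \<in> linked E `` {x}" by simp
        ultimately have "fst x \<in> {1}" by blast
        then have "fst x = 1" by simp
        then obtain i where i: "x = (1, i)" "i \<in> {1..n}"
          using x(1) by (cases x) (auto simp: N_def)
        then have "i \<in> h T" using C x by (simp add: h_def)
        then show "C \<in> g (h T)" using \<open>C \<in> QL\<close> i x by (auto simp: g_def)
      qed
    next
      show "\<forall>Y\<in>Pow {1..n} \<inter> {Y. good Y}. h (g Y) = Y"
      proof (intro ballI equalityI subsetI)
        fix Y i assume Y: "Y \<in> Pow {1..n} \<inter> {Y. good Y}" and i: "i \<in> h (g Y)"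
        then have disj: "linked E `` {(1, i)} \<in> g Y \<or>
            (\<exists>q\<in>N. fst q \<noteq> 1 \<and> ((1, i), q) \<in> linked E \<and> c {} q)" by (simp add: h_def)
        have gY: "good Y" using Y by simp
        from disj have "c Y (1, i)"
        proof
          assume "linked E `` {(1, i)} \<in> g Y"
          then obtain j where "j \<in> Y" "((1, i), (1, j)) \<in> linked E" by (auto simp: g_def)
          then have "c Y (1, i) = c Y (1, j)" "c Y (1, j)"
            using good_linked[OF gY] by (blast, simp add: c_def)
          then show ?thesis by simp
        next
          assume "\<exists>q\<in>N. fst q \<noteq> 1 \<and> ((1, i), q) \<in> linked E \<and> c {} q"
          then show ?thesis using good_linked[OF gY] c_outer by metis
        qed
        then show "i \<in> Y" by (simp add: c_def)
      next
        fix Y i assume Y: "Y \<in> Pow {1..n} \<inter> {Y. good Y}" and i: "i \<in> Y"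
        then have iN: "(1, i) \<in> N" and in1: "i \<in> {1..n}" by (auto simp: N_def)
        show "i \<in> h (g Y)"
        proof (cases "linked E `` {(1, i)} \<in> QL")
          case True
          then have "linked E `` {(1, i)} \<in> g Y"
            using i refl_linked[of "(1, i)" E] by (auto simp: g_def simp del: refl_linked)
          then show ?thesis using in1 by (simp add: h_def)
        next
          case False
          then obtain q where q: "((1, i), q) \<in> linked E" "fst q \<noteq> 1"
            using iN by (auto simp: QL_def quotient_def)
          then have "q \<in> N" using linked_in_Union[OF q(1)] iN UE by simp
          moreover have "good Y" using Y by simp
          from good_linked[OF this q(1)] have "c Y q" using i by (simp add: c_def)
          then have "c {} q" using c_outer q(2) by blast
          ultimately show ?thesis using q in1 by (auto simp: h_def)
        qed
      qed
    next
      show "h ` Pow QL \<subseteq> Pow {1..n} \<inter> {Y. good Y}"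
      proof clarify
        fix T assume T: "T \<subseteq> QL"
        have key: "c (h T) p \<longleftrightarrow> linked E `` {p} \<in> T \<or>
            (\<exists>q\<in>N. fst q \<noteq> 1 \<and> (p, q) \<in> linked E \<and> c {} q)" if p: "p \<in> N" for p
        proof (cases "fst p = 1")
          case True
          then show ?thesis using p by (cases p) (auto simp: c_def h_def N_def)
        next
          case False
          have "linked E `` {p} \<notin> T"
          proof
            assume "linked E `` {p} \<in> T"
            then have "fst ` (linked E `` {p}) \<subseteq> {1}" using T by (auto simp: QL_def)
            moreover have "p \<in> linked E `` {p}" by simp
        ultimately have "fst p \<in> {1}" by blast
        then show False using False by simp
          qed
          moreover have "c (h T) p = c {} p" using False by (rule c_outer)
          moreover have "(\<exists>q\<in>N. fst q \<noteq> 1 \<and> (p, q) \<in> linked E \<and> c {} q) \<longleftrightarrow> c {} p"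
            using outer_eq[OF p _ False] p False refl_linked by blast
          ultimately show ?thesis by simp
        qed
        have "good (h T)"
          unfolding good_iff
        proof (intro allI impI)
          fix p q assume pq: "{p, q} \<in> E"
          then have N: "p \<in> N" "q \<in> N" using UE by auto
          have l: "(p, q) \<in> linked E" using pq by (rule linked_edge)
          have "(p, x) \<in> linked E \<longleftrightarrow> (q, x) \<in> linked E" for x
            using l by (meson trans_linked sym_linked)
          then show "c (h T) p = c (h T) q"
            unfolding key[OF N(1)] key[OF N(2)] linked_class_eq[OF l] by simp
        qed
        then show "h T \<in> Pow {1..n} \<inter> {Y. good Y}" by (auto simp: h_def)
      qed
    next
      show "g ` (Pow {1..n} \<inter> {Y. good Y}) \<subseteq> Pow QL" by (auto simp: g_def)
    qed
    then have "card (Pow {1..n} \<inter> {Y. good Y}) = card (Pow QL)"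
      by (metis bij_betw_same_card)
    also have "\<dots> = 2 ^ loops D1 D2" by (simp add: card_Pow finQL loops)
    finally show ?thesis using True cardsum by simp
  qed
qed

text \<open>A composite diagram can be recovered from the colourings compatible with it, so that
  identities between diagrams reduce to identities between 0-1-matrices.\<close>

definition forced_edges :: "nat \<Rightarrow> (nat set \<Rightarrow> nat set \<Rightarrow> bool) \<Rightarrow> diagram" where
  "forced_edges n C = {{p, q} | p q. p \<in> points n \<and> q \<in> points n \<and> p \<noteq> q \<and>
     (\<forall>X\<subseteq>{1..n}. \<forall>Z\<subseteq>{1..n}. C X Z \<longrightarrow> colour X Z p = colour X Z q)}"

text \<open>Colouring exactly the component of \<open>p\<close> in the stack is compatible with the
  composite, and it separates \<open>p\<close> from every outer point outside that
  component.\<close>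

lemma forced_edges_diag_comp:
  assumes D: "covers n D1" "covers n D2"
  shows "forced_edges n (coloured (diag_comp D1 D2)) = diag_comp D1 D2"
proof (intro equalityI subsetI)
  fix e assume "e \<in> forced_edges n (coloured (diag_comp D1 D2))"
  then obtain p q where pq: "e = {p, q}" "p \<in> points n" "q \<in> points n" "p \<noteq> q"
    and f: "\<And>X Z. X \<subseteq> {1..n} \<Longrightarrow> Z \<subseteq> {1..n} \<Longrightarrow> coloured (diag_comp D1 D2) X Z \<Longrightarrow>
      colour X Z p = colour X Z q"
    by (auto simp: forced_edges_def)
  define C where "C = linked (stack D1 D2) `` {(2 * fst p, snd p)}"
  define X where "X = {i \<in> {1..n}. (0, i) \<in> C}"
  define Z where "Z = {i \<in> {1..n}. (2, i) \<in> C}"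
  have col: "colour X Z r \<longleftrightarrow> (2 * fst r, snd r) \<in> C" if "r \<in> points n" for r
    using that by (auto simp: colour_def X_def Z_def points_def)
  have "coloured (diag_comp D1 D2) X Z"
    unfolding coloured_def
  proof (intro allI impI)
    fix r s assume "{r, s} \<in> diag_comp D1 D2"
    note rs = diag_comp_edgeE[OF D this]
    show "colour X Z r = colour X Z s"
      unfolding col[OF rs(1)] col[OF rs(2)] C_def
      using rs(4) by (auto intro: trans_linked sym_linked)
  qed
  then have "colour X Z p = colour X Z q" by (intro f) (auto simp: X_def Z_def)
  then have "(2 * fst q, snd q) \<in> C" using col pq(2,3) by (simp add: C_def)
  then show "e \<in> diag_comp D1 D2"
    unfolding pq(1) diag_comp_edge_iff[OF D] using pq by (simp add: C_def)
next
  fix e assume e: "e \<in> diag_comp D1 D2"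
  then obtain p q where pq: "e = {p, q}" "p \<in> points n" "q \<in> points n" "p \<noteq> q"
    by (rule diag_comp_elem[OF D])
  then show "e \<in> forced_edges n (coloured (diag_comp D1 D2))"
    using e unfolding forced_edges_def coloured_def by blast
qed

lemma perfect_edge_unique:
  assumes "perfect n D" "e \<in> D" "e' \<in> D" "x \<in> e" "x \<in> e'"
  shows "e = e'"
proof (rule ccontr)
  assume "e \<noteq> e'"
  then have "e \<inter> e' = {}"
    using assms by (auto simp: perfect_def partition_on_def disjoint_def)
  then show False using assms by blast
qed

lemma perfect_elem:
  assumes "perfect n D" "e \<in> D"
  obtains p q where "e = {p, q}" "p \<in> points n" "q \<in> points n" "p \<noteq> q"
proof -
  have "card e = 2" "e \<subseteq> points n" using assms by (auto simp: perfect_def partition_on_def)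
  then show ?thesis using that by (auto simp: card_2_iff)
qed

lemma perfect_partner:
  assumes "perfect n D" "p \<in> points n"
  obtains q where "{p, q} \<in> D" "q \<in> points n" "p \<noteq> q"
proof -
  have "p \<in> \<Union>D" using assms by (simp add: perfect_def partition_on_def)
  then obtain e where e: "e \<in> D" "p \<in> e" by auto
  then obtain a b where ab: "e = {a, b}" "a \<in> points n" "b \<in> points n" "a \<noteq> b"
    using assms(1) by (elim perfect_elem)
  then have "p = a \<and> {p, b} \<in> D \<or> p = b \<and> {p, a} \<in> D"
    using e ab by (auto simp: insert_commute)
  then show ?thesis using that ab by metis
qed

text \<open>Here the test colouring consists of the two ends of the edge at \<open>p\<close>; it is
  compatible with the other edges because they are disjoint from this one.\<close>

lemma forced_edges_perfect:
  assumes D: "perfect n D"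
  shows "forced_edges n (coloured D) = D"
proof (intro equalityI subsetI)
  fix e assume "e \<in> forced_edges n (coloured D)"
  then obtain p q where pq: "e = {p, q}" "p \<in> points n" "q \<in> points n" "p \<noteq> q"
    and f: "\<And>X Z. X \<subseteq> {1..n} \<Longrightarrow> Z \<subseteq> {1..n} \<Longrightarrow> coloured D X Z \<Longrightarrow> colour X Z p = colour X Z q"
    by (auto simp: forced_edges_def)
  obtain r where r: "{p, r} \<in> D" "r \<in> points n" "p \<noteq> r" using perfect_partner[OF D pq(2)] .
  define X where "X = {i \<in> {1..n}. (0, i) \<in> {p, r}}"
  define Z where "Z = {i \<in> {1..n}. (1, i) \<in> {p, r}}"
  have col: "colour X Z s \<longleftrightarrow> s \<in> {p, r}" if "s \<in> points n" for s
    using that by (cases s) (auto simp: colour_def X_def Z_def points_def)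
  have "coloured D X Z"
    unfolding coloured_def
  proof (intro allI impI)
    fix s t assume st: "{s, t} \<in> D"
    then have "s \<in> points n" "t \<in> points n" using D by (auto simp: perfect_def partition_on_def)
    moreover have "s \<in> {p, r} \<longleftrightarrow> t \<in> {p, r}"
      using perfect_edge_unique[OF D st r(1)] by blast
    ultimately show "colour X Z s = colour X Z t" using col by simp
  qed
  then have "colour X Z p = colour X Z q" by (intro f) (auto simp: X_def Z_def)
  then have "q = r" using col pq(2-4) by simp
  then show "e \<in> D" using r pq by simp
next
  fix e assume e: "e \<in> D"
  then obtain p q where pq: "e = {p, q}" "p \<in> points n" "q \<in> points n" "p \<noteq> q"
    by (rule perfect_elem[OF D])
  then show "e \<in> forced_edges n (coloured D)"
    using e unfolding forced_edges_def coloured_def by blast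
qed

text \<open>Nonzero multiples of 0-1-matrices that agree have the same support, and the support
  determines the diagram. The empty colouring fits every diagram, so the entry at
  \<open>X = Z = {}\<close> reads off the scalar, hence the number of loops.\<close>

lemma diag_comp_eqI:
  assumes D: "covers n D1" "covers n D2" "perfect n D"
    and c: "c \<noteq> 0"
    and eq: "\<And>X Z. X \<subseteq> {1..n} \<Longrightarrow> Z \<subseteq> {1..n} \<Longrightarrow>
      (\<Sum>Y\<in>Pow {1..n}. of_bool (coloured D1 X Y) * of_bool (coloured D2 Y Z)) = (c * of_bool (coloured D X Z) :: rat)"
  shows "diag_comp D1 D2 = D" "2 ^ loops D1 D2 = c"
proof -
  have *: "2 ^ loops D1 D2 * of_bool (coloured (diag_comp D1 D2) X Z) = (c * of_bool (coloured D X Z) :: rat)"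
    if "X \<subseteq> {1..n}" "Z \<subseteq> {1..n}" for X Z
    using eq[OF that] coloured_diag_comp_sum[OF D(1,2) that] by simp
  then have "coloured (diag_comp D1 D2) X Z = coloured D X Z" if "X \<subseteq> {1..n}" "Z \<subseteq> {1..n}" for X Z
    using *[OF that] c by (auto simp: of_bool_def split: if_splits)
  then have "forced_edges n (coloured (diag_comp D1 D2)) = forced_edges n (coloured D)"
    unfolding forced_edges_def by (intro Collect_cong ex_cong1 conj_cong refl) simp
  then show "diag_comp D1 D2 = D"
    using forced_edges_diag_comp[OF D(1,2)] forced_edges_perfect[OF D(3)] by simp
  have "coloured D {} {}" for D by (simp add: coloured_def colour_def)
  then show "2 ^ loops D1 D2 = c" using *[of "{}" "{}"] by simp
qed

section \<open>The matrix of an element of the algebra\<close>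

text \<open>This is the matrix of \<open>x\<close> on the \<open>n\<close>-th tensor power of a
  two-dimensional space, in the basis of words, when cups and caps are given by the standard
  symmetric form.\<close>

definition kern :: "tl \<Rightarrow> nat set \<Rightarrow> nat set \<Rightarrow> rat" where
  "kern x X Y = (\<Sum>D\<in>Poly_Mapping.keys x. Poly_Mapping.lookup x D * of_bool (coloured D X Y))"

lemma kern_superset:
  assumes "finite A" "Poly_Mapping.keys x \<subseteq> A"
  shows "kern x X Y = (\<Sum>D\<in>A. Poly_Mapping.lookup x D * of_bool (coloured D X Y))"
  unfolding kern_def by (rule sum.mono_neutral_left) (use assms in \<open>auto simp: in_keys_iff\<close>)

lemma kern_zero [simp]: "kern 0 X Y = 0"
  by (simp add: kern_def)

lemma kern_add [simp]: "kern (x + y) X Y = kern x X Y + kern y X Y"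
proof -
  let ?A = "Poly_Mapping.keys x \<union> Poly_Mapping.keys y \<union> Poly_Mapping.keys (x + y)"
  have "kern z X Y = (\<Sum>D\<in>?A. Poly_Mapping.lookup z D * of_bool (coloured D X Y))"
    if "z \<in> {x, y, x + y}" for z
    by (rule kern_superset) (use that in auto)
  then show ?thesis by (simp add: lookup_add distrib_right sum.distrib)
qed

lemma lookup_tl_scale [simp]: "Poly_Mapping.lookup (c \<odot> x) D = c * Poly_Mapping.lookup x D"
  by (simp add: tl_scale_def map.rep_eq when_def)

lemma keys_tl_scale: "Poly_Mapping.keys (c \<odot> x) \<subseteq> Poly_Mapping.keys x"
  by (auto simp: in_keys_iff)

lemma kern_scale [simp]: "kern (c \<odot> x) X Y = c * kern x X Y"
proof -
  have "kern (c \<odot> x) X Y =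
      (\<Sum>D\<in>Poly_Mapping.keys x. Poly_Mapping.lookup (c \<odot> x) D * of_bool (coloured D X Y))"
    by (rule kern_superset) (simp_all add: keys_tl_scale)
  also have "\<dots> = c * kern x X Y"
    unfolding kern_def sum_distrib_left by (rule sum.cong) (simp_all add: mult.assoc)
  finally show ?thesis .
qed

lemma kern_uminus [simp]: "kern (- x) X Y = - kern x X Y"
  using kern_add[of x "- x" X Y] by simp

lemma kern_diff [simp]: "kern (x - y) X Y = kern x X Y - kern y X Y"
  using kern_add[of x "- y" X Y] by simp

lemma kern_single [simp]: "kern (Poly_Mapping.single D c) X Y = c * of_bool (coloured D X Y)"
proof -
  have "kern (Poly_Mapping.single D c) X Y =
      (\<Sum>D'\<in>{D}. Poly_Mapping.lookup (Poly_Mapping.single D c) D' * of_bool (coloured D' X Y))"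
    by (rule kern_superset) auto
  then show ?thesis by simp
qed

lemma kern_sum [simp]: "kern (sum f A) X Y = (\<Sum>a\<in>A. kern (f a) X Y)"
  by (induction A rule: infinite_finite_induct) auto

lemma kern_mult:
  assumes x: "\<And>D. D \<in> Poly_Mapping.keys x \<Longrightarrow> covers n D"
    and y: "\<And>D. D \<in> Poly_Mapping.keys y \<Longrightarrow> covers n D"
    and XZ: "X \<subseteq> {1..n}" "Z \<subseteq> {1..n}"
  shows "kern (x \<cdot> y) X Z = (\<Sum>Y\<in>Pow {1..n}. kern x X Y * kern y Y Z)"
proof -
  let ?lx = "Poly_Mapping.lookup x" and ?ly = "Poly_Mapping.lookup y"
  let ?kx = "Poly_Mapping.keys x" and ?ky = "Poly_Mapping.keys y"
  have "kern (x \<cdot> y) X Z = (\<Sum>D1\<in>?kx. \<Sum>D2\<in>?ky. ?lx D1 * ?ly D2 *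
      (2 ^ loops D1 D2 * of_bool (coloured (diag_comp D1 D2) X Z)))"
    unfolding tl_mult_def by (simp add: mult.assoc)
  also have "\<dots> = (\<Sum>D1\<in>?kx. \<Sum>D2\<in>?ky. ?lx D1 * ?ly D2 *
      (\<Sum>Y\<in>Pow {1..n}. of_bool (coloured D1 X Y) * of_bool (coloured D2 Y Z)))"
    by (intro sum.cong refl, subst coloured_diag_comp_sum[OF x y XZ]) auto
  also have "\<dots> = (\<Sum>D1\<in>?kx. \<Sum>D2\<in>?ky. \<Sum>Y\<in>Pow {1..n}.
      (?lx D1 * of_bool (coloured D1 X Y)) * (?ly D2 * of_bool (coloured D2 Y Z)))"
    by (simp only: sum_distrib_left mult_ac)
  also have "\<dots> = (\<Sum>Y\<in>Pow {1..n}. \<Sum>D1\<in>?kx. \<Sum>D2\<in>?ky.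
      (?lx D1 * of_bool (coloured D1 X Y)) * (?ly D2 * of_bool (coloured D2 Y Z)))"
    by (rule trans[OF sum.cong[OF refl sum.swap] sum.swap])
  also have "\<dots> = (\<Sum>Y\<in>Pow {1..n}. kern x X Y * kern y Y Z)"
    by (simp only: kern_def sum_product)
  finally show ?thesis .
qed

section \<open>Generators\<close>

definition one_diag :: "nat \<Rightarrow> diagram" where
  "one_diag n = {{(0, j), (1, j)} | j. j \<in> {1..n}}"

definition u_diag :: "nat \<Rightarrow> nat \<Rightarrow> diagram" where
  "u_diag n i = {{(0, i), (0, i + 1)}, {(1, i), (1, i + 1)}} \<union>
      {{(0, j), (1, j)} | j. j \<in> {1..n} - {i, i + 1}}"

lemma tl_one_eq: "tl_one n = Poly_Mapping.single (one_diag n) 1"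
  by (simp add: tl_one_def one_diag_def)

lemma tl_u_eq: "tl_u n i = Poly_Mapping.single (u_diag n i) 1"
  by (simp add: tl_u_def u_diag_def)

lemma coloured_insert:
  "coloured (insert {a, b} D) X Y \<longleftrightarrow> colour X Y a = colour X Y b \<and> coloured D X Y"
proof
  assume L: "coloured (insert {a, b} D) X Y"
  then show "colour X Y a = colour X Y b \<and> coloured D X Y"
    unfolding coloured_def by blast
next
  assume R: "colour X Y a = colour X Y b \<and> coloured D X Y"
  show "coloured (insert {a, b} D) X Y"
    unfolding coloured_def
  proof (intro allI impI)
    fix p q assume "{p, q} \<in> insert {a, b} D"
    then consider "p = a \<and> q = b \<or> p = b \<and> q = a" | "{p, q} \<in> D"
      by (auto simp: doubleton_eq_iff)
    then show "colour X Y p = colour X Y q"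
    proof cases
      case 1
      then show ?thesis using R by auto
    next
      case 2
      then show ?thesis using R unfolding coloured_def by blast
    qed
  qed
qed

lemma Union_verticals: "\<Union>{{(0, j), (1, j)} | j. j \<in> J} = {0, 1 :: nat} \<times> J"
proof -
  have "\<Union>{{(0, j), (1, j)} | j. j \<in> J} = (\<Union>j\<in>J. {(0, j), (1 :: nat, j)})" by blast
  then show ?thesis by auto
qed

lemma coloured_cong:
  assumes "\<And>p. p \<in> \<Union>D \<Longrightarrow> colour X Y p = colour X' Y' p"
  shows "coloured D X Y \<longleftrightarrow> coloured D X' Y'"
proof -
  have "colour X Y p = colour X' Y' p \<and> colour X Y q = colour X' Y' q" if "{p, q} \<in> D" for p q
    using that by (intro conjI assms) auto
  then show ?thesis unfolding coloured_def by blast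
qed

lemma coloured_verticals:
  "coloured {{(0, j), (1, j)} | j. j \<in> J} X Y \<longleftrightarrow> (\<forall>j\<in>J. j \<in> X \<longleftrightarrow> j \<in> Y)"
proof
  assume c: "coloured {{(0, j), (1, j)} | j. j \<in> J} X Y"
  show "\<forall>j\<in>J. j \<in> X \<longleftrightarrow> j \<in> Y"
  proof
    fix j assume "j \<in> J"
    then have "{(0, j), (1, j)} \<in> {{(0::nat, j), (1, j)} | j. j \<in> J}" by blast
    with c have "colour X Y (0, j) = colour X Y (1, j)" unfolding coloured_def by blast
    then show "j \<in> X \<longleftrightarrow> j \<in> Y" by (simp add: colour_def)
  qed
next
  assume *: "\<forall>j\<in>J. j \<in> X \<longleftrightarrow> j \<in> Y"
  show "coloured {{(0, j), (1, j)} | j. j \<in> J} X Y"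
    unfolding coloured_def
  proof (intro allI impI)
    fix p q :: point assume "{p, q} \<in> {{(0, j), (1, j)} | j. j \<in> J}"
    then obtain j where "j \<in> J" "{p, q} = {(0, j), (1, j)}" by blast
    then show "colour X Y p = colour X Y q" using * by (auto simp: doubleton_eq_iff colour_def)
  qed
qed

lemma coloured_one: 
  assumes "X \<subseteq> {1..n}" "Y \<subseteq> {1..n}"
  shows "coloured (one_diag n) X Y \<longleftrightarrow> X = Y"
  unfolding one_diag_def coloured_verticals using assms by auto

lemma coloured_u:
  "coloured (u_diag n k) X Y \<longleftrightarrow> (k \<in> X \<longleftrightarrow> k + 1 \<in> X) \<and> (k \<in> Y \<longleftrightarrow> k + 1 \<in> Y) \<and>
     (\<forall>j\<in>{1..n} - {k, k + 1}. j \<in> X \<longleftrightarrow> j \<in> Y)"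
proof -
  have "u_diag n k = insert {(0, k), (0, k + 1)} (insert {(1, k), (1, k + 1)}
      {{(0, j), (1, j)} | j. j \<in> {1..n} - {k, k + 1}})"
    by (simp only: u_diag_def Un_insert_left Un_empty_left)
  then show ?thesis
    by (simp only: coloured_insert coloured_verticals) (simp add: colour_def)
qed

lemma perfect_one: "perfect n (one_diag n)"
  unfolding perfect_def partition_on_def
proof (intro conjI)
  show "\<Union>(one_diag n) = points n" unfolding one_diag_def points_def by (rule Union_verticals)
  show "disjoint (one_diag n)" by (auto simp: one_diag_def disjoint_def)
  show "{} \<notin> one_diag n" by (auto simp: one_diag_def)
  show "\<forall>e\<in>one_diag n. card e = 2" by (auto simp: one_diag_def)
qed

lemma perfect_u:
  assumes "1 \<le> k" "k < n" shows "perfect n (u_diag n k)"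
  unfolding perfect_def partition_on_def
proof (intro conjI)
  have "{1..n} = {k, k + 1} \<union> ({1..n} - {k, k + 1})" using assms by auto
  then have "points n = {0, 1} \<times> ({k, k + 1} \<union> ({1..n} - {k, k + 1}))"
    by (simp add: points_def)
  also have "\<dots> = \<Union>(u_diag n k)"
    unfolding u_diag_def Union_Un_distrib Union_verticals by auto
  finally show "\<Union>(u_diag n k) = points n" ..
  show "disjoint (u_diag n k)" by (auto simp: u_diag_def disjoint_def)
  show "{} \<notin> u_diag n k" by (auto simp: u_diag_def)
  show "\<forall>e\<in>u_diag n k. card e = 2" by (auto simp: u_diag_def)
qed

lemma noncrossing_one: "noncrossing n (one_diag n)"
proof -
  have *: "circle_pos n a + circle_pos n c = 2 * n + 1" if "{a, c} \<in> one_diag n" for a c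
  proof -
    obtain j where j: "j \<in> {1..n}" "{a, c} = {(0, j), (1, j)}"
      using \<open>{a, c} \<in> one_diag n\<close> unfolding one_diag_def by blast
    from j(2) have "a = (0, j) \<and> c = (1, j) \<or> a = (1, j) \<and> c = (0, j)"
      by (simp only: doubleton_eq_iff)
    then show ?thesis using j(1) by (elim disjE conjE) (simp_all add: circle_pos_def)
  qed
  show ?thesis
    unfolding noncrossing_def
  proof (intro notI, elim exE conjE)
    fix a b c d
    assume "{a, c} \<in> one_diag n" "{b, d} \<in> one_diag n" "circle_pos n a < circle_pos n b"
      "circle_pos n b < circle_pos n c" "circle_pos n c < circle_pos n d"
    then show False using *[of a c] *[of b d] by linarith
  qed
qed

lemma one_diagrams: "one_diag n \<in> diagrams n"
  using perfect_one noncrossing_one by (auto simp: diagrams_def perfect_def)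

lemma diagrams_perfect: "D \<in> diagrams n \<Longrightarrow> perfect n D"
  by (simp add: diagrams_def perfect_def)

lemma diagrams_covers: "D \<in> diagrams n \<Longrightarrow> covers n D"
  by (simp add: diagrams_perfect perfect_covers)

lemma u_diag_sum:
  fixes f :: "nat set \<Rightarrow> rat"
  assumes k: "1 \<le> k" "k < n" and X: "X \<subseteq> {1..n}"
  shows "(\<Sum>Y\<in>Pow {1..n}. of_bool (coloured (u_diag n k) X Y) * f Y) =
     of_bool (k \<in> X \<longleftrightarrow> k + 1 \<in> X) * (f (X - {k, k + 1}) + f (X \<union> {k, k + 1}))"
proof -
  have *: "coloured (u_diag n k) X Y \<longleftrightarrow> (k \<in> X \<longleftrightarrow> k + 1 \<in> X) \<and> Y \<in> {X - {k, k + 1}, X \<union> {k, k + 1}}"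
    if "Y \<subseteq> {1..n}" for Y
  proof -
    have "(k \<in> Y \<longleftrightarrow> k + 1 \<in> Y) \<and> (\<forall>j\<in>{1..n} - {k, k + 1}. j \<in> X \<longleftrightarrow> j \<in> Y) \<longleftrightarrow>
        Y \<in> {X - {k, k + 1}, X \<union> {k, k + 1}}" (is "?L = ?R")
    proof
      assume L: ?L
      show ?R
      proof (cases "k \<in> Y")
        case True
        then have "Y = X \<union> {k, k + 1}" using L that X by blast
        then show ?thesis by simp
      next
        case False
        then have "Y = X - {k, k + 1}" using L that X by blast
        then show ?thesis by simp
      qed
    qed auto
    then show ?thesis unfolding coloured_u by blast
  qed
  have "(\<Sum>Y\<in>Pow {1..n}. of_bool (coloured (u_diag n k) X Y) * f Y) =
     (\<Sum>Y\<in>Pow {1..n}. if Y \<in> {X - {k, k + 1}, X \<union> {k, k + 1}} then of_bool (k \<in> X \<longleftrightarrow> k + 1 \<in> X) * f Y else 0)"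
    by (rule sum.cong) (auto simp: *)
  also have "\<dots> = (\<Sum>Y\<in>{X - {k, k + 1}, X \<union> {k, k + 1}}. of_bool (k \<in> X \<longleftrightarrow> k + 1 \<in> X) * f Y)"
    by (rule sum.inter_restrict[symmetric, THEN trans[OF _ sum.cong[OF _ refl]], OF _])
      (use X k in auto)
  also have "X - {k, k + 1} \<noteq> X \<union> {k, k + 1}" by blast
  then have "(\<Sum>Y\<in>{X - {k, k + 1}, X \<union> {k, k + 1}}. of_bool (k \<in> X \<longleftrightarrow> k + 1 \<in> X) * f Y) =
     of_bool (k \<in> X \<longleftrightarrow> k + 1 \<in> X) * (f (X - {k, k + 1}) + f (X \<union> {k, k + 1}))"
    by (simp add: distrib_left)
  finally show ?thesis .
qed

lemma one_diag_sum:
  fixes f :: "nat set \<Rightarrow> rat"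
  assumes "X \<subseteq> {1..n}"
  shows "(\<Sum>Y\<in>Pow {1..n}. of_bool (coloured (one_diag n) X Y) * f Y) = f X"
proof -
  have "(\<Sum>Y\<in>Pow {1..n}. of_bool (coloured (one_diag n) X Y) * f Y) =
      (\<Sum>Y\<in>Pow {1..n}. if Y = X then f Y else 0)"
    by (rule sum.cong) (use assms in \<open>auto simp: coloured_one\<close>)
  then show ?thesis using assms by simp
qed

lemma one_diag_sum_right:
  fixes f :: "nat set \<Rightarrow> rat"
  assumes "X \<subseteq> {1..n}"
  shows "(\<Sum>Y\<in>Pow {1..n}. f Y * of_bool (coloured (one_diag n) Y X)) = f X"
proof -
  have "(\<Sum>Y\<in>Pow {1..n}. f Y * of_bool (coloured (one_diag n) Y X)) =
      (\<Sum>Y\<in>Pow {1..n}. if Y = X then f Y else 0)"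
    by (rule sum.cong) (use assms in \<open>auto simp: coloured_one\<close>)
  then show ?thesis using assms by simp
qed

section \<open>Multiplication by a generator\<close>

lemma colour_cong_off:
  assumes "X - {k, k + 1} = X' - {k, k + 1}" "p \<noteq> (0, k)" "p \<noteq> (0, k + 1)"
  shows "colour X Z p = colour X' Z p"
proof (cases "fst p = 0")
  case True
  then have "snd p \<noteq> k" "snd p \<noteq> k + 1" using assms(2,3) by (auto simp: prod_eq_iff)
  then have "snd p \<in> X \<longleftrightarrow> snd p \<in> X - {k, k + 1}" "snd p \<in> X' \<longleftrightarrow> snd p \<in> X' - {k, k + 1}"
    by simp_all
  then have "snd p \<in> X \<longleftrightarrow> snd p \<in> X'" unfolding assms(1) by blast
  then show ?thesis using True by (simp add: colour_def)
qed (simp add: colour_def)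

lemma two_power_eq_1D: "(2 :: rat) ^ m = 1 \<Longrightarrow> m = 0"
  using power_inject_exp[of "2 :: rat" m 0] by simp

text \<open>The product of \<open>u_k\<close> with a diagram in which the top points
  \<open>k\<close> and \<open>k + 1\<close> are joined to \<open>x\<close> and \<open>y\<close>
  rather than to each other: the lower arc of \<open>u_k\<close> fuses their edges into
  \<open>{x, y}\<close>, and its upper arc stays as a new edge.\<close>

definition surgery :: "nat \<Rightarrow> point \<Rightarrow> point \<Rightarrow> diagram \<Rightarrow> diagram" where
  "surgery k x y D = insert {(0, k), (0, k + 1)} (insert {x, y}
     (D - {{(0, k), x}, {(0, k + 1), y}}))"

locale surgery_setup =
  fixes n k :: nat and D :: diagram and x y :: point
  assumes D: "perfect n D" and k: "1 \<le> k" "k < n"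
    and x: "{(0, k), x} \<in> D" and y: "{(0, k + 1), y} \<in> D" and xk: "x \<noteq> (0, k + 1)"
begin

definition "R = D - {{(0, k), x}, {(0, k + 1), y}}"

lemma D_eq: "D = insert {(0, k), x} (insert {(0, k + 1), y} R)"
  unfolding R_def using x y by blast

lemma edges_disj: "{(0, k), x} \<inter> {(0, k + 1), y} = {}"
proof (rule ccontr)
  assume "{(0, k), x} \<inter> {(0, k + 1), y} \<noteq> {}"
  then have "{(0, k), x} = {(0, k + 1), y}"
    using perfect_edge_unique[OF D x y] by blast
  then have "(0, k + 1) \<in> {(0, k), x}" by simp
  then show False using xk by simp
qed

lemma distinct_pts: "x \<noteq> y" "x \<noteq> (0, k)" "y \<noteq> (0, k)" "y \<noteq> (0, k + 1)" "x \<noteq> (0, k + 1)"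
proof -
  have c: "card {(0, k), x} = 2" "card {(0, k + 1), y} = 2"
    using D x y unfolding perfect_def by blast+
  show "x \<noteq> (0, k)" "y \<noteq> (0, k + 1)" using c by auto
  show "x \<noteq> y" "y \<noteq> (0, k)" "x \<noteq> (0, k + 1)" using edges_disj by blast+
qed

lemma R_avoid: "\<Union>R \<inter> {(0, k), (0, k + 1), x, y} = {}"
proof -
  have "e \<inter> {(0, k), (0, k + 1), x, y} = {}" if "e \<in> R" for e
  proof (rule ccontr)
    assume "e \<inter> {(0, k), (0, k + 1), x, y} \<noteq> {}"
    then obtain z where z: "z \<in> e" "z \<in> {(0, k), x} \<or> z \<in> {(0, k + 1), y}" by blast
    have "e \<in> D" using that by (simp add: R_def)
    then have "e = {(0, k), x} \<or> e = {(0, k + 1), y}"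
      using perfect_edge_unique[OF D _ x z(1)] perfect_edge_unique[OF D _ y z(1)] z(2) by blast
    then show False using that by (simp add: R_def)
  qed
  then show ?thesis by blast
qed

lemma surgery_eq: "surgery k x y D = insert {(0, k), (0, k + 1)} (insert {x, y} R)"
  by (simp add: surgery_def R_def)

lemma perfect_surgery: "perfect n (surgery k x y D)"
  unfolding perfect_def partition_on_def
proof (intro conjI)
  have "\<Union>(surgery k x y D) = \<Union>D"
    unfolding surgery_eq by (subst D_eq) auto
  then show "\<Union>(surgery k x y D) = points n"
    using D by (simp add: perfect_def partition_on_def)
  have R: "disjoint R"
    using D by (auto simp: perfect_def partition_on_def R_def disjoint_def)
  have "{x, y} \<inter> {(0, k), (0, k + 1)} = {}" using distinct_pts by auto
  moreover have "e \<inter> {x, y} = {}" "e \<inter> {(0, k), (0, k + 1)} = {}" if "e \<in> R" for e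
    using R_avoid that by blast+
  ultimately show "disjoint (surgery k x y D)"
    unfolding surgery_eq using R unfolding disjoint_def by (metis Int_commute insert_iff)
  show "{} \<notin> surgery k x y D"
    unfolding surgery_eq using D by (auto simp: perfect_def partition_on_def R_def)
  show "\<forall>e\<in>surgery k x y D. card e = 2"
    unfolding surgery_eq using D distinct_pts by (auto simp: perfect_def R_def)
qed

lemma coloured_R:
  "X - {k, k + 1} = X' - {k, k + 1} \<Longrightarrow> coloured R X Z \<longleftrightarrow> coloured R X' Z"
proof (rule coloured_cong)
  fix p assume X: "X - {k, k + 1} = X' - {k, k + 1}" and "p \<in> \<Union>R"
  then have "p \<noteq> (0, k)" "p \<noteq> (0, k + 1)" using R_avoid by auto
  then show "colour X Z p = colour X' Z p"
    using X by (intro colour_cong_off)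
qed

lemma colour_off:
  assumes "X - {k, k + 1} = X' - {k, k + 1}"
  shows "colour X Z x = colour X' Z x" "colour X Z y = colour X' Z y"
  using distinct_pts by (auto intro!: colour_cong_off[OF assms])

text \<open>The two admissible middle colourings give \<open>k\<close> and \<open>k + 1\<close> a
  common colour, which the old edges pass on to \<open>x\<close> and \<open>y\<close>. If
  \<open>x\<close> and \<open>y\<close> agree exactly one of the two fits, otherwise none.\<close>

lemma surgery_sum:
  assumes X: "X \<subseteq> {1..n}"
  shows "(\<Sum>Y\<in>Pow {1..n}. of_bool (coloured (u_diag n k) X Y) * of_bool (coloured D Y Z)) =
    (of_bool (coloured (surgery k x y D) X Z) :: rat)"
proof -
  have c1: "coloured D (X - {k, k + 1}) Z \<longleftrightarrow>
      \<not> colour X Z x \<and> \<not> colour X Z y \<and> coloured R X Z"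
  proof -
    have "X - {k, k + 1} - {k, k + 1} = X - {k, k + 1}" by blast
    note e = coloured_R[OF this, of Z] colour_off[OF this, of Z]
    show ?thesis
      by (subst D_eq, simp only: coloured_insert e) (auto simp: colour_def)
  qed
  have c2: "coloured D (X \<union> {k, k + 1}) Z \<longleftrightarrow> colour X Z x \<and> colour X Z y \<and> coloured R X Z"
  proof -
    have "X \<union> {k, k + 1} - {k, k + 1} = X - {k, k + 1}" by blast
    note e = coloured_R[OF this, of Z] colour_off[OF this, of Z]
    show ?thesis
      by (subst D_eq, simp only: coloured_insert e) (auto simp: colour_def)
  qed
  have c3: "coloured (surgery k x y D) X Z \<longleftrightarrow>
      (k \<in> X \<longleftrightarrow> k + 1 \<in> X) \<and> colour X Z x = colour X Z y \<and> coloured R X Z"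
    unfolding surgery_eq coloured_insert by (simp add: colour_def)
  show ?thesis
    unfolding u_diag_sum[OF k X] c1 c2 c3 by (auto simp: of_bool_def)
qed

lemma diag_comp_surgery:
  "diag_comp (u_diag n k) D = surgery k x y D" "loops (u_diag n k) D = 0"
proof -
  note * = diag_comp_eqI[where c = 1, OF perfect_covers[OF perfect_u[OF k]] perfect_covers[OF D]
      perfect_surgery]
  show "diag_comp (u_diag n k) D = surgery k x y D"
    by (rule *) (simp, simp only: surgery_sum mult_1)
  have "2 ^ loops (u_diag n k) D = (1::rat)"
    by (rule *) (simp, simp only: surgery_sum mult_1)
  then show "loops (u_diag n k) D = 0" by (rule two_power_eq_1D)
qed

end

text \<open>If the two top points are already joined, both middle colourings fit: this is the closed
  loop, and the source of the factor 2.\<close>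

lemma coloured_sum_u_cup:
  assumes D: "perfect n D" and k: "1 \<le> k" "k < n" and cup: "{(0, k), (0, k + 1)} \<in> D"
    and X: "X \<subseteq> {1..n}"
  shows "(\<Sum>Y\<in>Pow {1..n}. of_bool (coloured (u_diag n k) X Y) * of_bool (coloured D Y Z)) =
    (2 * of_bool (coloured D X Z) :: rat)"
proof -
  define R where "R = D - {{(0, k), (0, k + 1)}}"
  have D_eq: "D = insert {(0, k), (0, k + 1)} R" using cup by (auto simp: R_def)
  have avoid: "p \<noteq> (0, k) \<and> p \<noteq> (0, k + 1)" if "p \<in> \<Union>R" for p
  proof (rule ccontr)
    assume p: "\<not> (p \<noteq> (0, k) \<and> p \<noteq> (0, k + 1))"
    obtain e where e: "e \<in> R" "p \<in> e" using \<open>p \<in> \<Union>R\<close> by (elim UnionE)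
    then have "e = {(0, k), (0, k + 1)}"
      using p by (intro perfect_edge_unique[OF D _ cup]) (auto simp: R_def)
    then show False using e by (simp add: R_def)
  qed
  have R: "coloured R X' Z \<longleftrightarrow> coloured R X Z" if X': "X - {k, k + 1} = X' - {k, k + 1}" for X'
  proof (rule coloured_cong)
    fix p assume "p \<in> \<Union>R"
    then have "p \<noteq> (0, k)" "p \<noteq> (0, k + 1)" using avoid by auto
    then show "colour X' Z p = colour X Z p" using X' by (intro colour_cong_off[symmetric])
  qed
  have "X - {k, k + 1} = X - {k, k + 1} - {k, k + 1}" "X - {k, k + 1} = X \<union> {k, k + 1} - {k, k + 1}"
    by auto
  note e = this[THEN R]
  have c1: "coloured D (X - {k, k + 1}) Z \<longleftrightarrow> coloured R X Z"
    by (subst D_eq, simp only: coloured_insert e) (auto simp: colour_def)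
  have c2: "coloured D (X \<union> {k, k + 1}) Z \<longleftrightarrow> coloured R X Z"
    by (subst D_eq, simp only: coloured_insert e) (auto simp: colour_def)
  have c3: "coloured D X Z \<longleftrightarrow> (k \<in> X \<longleftrightarrow> k + 1 \<in> X) \<and> coloured R X Z"
    by (subst D_eq, simp only: coloured_insert) (auto simp: colour_def)
  show ?thesis
    unfolding u_diag_sum[OF k X] c1 c2 c3 by (auto simp: of_bool_def)
qed

section \<open>Surgery preserves the non-crossing condition\<close>

lemma circle_pos_inj: "p \<in> points n \<Longrightarrow> q \<in> points n \<Longrightarrow> circle_pos n p = circle_pos n q \<Longrightarrow> p = q"
  by (cases p; cases q) (auto simp: points_def circle_pos_def split: if_splits)

lemma noncrossingD:
  assumes "noncrossing n D" "{a, c} \<in> D" "{b, d} \<in> D"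
    "circle_pos n a < circle_pos n b" "circle_pos n b < circle_pos n c" "circle_pos n c < circle_pos n d"
  shows False
  using assms unfolding noncrossing_def by blast

text \<open>No position lies strictly between those of the top points \<open>k\<close> and
  \<open>k + 1\<close>, so the new edge joining them crosses nothing. An edge crossing
  \<open>{x, y}\<close> has both neighbours \<open>k\<close> and \<open>k + 1\<close> on the same
  side, and would already cross one of the two old edges that lead there.\<close>

lemma (in surgery_setup) noncrossing_surgery:
  assumes nc: "noncrossing n D"
  shows "noncrossing n (surgery k x y D)"
  unfolding noncrossing_def
proof clarify
  let ?P = "circle_pos n"
  fix a1 a2 b1 b2 c1 c2 d1 d2
  define a b c d where "a = (a1::nat, a2::nat)" "b = (b1::nat, b2::nat)" "c = (c1::nat, c2::nat)"
    "d = (d1::nat, d2::nat)"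
  assume "{(a1, a2), (c1, c2)} \<in> surgery k x y D" "{(b1, b2), (d1, d2)} \<in> surgery k x y D"
    "?P (a1, a2) < ?P (b1, b2)" "?P (b1, b2) < ?P (c1, c2)" "?P (c1, c2) < ?P (d1, d2)"
  then have ac: "{a, c} \<in> surgery k x y D" and bd: "{b, d} \<in> surgery k x y D"
    and ord: "?P a < ?P b" "?P b < ?P c" "?P c < ?P d" by (simp_all add: a_b_c_d_def)
  have pk: "?P (0, k) = k" "?P (0, k + 1) = k + 1" by (simp_all add: circle_pos_def)
  have pts: "p \<in> points n \<and> p \<noteq> (0, k) \<and> p \<noteq> (0, k + 1)" if "p \<in> \<Union>R" for p
  proof -
    have "\<Union>R \<subseteq> \<Union>D" unfolding R_def by (rule Union_mono) simp
    moreover have "\<Union>D = points n" using D by (simp add: perfect_def partition_on_def)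
    ultimately have "p \<in> points n" using that by blast
    then show ?thesis using that R_avoid by blast
  qed
  have kpts: "(0, k) \<in> points n" "(0, k + 1) \<in> points n" using k by (auto simp: points_def)
  have pne: "?P p < k \<or> k + 1 < ?P p" if "p \<in> \<Union>R" for p
    using pts[OF that] circle_pos_inj[OF _ kpts(1), of p] circle_pos_inj[OF _ kpts(2), of p] pk
    by fastforce
  have noK: "{u, v} \<noteq> {(0, k), (0, k + 1)}" if "?P u < ?P w" "?P w < ?P v" for u v w
    using that pk by (auto simp: doubleton_eq_iff)
  have ac': "{a, c} = {x, y} \<or> {a, c} \<in> R" using ac noK[OF ord(1,2)] by (auto simp: surgery_eq)
  have bd': "{b, d} = {x, y} \<or> {b, d} \<in> R" using bd noK[OF ord(2,3)] by (auto simp: surgery_eq)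
  have RD: "e \<in> R \<Longrightarrow> e \<in> D" for e by (simp add: R_def)
  have xy: "\<exists>i j. {u, (0, i)} \<in> D \<and> {v, (0, j)} \<in> D \<and> (i = k \<or> i = k + 1) \<and> (j = k \<or> j = k + 1)"
    if "{u, v} = {x, y}" for u v
  proof -
    have "{x, (0, k)} \<in> D" "{y, (0, k + 1)} \<in> D" using x y by (simp_all add: insert_commute)
    then show ?thesis using that by (auto simp: doubleton_eq_iff)
  qed
  have P0: "?P (0, i) = i" for i by (simp add: circle_pos_def)
  show False
  proof (cases "{a, c} \<in> R")
    case acR: True
    show False
    proof (cases "{b, d} \<in> R")
      case True
      then show False using noncrossingD[OF nc] acR RD ord by blast
    next
      case False
      then obtain i j where ij: "{b, (0, i)} \<in> D" "{d, (0, j)} \<in> D"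
        "i = k \<or> i = k + 1" "j = k \<or> j = k + 1"
        using xy[of b d] bd' by metis
      have ac_ne: "?P a < k \<or> k + 1 < ?P a" "?P c < k \<or> k + 1 < ?P c"
        using pne acR by blast+
      have acD: "{a, c} \<in> D" using acR RD by simp
      \<comment> \<open>According to where \<open>k\<close> and \<open>k + 1\<close> lie relative to
        the ends of \<open>{a, c}\<close>, the old edge at \<open>b\<close> or the one at
        \<open>d\<close> crosses it.\<close>
      consider "k + 1 < ?P a" | "?P a < k" "k + 1 < ?P c" | "?P c < k"
        using ac_ne ord by linarith
      then show False
      proof cases
        case 1
        then show False using noncrossingD[OF nc, of "(0, i)" b a c] ij acD ord P0[of i]
          by (auto simp: insert_commute)
      next
        case 2
        then show False using noncrossingD[OF nc, of a c "(0, j)" d] ij acD ord P0[of j]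
          by (auto simp: insert_commute)
      next
        case 3
        then show False using noncrossingD[OF nc, of a c b "(0, i)"] ij acD ord P0[of i]
          by auto
      qed
    qed
  next
    case False
    then have ace: "{a, c} = {x, y}" using ac' by blast
    then obtain i j where ij: "{a, (0, i)} \<in> D" "{c, (0, j)} \<in> D"
      "i = k \<or> i = k + 1" "j = k \<or> j = k + 1"
      using xy[of a c] by metis
    have "{b, d} \<noteq> {a, c}" using ord by (auto simp: doubleton_eq_iff)
    then have bdR: "{b, d} \<in> R" using bd' ace by simp
    then have bdD: "{b, d} \<in> D" using RD by simp
    have bd_ne: "?P b < k \<or> k + 1 < ?P b" "?P d < k \<or> k + 1 < ?P d"
      using pne bdR by blast+
    consider "k + 1 < ?P b" | "?P b < k" "k + 1 < ?P d" | "?P d < k"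
      using bd_ne ord by linarith
    then show False
    proof cases
      case 1
      then show False using noncrossingD[OF nc, of "(0, j)" c b d] ij bdD ord P0[of j]
        by (auto simp: insert_commute)
    next
      case 2
      then show False using noncrossingD[OF nc, of a "(0, i)" b d] ij bdD ord P0[of i]
        by auto
    next
      case 3
      then show False using noncrossingD[OF nc, of b d c "(0, j)"] ij bdD ord P0[of j]
        by auto
    qed
  qed
qed

lemma diag_comp_u_cases:
  assumes D: "perfect n D" and k: "1 \<le> k" "k < n"
  obtains "{(0, k), (0, k + 1)} \<in> D" | x y where "surgery_setup n k D x y"
proof -
  have "(0, k) \<in> points n" "(0, k + 1) \<in> points n" using k by (auto simp: points_def)
  then obtain x y where "{(0, k), x} \<in> D" "{(0, k + 1), y} \<in> D"
    using perfect_partner[OF D] by metis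
  then show ?thesis using that assms unfolding surgery_setup_def by metis
qed

lemma diag_comp_u_diagrams:
  assumes D: "D \<in> diagrams n" and k: "1 \<le> k" "k < n"
  shows "diag_comp (u_diag n k) D \<in> diagrams n"
  using diagrams_perfect[OF D] k
proof (cases rule: diag_comp_u_cases)
  case 1
  have "diag_comp (u_diag n k) D = D"
    by (rule diag_comp_eqI[where c = 2, OF perfect_covers[OF perfect_u[OF k]] diagrams_covers[OF D]
      diagrams_perfect[OF D]]) (simp, simp only: coloured_sum_u_cup[OF diagrams_perfect[OF D] k 1])
  then show ?thesis using D by simp
next
  case (2 x y)
  then interpret surgery_setup n k D x y .
  show ?thesis
  proof -
    have "noncrossing n D" using D(1) \<open>D \<in> diagrams n\<close> by (simp add: diagrams_def)
    then show ?thesis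
      using diag_comp_surgery(1) perfect_surgery noncrossing_surgery
      unfolding diagrams_def perfect_def by simp
  qed
qed

text \<open>The non-crossing condition is checked for left multiplication by a generator only.
  Diagrams reached in this way are closed under composition, and the Jucys--Murphy elements, the
  idempotents, the cell diagrams and the KLR elements are all shown to lie in their span.\<close>

inductive_set words :: "nat \<Rightarrow> diagram set" for n where
  one: "one_diag n \<in> words n"
| step: "D \<in> words n \<Longrightarrow> 1 \<le> k \<Longrightarrow> k < n \<Longrightarrow> diag_comp (u_diag n k) D \<in> words n"

lemma words_diagrams: "D \<in> words n \<Longrightarrow> D \<in> diagrams n"
  by (induction rule: words.induct) (auto intro: one_diagrams diag_comp_u_diagrams)

lemma diag_comp_one_left: "perfect n D \<Longrightarrow> diag_comp (one_diag n) D = D"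
  by (rule diag_comp_eqI[where c = 1, OF perfect_covers[OF perfect_one] perfect_covers])
    (simp, simp, simp, simp only: one_diag_sum mult_1)

lemma diag_comp_one_right: "perfect n D \<Longrightarrow> diag_comp D (one_diag n) = D"
  by (rule diag_comp_eqI[where c = 1, OF perfect_covers perfect_covers[OF perfect_one]])
    (simp, simp, simp, simp only: one_diag_sum_right mult_1)

lemma loops_one_right:
  assumes "perfect n D" shows "loops D (one_diag n) = 0"
proof -
  have "2 ^ loops D (one_diag n) = (1::rat)"
    by (rule diag_comp_eqI[where c = 1, OF perfect_covers perfect_covers[OF perfect_one]])
      (use assms in \<open>(simp, simp, simp, simp only: one_diag_sum_right mult_1)\<close>)
  then show ?thesis by (rule two_power_eq_1D)
qed

lemma u_words:
  assumes "1 \<le> k" "k < n" shows "u_diag n k \<in> words n"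
  using words.step[OF words.one assms] diag_comp_one_right[OF perfect_u[OF assms]] by simp

text \<open>Associativity of composition is inherited from matrix multiplication; with it, a
  generator in front of the first factor moves to the front of the composite.\<close>

lemma words_diag_comp:
  assumes "D1 \<in> words n" "D2 \<in> words n"
  shows "diag_comp D1 D2 \<in> words n"
  using assms(1)
proof induction
  case one
  then show ?case using assms(2) diag_comp_one_left diagrams_perfect words_diagrams by metis
next
  case (step D1 k)
  let ?U = "u_diag n k"
  have U: "covers n ?U" using step perfect_covers perfect_u by metis
  have c1: "covers n D1" and c2: "covers n D2"
    using step assms(2) diagrams_covers words_diagrams by metis+
  have c12: "covers n (diag_comp D1 D2)"
    using step.IH diagrams_covers words_diagrams by metis
  have cU1: "covers n (diag_comp ?U D1)"
    using words.step[OF step.hyps] diagrams_covers words_diagrams by metis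
  have w: "diag_comp ?U (diag_comp D1 D2) \<in> words n"
    using step by (intro words.step)
  \<comment> \<open>The two bracketings distribute their loops differently between the inner and the
    outer composition; \<open>c\<close> is the ratio that remains.\<close>
  define c :: rat where "c = 2 ^ loops D1 D2 * 2 ^ loops ?U (diag_comp D1 D2) / 2 ^ loops ?U D1"
  have "diag_comp (diag_comp ?U D1) D2 = diag_comp ?U (diag_comp D1 D2)"
  proof (rule diag_comp_eqI[where c = c, OF cU1 c2])
    show "perfect n (diag_comp ?U (diag_comp D1 D2))"
      using w words_diagrams diagrams_perfect by metis
    show "c \<noteq> 0" by (simp add: c_def)
    fix X Z :: "nat set" assume XZ: "X \<subseteq> {1..n}" "Z \<subseteq> {1..n}"
    have "2 ^ loops ?U D1 * (\<Sum>Y\<in>Pow {1..n}. of_bool (coloured (diag_comp ?U D1) X Y) * of_bool (coloured D2 Y Z)) =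
      (\<Sum>Y\<in>Pow {1..n}. (\<Sum>W\<in>Pow {1..n}. of_bool (coloured ?U X W) * of_bool (coloured D1 W Y))
         * of_bool (coloured D2 Y Z) :: rat)"
      unfolding sum_distrib_left
      by (intro sum.cong refl, subst coloured_diag_comp_sum[OF U c1 XZ(1)]) auto
    also have "\<dots> = (\<Sum>Y\<in>Pow {1..n}. \<Sum>W\<in>Pow {1..n}. of_bool (coloured ?U X W) *
        (of_bool (coloured D1 W Y) * of_bool (coloured D2 Y Z)))"
      by (simp only: sum_distrib_right mult.assoc)
    also have "\<dots> = (\<Sum>W\<in>Pow {1..n}. of_bool (coloured ?U X W) *
        (\<Sum>Y\<in>Pow {1..n}. of_bool (coloured D1 W Y) * of_bool (coloured D2 Y Z)))"
      by (subst sum.swap) (simp only: sum_distrib_left)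
    also have "\<dots> = (\<Sum>W\<in>Pow {1..n}. 2 ^ loops D1 D2 * (of_bool (coloured ?U X W) *
        of_bool (coloured (diag_comp D1 D2) W Z)))"
      by (intro sum.cong refl, subst coloured_diag_comp_sum[OF c1 c2 _ XZ(2)]) auto
    also have "\<dots> = 2 ^ loops D1 D2 * (2 ^ loops ?U (diag_comp D1 D2) *
        of_bool (coloured (diag_comp ?U (diag_comp D1 D2)) X Z))"
      unfolding sum_distrib_left[symmetric] coloured_diag_comp_sum[OF U c12 XZ] ..
    finally show "(\<Sum>Y\<in>Pow {1..n}. of_bool (coloured (diag_comp ?U D1) X Y) * of_bool (coloured D2 Y Z)) =
      c * of_bool (coloured (diag_comp ?U (diag_comp D1 D2)) X Z)"
      by (simp add: c_def field_simps)
  qed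
  then show ?case using w by simp
qed

section \<open>The subalgebra spanned by words in the generators\<close>

definition word_alg :: "nat \<Rightarrow> tl set" where
  "word_alg n = {x. Poly_Mapping.keys x \<subseteq> words n}"

lemma word_alg_TL: "x \<in> word_alg n \<Longrightarrow> x \<in> TL n"
  by (auto simp: word_alg_def TL_def words_diagrams)

lemma word_alg_zero [simp]: "0 \<in> word_alg n"
  by (simp add: word_alg_def)

lemma word_alg_add: "x \<in> word_alg n \<Longrightarrow> y \<in> word_alg n \<Longrightarrow> x + y \<in> word_alg n"
  using Poly_Mapping.keys_add[of x y] by (auto simp: word_alg_def)

lemma word_alg_uminus: "x \<in> word_alg n \<Longrightarrow> - x \<in> word_alg n"
  by (simp add: word_alg_def)

lemma word_alg_diff: "x \<in> word_alg n \<Longrightarrow> y \<in> word_alg n \<Longrightarrow> x - y \<in> word_alg n"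
  using word_alg_add[of x n "- y"] word_alg_uminus by simp

lemma word_alg_scale: "x \<in> word_alg n \<Longrightarrow> c \<odot> x \<in> word_alg n"
  using keys_tl_scale[of c x] by (auto simp: word_alg_def)

lemma word_alg_sum: "(\<And>a. a \<in> A \<Longrightarrow> f a \<in> word_alg n) \<Longrightarrow> sum f A \<in> word_alg n"
  by (induction A rule: infinite_finite_induct) (auto intro: word_alg_add)

lemma word_alg_single: "D \<in> words n \<Longrightarrow> Poly_Mapping.single D c \<in> word_alg n"
  by (simp add: word_alg_def)

lemma word_alg_one: "tl_one n \<in> word_alg n"
  by (simp add: tl_one_eq word_alg_single words.one)

lemma word_alg_u: "1 \<le> k \<Longrightarrow> k < n \<Longrightarrow> tl_u n k \<in> word_alg n"
  by (simp add: tl_u_eq word_alg_single u_words)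

lemma word_alg_mult: "x \<in> word_alg n \<Longrightarrow> y \<in> word_alg n \<Longrightarrow> x \<cdot> y \<in> word_alg n"
  unfolding tl_mult_def
  by (intro word_alg_sum word_alg_single words_diag_comp) (auto simp: word_alg_def)

lemma word_alg_prod: "(\<And>x. x \<in> set xs \<Longrightarrow> x \<in> word_alg n) \<Longrightarrow> tl_prod n xs \<in> word_alg n"
  by (induction xs) (auto simp: tl_prod_def intro: word_alg_one word_alg_mult)

lemma kern_word_mult:
  assumes "x \<in> word_alg n" "y \<in> word_alg n" "X \<subseteq> {1..n}" "Z \<subseteq> {1..n}"
  shows "kern (x \<cdot> y) X Z = (\<Sum>Y\<in>Pow {1..n}. kern x X Y * kern y Y Z)"
  using assms by (intro kern_mult) (auto simp: word_alg_def dest!: words_diagrams intro: diagrams_covers)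

lemma tl_mult_one_right:
  assumes "x \<in> TL n" shows "x \<cdot> tl_one n = x"
proof -
  have p: "perfect n D" if "D \<in> Poly_Mapping.keys x" for D
    using assms that diagrams_perfect by (auto simp: TL_def)
  have "x \<cdot> tl_one n = (\<Sum>D\<in>Poly_Mapping.keys x. Poly_Mapping.single D (Poly_Mapping.lookup x D))"
    unfolding tl_mult_def tl_one_eq
    by (auto intro!: sum.cong simp: diag_comp_one_right[OF p] loops_one_right[OF p])
  also have "\<dots> = x" 
    by (rule poly_mapping_eqI) (auto simp: lookup_sum lookup_single when_def in_keys_iff)
  finally show ?thesis .
qed

section \<open>Linear independence of the matrices of non-crossing diagrams\<close>

lemma circle_pos_bij: "bij_betw (circle_pos n) (points n) {1..2 * n}"
  unfolding bij_betw_def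
proof
  show "inj_on (circle_pos n) (points n)"
    by (rule inj_onI) (rule circle_pos_inj)
  show "circle_pos n ` points n = {1..2 * n}"
  proof (intro equalityI subsetI)
    fix m assume m: "m \<in> {1..2 * n}"
    show "m \<in> circle_pos n ` points n"
    proof (cases "m \<le> n")
      case True
      then show ?thesis using m
        by (intro image_eqI[of _ _ "(0, m)"]) (auto simp: points_def circle_pos_def)
    next
      case False
      then show ?thesis using m
        by (intro image_eqI[of _ _ "(1, 2 * n + 1 - m)"]) (auto simp: points_def circle_pos_def)
    qed
  qed (auto simp: points_def circle_pos_def)
qed

lemma finite_points: "finite (points n)"
  by (simp add: points_def)

lemma diagrams_edge_points:
  assumes "D \<in> diagrams n" "{p, q} \<in> D"
  shows "p \<in> points n" "q \<in> points n" "circle_pos n p \<noteq> circle_pos n q"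
proof -
  have "\<Union>D = points n" using assms(1) by (simp add: diagrams_def partition_on_def)
  then show pq: "p \<in> points n" "q \<in> points n" using assms(2) by auto
  have "card {p, q} = 2" using assms by (simp add: diagrams_def)
  then have "p \<noteq> q" by auto
  then show "circle_pos n p \<noteq> circle_pos n q" using pq circle_pos_inj by blast
qed

lemma diagrams_partner_unique:
  assumes "D \<in> diagrams n" "{p, q} \<in> D" "{p, q'} \<in> D"
  shows "q = q'"
  using perfect_edge_unique[OF diagrams_perfect[OF assms(1)] assms(2,3), of p]
  by (auto simp: doubleton_eq_iff)

text \<open>The points strictly between the ends of an edge are matched among themselves, since an
  edge leaving this interval would cross; so their number is even.\<close>

lemma noncrossing_parity:
  assumes D: "D \<in> diagrams n" and pq: "{p, q} \<in> D" and less: "circle_pos n p < circle_pos n q"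
  shows "odd (circle_pos n p + circle_pos n q)"
proof -
  let ?P = "circle_pos n"
  have nc: "noncrossing n D" using D by (simp add: diagrams_def)
  define I where "I = {r \<in> points n. ?P p < ?P r \<and> ?P r < ?P q}"
  have inside: "s \<in> I" if rs: "{r, s} \<in> D" and r: "r \<in> I" for r s
  proof (rule ccontr)
    assume "s \<notin> I"
    have pts: "r \<in> points n" "s \<in> points n" "p \<in> points n" "q \<in> points n"
      using diagrams_edge_points[OF D] rs pq by auto
    have "s \<noteq> p"
      using diagrams_partner_unique[OF D, of s q r] pq rs r by (auto simp: insert_commute I_def)
    moreover have "s \<noteq> q"
      using diagrams_partner_unique[OF D, of s p r] pq rs r by (auto simp: insert_commute I_def)
    ultimately have ne: "?P s \<noteq> ?P p" "?P s \<noteq> ?P q" using pts circle_pos_inj by blast+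
    have r': "?P p < ?P r" "?P r < ?P q" using r by (auto simp: I_def)
    have "{s, r} \<in> D" using rs by (simp add: insert_commute)
    then have "\<not> ?P s < ?P p" "\<not> ?P q < ?P s"
      using noncrossingD[OF nc, of s r p q] noncrossingD[OF nc, of p q r s] rs pq r' by blast+
    then show False using ne \<open>s \<notin> I\<close> pts by (auto simp: I_def)
  qed
  define C where "C = {e \<in> D. e \<subseteq> I}"
  have "\<Union>C = I"
  proof (intro equalityI subsetI)
    fix r assume r: "r \<in> I"
    then have "r \<in> points n" by (simp add: I_def)
    then obtain s where s: "{r, s} \<in> D" using perfect_partner[OF diagrams_perfect[OF D]] by metis
    then have "{r, s} \<in> C" using inside[OF s r] r by (simp add: C_def)
    then show "r \<in> \<Union>C" by blast
  qed (auto simp: C_def)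
  moreover have "card (\<Union>C) = sum card C"
  proof (rule card_Union_disjoint)
    have "disjoint D" using D by (simp add: diagrams_def partition_on_def)
    then show "pairwise disjnt C" unfolding C_def disjoint_def pairwise_def disjnt_def by blast
    show "finite A" if "A \<in> C" for A
      using that finite_points[of n] by (auto simp: C_def I_def intro: finite_subset)
  qed
  moreover have "sum card C = 2 * card C"
  proof -
    have "sum card C = (\<Sum>e\<in>C. 2)"
      by (rule sum.cong) (use D in \<open>auto simp: C_def diagrams_def\<close>)
    then show ?thesis by simp
  qed
  ultimately have even: "even (card I)" by simp
  have "?P ` I = {?P p<..<?P q}"
  proof (intro equalityI subsetI)
    fix m assume m: "m \<in> {?P p<..<?P q}"
    have "?P q \<le> 2 * n"
      using bij_betwE[OF circle_pos_bij[of n]] diagrams_edge_points(2)[OF D pq] by fastforce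
    then have "m \<in> {1..2 * n}" using m by auto
    then obtain r where "r \<in> points n" "m = ?P r"
      using circle_pos_bij[of n] unfolding bij_betw_def by blast
    then show "m \<in> ?P ` I" using m by (auto simp: I_def)
  qed (auto simp: I_def)
  moreover have "inj_on ?P I"
    by (rule inj_onI) (use circle_pos_inj in \<open>unfold I_def, blast\<close>)
  ultimately have "card I = ?P q - ?P p - 1"
    using card_image[of ?P I] by simp
  then have "even (?P q - ?P p - 1)" using even by simp
  then show ?thesis using less by presburger
qed

definition opener :: "nat \<Rightarrow> diagram \<Rightarrow> point \<Rightarrow> bool" where
  "opener n D p \<longleftrightarrow> (\<exists>q. {p, q} \<in> D \<and> circle_pos n p < circle_pos n q)"

lemma opener_edge:
  assumes D: "D \<in> diagrams n" and pq: "{p, q} \<in> D"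
  shows "opener n D p \<longleftrightarrow> circle_pos n p < circle_pos n q"
  using pq diagrams_partner_unique[OF D pq] unfolding opener_def by blast

text \<open>As with bracketings, the opening points determine the partners of the closing points.
  The induction runs over closing points \<open>c\<close>: if the partners of \<open>c\<close>
  differed, the inner one would have, in the other diagram, a partner closing before
  \<open>c\<close>; the induction hypothesis carries this edge over and gives the point two
  partners.\<close>

lemma openers_determine:
  assumes D: "D \<in> diagrams n" and D': "D' \<in> diagrams n"
    and op: "\<And>p. p \<in> points n \<Longrightarrow> opener n D p \<longleftrightarrow> opener n D' p"
  shows "D = D'"
proof -
  let ?P = "circle_pos n"
  have nc: "noncrossing n D" "noncrossing n D'" using D D' by (simp_all add: diagrams_def)
  have main: "{a, c} \<in> D \<longleftrightarrow> {a, c} \<in> D'" if "c \<in> points n" "\<not> opener n D c" for a c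
    using that
  proof (induction "?P c" arbitrary: a c rule: less_induct)
    case less
    obtain b where b: "{c, b} \<in> D" using perfect_partner[OF diagrams_perfect[OF D] less.prems(1)] .
    obtain b' where b': "{c, b'} \<in> D'" using perfect_partner[OF diagrams_perfect[OF D'] less.prems(1)] .
    note pts = diagrams_edge_points[OF D b] diagrams_edge_points[OF D' b']
    have bc: "?P b < ?P c"
      using opener_edge[OF D b] less.prems(2) pts by auto
    have b'c: "?P b' < ?P c"
      using opener_edge[OF D' b'] less.prems(2) op[OF less.prems(1)] pts by auto
    have opb: "opener n D b"
      using opener_edge[OF D, of b c] b bc by (simp add: insert_commute)
    have opb': "opener n D' b'"
      using opener_edge[OF D', of b' c] b' b'c by (simp add: insert_commute)
    have "b = b'"
    proof (rule ccontr)
      assume ne: "b \<noteq> b'"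
      then have "?P b \<noteq> ?P b'" using circle_pos_inj pts by blast
      then consider "?P b < ?P b'" | "?P b' < ?P b" by linarith
      then show False
      proof cases
        case 1
        have "opener n D b'" using op opb' pts by blast
        then obtain c' where c': "{b', c'} \<in> D" "?P b' < ?P c'" by (auto simp: opener_def)
        have "c' \<noteq> c"
          using diagrams_partner_unique[OF D, of c b b'] b c'(1) ne by (auto simp: insert_commute)
        then have "?P c' \<noteq> ?P c" using circle_pos_inj pts diagrams_edge_points[OF D c'(1)] by blast
        moreover have "\<not> ?P c < ?P c'"
          using noncrossingD[OF nc(1), of b c b' c'] b c' 1 b'c by (auto simp: insert_commute)
        ultimately have lt: "?P c' < ?P c" by simp
        have "\<not> opener n D c'"
          using opener_edge[OF D, of c' b'] c' by (simp add: insert_commute)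
        then have "{b', c'} \<in> D'"
          using less.hyps[OF lt] c'(1) diagrams_edge_points[OF D c'(1)] by blast
        then show False
          using diagrams_partner_unique[OF D', of b' c c'] b' \<open>c' \<noteq> c\<close> by (auto simp: insert_commute)
      next
        case 2
        have "opener n D' b" using op opb pts by blast
        then obtain c' where c': "{b, c'} \<in> D'" "?P b < ?P c'" by (auto simp: opener_def)
        have "c' \<noteq> c"
          using diagrams_partner_unique[OF D', of c b b'] b' c'(1) ne by (auto simp: insert_commute)
        then have "?P c' \<noteq> ?P c" using circle_pos_inj pts diagrams_edge_points[OF D' c'(1)] by blast
        moreover have "\<not> ?P c < ?P c'"
          using noncrossingD[OF nc(2), of b' c b c'] b' c' 2 bc by (auto simp: insert_commute)
        ultimately have lt: "?P c' < ?P c" by simp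
        have "\<not> opener n D' c'"
          using opener_edge[OF D', of c' b] c' by (simp add: insert_commute)
        then have "\<not> opener n D c'" using op diagrams_edge_points[OF D' c'(1)] by blast
        then have "{b, c'} \<in> D"
          using less.hyps[OF lt] c'(1) diagrams_edge_points[OF D' c'(1)] by blast
        then show False
          using diagrams_partner_unique[OF D, of b c c'] b \<open>c' \<noteq> c\<close> by (auto simp: insert_commute)
      qed
    qed
    then show ?case
      using b b' diagrams_partner_unique[OF D, of c a b] diagrams_partner_unique[OF D', of c a b']
      by (auto simp: insert_commute)
  qed
  have sub: "e \<in> D1 \<Longrightarrow> D1 \<in> diagrams n \<Longrightarrow> \<exists>a c. e = {a, c} \<and> c \<in> points n \<and> \<not> opener n D1 c" for e D1
  proof -
    assume e: "e \<in> D1" and D1: "D1 \<in> diagrams n"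
    obtain p q where pq: "e = {p, q}" "p \<in> points n" "q \<in> points n" "p \<noteq> q"
      using perfect_elem[OF diagrams_perfect[OF D1] e] .
    have *: "{p, q} \<in> D1" "{q, p} \<in> D1" using e pq by (simp_all add: insert_commute)
    show ?thesis
    proof (cases "?P p < ?P q")
      case True
      then have "\<not> opener n D1 q" using opener_edge[OF D1 *(2)] by simp
      then show ?thesis using pq by blast
    next
      case False
      then have "\<not> opener n D1 p" using opener_edge[OF D1 *(1)] by simp
      then show ?thesis using pq by (metis insert_commute)
    qed
  qed
  show ?thesis
  proof (intro equalityI subsetI)
    fix e assume "e \<in> D"
    then show "e \<in> D'" using sub[OF _ D] main by metis
  next
    fix e assume "e \<in> D'"
    then show "e \<in> D" using sub[OF _ D'] main op by metis
  qed
qed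

section \<open>Triangularity with respect to opening points\<close>

definition opener_weight :: "nat \<Rightarrow> diagram \<Rightarrow> nat" where
  "opener_weight n D = (\<Sum>p\<in>points n. of_bool (opener n D p) * circle_pos n p)"

text \<open>In a non-crossing diagram every edge joins points whose positions on the circle have opposite
  parity, so this colouring is compatible with \<open>D'\<close> iff every edge of \<open>D'\<close> has exactly one
  end that is an opening point of \<open>D\<close>.\<close>

definition opener_top :: "nat \<Rightarrow> diagram \<Rightarrow> nat set" where
  "opener_top n D = {i \<in> {1..n}. opener n D (0, i) \<longleftrightarrow> odd (circle_pos n (0, i))}"

definition opener_bottom :: "nat \<Rightarrow> diagram \<Rightarrow> nat set" where
  "opener_bottom n D = {i \<in> {1..n}. opener n D (1, i) \<longleftrightarrow> odd (circle_pos n (1, i))}"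

lemma coloured_opener_iff:
  assumes D': "D' \<in> diagrams n"
  shows "coloured D' (opener_top n D) (opener_bottom n D) \<longleftrightarrow>
    (\<forall>p q. {p, q} \<in> D' \<longrightarrow> opener n D p \<noteq> opener n D q)"
proof -
  have col: "colour (opener_top n D) (opener_bottom n D) p \<longleftrightarrow>
      (opener n D p \<longleftrightarrow> odd (circle_pos n p))" if "p \<in> points n" for p
    using that by (cases p) (auto simp: points_def colour_def opener_top_def opener_bottom_def)
  have par: "odd (circle_pos n p + circle_pos n q)" if pq: "{p, q} \<in> D'" for p q
  proof (cases "circle_pos n p < circle_pos n q")
    case True
    then show ?thesis using noncrossing_parity[OF D' pq] by simp
  next
    case False
    then have "circle_pos n q < circle_pos n p" using diagrams_edge_points[OF D' pq] by simp
    moreover have "{q, p} \<in> D'" using pq by (simp add: insert_commute)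
    ultimately show ?thesis using noncrossing_parity[OF D', of q p] by simp
  qed
  have "colour (opener_top n D) (opener_bottom n D) p = colour (opener_top n D) (opener_bottom n D) q
      \<longleftrightarrow> opener n D p \<noteq> opener n D q" if pq: "{p, q} \<in> D'" for p q
    using par[OF pq] diagrams_edge_points[OF D' pq] by (simp add: col) blast
  then show ?thesis unfolding coloured_def by blast
qed

lemma coloured_opener_self:
  assumes D: "D \<in> diagrams n"
  shows "coloured D (opener_top n D) (opener_bottom n D)"
  unfolding coloured_opener_iff[OF D]
proof (intro allI impI)
  fix p q assume pq: "{p, q} \<in> D"
  then have "{q, p} \<in> D" by (simp add: insert_commute)
  then show "opener n D p \<noteq> opener n D q"
    using opener_edge[OF D pq] opener_edge[OF D, of q p] diagrams_edge_points[OF D pq] by auto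
qed

text \<open>On each edge of \<open>D'\<close> the end opening in \<open>D'\<close> is the one of
  smaller position, while compatibility says that exactly one of the two ends opens in
  \<open>D\<close>. So edge by edge the weight can only grow from \<open>D'\<close> to
  \<open>D\<close>, and equality forces the same opening points.\<close>

lemma opener_weight_le:
  assumes D: "D \<in> diagrams n" and D': "D' \<in> diagrams n"
    and c: "coloured D' (opener_top n D) (opener_bottom n D)"
  shows "opener_weight n D' \<le> opener_weight n D"
    "opener_weight n D' = opener_weight n D \<Longrightarrow> D' = D"
proof -
  let ?P = "circle_pos n"
  let ?g = "\<lambda>D e. \<Sum>p\<in>e. of_bool (opener n D p) * ?P p"
  have U: "\<Union>D' = points n" "disjoint D'" using D' by (auto simp: diagrams_def partition_on_def)
  have fin: "finite D'" using U(1) finite_points[of n] by (metis finite_UnionD)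
  have W: "opener_weight n E = (\<Sum>e\<in>D'. ?g E e)" for E
  proof -
    have "(\<Sum>p\<in>\<Union>D'. of_bool (opener n E p) * ?P p) = (\<Sum>e\<in>D'. ?g E e)"
    proof (subst sum.Union_disjoint)
      show "\<forall>A\<in>D'. finite A" using U(1) finite_points[of n] by (metis Union_upper finite_subset)
      show "\<forall>A\<in>D'. \<forall>B\<in>D'. A \<noteq> B \<longrightarrow> A \<inter> B = {}" using U(2) by (auto simp: disjoint_def)
    qed simp
    then show ?thesis unfolding opener_weight_def U(1) .
  qed
  have key: "?g D' e \<le> ?g D e \<and> (?g D' e = ?g D e \<longrightarrow> (\<forall>p\<in>e. opener n D p \<longleftrightarrow> opener n D' p))"
    if "e \<in> D'" for e
  proof -
    obtain p q where pq: "e = {p, q}" "?P p < ?P q"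
    proof -
      obtain p q where *: "e = {p, q}" "p \<in> points n" "q \<in> points n" "p \<noteq> q"
        using perfect_elem[OF diagrams_perfect[OF D'] \<open>e \<in> D'\<close>] .
      then have "?P p < ?P q \<or> ?P q < ?P p" using circle_pos_inj by (metis nat_neq_iff)
      then show ?thesis using that * by (metis insert_commute)
    qed
    have *: "{p, q} \<in> D'" "{q, p} \<in> D'" using that pq by (simp_all add: insert_commute)
    have "opener n D' p" "\<not> opener n D' q"
      using opener_edge[OF D' *(1)] opener_edge[OF D' *(2)] pq by auto
    moreover have "opener n D p \<noteq> opener n D q"
      using c * unfolding coloured_opener_iff[OF D'] by blast
    moreover have "p \<noteq> q" using pq by auto
    ultimately show ?thesis using pq by (cases "opener n D p") auto
  qed
  show "opener_weight n D' \<le> opener_weight n D"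
    unfolding W by (rule sum_mono) (use key in blast)
  show "D' = D" if eq: "opener_weight n D' = opener_weight n D"
  proof -
    have "?g D' e = ?g D e" if "e \<in> D'" for e
      by (rule sum_mono_inv[OF eq[unfolded W] _ that fin]) (use key in blast)
    then have "opener n D p \<longleftrightarrow> opener n D' p" if "p \<in> points n" for p
      using key U(1) that by blast
    then show ?thesis using openers_determine[OF D' D] by blast
  qed
qed

text \<open>Among the diagrams occurring in \<open>x\<close> take one of least weight. At its test
  colouring all others contribute 0, so its coefficient is an entry of the zero matrix.\<close>

lemma kern_faithful:
  assumes x: "x \<in> TL n" and zero: "\<And>X Y. X \<subseteq> {1..n} \<Longrightarrow> Y \<subseteq> {1..n} \<Longrightarrow> kern x X Y = 0"
  shows "x = 0"
proof (rule ccontr)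
  assume "x \<noteq> 0"
  let ?K = "Poly_Mapping.keys x"
  have dia: "D \<in> diagrams n" if "D \<in> ?K" for D using x that by (auto simp: TL_def)
  have "?K \<noteq> {}" using \<open>x \<noteq> 0\<close> by simp
  then obtain D where "is_arg_min (opener_weight n) (\<lambda>D. D \<in> ?K) D"
    using ex_is_arg_min_if_finite[of ?K] by auto
  then have D: "D \<in> ?K" and min: "\<And>D'. D' \<in> ?K \<Longrightarrow> opener_weight n D \<le> opener_weight n D'"
    by (auto simp: is_arg_min_linorder)
  let ?X = "opener_top n D" and ?Y = "opener_bottom n D"
  have "kern x ?X ?Y = (\<Sum>D'\<in>?K. if D' = D then Poly_Mapping.lookup x D' else 0)"
    unfolding kern_def
  proof (intro sum.cong refl)
    fix D' assume D': "D' \<in> ?K"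
    show "Poly_Mapping.lookup x D' * of_bool (coloured D' ?X ?Y) =
        (if D' = D then Poly_Mapping.lookup x D' else 0)"
    proof (cases "D' = D")
      case True
      then show ?thesis using coloured_opener_self[OF dia[OF D]] by simp
    next
      case False
      then have "\<not> coloured D' ?X ?Y"
        using opener_weight_le[OF dia[OF D] dia[OF D']] min[OF D'] by fastforce
      then show ?thesis using False by simp
    qed
  qed
  also have "\<dots> = Poly_Mapping.lookup x D" using D by simp
  finally have "kern x ?X ?Y = Poly_Mapping.lookup x D" .
  moreover have "kern x ?X ?Y = 0"
    by (rule zero) (auto simp: opener_top_def opener_bottom_def)
  ultimately have "Poly_Mapping.lookup x D = 0" by simp
  then show False using D by (simp add: in_keys_iff)
qed

section \<open>The action on functions of words\<close>

text \<open>A word in two letters is encoded by the set of positions of its second letter.  Exchanging the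
  letters at the even positions, with a sign, turns the matrix of \<open>u\<^sub>k\<close> into \<open>1 - P\<close>, where \<open>P\<close>
  swaps the letters \<open>k\<close> and \<open>k + 1\<close>.\<close>

definition evens :: "nat \<Rightarrow> nat set" where
  "evens n = {i \<in> {1..n}. even i}"

definition flip :: "nat \<Rightarrow> nat set \<Rightarrow> nat set" where
  "flip n w = (w - evens n) \<union> (evens n - w)"

definition gauge :: "nat \<Rightarrow> nat set \<Rightarrow> rat" where
  "gauge n w = (- 1) ^ card (w \<inter> evens n)"

text \<open>Outside the words the value is 0, so that two results are equal as functions as soon as
  they agree on words.\<close>

definition act :: "nat \<Rightarrow> tl \<Rightarrow> (nat set \<Rightarrow> rat) \<Rightarrow> nat set \<Rightarrow> rat" where
  "act n x f w = (if w \<subseteq> {1..n}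
     then \<Sum>z\<in>Pow {1..n}. gauge n w * gauge n z * kern x (flip n w) (flip n z) * f z else 0)"

definition swap_word :: "nat \<Rightarrow> nat set \<Rightarrow> nat set" where
  "swap_word k w = transpose k (k + 1) -` w"

lemma flip_flip [simp]: "flip n (flip n w) = w"
  by (auto simp: flip_def)

lemma flip_subset [simp]: "flip n w \<subseteq> {Suc 0..n} \<longleftrightarrow> w \<subseteq> {Suc 0..n}"
  by (auto simp: flip_def evens_def)

lemma flip_eq_iff [simp]: "flip n w = flip n z \<longleftrightarrow> w = z"
  by (metis flip_flip)

lemma gauge_square [simp]: "gauge n w * gauge n w = 1"
  by (simp add: gauge_def flip: power_add)

lemma gauge_square' [simp]: "gauge n w * (gauge n w * x) = x"
  by (simp flip: mult.assoc)

lemma sum_flip: "(\<Sum>z\<in>Pow {1..n}. f (flip n z)) = (\<Sum>z\<in>Pow {1..n}. f z)"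
  by (rule sum.reindex_bij_witness[of _ "flip n" "flip n"]) simp_all

lemma act_add_left: "act n (x + y) f = act n x f + act n y f"
  by (auto simp: act_def fun_eq_iff distrib_left distrib_right sum.distrib)

lemma act_scale_left: "act n (c \<odot> x) f = (\<lambda>w. c * act n x f w)"
  by (auto simp: act_def fun_eq_iff sum_distrib_left mult_ac)

lemma act_diff_left: "act n (x - y) f = act n x f - act n y f"
  by (auto simp: act_def fun_eq_iff left_diff_distrib right_diff_distrib sum_subtractf)

lemma act_zero_left [simp]: "act n 0 f = 0"
  by (auto simp: act_def fun_eq_iff)

lemma act_sum_left: "act n (sum x A) f = (\<Sum>a\<in>A. act n (x a) f)"
  by (induction A rule: infinite_finite_induct) (auto simp: act_add_left)

lemma act_add: "act n x (f + g) = act n x f + act n x g"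
  by (auto simp: act_def fun_eq_iff distrib_left sum.distrib)

lemma act_zero [simp]: "act n x 0 = 0"
  by (auto simp: act_def fun_eq_iff)

lemma act_scale: "act n x (\<lambda>w. c * f w) = (\<lambda>w. c * act n x f w)"
  by (auto simp: act_def fun_eq_iff sum_distrib_left mult_ac)

lemma act_outside: "\<not> w \<subseteq> {1..n} \<Longrightarrow> act n x f w = 0"
  by (simp add: act_def)

lemma act_mult:
  assumes xy: "x \<in> word_alg n" "y \<in> word_alg n"
  shows "act n (x \<cdot> y) f = act n x (act n y f)"
proof
  fix w
  show "act n (x \<cdot> y) f w = act n x (act n y f) w"
  proof (cases "w \<subseteq> {1..n}")
    case True
    then have w: "flip n w \<subseteq> {1..n}" by simp
    have "act n (x \<cdot> y) f w = (\<Sum>z\<in>Pow {1..n}. gauge n w * gauge n z *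
        (\<Sum>v\<in>Pow {1..n}. kern x (flip n w) v * kern y v (flip n z)) * f z)"
      using True by (simp only: act_def if_True)
        (intro sum.cong refl, subst kern_word_mult[OF xy w], simp_all)
    also have "\<dots> = (\<Sum>z\<in>Pow {1..n}. gauge n w * gauge n z *
        (\<Sum>v\<in>Pow {1..n}. kern x (flip n w) (flip n v) * kern y (flip n v) (flip n z)) * f z)"
      by (subst sum_flip) (rule refl)
    also have "\<dots> = (\<Sum>z\<in>Pow {1..n}. \<Sum>v\<in>Pow {1..n}. gauge n w * gauge n v * kern x (flip n w) (flip n v) *
        (gauge n v * gauge n z * kern y (flip n v) (flip n z) * f z))"
      by (simp add: sum_distrib_left sum_distrib_right mult_ac)
    also have "\<dots> = (\<Sum>v\<in>Pow {1..n}. gauge n w * gauge n v * kern x (flip n w) (flip n v) *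
        (\<Sum>z\<in>Pow {1..n}. gauge n v * gauge n z * kern y (flip n v) (flip n z) * f z))"
      by (subst sum.swap) (simp only: sum_distrib_left)
    also have "\<dots> = act n x (act n y f) w"
      using True by (auto simp: act_def intro!: sum.cong)
    finally show ?thesis .
  qed (simp add: act_outside)
qed

lemma act_one:
  assumes "\<And>w. \<not> w \<subseteq> {1..n} \<Longrightarrow> f w = 0"
  shows "act n (tl_one n) f = f"
proof
  fix w
  show "act n (tl_one n) f w = f w"
  proof (cases "w \<subseteq> {1..n}")
    case True
    then have "act n (tl_one n) f w = (\<Sum>z\<in>Pow {1..n}. if z = w then f z else 0)"
      unfolding act_def by (simp only: if_True) (intro sum.cong refl, simp add: tl_one_eq coloured_one)
    then show ?thesis using True by simp
  qed (simp add: act_outside assms)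
qed

lemma swap_word_subset:
  assumes "1 \<le> k" "k < n" shows "swap_word k w \<subseteq> {1..n} \<longleftrightarrow> w \<subseteq> {1..n}"
proof -
  have *: "transpose k (k + 1) i \<in> {1..n} \<longleftrightarrow> i \<in> {1..n}" for i
    using assms by (auto simp: transpose_def)
  show ?thesis
  proof
    assume L: "swap_word k w \<subseteq> {1..n}"
    show "w \<subseteq> {1..n}"
    proof
      fix i assume "i \<in> w"
      then have "transpose k (k + 1) i \<in> swap_word k w" by (simp add: swap_word_def)
      then show "i \<in> {1..n}" using L * by blast
    qed
  qed (use * in \<open>auto simp: swap_word_def\<close>)
qed

lemma swap_word_simps [simp]:
  "k \<in> swap_word k w \<longleftrightarrow> k + 1 \<in> w" "Suc k \<in> swap_word k w \<longleftrightarrow> k \<in> w"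
  "swap_word k (swap_word k w) = w"
  by (auto simp: swap_word_def)

lemma swap_word_other: "i \<noteq> k \<Longrightarrow> i \<noteq> k + 1 \<Longrightarrow> i \<in> swap_word k w \<longleftrightarrow> i \<in> w"
  by (simp add: swap_word_def transpose_def)

lemma swap_word_cong:
  assumes "k \<in> w \<longleftrightarrow> k + 1 \<in> w" shows "swap_word k w = w"
  using assms by (auto simp: swap_word_def transpose_def split: if_splits)

lemma card_diff_one:
  assumes "finite A" "e \<in> A" "e \<notin> B" "A - {e} = B - {e}"
  shows "card A = Suc (card B)"
proof -
  have "A = insert e B" using assms by blast
  moreover have "finite B" using assms by (metis finite_Diff finite_insert insert_Diff_single Diff_insert0)
  ultimately show ?thesis using assms by simp
qed

text \<open>Exactly one of \<open>k\<close> and \<open>k + 1\<close> is even, and it lies in exactly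
  one of the two words. This sign turns the off-diagonal entry 1 of \<open>u_k\<close> into
  -1.\<close>

lemma gauge_swap:
  assumes k: "1 \<le> k" "k < n" and w: "(k \<in> w) \<noteq> (k + 1 \<in> w)"
  shows "gauge n (swap_word k w) = - gauge n w"
proof -
  define e where "e = (if even k then k else k + 1)"
  let ?A = "w \<inter> evens n" and ?B = "swap_word k w \<inter> evens n"
  have fin: "finite ?A" "finite ?B" by (auto simp: evens_def)
  have e: "e \<in> evens n" using k by (auto simp: e_def evens_def)
  have off: "i \<in> ?A - {e} \<longleftrightarrow> i \<in> ?B - {e}" for i
  proof -
    consider "i = k \<or> i = k + 1" "i \<noteq> e" | "i = e" | "i \<noteq> k" "i \<noteq> k + 1" by blast
    then show ?thesis
    proof cases
      case 1
      then have "odd i" by (auto simp: e_def split: if_splits)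
      then show ?thesis by (auto simp: evens_def)
    qed (auto simp: swap_word_other)
  qed
  then have eq: "?A - {e} = ?B - {e}" by blast
  have "(e \<in> ?A) \<noteq> (e \<in> ?B)" using w e by (auto simp: e_def)
  then consider "e \<in> ?A" "e \<notin> ?B" | "e \<in> ?B" "e \<notin> ?A" by blast
  then have "card ?A = Suc (card ?B) \<or> card ?B = Suc (card ?A)"
    by cases (use card_diff_one fin eq in metis)+
  then show ?thesis by (auto simp: gauge_def)
qed

text \<open>Exactly one of two neighbouring positions is flipped, so equal colours become different
  letters. Hence \<open>u_k\<close> vanishes on words with equal letters at \<open>k\<close> and
  \<open>k + 1\<close>; in the other rows its two nonzero entries belong to the word itself and,
  with a sign, to its swap.\<close>

lemma act_u:
  assumes k: "1 \<le> k" "k < n" and w: "w \<subseteq> {1..n}"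
  shows "act n (tl_u n k) f w = f w - f (swap_word k w)"
proof -
  define g where "g Y = gauge n w * gauge n (flip n Y) * f (flip n Y)" for Y
  have fw: "flip n w \<subseteq> {1..n}" using w by simp
  have "act n (tl_u n k) f w =
      (\<Sum>z\<in>Pow {1..n}. of_bool (coloured (u_diag n k) (flip n w) (flip n z)) * g (flip n z))"
    unfolding act_def using w by (simp only: tl_u_eq kern_single g_def flip_flip if_True mult_ac mult_1)
  also have "\<dots> = (\<Sum>Y\<in>Pow {1..n}. of_bool (coloured (u_diag n k) (flip n w) Y) * g Y)"
    by (rule sum_flip)
  also have "\<dots> = of_bool (k \<in> flip n w \<longleftrightarrow> k + 1 \<in> flip n w) *
      (g (flip n w - {k, k + 1}) + g (flip n w \<union> {k, k + 1}))"
    by (rule u_diag_sum[OF k fw])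
  also have "\<dots> = f w - f (swap_word k w)"
  proof -
    have ev: "k \<in> evens n \<longleftrightarrow> even k" "k + 1 \<in> evens n \<longleftrightarrow> odd k" using k by (auto simp: evens_def)
    have mem: "k \<in> flip n w \<longleftrightarrow> (k \<in> w) \<noteq> even k" "k + 1 \<in> flip n w \<longleftrightarrow> (k + 1 \<in> w) \<noteq> odd k"
      using ev by (auto simp: flip_def)
    show ?thesis
    proof (cases "(k \<in> w) = (k + 1 \<in> w)")
      case True
      then show ?thesis using mem by (simp add: swap_word_cong)
    next
      case False
      have mem': "k \<in> flip n (swap_word k w) \<longleftrightarrow> (k + 1 \<in> w) \<noteq> even k"
        "k + 1 \<in> flip n (swap_word k w) \<longleftrightarrow> (k \<in> w) \<noteq> odd k"
        using ev by (auto simp: flip_def)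
      have off: "i \<in> flip n (swap_word k w) \<longleftrightarrow> i \<in> flip n w" if "i \<noteq> k" "i \<noteq> k + 1" for i
        using that by (auto simp: flip_def swap_word_other)
      have gw: "g (flip n w) = f w" by (simp add: g_def)
      have gs: "g (flip n (swap_word k w)) = - f (swap_word k w)"
        using gauge_swap[OF k False] by (simp add: g_def)
      have same: "(k \<in> flip n w) = (k + 1 \<in> flip n w)" using False mem by blast
      show ?thesis
      proof (cases "k \<in> flip n w")
        case True
        have "flip n w \<union> {k, k + 1} = flip n w" using True same by auto
        moreover have "flip n w - {k, k + 1} = flip n (swap_word k w)"
        proof (rule set_eqI)
          fix i show "i \<in> flip n w - {k, k + 1} \<longleftrightarrow> i \<in> flip n (swap_word k w)"
            using True same off[of i] mem mem' False by (cases "i = k \<or> i = k + 1") auto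
        qed
        ultimately show ?thesis using same gw gs by simp
      next
        case nk: False
        have "flip n w - {k, k + 1} = flip n w" using nk same by auto
        moreover have "flip n w \<union> {k, k + 1} = flip n (swap_word k w)"
        proof (rule set_eqI)
          fix i show "i \<in> flip n w \<union> {k, k + 1} \<longleftrightarrow> i \<in> flip n (swap_word k w)"
            using nk same off[of i] mem mem' False by (cases "i = k \<or> i = k + 1") auto
        qed
        ultimately show ?thesis using same gw gs by simp
      qed
    qed
  qed
  finally show ?thesis .
qed

lemma act_faithful:
  assumes x: "x \<in> TL n" and zero: "\<And>z. z \<subseteq> {1..n} \<Longrightarrow> act n x (\<lambda>w. of_bool (w = z)) = 0"
  shows "x = 0"
proof (rule kern_faithful[OF x])
  fix X Y :: "nat set" assume XY: "X \<subseteq> {1..n}" "Y \<subseteq> {1..n}"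
  have "act n x (\<lambda>w. of_bool (w = flip n Y)) (flip n X) =
      (\<Sum>z\<in>Pow {1..n}. if z = flip n Y then gauge n (flip n X) * gauge n z * kern x X (flip n z) else 0)"
    using XY by (auto simp: act_def intro!: sum.cong)
  also have "\<dots> = gauge n (flip n X) * gauge n (flip n Y) * kern x X Y"
    using XY by simp
  finally have eq: "act n x (\<lambda>w. of_bool (w = flip n Y)) (flip n X) =
      gauge n (flip n X) * gauge n (flip n Y) * kern x X Y" .
  have "flip n Y \<subseteq> {1..n}" using XY by simp
  from zero[OF this] eq have "gauge n (flip n X) * gauge n (flip n Y) * kern x X Y = 0" by simp
  then show "kern x X Y = 0" by (auto simp: gauge_def)
qed

lemma act_eqI:
  assumes "x \<in> TL n" "y \<in> TL n" "\<And>f. act n x f = act n y f"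
  shows "x = y"
proof -
  have "x - y \<in> TL n"
  proof -
    have "- y \<in> TL n" using assms(2) by (simp add: TL_def)
    then show ?thesis using TL_add[OF assms(1), of "- y"] by simp
  qed
  then have "x - y = 0"
    by (rule act_faithful) (simp add: act_diff_left assms(3))
  then show ?thesis by simp
qed

section \<open>The homomorphism from the symmetric group\<close>

text \<open>The sign is there because \<open>u_k - 1\<close> acts as minus the swap of two
  letters.\<close>

definition perm_act :: "nat \<Rightarrow> (nat \<Rightarrow> nat) \<Rightarrow> (nat set \<Rightarrow> rat) \<Rightarrow> nat set \<Rightarrow> rat" where
  "perm_act n p f w = (if w \<subseteq> {1..n} then of_int (sign p) * f (p -` w) else 0)"

lemma perm_act_comp:
  assumes p: "p permutes {1..n}" and q: "q permutes {1..n}"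
  shows "perm_act n p (perm_act n q f) = perm_act n (p \<circ> q) f"
proof
  fix w
  have "p -` w \<subseteq> {1..n}" if "w \<subseteq> {1..n}"
  proof
    fix i assume "i \<in> p -` w"
    then have "p i \<in> {1..n}" using that by auto
    then show "i \<in> {1..n}" using permutes_in_image[OF p] by blast
  qed
  moreover have "sign (p \<circ> q) = sign p * sign q"
    by (rule sign_compose) (use p q permutes_imp_permutation in blast)+
  ultimately show "perm_act n p (perm_act n q f) w = perm_act n (p \<circ> q) f w"
    by (auto simp: perm_act_def vimage_comp)
qed

text \<open>By faithfulness at most one element represents a permutation; the homomorphism property
  then follows without recourse to a presentation of the symmetric group.\<close>

definition represents :: "nat \<Rightarrow> (nat \<Rightarrow> nat) \<Rightarrow> tl \<Rightarrow> bool" where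
  "represents n p x \<longleftrightarrow> x \<in> word_alg n \<and> (\<forall>f. act n x f = perm_act n p f)"

lemma represents_unique: "represents n p x \<Longrightarrow> represents n p y \<Longrightarrow> x = y"
  by (rule act_eqI[of _ n]) (auto simp: represents_def word_alg_TL)

lemma represents_id: "represents n id (tl_one n)"
  unfolding represents_def
proof (intro conjI allI ext)
  fix f w
  show "act n (tl_one n) f w = perm_act n id f w"
  proof (cases "w \<subseteq> {1..n}")
    case True
    have "act n (tl_one n) f w = act n (tl_one n) (\<lambda>w. if w \<subseteq> {1..n} then f w else 0) w"
      unfolding act_def by (rule if_cong[OF refl _ refl], rule sum.cong) auto
    also have "act n (tl_one n) (\<lambda>w. if w \<subseteq> {1..n} then f w else 0) =
        (\<lambda>w. if w \<subseteq> {1..n} then f w else 0)"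
      by (rule act_one) simp
    finally show ?thesis using True by (simp add: perm_act_def)
  qed (simp add: act_outside perm_act_def)
qed (rule word_alg_one)

lemma represents_comp:
  assumes "p permutes {1..n}" "q permutes {1..n}" "represents n p x" "represents n q y"
  shows "represents n (p \<circ> q) (x \<cdot> y)"
  using assms by (auto simp: represents_def word_alg_mult act_mult perm_act_comp)

lemma represents_adjacent:
  assumes k: "1 \<le> k" "k < n"
  shows "represents n (transpose k (k + 1)) (tl_u n k - tl_one n)"
  unfolding represents_def
proof (intro conjI allI ext)
  fix f w
  have one: "act n (tl_one n) f = perm_act n id f"
    using represents_id by (simp add: represents_def)
  show "act n (tl_u n k - tl_one n) f w = perm_act n (transpose k (k + 1)) f w"
  proof (cases "w \<subseteq> {1..n}")
    case True
    then show ?thesis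
      by (simp add: act_diff_left one perm_act_def act_u[OF k True] sign_swap_id swap_word_def)
  qed (simp add: act_outside perm_act_def)
qed (intro word_alg_diff word_alg_u word_alg_one k)

lemma represents_transpose:
  assumes "1 \<le> a" "a < b" "b \<le> n"
  shows "\<exists>x. represents n (transpose a b) x"
proof -
  have "Suc a \<le> b" using assms by simp
  then show ?thesis using assms(3)
  proof (induction b rule: dec_induct)
    case base
    then show ?case using represents_adjacent[of a n] assms by auto
  next
    case (step b)
    then obtain x where x: "represents n (transpose a b) x" by auto
    let ?y = "tl_u n b - tl_one n"
    have y: "represents n (transpose b (b + 1)) ?y"
      using step assms by (intro represents_adjacent) auto
    have perm: "transpose a b permutes {1..n}" "transpose b (b + 1) permutes {1..n}"
      using step assms by (auto intro!: permutes_swap_id)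
    have "transpose a (Suc b) = transpose b (b + 1) \<circ> transpose a b \<circ> transpose b (b + 1)"
      using step by (auto simp: fun_eq_iff transpose_def)
    moreover have "represents n (transpose b (b + 1) \<circ> transpose a b \<circ> transpose b (b + 1)) (?y \<cdot> x \<cdot> ?y)"
      using perm x y by (intro represents_comp permutes_compose)
    ultimately show ?case by metis
  qed
qed

lemma represents_exists:
  assumes "p permutes {1..n}"
  shows "\<exists>x. represents n p x"
proof -
  have "finite {1..n}" by simp
  from this assms show ?thesis
  proof (induction p rule: permutes_rev_induct)
    case id
    then show ?case using represents_id by (metis id_def)
  next
    case (swap a b p)
    then obtain x where x: "represents n p x" by blast
    show ?case
    proof (cases "a = b")
      case True
      then show ?thesis using x by auto
    next
      case False
      have "\<exists>y. represents n (transpose a b) y"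
        using represents_transpose[of a b n] represents_transpose[of b a n] swap False
        by (cases "a < b") (auto simp: transpose_commute)
      then obtain y where y: "represents n (transpose a b) y" ..
      have "transpose a b permutes {1..n}" using swap by (intro permutes_swap_id)
      then show ?thesis using represents_comp[OF swap(4) _ x y] swap by blast
    qed
  qed
qed

text \<open>\<open>Phi\<close> is built from a choice among the maps satisfying
  \<open>is_Phi\<close>, so this is what gives the Jucys--Murphy elements a meaning. Their recursion
  then follows from \<open>is_Phi\<close> alone.\<close>

lemma is_Phi_exists: "\<exists>\<phi>. is_Phi n \<phi>"
proof
  define \<phi> where "\<phi> p = (SOME x. represents n p x)" for p
  have \<phi>: "represents n p (\<phi> p)" if "p permutes {1..n}" for p
    unfolding \<phi>_def using someI_ex[OF represents_exists[OF that]] .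
  show "is_Phi n \<phi>"
    unfolding is_Phi_def
  proof (intro conjI allI impI)
    show "\<phi> w \<in> TL n" if "w permutes {1..n}" for w
      using \<phi>[OF that] by (simp add: represents_def word_alg_TL)
    show "\<phi> id = tl_one n"
      by (rule represents_unique[OF \<phi> represents_id]) (rule permutes_id)
    show "\<phi> (v \<circ> w) = \<phi> v \<cdot> \<phi> w" if "v permutes {1..n}" "w permutes {1..n}" for v w
      by (rule represents_unique[OF \<phi> represents_comp[OF that \<phi>[OF that(1)] \<phi>[OF that(2)]]])
        (rule permutes_compose[OF that(2,1)])
    show "\<phi> (transpose i (i + 1)) = tl_u n i - tl_one n" if "1 \<le> i" "i < n" for i
      by (rule represents_unique[OF \<phi> represents_adjacent[OF that]])
        (rule permutes_swap_id, use that in auto)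
  qed
qed

section \<open>Recursion for the Jucys--Murphy elements\<close>

lemma tl_jm_one: "tl_jm n (Suc 0) = 0"
  by (simp add: tl_jm_def Phi_def linear_ext_jm)

text \<open>Conjugation by \<open>s_k\<close> takes \<open>(j, k)\<close> to
  \<open>(j, k + 1)\<close> for \<open>j < k\<close>, and \<open>s_k\<close> itself is the remaining
  summand. The recursion has the shape of the one defining \<open>klr_jm\<close>, so that one
  eigenvalue computation serves both.\<close>

lemma tl_jm_step:
  assumes k: "1 \<le> k" "k < n"
  shows "tl_jm n (Suc k) = (tl_u n k - tl_one n) \<cdot> tl_jm n k \<cdot> (tl_u n k - tl_one n) + (tl_u n k - tl_one n)"
proof -
  define \<phi> where "\<phi> = (SOME \<phi>. is_Phi n \<phi>)"
  have \<phi>: "is_Phi n \<phi>" unfolding \<phi>_def using is_Phi_exists by (rule someI_ex)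
  have jm: "tl_jm n i = (\<Sum>j\<in>{1..<i}. \<phi> (transpose j i))" for i
    by (simp add: tl_jm_def Phi_def linear_ext_jm flip: \<phi>_def)
  let ?s = "transpose k (k + 1)"
  have s: "\<phi> ?s = tl_u n k - tl_one n" using \<phi> k by (simp add: is_Phi_def)
  have conj: "\<phi> (transpose j (Suc k)) = \<phi> ?s \<cdot> \<phi> (transpose j k) \<cdot> \<phi> ?s" if j: "j \<in> {1..<k}" for j
  proof -
    have ps: "?s permutes {1..n}" and pj: "transpose j k permutes {1..n}"
      by (rule permutes_swap_id; use k j in simp)+
    have "transpose j (Suc k) = ?s \<circ> transpose j k \<circ> ?s"
      using j by (auto simp: fun_eq_iff transpose_def)
    then show ?thesis
      using \<phi> ps pj permutes_compose[OF pj ps] unfolding is_Phi_def by metis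
  qed
  have "tl_jm n (Suc k) = (\<Sum>j\<in>{1..<k}. \<phi> (transpose j (Suc k))) + \<phi> ?s"
    using k by (simp add: jm)
  also have "(\<Sum>j\<in>{1..<k}. \<phi> (transpose j (Suc k))) =
      \<phi> ?s \<cdot> (\<Sum>j\<in>{1..<k}. \<phi> (transpose j k)) \<cdot> \<phi> ?s"
    unfolding tl_mult_sum_left tl_mult_sum_right by (rule sum.cong[OF refl]) (rule conj)
  finally show ?thesis by (simp only: jm s)
qed

lemma tl_jm_word: "1 \<le> i \<Longrightarrow> i \<le> n \<Longrightarrow> tl_jm n i \<in> word_alg n"
proof (induction i rule: dec_induct)
  case base
  then show ?case by (simp add: tl_jm_one)
next
  case (step k)
  then have "tl_u n k - tl_one n \<in> word_alg n"
    by (intro word_alg_diff word_alg_u word_alg_one) auto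
  then show ?case using step by (simp only: tl_jm_step) (intro word_alg_add word_alg_mult; simp)
qed

section \<open>Joint eigenvectors\<close>

text \<open>\<open>S\<close> is the set of entries in the second column of a tableau, and column-one and column-two
  steps are the two Clebsch--Gordan embeddings.  Realising the \<open>SL\<^sub>2\<close>-module of highest weight \<open>e\<close>
  as the forms of degree \<open>e\<close> in two variables, the first one multiplies by a variable and the
  second one differentiates, which produces the factors below.\<close>

definition cin :: "nat \<Rightarrow> nat set \<Rightarrow> nat" where
  "cin k w = card ({1..<k} \<inter> w)"

definition cout :: "nat \<Rightarrow> nat set \<Rightarrow> nat" where
  "cout k w = card ({1..<k} - w)"

lemma cin_Suc: "1 \<le> k \<Longrightarrow> cin (Suc k) w = cin k w + of_bool (k \<in> w)"
proof -
  assume "1 \<le> k"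
  then have "{1..<Suc k} = insert k {1..<k}" by auto
  then show ?thesis by (cases "k \<in> w") (simp_all add: cin_def Int_insert_left)
qed

lemma cout_Suc: "1 \<le> k \<Longrightarrow> cout (Suc k) w = cout k w + of_bool (k \<notin> w)"
proof -
  assume "1 \<le> k"
  then have "{1..<Suc k} = insert k {1..<k}" by auto
  then show ?thesis by (cases "k \<in> w") (simp_all add: cout_def insert_Diff_if)
qed

lemma cin_cout: "cin k w + cout k w = k - 1"
  unfolding cin_def cout_def using card_Int_Diff[of "{1..<k}" w] by simp

lemma cin_1 [simp]: "cin (Suc 0) w = 0" and cout_1 [simp]: "cout (Suc 0) w = 0"
  by (simp_all add: cin_def cout_def)

lemma cin_full: "w \<subseteq> {1..n} \<Longrightarrow> cin (Suc n) w = card w"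
  unfolding cin_def by (rule arg_cong[of _ _ card]) auto

text \<open>After the first \<open>i - 1\<close> steps the partial word has become a monomial with
  exponents \<open>cout i w - cin i S\<close> and \<open>cin i w - cin i S\<close>, because each
  column-two step uses up one letter of each kind. The factor is the exponent brought down by the
  derivative, with the sign of the invariant alternating form.\<close>

definition cg_factor :: "nat set \<Rightarrow> nat set \<Rightarrow> nat \<Rightarrow> rat" where
  "cg_factor S w i = (if i \<in> w then of_nat (cout i w) - of_nat (cin i S)
     else of_nat (cin i S) - of_nat (cin i w))"

definition cg :: "nat set \<Rightarrow> nat set \<Rightarrow> rat" where
  "cg S w = (\<Prod>i\<in>S. cg_factor S w i)"

definition vec :: "nat \<Rightarrow> nat set \<Rightarrow> nat \<Rightarrow> nat set \<Rightarrow> rat" where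
  "vec n S b w = (if w \<subseteq> {1..n} \<and> card w = b then cg S w else 0)"

section \<open>Local effect of exchanging two neighbouring positions\<close>

lemma cin_swap_word:
  assumes "i \<le> k \<or> k + 2 \<le> i" "1 \<le> k"
  shows "cin i (swap_word k w) = cin i w" "cout i (swap_word k w) = cout i w"
proof -
  let ?t = "transpose k (k + 1)"
  have t: "?t j \<in> {1..<i} \<longleftrightarrow> j \<in> {1..<i}" for j
    using assms by (auto simp: transpose_def)
  have v: "card (?t -` A) = card A" for A
    by (rule card_vimage_inj) (simp_all add: bij_is_surj)
  have "{1..<i} \<inter> swap_word k w = ?t -` ({1..<i} \<inter> w)"
    "{1..<i} - swap_word k w = ?t -` ({1..<i} - w)"
    by (rule set_eqI, simp only: swap_word_def Int_iff Diff_iff vimage_eq t)+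
  then show "cin i (swap_word k w) = cin i w" "cout i (swap_word k w) = cout i w"
    by (simp_all only: cin_def cout_def v)
qed

lemma card_swap_word_full:
  assumes "1 \<le> k" "k < n" "w \<subseteq> {1..n}"
  shows "card (swap_word k w) = card w"
  using cin_swap_word(1)[of "Suc n" k w] assms cin_full[of _ n] swap_word_subset[OF assms(1,2), of w]
  by simp

text \<open>A factor away from \<open>k\<close> and \<open>k + 1\<close> sees the word and the set
  only through counts of earlier positions and through position \<open>i\<close> itself, none of
  which the exchange changes. All identities about the exchange are therefore local.\<close>

lemma cg_factor_swap:
  assumes "i \<noteq> k" "i \<noteq> k + 1" "1 \<le> k"
  shows "cg_factor S (swap_word k w) i = cg_factor S w i"
    "cg_factor (swap_word k S) w i = cg_factor S w i"
proof -
  have "i \<le> k \<or> k + 2 \<le> i" using assms by auto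
  note c = cin_swap_word[OF this assms(3)]
  show "cg_factor S (swap_word k w) i = cg_factor S w i"
    "cg_factor (swap_word k S) w i = cg_factor S w i"
    using assms(1,2) by (simp_all add: cg_factor_def c swap_word_other)
qed

definition cg_local :: "nat \<Rightarrow> nat set \<Rightarrow> nat set \<Rightarrow> rat" where
  "cg_local k S w = (if k \<in> S then cg_factor S w k else 1) *
     (if k + 1 \<in> S then cg_factor S w (k + 1) else 1)"

lemma cg_split:
  assumes "finite S"
  shows "cg S w = cg_local k S w * (\<Prod>i\<in>S - {k, k + 1}. cg_factor S w i)"
proof -
  have "cg S w = (\<Prod>i\<in>S \<inter> {k, k + 1}. cg_factor S w i) * (\<Prod>i\<in>S - {k, k + 1}. cg_factor S w i)"
    unfolding cg_def by (subst prod.union_disjoint[symmetric]) (use assms in \<open>auto intro: prod.cong\<close>)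
  also have "(\<Prod>i\<in>S \<inter> {k, k + 1}. cg_factor S w i) = cg_local k S w"
    by (cases "k \<in> S"; cases "k + 1 \<in> S") (auto simp: cg_local_def Int_insert_right)
  finally show ?thesis .
qed

lemma cg_split_swap:
  assumes "finite S" "1 \<le> k"
  shows "cg S (swap_word k w) = cg_local k S (swap_word k w) * (\<Prod>i\<in>S - {k, k + 1}. cg_factor S w i)"
    "cg (swap_word k S) w = cg_local k (swap_word k S) w * (\<Prod>i\<in>S - {k, k + 1}. cg_factor S w i)"
proof -
  have "(\<Prod>i\<in>S - {k, k + 1}. cg_factor S (swap_word k w) i) = (\<Prod>i\<in>S - {k, k + 1}. cg_factor S w i)"
    by (rule prod.cong[OF refl], rule cg_factor_swap(1)) (use assms(2) in simp_all)
  then show "cg S (swap_word k w) = cg_local k S (swap_word k w) * (\<Prod>i\<in>S - {k, k + 1}. cg_factor S w i)"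
    unfolding cg_split[OF assms(1), of "swap_word k w" k] by simp
  have fin: "finite (swap_word k S)"
    unfolding swap_word_def by (rule finite_vimageI[OF assms(1)]) simp
  have "swap_word k S - {k, k + 1} = S - {k, k + 1}"
    by (rule set_eqI) (auto simp: swap_word_other)
  moreover have "(\<Prod>i\<in>S - {k, k + 1}. cg_factor (swap_word k S) w i) = (\<Prod>i\<in>S - {k, k + 1}. cg_factor S w i)"
    by (rule prod.cong[OF refl], rule cg_factor_swap(2)) (use assms(2) in simp_all)
  ultimately show "cg (swap_word k S) w = cg_local k (swap_word k S) w * (\<Prod>i\<in>S - {k, k + 1}. cg_factor S w i)"
    unfolding cg_split[OF fin, of w k] by simp
qed

text \<open>Two multiplications by variables commute, and so do two derivatives; hence the vector is
  symmetric in the letters \<open>k\<close> and \<open>k + 1\<close>.\<close>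

lemma cg_swap_equal:
  assumes "finite S" "1 \<le> k" and eq: "k \<in> S \<longleftrightarrow> k + 1 \<in> S"
  shows "cg S (swap_word k w) = cg S w"
proof -
  have c: "cin k (swap_word k w) = cin k w" "cout k (swap_word k w) = cout k w"
    using cin_swap_word[of k k w] assms by auto
  note Sucs = cin_Suc[OF assms(2)] cout_Suc[OF assms(2)]
  have "cg_local k S (swap_word k w) = cg_local k S w"
    unfolding cg_local_def cg_factor_def
    by (cases "k \<in> S"; cases "k \<in> w"; cases "Suc k \<in> w")
      (use eq in \<open>simp_all add: Sucs c algebra_simps\<close>)
  then show ?thesis
    unfolding cg_split_swap[OF assms(1,2)] cg_split[OF assms(1), of w k] by simp
qed

text \<open>\<open>r\<close> is the difference of the contents of \<open>k\<close> and \<open>k + 1\<close>.\<close>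

lemma cg_swap_unequal:
  assumes "finite S" "1 \<le> k" and ne: "(k \<in> S) \<noteq> (k + 1 \<in> S)"
    and r: "r = (if k \<in> S then of_nat k - 2 * of_nat (cin k S) else 2 * of_nat (cin k S) - of_nat k)"
  shows "r * (cg S w - cg S (swap_word k w)) = (r - 1) * (cg S w - cg (swap_word k S) w)"
proof -
  \<comment> \<open>Replacing \<open>k\<close> by the two letter counts turns each of the eight
    local cases into a polynomial identity.\<close>
  have "cin k w + cout k w + 1 = k" using cin_cout[of k w] assms(2) by simp
  then have "of_nat (cin k w + cout k w + 1) = (of_nat k :: rat)" by (rule arg_cong)
  then have k: "of_nat k = of_nat (cin k w) + of_nat (cout k w) + (1 :: rat)" by simp
  have c: "cin k (swap_word k w) = cin k w" "cout k (swap_word k w) = cout k w"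
    "cin k (swap_word k S) = cin k S"
    using cin_swap_word[of k k w] cin_swap_word[of k k S] assms by auto
  note Sucs = cin_Suc[OF assms(2)] cout_Suc[OF assms(2)]
  have "r * (cg_local k S w - cg_local k S (swap_word k w)) =
      (r - 1) * (cg_local k S w - cg_local k (swap_word k S) w)"
    unfolding cg_local_def cg_factor_def r k
    by (cases "k \<in> S"; cases "k \<in> w"; cases "Suc k \<in> w")
      (use ne in \<open>simp_all add: Sucs c algebra_simps\<close>)
  then show ?thesis
    unfolding cg_split_swap[OF assms(1,2)] cg_split[OF assms(1), of w k]
      left_diff_distrib[symmetric] mult.assoc[symmetric] by simp
qed

text \<open>The two inequalities say that both exponents of the monomial stay nonnegative: a
  derivative in a variable of exponent 0 contributes the factor 0.\<close>

lemma cg_support: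
  assumes "finite S" and nz: "(\<Prod>i\<in>S \<inter> {1..<k}. cg_factor S w i) \<noteq> 0" and "1 \<le> k"
  shows "cin k S \<le> cout k w \<and> cin k S \<le> cin k w"
  using assms(3,2)
proof (induction k rule: dec_induct)
  case (step k)
  show ?case
  proof (cases "k \<in> S")
    case False
    then have "S \<inter> {1..<Suc k} = S \<inter> {1..<k}" by (auto simp: less_Suc_eq)
    then show ?thesis
      using step False by (auto simp: cin_Suc cout_Suc)
  next
    case True
    have "S \<inter> {1..<Suc k} = insert k (S \<inter> {1..<k})" using True step(1) by auto
    then have "(\<Prod>i\<in>S \<inter> {1..<Suc k}. cg_factor S w i) = cg_factor S w k * (\<Prod>i\<in>S \<inter> {1..<k}. cg_factor S w i)"
      using assms(1) by simp
    then have nz: "cg_factor S w k \<noteq> 0" "(\<Prod>i\<in>S \<inter> {1..<k}. cg_factor S w i) \<noteq> 0"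
      using step.prems by auto
    have "cout k w \<noteq> cin k S" if "k \<in> w" using nz(1) that by (auto simp: cg_factor_def)
    moreover have "cin k w \<noteq> cin k S" if "k \<notin> w" using nz(1) that by (auto simp: cg_factor_def)
    ultimately show ?thesis
      using step.IH[OF nz(2)] True step(1) by (cases "k \<in> w") (auto simp: cin_Suc cout_Suc)
  qed
qed simp

lemma cg_support':
  assumes "S \<subseteq> {1..n}" "w \<subseteq> {1..n}" "cg S w \<noteq> 0"
  shows "card S + card w \<le> n" "card S \<le> card w"
proof -
  have fin: "finite S" using assms finite_subset by blast
  have "S \<inter> {1..<Suc n} = S" using assms by auto
  then have "cin (Suc n) S \<le> cout (Suc n) w \<and> cin (Suc n) S \<le> cin (Suc n) w"
    using cg_support[OF fin, where k = "Suc n" and w = w] assms(3) by (simp add: cg_def)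
  then show "card S + card w \<le> n" "card S \<le> card w"
    using cin_cout[of "Suc n" w] cin_full[OF assms(1)] cin_full[OF assms(2)] by auto
qed

section \<open>Ballot sets and the vanishing of non-standard vectors\<close>

definition ballot :: "nat \<Rightarrow> nat set \<Rightarrow> bool" where
  "ballot n S \<longleftrightarrow> S \<subseteq> {1..n} \<and> (\<forall>m\<le>n. 2 * card (S \<inter> {1..m}) \<le> m)"

text \<open>At \<open>k\<close> a form of degree \<open>k - 1 - 2 * cin k S = 0\<close> is
  differentiated. This makes the formula for \<open>u_k\<close> correct also when exchanging
  \<open>k\<close> and \<open>k + 1\<close> leaves the standard tableaux.\<close>

lemma cg_nonballot_zero:
  assumes "finite S" "1 \<le> k" "k \<in> S" and e: "2 * cin k S + 1 = k"
  shows "cg S w = 0"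
proof (rule ccontr)
  assume nz: "cg S w \<noteq> 0"
  have "(\<Prod>i\<in>S \<inter> {1..<k}. cg_factor S w i) \<noteq> 0" and "cg_factor S w k \<noteq> 0"
    using nz assms(1,3) by (auto simp: cg_def)
  then have "cin k S \<le> cout k w" "cin k S \<le> cin k w" "cg_factor S w k \<noteq> 0"
    using cg_support[OF assms(1) _ assms(2)] by blast+
  moreover from this have "cout k w = cin k S" "cin k w = cin k S"
    using cin_cout[of k w] e by linarith+
  ultimately show False by (simp add: cg_factor_def split: if_splits)
qed

lemma vec_outside: "\<not> w \<subseteq> {1..n} \<Longrightarrow> vec n S b w = 0"
  by (simp add: vec_def)

lemma ballot_finite: "ballot n S \<Longrightarrow> finite S"
  by (auto simp: ballot_def intro: finite_subset)

lemma act_u_vec_equal: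
  assumes "1 \<le> k" "k < n" "finite S" "k \<in> S \<longleftrightarrow> k + 1 \<in> S"
  shows "act n (tl_u n k) (vec n S b) = 0"
proof
  fix w
  show "act n (tl_u n k) (vec n S b) w = 0 w"
  proof (cases "w \<subseteq> {1..n}")
    case True
    have "vec n S b (swap_word k w) = vec n S b w"
      unfolding vec_def swap_word_subset[OF assms(1,2)] card_swap_word_full[OF assms(1,2) True]
        cg_swap_equal[OF assms(3,1,4)] ..
    then show ?thesis using True by (simp add: act_u[OF assms(1,2)])
  qed (simp add: act_outside)
qed

lemma act_u_vec_unequal:
  assumes "1 \<le> k" "k < n" "finite S" and ne: "(k \<in> S) \<noteq> (k + 1 \<in> S)"
    and r: "r = (if k \<in> S then of_nat k - 2 * of_nat (cin k S)
      else 2 * of_nat (cin k S) - of_nat k)" and "r \<noteq> 0"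
  shows "act n (tl_u n k) (vec n S b) = (\<lambda>w. (1 - 1 / r) * (vec n S b w - vec n (swap_word k S) b w))"
proof
  fix w
  show "act n (tl_u n k) (vec n S b) w = (1 - 1 / r) * (vec n S b w - vec n (swap_word k S) b w)"
  proof (cases "w \<subseteq> {1..n}")
    case True
    have "r * (vec n S b w - vec n S b (swap_word k w)) = (r - 1) * (vec n S b w - vec n (swap_word k S) b w)"
      unfolding vec_def swap_word_subset[OF assms(1,2)] card_swap_word_full[OF assms(1,2) True]
      using cg_swap_unequal[OF assms(3,1) ne r, of w] by auto
    then have "vec n S b w - vec n S b (swap_word k w) = (1 - 1 / r) * (vec n S b w - vec n (swap_word k S) b w)"
      using \<open>r \<noteq> 0\<close> by (simp add: field_simps)
    then show ?thesis using act_u[OF assms(1,2) True] by simp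
  qed (simp add: act_outside vec_outside)
qed

text \<open>The last letter is split off; the two Clebsch--Gordan embeddings are inverted with the
  determinant \<open>n + 1 - 2 l\<close>.\<close>

lemma ballot_extend:
  assumes "ballot n S"
  shows "ballot (Suc n) S" "2 * card S < n \<Longrightarrow> ballot (Suc n) (insert (Suc n) S)"
    "2 * card S \<le> n" "Suc n \<notin> S"
proof -
  have S: "S \<subseteq> {1..n}" and b: "\<And>m. m \<le> n \<Longrightarrow> 2 * card (S \<inter> {1..m}) \<le> m"
    using assms by (auto simp: ballot_def)
  have Sn: "S \<inter> {1..n} = S" "S \<inter> {1..Suc n} = S" using S by auto
  show "2 * card S \<le> n" using b[of n] Sn by simp
  show "Suc n \<notin> S" using S by auto
  show "ballot (Suc n) S"
    unfolding ballot_def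
  proof (intro conjI allI impI)
    show "S \<subseteq> {1..Suc n}" using S by auto
    fix m assume "m \<le> Suc n"
    then show "2 * card (S \<inter> {1..m}) \<le> m"
      using b \<open>2 * card S \<le> n\<close> Sn by (cases "m = Suc n") auto
  qed
  show "ballot (Suc n) (insert (Suc n) S)" if "2 * card S < n"
    unfolding ballot_def
  proof (intro conjI allI impI)
    show "insert (Suc n) S \<subseteq> {1..Suc n}" using S by auto
    fix m assume m: "m \<le> Suc n"
    show "2 * card (insert (Suc n) S \<inter> {1..m}) \<le> m"
    proof (cases "m = Suc n")
      case True
      then have "insert (Suc n) S \<inter> {1..m} = insert (Suc n) S" using S by auto
      then show ?thesis using True that ballot_finite[OF assms] \<open>Suc n \<notin> S\<close> by simp
    next
      case False
      then have "insert (Suc n) S \<inter> {1..m} = S \<inter> {1..m}" using m by auto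
      then show ?thesis using b m False by simp
    qed
  qed
qed

lemma cg_cong_word:
  assumes "S \<subseteq> {1..n}" "w \<inter> {1..n} = w' \<inter> {1..n}"
  shows "cg S w = cg S w'"
  unfolding cg_def
proof (rule prod.cong)
  fix i assume "i \<in> S"
  then have i: "i \<in> {1..n}" using assms(1) by auto
  have mem: "j \<in> w \<longleftrightarrow> j \<in> w'" if "j \<in> {1..n}" for j using assms(2) that by blast
  have "{1..<i} \<inter> w = {1..<i} \<inter> w'" "{1..<i} - w = {1..<i} - w'"
    by (rule set_eqI, use mem i in auto)+
  then show "cg_factor S w i = cg_factor S w' i" using mem[OF i] by (simp add: cg_factor_def cin_def cout_def)
qed simp

lemma cg_insert:
  assumes "S \<subseteq> {1..n}"
  shows "cg (insert (Suc n) S) w = cg_factor S w (Suc n) * cg S w"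
proof -
  have "finite S" "Suc n \<notin> S" using assms finite_subset by (blast, auto)
  then have "cg (insert (Suc n) S) w = cg_factor (insert (Suc n) S) w (Suc n) *
      (\<Prod>i\<in>S. cg_factor (insert (Suc n) S) w i)" by (simp add: cg_def)
  moreover have "cg_factor (insert (Suc n) S) w i = cg_factor S w i" if "i \<le> Suc n" for i
  proof -
    have "{1..<i} \<inter> insert (Suc n) S = {1..<i} \<inter> S" using that by auto
    then show ?thesis by (simp add: cg_factor_def cin_def)
  qed
  ultimately show ?thesis using assms by (auto simp: cg_def intro!: prod.cong)
qed

lemma vec_spanning:
  assumes "\<And>f g. P f \<Longrightarrow> P g \<Longrightarrow> P (\<lambda>w. f w + g w :: rat)" "\<And>c f. P f \<Longrightarrow> P (\<lambda>w. c * f w)"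
    and "\<And>S b. ballot n S \<Longrightarrow> P (vec n S b)"
    and "z \<subseteq> {1..n}"
  shows "P (\<lambda>w. of_bool (w = z))"
  using assms
proof (induction n arbitrary: P z)
  case 0
  have "ballot 0 {}" by (simp add: ballot_def)
  then have "P (vec 0 {} 0)" by (rule 0(3))
  moreover have "vec 0 {} 0 = (\<lambda>w. of_bool (w = z))"
    using 0(4) by (auto simp: fun_eq_iff vec_def cg_def)
  ultimately show ?case by simp
next
  case (Suc n)
  define E0 where "E0 f w = (if Suc n \<in> w then 0 else f w)" for f :: "nat set \<Rightarrow> rat" and w
  define E1 where "E1 f w = (if Suc n \<in> w then f (w - {Suc n}) else 0)" for f :: "nat set \<Rightarrow> rat" and w
  \<comment> \<open>The induction hypothesis is applied to the functions of \<open>n\<close> letters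
    whose extensions by either last letter both satisfy \<open>P\<close>.\<close>
  define P' where "P' f \<longleftrightarrow> P (E0 f) \<and> P (E1 f)" for f
  note add = Suc.prems(1) and scale = Suc.prems(2) and vec = Suc.prems(3)
  have lin: "P (\<lambda>w. c * f w + d * g w)" if "P f" "P g" for c d f g
    by (intro add scale that)
  have P0: "P (\<lambda>w. 0)" using scale[OF vec[of "{}" 0], of 0] by (simp add: ballot_def)
  have main: "P' (vec n S b)" if bal: "ballot n S" for S b
  proof -
    define l where "l = card S"
    have S: "S \<subseteq> {1..n}" using bal by (simp add: ballot_def)
    define A where "A b = E0 (vec n S b)" for b
    \<comment> \<open>A last letter in the word leaves weight \<open>b - 1\<close> for the rest. No
      such word exists for \<open>b = 0\<close>, where truncated subtraction would give a wrong
      function.\<close>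
    define B where "B b = (if b = 0 then (\<lambda>w. 0) else E1 (vec n S (b - 1)))" for b
    define X where "X b = vec (Suc n) S b" for b
    define Y where "Y b = vec (Suc n) (insert (Suc n) S) b" for b
    have fin: "finite w" if "w \<subseteq> {1..Suc n}" for w using that finite_subset by blast
    have sub: "w \<subseteq> {1..Suc n} \<longleftrightarrow> w - {Suc n} \<subseteq> {1..n}" for w by auto
    have cgw: "cg S w = cg S (w - {Suc n})" for w
      by (rule cg_cong_word[OF S]) auto
    have X_eq: "X b w = A b w + B b w" for b w
    proof (cases "Suc n \<in> w")
      case True
      have c: "card w = b \<longleftrightarrow> b \<noteq> 0 \<and> card (w - {Suc n}) = b - 1" if "w \<subseteq> {1..Suc n}"
        using True fin[OF that] card.remove[of w "Suc n"] by auto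
      have "A b w = 0" by (simp add: A_def E0_def True)
      moreover have "B b w = (if b = 0 then 0 else
          if w - {Suc n} \<subseteq> {1..n} \<and> card (w - {Suc n}) = b - 1 then cg S (w - {Suc n}) else 0)"
        by (simp add: B_def E1_def vec_def True)
      moreover have "X b w = (if w \<subseteq> {1..Suc n} \<and> card w = b then cg S w else 0)"
        by (simp add: X_def vec_def)
      ultimately show ?thesis
        unfolding cgw[of w, symmetric] sub[of w, symmetric] using c
        by (cases "w \<subseteq> {1..Suc n}") simp_all
    next
      case False
      then show ?thesis using sub[of w] by (auto simp: X_def A_def B_def E0_def E1_def vec_def)
    qed
    have Y_eq: "Y b w = (of_nat l - of_nat b) * A b w + (of_nat n - of_nat b + 1 - of_nat l) * B b w" for b w
    proof (cases "w \<subseteq> {1..Suc n}")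
      case sw: True
      show ?thesis
      proof (cases "Suc n \<in> w")
        case True
        have c: "card w = b \<longleftrightarrow> b \<noteq> 0 \<and> card (w - {Suc n}) = b - 1"
          using True fin[OF sw] card.remove[of w "Suc n"] by auto
        have w': "w - {Suc n} \<subseteq> {1..n}" using sw sub by blast
        have "cin (Suc n) w = card (w - {Suc n})"
          unfolding cin_def by (rule arg_cong[of _ _ card]) (use sw in auto)
        then have "card (w - {Suc n}) + cout (Suc n) w = n" using cin_cout[of "Suc n" w] by simp
        then have "of_nat (card (w - {Suc n}) + cout (Suc n) w) = (of_nat n :: rat)" by (rule arg_cong)
        then have "cg_factor S w (Suc n) = of_nat n - of_nat (card (w - {Suc n})) - of_nat l"
          using True cin_full[OF S] by (simp add: cg_factor_def l_def)
        then show ?thesis using True c sw w' cgw[of w]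
          by (cases b) (auto simp: Y_def A_def B_def E0_def E1_def vec_def cg_insert[OF S])
      next
        case False
        then have "w \<subseteq> {1..n}" using sw by (auto simp: le_Suc_eq)
        then have "cg_factor S w (Suc n) = of_nat l - of_nat (card w)"
          using False cin_full[OF S] cin_full[of w n] by (simp add: cg_factor_def l_def)
        then show ?thesis using False sub[of w] sw
          by (auto simp: Y_def A_def B_def E0_def E1_def vec_def cg_insert[OF S])
      qed
    next
      case False
      then show ?thesis using sub[of w] by (auto simp: Y_def A_def B_def E0_def E1_def vec_def)
    qed
    have PX: "P (X b)" for b unfolding X_def by (rule vec[OF ballot_extend(1)[OF bal]])
    have "P (A b) \<and> P (B b)" for b
    proof (cases "2 * l < n")
      case True
      have PY: "P (Y b)" unfolding Y_def
        by (rule vec[OF ballot_extend(2)[OF bal]]) (use True l_def in simp)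
      define d :: rat where "d = of_nat n + 1 - 2 * of_nat l"
      have d: "d \<noteq> 0"
      proof -
        have "of_nat (2 * l) < (of_nat n + 1 :: rat)" using True by (metis less_Suc_eq of_nat_less_iff of_nat_Suc add.commute)
        then show ?thesis by (simp add: d_def)
      qed
      have aux: "(\<alpha> * x - y) / d = (\<alpha> / d) * x + (- 1 / d) * y" for \<alpha> x y :: rat
        by (simp add: diff_divide_distrib)
      have "A b = (\<lambda>w. ((of_nat n - of_nat b + 1 - of_nat l) / d) * X b w + (- 1 / d) * Y b w)"
      proof
        fix w
        have "d * A b w = (of_nat n - of_nat b + 1 - of_nat l) * X b w - Y b w"
          unfolding X_eq Y_eq d_def by (simp add: algebra_simps)
        then have "A b w = ((of_nat n - of_nat b + 1 - of_nat l) * X b w - Y b w) / d"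
          unfolding nonzero_eq_divide_eq[OF d] by (simp only: mult.commute)
        then show "A b w = ((of_nat n - of_nat b + 1 - of_nat l) / d) * X b w + (- 1 / d) * Y b w"
          by (rule trans) (rule aux)
      qed
      moreover have "B b = (\<lambda>w. (- (of_nat l - of_nat b) / d) * X b w + (1 / d) * Y b w)"
      proof
        fix w
        have "d * B b w = Y b w - (of_nat l - of_nat b) * X b w"
          unfolding X_eq Y_eq d_def by (simp add: algebra_simps)
        then have "B b w = (Y b w - (of_nat l - of_nat b) * X b w) / d"
          unfolding nonzero_eq_divide_eq[OF d] by (simp only: mult.commute)
        then have "B b w = Y b w / d - (of_nat l - of_nat b) * X b w / d"
          by (simp add: diff_divide_distrib)
        moreover have "(- (of_nat l - of_nat b) / d) * X b w = - ((of_nat l - of_nat b) * X b w / d)"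
          by (simp only: minus_divide_left mult_minus_left times_divide_eq_left)
        ultimately show "B b w = (- (of_nat l - of_nat b) / d) * X b w + (1 / d) * Y b w"
          by (simp del: minus_diff_eq)
      qed
      ultimately show ?thesis using lin[OF PX PY] by metis
    next
      case False
      \<comment> \<open>The shape is a rectangle and allows no column-two step. The module is then
        one-dimensional and only the weight \<open>l\<close> occurs, so one of the two parts of
        \<open>X b\<close> is zero and the other equals \<open>X b\<close>.\<close>
      then have n: "n = 2 * l" using ballot_extend(3)[OF bal] l_def by simp
      have zero: "vec n S b = (\<lambda>w. 0)" if "b \<noteq> l" for b
      proof
        fix w
        show "vec n S b w = 0"
        proof (cases "w \<subseteq> {1..n} \<and> cg S w \<noteq> 0")
          case True
          then have "card w = l" using cg_support'[OF S, of w] n l_def by linarith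
          then show ?thesis using that by (simp add: vec_def)
        qed (auto simp: vec_def)
      qed
      have "A b = (\<lambda>w. 0) \<or> B b = (\<lambda>w. 0)"
      proof (cases "b = l")
        case True
        then have "B b = (\<lambda>w. 0)" using zero[of "b - 1"] by (auto simp: B_def E1_def fun_eq_iff)
        then show ?thesis ..
      next
        case False
        then have "A b = (\<lambda>w. 0)" using zero[of b] by (auto simp: A_def E0_def fun_eq_iff)
        then show ?thesis ..
      qed
      moreover have "X b = (\<lambda>w. A b w + B b w)" using X_eq by auto
      ultimately show ?thesis using PX[of b] P0 by auto
    qed
    from this[of b] this[of "Suc b"] show ?thesis by (simp add: P'_def A_def B_def)
  qed
  have P'add: "P' (\<lambda>w. f w + g w)" if "P' f" "P' g" for f g
  proof -
    have "E0 (\<lambda>w. f w + g w) = (\<lambda>w. E0 f w + E0 g w)" "E1 (\<lambda>w. f w + g w) = (\<lambda>w. E1 f w + E1 g w)"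
      by (auto simp: E0_def E1_def fun_eq_iff)
    then show ?thesis using that add unfolding P'_def by simp
  qed
  have P'scale: "P' (\<lambda>w. c * f w)" if "P' f" for c f
  proof -
    have "E0 (\<lambda>w. c * f w) = (\<lambda>w. c * E0 f w)" "E1 (\<lambda>w. c * f w) = (\<lambda>w. c * E1 f w)"
      by (auto simp: E0_def E1_def fun_eq_iff)
    then show ?thesis using that scale unfolding P'_def by simp
  qed
  have "z - {Suc n} \<subseteq> {1..n}" using Suc.prems(4) by auto
  from Suc.IH[of P', OF P'add P'scale main this]
  have PE: "P (E0 (\<lambda>w. of_bool (w = z - {Suc n})))" "P (E1 (\<lambda>w. of_bool (w = z - {Suc n})))"
    by (auto simp: P'_def)
  show ?case
  proof (cases "Suc n \<in> z")
    case True
    have "(\<lambda>w. of_bool (w = z)) = E1 (\<lambda>w. of_bool (w = z - {Suc n}))"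
    proof
      fix w
      have "w = z \<longleftrightarrow> Suc n \<in> w \<and> w - {Suc n} = z - {Suc n}" using True by auto
      then show "of_bool (w = z) = E1 (\<lambda>w. of_bool (w = z - {Suc n})) w" by (simp add: E1_def)
    qed
    then show ?thesis using PE(2) by (simp only:)
  next
    case False
    have "(\<lambda>w. of_bool (w = z)) = E0 (\<lambda>w. of_bool (w = z - {Suc n}))"
    proof
      fix w
      have "w = z \<longleftrightarrow> Suc n \<notin> w \<and> w = z - {Suc n}" using False by auto
      then show "of_bool (w = z) = E0 (\<lambda>w. of_bool (w = z - {Suc n})) w" by (simp add: E0_def)
    qed
    then show ?thesis using PE(1) by (simp only:)
  qed
qed

lemma act_vec_faithful:
  assumes x: "x \<in> TL n" and zero: "\<And>S b. ballot n S \<Longrightarrow> act n x (vec n S b) = 0"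
  shows "x = 0"
proof (rule act_faithful[OF x])
  fix z assume z: "z \<subseteq> {1..n}"
  show "act n x (\<lambda>w. of_bool (w = z)) = 0"
  proof (rule vec_spanning[where P = "\<lambda>f. act n x f = 0", OF _ _ _ z])
    show "act n x (\<lambda>w. f w + g w) = 0" if "act n x f = 0" "act n x g = 0" for f g
    proof -
      have "act n x (f + g) = 0" using act_add[of n x f g] that by simp
      then show ?thesis by (simp only: plus_fun_def)
    qed
    show "act n x (\<lambda>w. c * f w) = 0" if "act n x f = 0" for c f
      using that by (simp add: act_scale fun_eq_iff)
  qed (rule zero)
qed

section \<open>Two-column tableaux and ballot sets\<close>

definition col2 :: "nat \<Rightarrow> tableau \<Rightarrow> nat set" where
  "col2 n t = {i \<in> {1..n}. snd (t i) = 2}"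

definition tab :: "nat \<Rightarrow> nat set \<Rightarrow> tableau" where
  "tab n S = restrict (\<lambda>i. if i \<in> S then (cin (Suc i) S, 2) else (cout (Suc i) S, 1)) {1..n}"

definition two_col_shape :: "nat \<Rightarrow> nat \<Rightarrow> box set" where
  "two_col_shape n l = {1..n - l} \<times> {1} \<union> {1..l} \<times> {2}"

lemma Std_entry:
  assumes nu: "\<nu> \<in> Par2 n" and t: "t \<in> Std n \<nu>" and i: "i \<in> {1..n}"
  shows "1 \<le> fst (t i)" "snd (t i) = 1 \<or> snd (t i) = 2" "t i \<in> \<nu>"
proof -
  show "t i \<in> \<nu>" using t i by (auto simp: Std_def bij_betw_def)
  then have "t i \<in> {1..} \<times> {1..2}" using nu by (auto simp: Par2_def)
  then show "1 \<le> fst (t i)" "snd (t i) = 1 \<or> snd (t i) = 2" by (cases "t i"; auto)+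
qed

text \<open>The boxes above that of \<open>i\<close> in its column belong to the shape and carry
  smaller entries, those below carry larger ones. So a standard tableau is determined by its second
  column alone.\<close>

lemma Std_row:
  assumes nu: "\<nu> \<in> Par2 n" and t: "t \<in> Std n \<nu>" and i: "i \<in> {1..n}"
  shows "fst (t i) = card {j \<in> {1..i}. snd (t j) = snd (t i)}"
proof -
  let ?C = "{j \<in> {1..i}. snd (t j) = snd (t i)}"
  have inj: "inj_on t {1..n}" and img: "t ` {1..n} = \<nu>"
    using t by (auto simp: Std_def bij_betw_def)
  have std: "j < k" if "j \<in> {1..n}" "k \<in> {1..n}" "snd (t j) = snd (t k)" "fst (t j) < fst (t k)" for j k
    using t that unfolding Std_def by blast
  have sub: "?C \<subseteq> {1..n}" using i by auto
  have "fst ` (t ` ?C) = {1..fst (t i)}"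
  proof (intro equalityI subsetI)
    fix r assume "r \<in> fst ` (t ` ?C)"
    then obtain j where j: "j \<in> ?C" "r = fst (t j)" by auto
    then have "j \<in> {1..n}" using sub by blast
    then show "r \<in> {1..fst (t i)}"
      using std[OF i \<open>j \<in> {1..n}\<close>] j Std_entry(1)[OF nu t \<open>j \<in> {1..n}\<close>] by fastforce
  next
    fix r assume r: "r \<in> {1..fst (t i)}"
    have "(fst (t i), snd (t i)) \<in> \<nu>" using Std_entry(3)[OF nu t i] by simp
    moreover have "1 \<le> snd (t i)" using Std_entry(2)[OF nu t i] by auto
    ultimately have "(r, snd (t i)) \<in> \<nu>" using nu r unfolding Par2_def by fastforce
    then obtain j where j: "j \<in> {1..n}" "t j = (r, snd (t i))" using img by (metis imageE)
    have "j \<le> i"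
    proof (cases "r = fst (t i)")
      case True
      then have "t j = t i" using j(2) by (simp add: prod_eq_iff)
      then show ?thesis using inj_onD[OF inj _ j(1) i] by simp
    next
      case False
      then show ?thesis using std[OF j(1) i] j(2) r by auto
    qed
    then have "j \<in> ?C" using j by auto
    then have "fst (t j) \<in> fst ` (t ` ?C)" by blast
    then show "r \<in> fst ` (t ` ?C)" using j(2) by simp
  qed
  moreover have "inj_on fst (t ` ?C)" by (rule inj_onI) (auto simp: prod_eq_iff)
  note card_image[OF this]
  moreover have "inj_on t ?C" using inj sub by (rule inj_on_subset)
  note card_image[OF this]
  ultimately have "card ?C = card {1..fst (t i)}" by simp
  then show ?thesis by simp
qed

lemma Std_eq_tab:
  assumes nu: "\<nu> \<in> Par2 n" and t: "t \<in> Std n \<nu>"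
  shows "t = tab n (col2 n t)"
proof
  fix i
  show "t i = tab n (col2 n t) i"
  proof (cases "i \<in> {1..n}")
    case True
    have mem: "j \<in> col2 n t \<longleftrightarrow> snd (t j) = 2" "j \<notin> col2 n t \<longleftrightarrow> snd (t j) = 1" if "j \<in> {1..i}" for j
    proof -
      have "j \<in> {1..n}" using that True by auto
      then show "j \<in> col2 n t \<longleftrightarrow> snd (t j) = 2" "j \<notin> col2 n t \<longleftrightarrow> snd (t j) = 1"
        using Std_entry(2)[OF nu t, of j] by (auto simp: col2_def)
    qed
    have int: "{1..<Suc i} = {1..i}" by auto
    show ?thesis
    proof (cases "i \<in> col2 n t")
      case c: True
      then have s: "snd (t i) = 2" by (simp add: col2_def)
      have "{j \<in> {1..i}. snd (t j) = snd (t i)} = {1..<Suc i} \<inter> col2 n t"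
        unfolding int s using mem(1) by blast
      then have "fst (t i) = cin (Suc i) (col2 n t)"
        unfolding Std_row[OF nu t True] cin_def by (rule arg_cong)
      then show ?thesis using s c True by (simp add: tab_def prod_eq_iff)
    next
      case c: False
      then have s: "snd (t i) = 1" using mem(2)[of i] True by simp
      have "{j \<in> {1..i}. snd (t j) = snd (t i)} = {1..<Suc i} - col2 n t"
        unfolding int s using mem(2) by blast
      then have "fst (t i) = cout (Suc i) (col2 n t)"
        unfolding Std_row[OF nu t True] cout_def by (rule arg_cong)
      then show ?thesis using s c True by (simp add: tab_def prod_eq_iff)
    qed
  next
    case False
    then show ?thesis using t by (auto simp: tab_def Std_def extensional_def)
  qed
qed

lemma cin_mono: "i \<le> j \<Longrightarrow> cin i S \<le> cin j S" and cout_mono: "i \<le> j \<Longrightarrow> cout i S \<le> cout j S"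
  unfolding cin_def cout_def by (rule card_mono; auto)+

lemma cin_strict: "1 \<le> i \<Longrightarrow> i < j \<Longrightarrow> i \<in> S \<Longrightarrow> cin i S < cin j S"
  using cin_mono[of "Suc i" j S] cin_Suc[of i S] by simp

lemma cout_strict: "1 \<le> i \<Longrightarrow> i < j \<Longrightarrow> i \<notin> S \<Longrightarrow> cout i S < cout j S"
  using cout_mono[of "Suc i" j S] cout_Suc[of i S] by simp

lemma ballot_iff: "ballot n S \<longleftrightarrow> S \<subseteq> {1..n} \<and> (\<forall>m\<le>n. 2 * cin (Suc m) S \<le> m)"
proof -
  have "S \<inter> {1..m} = {1..<Suc m} \<inter> S" for m by auto
  then show ?thesis by (simp only: ballot_def cin_def)
qed

lemma ballotD: "ballot n S \<Longrightarrow> m \<le> n \<Longrightarrow> 2 * cin (Suc m) S \<le> m"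
  by (simp add: ballot_iff)

text \<open>An entry in row \<open>q\<close> of the second column has a smaller left neighbour, so
  at least \<open>q\<close> entries of the first column precede it.\<close>

lemma Std_ballot:
  assumes nu: "\<nu> \<in> Par2 n" and t: "t \<in> Std n \<nu>"
  shows "ballot n (col2 n t)"
  unfolding ballot_iff
proof (intro conjI allI impI)
  let ?S = "col2 n t"
  show "?S \<subseteq> {1..n}" by (auto simp: col2_def)
  have "m \<le> n \<Longrightarrow> 2 * cin (Suc m) ?S \<le> m" for m
  proof (induction m)
    case (Suc m)
    show ?case
    proof (cases "Suc m \<in> ?S")
      case False
      then show ?thesis using Suc cin_Suc[of "Suc m" ?S] by simp
    next
      case True
      let ?q = "cin (Suc (Suc m)) ?S"
      have i: "Suc m \<in> {1..n}" using Suc by simp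
      have tt: "t (Suc m) = (?q, 2)"
        using fun_cong[OF Std_eq_tab[OF nu t], of "Suc m"] True i by (simp add: tab_def)
      then have "(?q, 2) \<in> \<nu>" using Std_entry(3)[OF nu t i] by simp
      moreover have "1 \<le> ?q" using Std_entry(1)[OF nu t i] tt by simp
      ultimately have "(?q, 1) \<in> \<nu>" using nu unfolding Par2_def by fastforce
      moreover have "\<nu> = t ` {1..n}" using t by (auto simp: Std_def bij_betw_def)
      ultimately obtain j where j: "j \<in> {1..n}" "t j = (?q, 1)" by auto
      have "j < Suc m" using t j i tt unfolding Std_def by fastforce
      have "j \<notin> ?S" using j by (simp add: col2_def)
      then have "cout (Suc j) ?S = ?q"
        using fun_cong[OF Std_eq_tab[OF nu t], of j] j by (simp add: tab_def)
      then have "?q \<le> cout (Suc (Suc m)) ?S"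
        using cout_mono[of "Suc j" "Suc (Suc m)" ?S] \<open>j < Suc m\<close> by simp
      then show ?thesis using cin_cout[of "Suc (Suc m)" ?S] by simp
    qed
  qed simp
  then show "2 * cin (Suc m) ?S \<le> m" if "m \<le> n" for m using that .
qed

lemma col2_tab: "S \<subseteq> {1..n} \<Longrightarrow> col2 n (tab n S) = S"
  by (auto simp: col2_def tab_def)

lemma ballot_card: "ballot n S \<Longrightarrow> 2 * card S \<le> n"
  using ballotD[of n S n] cin_full[of S n] by (simp add: ballot_iff)

lemma two_col_shape_Par2:
  assumes "2 * l \<le> n" shows "two_col_shape n l \<in> Par2 n"
  unfolding Par2_def
proof (intro CollectI conjI)
  show "finite (two_col_shape n l)" by (simp add: two_col_shape_def)
  have "card (two_col_shape n l) = card ({1..n - l} \<times> {1 :: nat}) + card ({1..l} \<times> {2 :: nat})"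
    unfolding two_col_shape_def by (rule card_Un_disjoint) auto
  then show "card (two_col_shape n l) = n" using assms by (simp add: card_cartesian_product)
  show "two_col_shape n l \<subseteq> {1..} \<times> {1..2}" by (auto simp: two_col_shape_def)
  show "\<forall>r c r' c'. (r, c) \<in> two_col_shape n l \<longrightarrow> 1 \<le> r' \<longrightarrow> r' \<le> r \<longrightarrow> 1 \<le> c' \<longrightarrow> c' \<le> c \<longrightarrow>
      (r', c') \<in> two_col_shape n l"
  proof (intro allI impI)
    fix r c r' c' :: nat
    assume *: "(r, c) \<in> two_col_shape n l" "1 \<le> r'" "r' \<le> r" "1 \<le> c'" "c' \<le> c"
    then have "c' = 1 \<or> c' = 2" by (auto simp: two_col_shape_def)
    then show "(r', c') \<in> two_col_shape n l" using * assms by (auto simp: two_col_shape_def)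
  qed
qed

lemma tab_Std:
  assumes b: "ballot n S"
  shows "tab n S \<in> Std n (two_col_shape n (card S))"
proof -
  have S: "S \<subseteq> {1..n}" using b by (simp add: ballot_iff)
  let ?t = "tab n S"
  have t: "?t i = (if i \<in> S then (cin (Suc i) S, 2) else (cout (Suc i) S, 1))" if "i \<in> {1..n}" for i
    using that by (simp add: tab_def)
  have inj: "inj_on ?t {1..n}"
  proof (rule inj_onI)
    fix i j assume ij: "i \<in> {1..n}" "j \<in> {1..n}" "?t i = ?t j"
    have *: False if "i < j" "i \<in> {1..n}" "j \<in> {1..n}" "?t i = ?t j" for i j
      using that t[of i] t[of j] cin_strict[of i j S] cout_strict[of i j S] cin_Suc[of i S] cin_Suc[of j S]
        cout_Suc[of i S] cout_Suc[of j S] by (auto split: if_splits)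
    show "i = j" using *[of i j] *[of j i] ij by (metis nat_neq_iff)
  qed
  have "?t ` {1..n} \<subseteq> two_col_shape n (card S)"
  proof
    fix x assume "x \<in> ?t ` {1..n}"
    then obtain i where i: "i \<in> {1..n}" "x = ?t i" by auto
    have "cin (Suc i) S \<le> card S" using cin_mono[of "Suc i" "Suc n" S] cin_full[OF S] i by simp
    moreover have "cout (Suc n) S = n - card S" using cin_cout[of "Suc n" S] cin_full[OF S] by simp
    then have "cout (Suc i) S \<le> n - card S" using cout_mono[of "Suc i" "Suc n" S] i by simp
    ultimately show "x \<in> two_col_shape n (card S)"
      using i t[OF i(1)] cin_Suc[of i S] cout_Suc[of i S] by (auto simp: two_col_shape_def)
  qed
  moreover have "card (?t ` {1..n}) = n" using card_image[OF inj] by simp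
  moreover have "finite (two_col_shape n (card S))" "card (two_col_shape n (card S)) = n"
    using two_col_shape_Par2[OF ballot_card[OF b]] by (auto simp: Par2_def)
  ultimately have "?t ` {1..n} = two_col_shape n (card S)" by (metis card_subset_eq)
  then have bij: "bij_betw ?t {1..n} (two_col_shape n (card S))" using inj by (simp add: bij_betw_def)
  have "i < j" if ij: "i \<in> {1..n}" "j \<in> {1..n}"
    and less: "fst (?t i) = fst (?t j) \<and> snd (?t i) < snd (?t j) \<or>
      snd (?t i) = snd (?t j) \<and> fst (?t i) < fst (?t j)" for i j
  proof (rule ccontr)
    assume "\<not> i < j"
    moreover have "i \<noteq> j" using less by auto
    ultimately have ji: "j < i" by simp
    from less show False
    proof (elim disjE conjE)
      assume "fst (?t i) = fst (?t j)" "snd (?t i) < snd (?t j)"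
      then have *: "i \<notin> S" "j \<in> S" "cout (Suc i) S = cin (Suc j) S"
        using t[OF ij(1)] t[OF ij(2)] by (auto split: if_splits)
      have "2 * cin (Suc j) S \<le> j" using ballotD[OF b] ij by simp
      then have "cin (Suc j) S \<le> cout (Suc j) S" using cin_cout[of "Suc j" S] by simp
      also have "cout (Suc j) S \<le> cout i S" using cout_mono ji by simp
      also have "cout i S < cout (Suc i) S" using cout_strict[of i "Suc i" S] *(1) ij by simp
      finally show False using *(3) by simp
    next
      assume "snd (?t i) = snd (?t j)" "fst (?t i) < fst (?t j)"
      then show False
        using t[OF ij(1)] t[OF ij(2)] cin_mono[of "Suc j" "Suc i" S] cout_mono[of "Suc j" "Suc i" S] ji
        by (auto split: if_splits)
    qed
  qed
  moreover have "?t \<in> extensional {1..n}" by (simp add: tab_def)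
  ultimately show ?thesis unfolding Std_def using bij by blast
qed

lemma Std_shape:
  assumes nu: "\<nu> \<in> Par2 n" and t: "t \<in> Std n \<nu>"
  shows "\<nu> = two_col_shape n (card (col2 n t))"
proof -
  have "\<nu> = t ` {1..n}" using t by (auto simp: Std_def bij_betw_def)
  also have "\<dots> = tab n (col2 n t) ` {1..n}" using Std_eq_tab[OF nu t] by simp
  also have "\<dots> = two_col_shape n (card (col2 n t))"
    using tab_Std[OF Std_ballot[OF nu t]] by (auto simp: Std_def bij_betw_def)
  finally show ?thesis .
qed

lemma tab_Std2: "ballot n S \<Longrightarrow> tab n S \<in> Std2 n"
  unfolding Std2_def by (rule UN_I, rule two_col_shape_Par2, erule ballot_card, erule tab_Std)

lemma Std2_ballot: "t \<in> Std2 n \<Longrightarrow> ballot n (col2 n t)"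
  unfolding Std2_def using Std_ballot by blast

lemma Std2_eq_tab: "t \<in> Std2 n \<Longrightarrow> t = tab n (col2 n t)"
  unfolding Std2_def using Std_eq_tab by blast

lemma tab_Std2_iff: "S \<subseteq> {1..n} \<Longrightarrow> tab n S \<in> Std2 n \<longleftrightarrow> ballot n S"
  using tab_Std2 Std2_ballot[of "tab n S" n] col2_tab[of S n] by auto

lemma Std_iff:
  assumes nu: "\<nu> \<in> Par2 n" and s: "s \<in> Std n \<nu>"
  shows "t \<in> Std n \<nu> \<longleftrightarrow> t \<in> Std2 n \<and> card (col2 n t) = card (col2 n s)"
proof
  assume t: "t \<in> Std n \<nu>"
  have sh: "two_col_shape n (card (col2 n t)) = two_col_shape n (card (col2 n s))"
    using Std_shape[OF nu s] Std_shape[OF nu t] by simp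
  have "{r. (r, 2) \<in> two_col_shape n l} = {1..l}" for l by (auto simp: two_col_shape_def)
  then have "{1..card (col2 n t)} = {1..card (col2 n s)}" using sh by metis
  then have "card {1..card (col2 n t)} = card {1..card (col2 n s)}" by (rule arg_cong)
  then have "card (col2 n t) = card (col2 n s)" by (simp only: card_atLeastAtMost diff_Suc_1)
  then show "t \<in> Std2 n \<and> card (col2 n t) = card (col2 n s)"
    using t nu by (auto simp: Std2_def)
next
  assume t: "t \<in> Std2 n \<and> card (col2 n t) = card (col2 n s)"
  then show "t \<in> Std n \<nu>"
    using tab_Std[OF Std2_ballot, of t n] Std2_eq_tab[of t n] Std_shape[OF nu s] by simp
qed

section \<open>Contents separate the tableaux\<close>

lemma finite_Std2: "finite (Std2 n)"
proof (rule finite_subset)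
  show "Std2 n \<subseteq> tab n ` Pow {1..n}"
  proof
    fix t assume t: "t \<in> Std2 n"
    have "col2 n t \<in> Pow {1..n}" by (auto simp: col2_def)
    then show "t \<in> tab n ` Pow {1..n}" using Std2_eq_tab[OF t] by (rule image_eqI[rotated])
  qed
qed simp

lemma finite_contents: "finite (contents n)"
proof -
  have "contents n = (\<Union>s\<in>Std2 n. content s ` {1..n})" unfolding contents_def by blast
  then show ?thesis using finite_Std2 by simp
qed

lemma content_tab:
  assumes "i \<in> {1..n}"
  shows "content (tab n S) i = (if i \<in> S then 1 - int (cin i S) else int (cin i S) + 1 - int i)"
proof -
  have i: "1 \<le> i" using assms by simp
  have "cin i S + cout i S + 1 = i" using cin_cout[of i S] i by simp
  then have "int (cout i S) = int i - 1 - int (cin i S)" by linarith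
  then show ?thesis using assms cin_Suc[OF i, of S] cout_Suc[OF i, of S]
    by (simp add: content_def tab_def)
qed

lemma content_Std2:
  assumes "t \<in> Std2 n" "i \<in> {1..n}"
  shows "content t i = (if i \<in> col2 n t then 1 - int (cin i (col2 n t)) else int (cin i (col2 n t)) + 1 - int i)"
  by (subst Std2_eq_tab[OF assms(1)]) (rule content_tab[OF assms(2)])

lemma cin_cong: "(\<And>j. 1 \<le> j \<Longrightarrow> j < i \<Longrightarrow> j \<in> S \<longleftrightarrow> j \<in> T) \<Longrightarrow> cin i S = cin i T"
  unfolding cin_def by (rule arg_cong[of _ _ card]) auto

text \<open>Before the first entry \<open>i\<close> on which the columns differ, both tableaux have
  the same number \<open>c\<close> of entries in the second column. The contents of \<open>i\<close>
  are \<open>1 - c\<close> and \<open>c + 1 - i\<close>; equality means \<open>i = 2 * c\<close>,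
  against the ballot condition \<open>2 * (c + 1) <= i\<close> in the tableau that has
  \<open>i\<close> in the second column.\<close>

lemma contents_separate:
  assumes s: "s \<in> Std2 n" and t: "t \<in> Std2 n" and ne: "s \<noteq> t"
  obtains i where "i \<in> {1..n}" "content s i \<noteq> content t i"
proof -
  let ?S = "col2 n s" and ?T = "col2 n t"
  have "?S \<noteq> ?T" using Std2_eq_tab[OF s] Std2_eq_tab[OF t] ne by metis
  then have ex: "\<exists>i. (i \<in> ?S) \<noteq> (i \<in> ?T)" by blast
  define i where "i = (LEAST i. (i \<in> ?S) \<noteq> (i \<in> ?T))"
  have i: "(i \<in> ?S) \<noteq> (i \<in> ?T)" unfolding i_def using ex by (rule LeastI_ex)
  have below: "j \<in> ?S \<longleftrightarrow> j \<in> ?T" if "j < i" for j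
    using not_less_Least[of j "\<lambda>i. (i \<in> ?S) \<noteq> (i \<in> ?T)"] that unfolding i_def by blast
  have c: "cin i ?S = cin i ?T" by (rule cin_cong) (rule below)
  have i1: "i \<in> {1..n}" using i by (auto simp: col2_def)
  have *: "2 * (cin i (col2 n u) + 1) \<le> i" if "u \<in> Std2 n" "i \<in> col2 n u" for u
    using ballotD[OF Std2_ballot[OF that(1)], of i] i1 cin_Suc[of i "col2 n u"] that(2) by simp
  have "content s i \<noteq> content t i"
    unfolding content_Std2[OF s i1] content_Std2[OF t i1] using i c *[OF s] *[OF t] by auto
  then show ?thesis using that i1 by blast
qed

section \<open>Exchanging two consecutive entries\<close>

lemma tab_swap_swap [simp]: "tab_swap (tab_swap s k) k = s"
  by (simp add: tab_swap_def comp_assoc)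

lemma tab_swap_apply [simp]:
  "tab_swap s k k = s (k + 1)" "tab_swap s k (Suc k) = s k"
  by (simp_all add: tab_swap_def)

lemma tab_swap_other: "i \<noteq> k \<Longrightarrow> i \<noteq> Suc k \<Longrightarrow> tab_swap s k i = s i"
  by (simp add: tab_swap_def transpose_def)

lemma content_tab_swap:
  "content (tab_swap s k) k = content s (k + 1)" "content (tab_swap s k) (Suc k) = content s k"
  "i \<noteq> k \<Longrightarrow> i \<noteq> Suc k \<Longrightarrow> content (tab_swap s k) i = content s i"
  by (simp_all add: content_def tab_swap_other)

lemma tab_swap_tab:
  assumes k: "1 \<le> k" "k < n" and ne: "(k \<in> S) \<noteq> (k + 1 \<in> S)"
  shows "tab_swap (tab n S) k = tab n (swap_word k S)"
proof
  fix i
  have c: "cin k (swap_word k S) = cin k S" "cout k (swap_word k S) = cout k S"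
    using cin_swap_word[of k k S] k by auto
  note Sucs = cin_Suc cout_Suc
  consider "i = k" | "i = Suc k" | "i \<noteq> k" "i \<noteq> Suc k" by blast
  then show "tab_swap (tab n S) k i = tab n (swap_word k S) i"
  proof cases
    case 1
    then show ?thesis using k ne c by (auto simp: tab_def Sucs)
  next
    case 2
    then show ?thesis using k ne c by (auto simp: tab_def Sucs)
  next
    case 3
    then have "Suc i \<le> k \<or> k + 2 \<le> Suc i" by auto
    note c = cin_swap_word[OF this k(1), of S]
    show ?thesis using 3 c by (auto simp: tab_swap_other tab_def swap_word_other)
  qed
qed

locale swap_setup =
  fixes n k :: nat and s :: tableau and r :: int
  assumes s: "s \<in> Std2 n" and k: "1 \<le> k" "k < n"
    and r: "r = content s k - content s (Suc k)"
begin

definition "S = col2 n s"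
definition "c = cin k S"

lemma ballot_S: "ballot n S" unfolding S_def by (rule Std2_ballot[OF s])

lemma s_tab: "s = tab n S" unfolding S_def by (rule Std2_eq_tab[OF s])

lemma S_sub: "S \<subseteq> {1..n}" using ballot_S by (simp add: ballot_iff)

lemma r_cases:
  "k \<in> S \<Longrightarrow> Suc k \<in> S \<Longrightarrow> r = 1"
  "k \<notin> S \<Longrightarrow> Suc k \<notin> S \<Longrightarrow> r = 1"
  "k \<in> S \<Longrightarrow> Suc k \<notin> S \<Longrightarrow> r = int k - 2 * int c"
  "k \<notin> S \<Longrightarrow> Suc k \<in> S \<Longrightarrow> r = 2 * int c - int k"
proof -
  have "k \<in> {1..n}" "Suc k \<in> {1..n}" using k by auto
  note * = content_Std2[OF s this(1), folded S_def] content_Std2[OF s this(2), folded S_def]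
  show "k \<in> S \<Longrightarrow> Suc k \<in> S \<Longrightarrow> r = 1"
    "k \<notin> S \<Longrightarrow> Suc k \<notin> S \<Longrightarrow> r = 1"
    "k \<in> S \<Longrightarrow> Suc k \<notin> S \<Longrightarrow> r = int k - 2 * int c"
    "k \<notin> S \<Longrightarrow> Suc k \<in> S \<Longrightarrow> r = 2 * int c - int k"
    unfolding r * using cin_Suc[OF k(1), of S] by (simp_all add: c_def)
qed

text \<open>The two bounds are the ballot condition for the prefixes of length \<open>k\<close> and
  \<open>k - 1\<close>.\<close>

lemma r_bounds:
  "k \<in> S \<Longrightarrow> Suc k \<notin> S \<Longrightarrow> 2 \<le> r"
  "k \<notin> S \<Longrightarrow> Suc k \<in> S \<Longrightarrow> r \<le> -1"
  "r \<noteq> 0"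
proof -
  show 1: "2 \<le> r" if "k \<in> S" "Suc k \<notin> S"
    using ballotD[OF ballot_S, of k] k cin_Suc[OF k(1), of S] that r_cases(3)[OF that] by (simp add: c_def)
  show 2: "r \<le> -1" if "k \<notin> S" "Suc k \<in> S"
  proof -
    have "2 * cin (Suc (k - 1)) S \<le> k - 1" by (rule ballotD[OF ballot_S]) (use k in simp)
    then have "2 * c \<le> k - 1" using k by (simp add: c_def)
    then show ?thesis using k r_cases(4)[OF that] by linarith
  qed
  show "r \<noteq> 0" using 1 2 r_cases(1,2) by linarith
qed

text \<open>Only the count for the prefix of length \<open>k\<close> changes, so one inequality
  decides. It fails exactly for \<open>r = -1\<close>, when \<open>k + 1\<close> stands directly to
  the right of \<open>k\<close>.\<close>

lemma ballot_swap:
  assumes "(k \<in> S) \<noteq> (Suc k \<in> S)"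
  shows "ballot n (swap_word k S) \<longleftrightarrow> \<bar>r\<bar> \<noteq> 1"
proof -
  have sub: "swap_word k S \<subseteq> {1..n}" using swap_word_subset[OF k] S_sub by simp
  have same: "cin (Suc m) (swap_word k S) = cin (Suc m) S" if "m \<noteq> k" for m
  proof -
    have "Suc m \<le> k \<or> k + 2 \<le> Suc m" using that by linarith
    then show ?thesis by (rule cin_swap_word(1)[OF _ k(1)])
  qed
  have atk: "cin (Suc k) (swap_word k S) = c + of_bool (Suc k \<in> S)"
    using cin_Suc[OF k(1), of "swap_word k S"] cin_swap_word(1)[of k k S] k by (simp add: c_def)
  have "ballot n (swap_word k S) \<longleftrightarrow> 2 * (c + of_bool (Suc k \<in> S)) \<le> k"
  proof
    assume "ballot n (swap_word k S)"
    from ballotD[OF this, of k] show "2 * (c + of_bool (Suc k \<in> S)) \<le> k" using atk k by simp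
  next
    assume *: "2 * (c + of_bool (Suc k \<in> S)) \<le> k"
    show "ballot n (swap_word k S)"
      unfolding ballot_iff
    proof (intro conjI allI impI sub)
      fix m assume "m \<le> n"
      then show "2 * cin (Suc m) (swap_word k S) \<le> m"
        using same[of m] atk * ballotD[OF ballot_S, of m] by (cases "m = k") auto
    qed
  qed
  also have "\<dots> \<longleftrightarrow> \<bar>r\<bar> \<noteq> 1"
    using assms r_cases r_bounds by (cases "k \<in> S") auto
  finally show ?thesis .
qed

lemma swap_Std2_iff: "tab_swap s k \<in> Std2 n \<longleftrightarrow> \<bar>r\<bar> \<noteq> 1"
proof (cases "(k \<in> S) = (Suc k \<in> S)")
  case True
  then have r1: "r = 1" using r_cases by blast
  have "tab_swap s k \<notin> Std2 n"
  proof
    assume t: "tab_swap s k \<in> Std2 n"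
    have kn: "k \<in> {1..n}" "Suc k \<in> {1..n}" using k by auto
    have snd: "snd (s k) = snd (s (Suc k))"
      using True kn fun_cong[OF s_tab, of k] fun_cong[OF s_tab, of "Suc k"] by (simp add: tab_def)
    have "fst (s (Suc k)) = fst (s k) + 1"
      using r1 snd by (simp add: r content_def)
    then have *: "snd (tab_swap s k (Suc k)) = snd (tab_swap s k k)"
      "fst (tab_swap s k (Suc k)) < fst (tab_swap s k k)" using snd by simp_all
    obtain \<nu> where "tab_swap s k \<in> Std n \<nu>" using t by (auto simp: Std2_def)
    then have "Suc k < k" using * kn unfolding Std_def by blast
    then show False by simp
  qed
  then show ?thesis using r1 by simp
next
  case False
  have "tab_swap s k = tab n (swap_word k S)"
    by (rule trans[OF arg_cong[where f = "\<lambda>u. tab_swap u k", OF s_tab] tab_swap_tab[OF k]])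
      (use False in simp)
  moreover have "swap_word k S \<subseteq> {1..n}" using swap_word_subset[OF k] S_sub by simp
  ultimately show ?thesis using tab_Std2_iff ballot_swap False by simp
qed

lemma swap_Std2D:
  assumes "tab_swap s k \<in> Std2 n"
  shows "(k \<in> S) \<noteq> (Suc k \<in> S)" "col2 n (tab_swap s k) = swap_word k S" "card (swap_word k S) = card S"
proof -
  have "\<bar>r\<bar> \<noteq> 1" using assms swap_Std2_iff by simp
  then show ne: "(k \<in> S) \<noteq> (Suc k \<in> S)" using r_cases(1,2) by fastforce
  have sub: "swap_word k S \<subseteq> {1..n}" using swap_word_subset[OF k] S_sub by simp
  have "tab_swap s k = tab n (swap_word k S)"
    by (rule trans[OF arg_cong[where f = "\<lambda>u. tab_swap u k", OF s_tab] tab_swap_tab[OF k]])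
      (use ne in simp)
  then show "col2 n (tab_swap s k) = swap_word k S" using col2_tab[OF sub] by simp
  show "card (swap_word k S) = card S" by (rule card_swap_word_full[OF k S_sub])
qed

text \<open>Among the restrictions only the one to the entries up to \<open>k\<close> changes: the
  box of \<open>k\<close> is replaced by that of \<open>k + 1\<close>. The shape with the box in the
  upper row dominates, and \<open>0 < r\<close> means that this is the box of
  \<open>k\<close>.\<close>

lemma swap_tab_less:
  assumes t: "tab_swap s k \<in> Std2 n"
  shows "tab_less n (tab_swap s k) s \<longleftrightarrow> 0 < r"
proof -
  let ?t = "tab_swap s k"
  have kn: "k \<in> {1..n}" "Suc k \<in> {1..n}" using k by auto
  have ne: "(k \<in> S) \<noteq> (Suc k \<in> S)" by (rule swap_Std2D[OF t])
  have r': "\<bar>r\<bar> \<noteq> 1" using t swap_Std2_iff by simp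
  have "cin k S + cout k S + 1 = k" using cin_cout[of k S] k by simp
  moreover have "s k = (if k \<in> S then (c + 1, 2) else (cout k S + 1, 1))"
    "s (Suc k) = (if Suc k \<in> S then (cin (Suc k) S + 1, 2) else (cout (Suc k) S + 1, 1))"
    using fun_cong[OF s_tab, of k] fun_cong[OF s_tab, of "Suc k"] kn cin_Suc[of _ S] cout_Suc[of _ S]
    by (simp_all add: tab_def c_def)
  ultimately have fst_less: "0 < r \<Longrightarrow> fst (s k) < fst (s (Suc k))"
    "\<not> 0 < r \<Longrightarrow> fst (s (Suc k)) < fst (s k)"
    using ne r_cases(3,4) r_bounds r' cin_Suc[OF k(1), of S] cout_Suc[OF k(1), of S]
    by (cases "k \<in> S"; simp add: c_def)+
  define A where "A = s ` {1..k - 1}"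
  have kk: "{1..k} = insert k {1..k - 1}" using k by auto
  have inj: "inj_on s {1..n}" using s by (auto simp: Std2_def Std_def bij_betw_def)
  have fin: "finite A" by (simp add: A_def)
  have "?t ` {1..k - 1} = A" unfolding A_def by (rule image_cong) (auto simp: tab_swap_other)
  then have im: "?t ` {1..k} = insert (s (Suc k)) A" "s ` {1..k} = insert (s k) A"
    unfolding kk by (simp_all add: A_def)
  have notA: "s k \<notin> A" "s (Suc k) \<notin> A"
  proof -
    have "s i \<noteq> s j" if "i \<in> {k, Suc k}" "j \<in> {1..k - 1}" for i j
    proof
      assume eq: "s i = s j"
      have "i \<in> {1..n}" "j \<in> {1..n}" using that k by auto
      then have "i = j" using inj_onD[OF inj eq] by blast
      then show False using that k by auto
    qed
    then show "s k \<notin> A" "s (Suc k) \<notin> A" unfolding A_def by blast+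
  qed
  have cnt: "card {b \<in> insert x A. fst b \<le> q} = card {b \<in> A. fst b \<le> q} + of_bool (fst x \<le> q)"
    if "x \<notin> A" for x q
  proof -
    have "{b \<in> insert x A. fst b \<le> q} = (if fst x \<le> q then insert x {b \<in> A. fst b \<le> q} else {b \<in> A. fst b \<le> q})"
      by auto
    then show ?thesis using fin that by simp
  qed
  have same: "?t ` {1..m} = s ` {1..m}" if "m \<noteq> k" for m
  proof (cases "m < k")
    case True
    then show ?thesis by (intro image_cong) (auto simp: tab_swap_other)
  next
    case False
    have "transpose k (k + 1) ` {1..m} = {1..m}"
      by (rule permutes_image, rule permutes_swap_id) (use False that k in auto)
    then show ?thesis unfolding tab_swap_def image_comp[symmetric] by simp
  qed
  have le: "tab_le n ?t s \<longleftrightarrow> (\<forall>q. of_bool (fst (s (Suc k)) \<le> q) \<le> (of_bool (fst (s k) \<le> q) :: nat))"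
  proof -
    have "shape_le (?t ` {1..m}) (s ` {1..m})" if "m \<noteq> k" for m
      using same[OF that] by (simp add: shape_le_def)
    then have "tab_le n ?t s \<longleftrightarrow> shape_le (?t ` {1..k}) (s ` {1..k})"
      unfolding tab_le_def using kn by metis
    then show ?thesis unfolding im shape_le_def cnt[OF notA(1)] cnt[OF notA(2)] by simp
  qed
  show ?thesis
  proof (cases "0 < r")
    case True
    then have "tab_le n ?t s" unfolding le using fst_less by (auto simp: of_bool_def)
    moreover have "?t \<noteq> s" using fst_less(1)[OF True] tab_swap_apply(1)[of s k] by fastforce
    ultimately show ?thesis using True by (simp add: tab_less_def)
  next
    case False
    then have "\<not> tab_le n ?t s"
      unfolding le using fst_less by (auto simp: of_bool_def intro!: exI[of _ "fst (s (Suc k))"])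
    then show ?thesis using False by (simp add: tab_less_def)
  qed
qed

end

text \<open>The coefficient \<open>\<beta>\<close> as a function of the content difference; the value at \<open>\<plusminus> 1\<close> covers the case
  that the exchange is not standard.\<close>

definition beta :: "nat \<Rightarrow> int \<Rightarrow> rat" where
  "beta p r = (if \<bar>r\<bar> = 1 then 0 else
     (if 0 < r then 1 else ((of_int r)\<^sup>2 - 1) / (of_int r)\<^sup>2) *
     (if [r = 0] (mod int p) then 1 / of_int (1 - r)
      else if [r = 1] (mod int p) then of_int r
      else of_int r / of_int (1 - r)))"

definition delta :: "nat \<Rightarrow> int \<Rightarrow> rat" where
  "delta p r = (if [r = 0] (mod int p) then 1 / of_int r else 0)"

lemma klr_beta_eq:
  assumes "s \<in> Std2 n" "1 \<le> k" "k < n"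
  shows "klr_beta p n k s = beta p (content s k - content s (Suc k))"
proof -
  interpret swap_setup n k s "content s k - content s (Suc k)"
    by unfold_locales (use assms in simp_all)
  show ?thesis
    using swap_Std2_iff swap_tab_less
    by (auto simp: klr_beta_def klr_alpha_def beta_def Let_def)
qed

lemma klr_delta_eq:
  "klr_delta p k s / of_int (content s k - content s (k + 1)) = delta p (content s k - content s (Suc k))"
  by (simp add: klr_delta_def delta_def)

section \<open>Jucys--Murphy elements and seminormal idempotents\<close>

definition vt :: "nat \<Rightarrow> tableau \<Rightarrow> nat \<Rightarrow> nat set \<Rightarrow> rat" where
  "vt n t b = (if t \<in> Std2 n then vec n (col2 n t) b else (\<lambda>w. 0))"

lemma vt_outside: "\<not> w \<subseteq> {1..n} \<Longrightarrow> vt n t b w = 0"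
  by (simp add: vt_def vec_outside)

lemma act_lin: "act n x (\<lambda>w. a * f w + b * g w) = (\<lambda>w. a * act n x f w + b * act n x g w)"
  using act_add[of n x "\<lambda>w. a * f w" "\<lambda>w. b * g w"] by (simp add: act_scale plus_fun_def)

lemma act_zero_fun: "act n x (\<lambda>w. 0) = (\<lambda>w. 0)"
  using act_zero[of n x] by (simp add: zero_fun_def)

lemma act_u_vt:
  assumes t: "t \<in> Std2 n" and k: "1 \<le> k" "k < n"
    and rr: "r = of_int (content t k - content t (Suc k))"
  shows "act n (tl_u n k) (vt n t b) = (\<lambda>w. (1 - 1 / r) * (vt n t b w - vt n (tab_swap t k) b w))"
proof -
  interpret swap_setup n k t "content t k - content t (Suc k)"
    by unfold_locales (use assms in simp_all)
  have vt: "vt n t b = vec n S b" using t by (simp add: vt_def S_def)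
  have fin: "finite S" using ballot_S by (rule ballot_finite)
  show ?thesis
  proof (cases "(k \<in> S) = (Suc k \<in> S)")
    case True
    then have "r = 1" using r_cases(1,2) rr by auto
    moreover have "act n (tl_u n k) (vt n t b) = 0"
      unfolding vt by (rule act_u_vec_equal[OF k fin]) (use True in simp)
    ultimately show ?thesis by (simp add: fun_eq_iff)
  next
    case False
    then have r': "r = (if k \<in> S then of_nat k - 2 * of_nat (cin k S) else 2 * of_nat (cin k S) - of_nat k)"
    proof -
      have d: "content t k - content t (Suc k) =
          (if k \<in> S then int k - 2 * int (cin k S) else 2 * int (cin k S) - int k)"
        using False r_cases(3,4) by (auto simp: c_def)
      show ?thesis unfolding rr d by simp
    qed
    have r0: "r \<noteq> 0" using rr r_bounds(3) by simp
    have *: "act n (tl_u n k) (vec n S b) = (\<lambda>w. (1 - 1 / r) * (vec n S b w - vec n (swap_word k S) b w))"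
      by (rule act_u_vec_unequal[OF k fin _ r' r0]) (use False in simp)
    have "vt n (tab_swap t k) b = vec n (swap_word k S) b"
    proof (cases "tab_swap t k \<in> Std2 n")
      case True
      then show ?thesis using swap_Std2D(2) by (simp add: vt_def)
    next
      case nonstd: False
      then have "\<bar>content t k - content t (Suc k)\<bar> = 1" using swap_Std2_iff by simp
      then have kS: "k \<notin> S" "Suc k \<in> S" "2 * c + 1 = k"
      proof -
        show nk: "k \<notin> S" using False r_bounds(1) \<open>\<bar>_\<bar> = 1\<close> by linarith
        then show Sk: "Suc k \<in> S" using False by simp
        have "2 * int c - int k = -1"
          using r_cases(4)[OF nk Sk] r_bounds(2)[OF nk Sk] \<open>\<bar>_\<bar> = 1\<close> by linarith
        then show "2 * c + 1 = k" by linarith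
      qed
      have "cg (swap_word k S) w = 0" for w
      proof (rule cg_nonballot_zero)
        show "finite (swap_word k S)"
          unfolding swap_word_def by (rule finite_vimageI[OF fin]) simp
        show "2 * cin k (swap_word k S) + 1 = k"
          using kS(3) cin_swap_word(1)[of k k S] k by (simp add: c_def)
      qed (use k kS in simp_all)
      then show ?thesis using nonstd by (simp add: vt_def vec_def fun_eq_iff)
    qed
    then show ?thesis using * vt by simp
  qed
qed

text \<open>Put \<open>a = - 1 / \<rho>\<close>, so that \<open>a * (x - y) + 1 = 0\<close>. On the
  span of \<open>v\<close> and \<open>v'\<close> the element \<open>s\<close> has diagonal entries
  \<open>a\<close> and \<open>- a\<close> and off-diagonal product \<open>1 - a * a\<close>; in
  \<open>s L s + s\<close> the relation for \<open>a\<close> kills the coefficient of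
  \<open>v'\<close> and turns that of \<open>v\<close> into \<open>y\<close>. The first alternative
  is the one-dimensional case. The lemma serves the Jucys--Murphy elements of both the large and the
  small algebra.\<close>

lemma jm_step:
  fixes \<rho> x y :: rat
  assumes sL: "s \<in> word_alg n" "L \<in> word_alg n"
    and s: "act n s v = (\<lambda>w. (- 1 / \<rho>) * v w + \<beta> * v' w)" and L: "act n L v = (\<lambda>w. x * v w)"
    and \<rho>: "\<rho> = x - y" "\<rho> \<noteq> 0"
    and alt: "(\<beta> = 0 \<and> \<rho>\<^sup>2 = 1) \<or> (act n s v' = (\<lambda>w. (1 / \<rho>) * v' w + \<beta>' * v w) \<and>
      act n L v' = (\<lambda>w. y * v' w) \<and> \<beta> * \<beta>' = 1 - 1 / \<rho>\<^sup>2)"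
  shows "act n (s \<cdot> L \<cdot> s + s) v = (\<lambda>w. y * v w)"
proof -
  have "act n (s \<cdot> L \<cdot> s + s) v = act n s (act n L (act n s v)) + act n s v"
    using sL by (simp add: act_add_left act_mult word_alg_mult)
  also have "\<dots> = (\<lambda>w. y * v w)"
    using alt
  proof (elim disjE conjE)
    assume *: "\<beta> = 0" "\<rho>\<^sup>2 = 1"
    then have s': "act n s v = (\<lambda>w. (- 1 / \<rho>) * v w)" using s by simp
    show ?thesis
    proof
      fix w
      have inv: "1 / \<rho> = \<rho>" using *(2) \<rho>(2) by (simp add: field_simps power2_eq_square)
      have "(act n s (act n L (act n s v)) + act n s v) w = (- 1 / \<rho>) * (x * ((- 1 / \<rho>) * v w)) + (- 1 / \<rho>) * v w"
        by (simp only: s' act_scale L plus_fun_def)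
      also have "\<dots> = ((1 / \<rho>) * (1 / \<rho>) * x - 1 / \<rho>) * v w" by (simp add: algebra_simps)
      also have "\<dots> = (\<rho>\<^sup>2 * x - \<rho>) * v w" unfolding inv power2_eq_square ..
      also have "\<rho>\<^sup>2 * x - \<rho> = y" by (subst *(2)) (simp add: \<rho>(1))
      finally show "(act n s (act n L (act n s v)) + act n s v) w = y * v w" .
    qed
  next
    assume s': "act n s v' = (\<lambda>w. (1 / \<rho>) * v' w + \<beta>' * v w)" and L': "act n L v' = (\<lambda>w. y * v' w)"
      and b: "\<beta> * \<beta>' = 1 - 1 / \<rho>\<^sup>2"
    show ?thesis
    proof
      fix w
      define a where "a = - 1 / \<rho>"
      have a: "a * \<rho> = -1" "1 / \<rho> = - a" using \<rho>(2) by (simp_all add: a_def)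
      have b': "\<beta> * \<beta>' = 1 - a * a" using b by (simp add: a_def power2_eq_square)
      have "act n L (act n s v) = (\<lambda>w. (a * x) * v w + (\<beta> * y) * v' w)"
        unfolding s act_lin L L' a_def by (simp add: mult_ac)
      then have "(act n s (act n L (act n s v)) + act n s v) w =
          (a * x) * (a * v w + \<beta> * v' w) + (\<beta> * y) * (- a * v' w + \<beta>' * v w) + (a * v w + \<beta> * v' w)"
        by (simp only: act_lin s s' plus_fun_def a(2) a_def[symmetric])
      also have "\<dots> = (a * a * x + (\<beta> * \<beta>') * y + a) * v w + \<beta> * (a * (x - y) + 1) * v' w"
        by (simp add: algebra_simps)
      also have "a * (x - y) + 1 = 0" using a(1) \<rho>(1) by simp
      also have "a * a * x + (\<beta> * \<beta>') * y + a = a * (a * (x - y) + 1) + y"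
        unfolding b' by (simp add: algebra_simps)
      also have "a * (x - y) + 1 = 0" using a(1) \<rho>(1) by simp
      finally show "(act n s (act n L (act n s v)) + act n s v) w = y * v w" by simp
    qed
  qed
  finally show ?thesis .
qed

lemma act_one_vt: "act n (tl_one n) (vt n t b) = vt n t b"
  by (rule act_one) (rule vt_outside)

lemma content_first:
  assumes "t \<in> Std2 n" "1 \<le> n" shows "content t 1 = 0"
proof -
  have "1 \<notin> col2 n t"
    using ballotD[OF Std2_ballot[OF assms(1)], of 1] assms(2) cin_Suc[of 1 "col2 n t"] by auto
  then show ?thesis using content_Std2[OF assms(1), of 1] assms(2) by simp
qed

lemma act_tl_jm:
  assumes "1 \<le> i" "i \<le> n" "t \<in> Std2 n"
  shows "act n (tl_jm n i) (vt n t b) = (\<lambda>w. of_int (content t i) * vt n t b w)"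
  using assms
proof (induction i arbitrary: t rule: dec_induct)
  case base
  then show ?case using content_first[of t n] by (simp add: tl_jm_one zero_fun_def)
next
  case (step k)
  let ?s = "tl_u n k - tl_one n"
  have k: "1 \<le> k" "k < n" using step by auto
  define r :: "tableau \<Rightarrow> rat" where "r t = of_int (content t k - content t (Suc k))" for t
  have act_s: "act n ?s (vt n t b) = (\<lambda>w. (- 1 / r t) * vt n t b w + (- (1 - 1 / r t)) * vt n (tab_swap t k) b w)"
    if "t \<in> Std2 n" for t
    unfolding act_diff_left act_one_vt act_u_vt[OF that k r_def]
    by (simp add: fun_eq_iff algebra_simps)
  interpret swap_setup n k t "content t k - content t (Suc k)"
    by unfold_locales (use k step in simp_all)
  have "act n (?s \<cdot> tl_jm n k \<cdot> ?s + ?s) (vt n t b) = (\<lambda>w. of_int (content t (Suc k)) * vt n t b w)"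
  proof (cases "tab_swap t k \<in> Std2 n")
    case False
    then have abs: "\<bar>content t k - content t (Suc k)\<bar> = 1" using swap_Std2_iff by simp
    then have "content t k - content t (Suc k) = 1 \<or> content t k - content t (Suc k) = -1" by linarith
    then have sq: "(r t)\<^sup>2 = 1" unfolding r_def by (elim disjE) (simp_all only:, simp_all)
    have "act n ?s (vt n t b) = (\<lambda>w. (- 1 / r t) * vt n t b w + 0 * vt n t b w)"
      unfolding act_s[OF step.prems(2)] using False by (simp add: vt_def)
    then show ?thesis
      by (rule jm_step[where \<beta>' = 0 and x = "of_int (content t k)", rotated 2])
        (use step k sq r_bounds(3) in \<open>auto simp: r_def intro!: word_alg_diff word_alg_u word_alg_one tl_jm_word\<close>)
  next
    case True
    have r': "r (tab_swap t k) = - r t" by (simp add: r_def content_tab_swap)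
    have r0: "r t \<noteq> 0" using r_bounds(3) by (simp add: r_def)
    have s': "act n ?s (vt n (tab_swap t k) b) = (\<lambda>w. (1 / r t) * vt n (tab_swap t k) b w + (- (1 + 1 / r t)) * vt n t b w)"
      using act_s[OF True] unfolding r' by simp
    have L': "act n (tl_jm n k) (vt n (tab_swap t k) b) = (\<lambda>w. of_int (content t (Suc k)) * vt n (tab_swap t k) b w)"
      using step.IH[OF _ True] k by (simp add: content_tab_swap)
    have prod: "- (1 - 1 / r t) * - (1 + 1 / r t) = 1 - 1 / (r t)\<^sup>2"
      using r0 by (simp add: field_simps power2_eq_square)
    show ?thesis
    proof (rule jm_step[OF _ _ act_s[OF step.prems(2)], where x = "of_int (content t k)"])
      show "?s \<in> word_alg n" "tl_jm n k \<in> word_alg n"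
        using k by (auto intro!: word_alg_diff word_alg_u word_alg_one tl_jm_word)
      show "act n (tl_jm n k) (vt n t b) = (\<lambda>w. of_int (content t k) * vt n t b w)"
        using step.IH[OF _ step.prems(2)] k by simp
      show "r t = of_int (content t k) - of_int (content t (Suc k))" by (simp add: r_def)
      show "r t \<noteq> 0" by (rule r0)
    qed (use s' L' prod in blast)
  qed
  then show ?case unfolding tl_jm_step[OF k] .
qed

lemma act_vt_eqI:
  assumes "x \<in> TL n" "y \<in> TL n"
    and eq: "\<And>t b. t \<in> Std2 n \<Longrightarrow> act n x (vt n t b) = act n y (vt n t b)"
  shows "x = y"
proof -
  have "- y \<in> TL n" using assms(2) by (simp add: TL_def)
  then have "x - y \<in> TL n" using TL_add[OF assms(1), of "- y"] by simp
  then have "x - y = 0"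
  proof (rule act_vec_faithful)
    fix S b assume S: "ballot n S"
    have "vec n S b = vt n (tab n S) b"
      using tab_Std2[OF S] col2_tab[of S n] S by (simp add: vt_def ballot_iff)
    then show "act n (x - y) (vec n S b) = 0"
      using eq[OF tab_Std2[OF S]] by (simp add: act_diff_left)
  qed
  then show ?thesis by simp
qed

text \<open>On a common eigenvector the order of the factors of \<open>idem\<close> is immaterial,
  and a single factor with eigenvalue 0 annihilates it.\<close>

lemma act_tl_prod:
  assumes "\<And>x. x \<in> set xs \<Longrightarrow> x \<in> word_alg n \<and> (\<exists>a. act n x (vt n t b) = (\<lambda>w. a * vt n t b w))"
  shows "\<exists>a. act n (tl_prod n xs) (vt n t b) = (\<lambda>w. a * vt n t b w)"
    "(\<And>x. x \<in> set xs \<Longrightarrow> act n x (vt n t b) = vt n t b) \<Longrightarrow> act n (tl_prod n xs) (vt n t b) = vt n t b"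
    "(\<exists>x\<in>set xs. act n x (vt n t b) = (\<lambda>w. 0)) \<Longrightarrow> act n (tl_prod n xs) (vt n t b) = (\<lambda>w. 0)"
proof -
  have "(\<exists>a. act n (tl_prod n xs) (vt n t b) = (\<lambda>w. a * vt n t b w)) \<and>
    ((\<forall>x\<in>set xs. act n x (vt n t b) = vt n t b) \<longrightarrow> act n (tl_prod n xs) (vt n t b) = vt n t b) \<and>
    ((\<exists>x\<in>set xs. act n x (vt n t b) = (\<lambda>w. 0)) \<longrightarrow> act n (tl_prod n xs) (vt n t b) = (\<lambda>w. 0))"
    using assms
  proof (induction xs)
    case Nil
    have "act n (tl_prod n []) (vt n t b) = vt n t b" by (simp add: tl_prod_def act_one_vt)
    then show ?case by (auto intro: exI[of _ 1])
  next
    case (Cons x xs)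
    have IH: "\<exists>a. act n (tl_prod n xs) (vt n t b) = (\<lambda>w. a * vt n t b w)"
      "(\<forall>x\<in>set xs. act n x (vt n t b) = vt n t b) \<longrightarrow> act n (tl_prod n xs) (vt n t b) = vt n t b"
      "(\<exists>x\<in>set xs. act n x (vt n t b) = (\<lambda>w. 0)) \<longrightarrow> act n (tl_prod n xs) (vt n t b) = (\<lambda>w. 0)"
      using Cons.IH Cons.prems by auto
    have xw: "x \<in> word_alg n" and xsw: "tl_prod n xs \<in> word_alg n"
      using Cons.prems by (auto intro: word_alg_prod)
    have step: "act n (tl_prod n (x # xs)) (vt n t b) = act n x (act n (tl_prod n xs) (vt n t b))"
      using act_mult[OF xw xsw] by (simp add: tl_prod_def)
    obtain a where a: "act n x (vt n t b) = (\<lambda>w. a * vt n t b w)" using Cons.prems by auto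
    obtain a' where a': "act n (tl_prod n xs) (vt n t b) = (\<lambda>w. a' * vt n t b w)" using IH(1) ..
    have e: "act n (tl_prod n (x # xs)) (vt n t b) = (\<lambda>w. a' * (a * vt n t b w))"
      unfolding step a' act_scale a ..
    have "act n (tl_prod n (x # xs)) (vt n t b) = (\<lambda>w. (a' * a) * vt n t b w)"
      unfolding e by (simp add: mult.assoc)
    moreover have "act n (tl_prod n (x # xs)) (vt n t b) = vt n t b"
      if "\<forall>y\<in>set (x # xs). act n y (vt n t b) = vt n t b"
      unfolding step using that IH(2) by simp
    moreover have "act n (tl_prod n (x # xs)) (vt n t b) = (\<lambda>w. 0)"
      if "\<exists>y\<in>set (x # xs). act n y (vt n t b) = (\<lambda>w. 0)"
    proof -
      from that consider "act n x (vt n t b) = (\<lambda>w. 0)" | "\<exists>y\<in>set xs. act n y (vt n t b) = (\<lambda>w. 0)" by auto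
      then show ?thesis
      proof cases
        case 1
        then show ?thesis unfolding step a' act_scale by simp
      next
        case 2
        then show ?thesis unfolding step using IH(3) act_zero_fun by simp
      qed
    qed
    ultimately show ?case by blast
  qed
  then show "\<exists>a. act n (tl_prod n xs) (vt n t b) = (\<lambda>w. a * vt n t b w)"
    "(\<And>x. x \<in> set xs \<Longrightarrow> act n x (vt n t b) = vt n t b) \<Longrightarrow> act n (tl_prod n xs) (vt n t b) = vt n t b"
    "(\<exists>x\<in>set xs. act n x (vt n t b) = (\<lambda>w. 0)) \<Longrightarrow> act n (tl_prod n xs) (vt n t b) = (\<lambda>w. 0)"
    by blast+
qed

section \<open>The idempotents as projections onto the eigenvectors\<close>

definition idem_factors :: "nat \<Rightarrow> tableau \<Rightarrow> tl list" where
  "idem_factors n t = [(1 / of_int (content t i - c)) \<odot> (tl_jm n i - of_int c \<odot> tl_one n).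
        c \<leftarrow> sorted_list_of_set (contents n), i \<leftarrow> [1..<n + 1], c \<noteq> content t i]"

lemma set_idem_factors:
  "set (idem_factors n t) = {(1 / of_int (content t i - c)) \<odot> (tl_jm n i - of_int c \<odot> tl_one n) | c i.
     c \<in> contents n \<and> i \<in> {1..n} \<and> c \<noteq> content t i}"
proof -
  have "set [F c i. c \<leftarrow> cs, i \<leftarrow> is, P c i] = {F c i | c i. c \<in> set cs \<and> i \<in> set is \<and> P c i}"
    for cs :: "int list" and "is" :: "nat list" and P and F :: "int \<Rightarrow> nat \<Rightarrow> tl"
    by (auto split: if_splits)
  moreover have "set (sorted_list_of_set (contents n)) = contents n" "set [1..<n + 1] = {1..n}"
    using finite_contents by auto
  ultimately show ?thesis unfolding idem_factors_def by (simp only:)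
qed

lemma idem_eq: "idem n t = tl_prod n (idem_factors n t)"
  by (simp add: idem_def idem_factors_def)

lemma idem_factor_word: "x \<in> set (idem_factors n t) \<Longrightarrow> x \<in> word_alg n"
  unfolding set_idem_factors
  by (auto intro!: word_alg_scale word_alg_diff word_alg_one tl_jm_word)

lemma idem_word: "idem n t \<in> word_alg n"
  unfolding idem_eq by (rule word_alg_prod) (rule idem_factor_word)

lemma act_idem_factor:
  assumes "s \<in> Std2 n" "i \<in> {1..n}"
  shows "act n ((1 / of_int (content t i - c)) \<odot> (tl_jm n i - of_int c \<odot> tl_one n)) (vt n s b) =
    (\<lambda>w. (of_int (content s i - c) / of_int (content t i - c)) * vt n s b w)"
  using act_tl_jm[of i n s b] assms
  by (simp add: act_scale_left act_diff_left act_one_vt fun_eq_iff algebra_simps diff_divide_distrib)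

text \<open>A factor acts on \<open>v_s\<close> by
  \<open>(content s i - c) / (content t i - c)\<close>. This is always 1 if \<open>s = t\<close>;
  otherwise the factor with \<open>c = content s i\<close>, at an \<open>i\<close> that separates
  the tableaux, is 0.\<close>

lemma act_idem:
  assumes s: "s \<in> Std2 n" and t: "t \<in> Std2 n"
  shows "act n (idem n t) (vt n s b) = (if s = t then vt n t b else (\<lambda>w. 0))"
proof -
  have pre: "x \<in> word_alg n \<and> (\<exists>a. act n x (vt n s b) = (\<lambda>w. a * vt n s b w))"
    if "x \<in> set (idem_factors n t)" for x
    using idem_factor_word[OF that] that act_idem_factor[OF s] unfolding set_idem_factors by blast
  show ?thesis
  proof (cases "s = t")
    case True
    have "act n x (vt n s b) = vt n s b" if "x \<in> set (idem_factors n t)" for x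
      using that act_idem_factor[OF s] unfolding set_idem_factors True by fastforce
    then show ?thesis unfolding idem_eq using act_tl_prod(2)[OF pre] True by simp
  next
    case False
    then obtain i where i: "i \<in> {1..n}" "content s i \<noteq> content t i"
      using contents_separate[OF s t] by metis
    let ?x = "(1 / of_int (content t i - content s i)) \<odot> (tl_jm n i - of_int (content s i) \<odot> tl_one n)"
    have "content s i \<in> contents n" using s i by (auto simp: contents_def)
    then have "?x \<in> set (idem_factors n t)" unfolding set_idem_factors using i by blast
    moreover have "act n ?x (vt n s b) = (\<lambda>w. 0)" using act_idem_factor[OF s i(1)] by simp
    ultimately show ?thesis unfolding idem_eq using act_tl_prod(3)[OF pre] False by auto
  qed
qed

lemma idem_sum: "(\<Sum>t\<in>Std2 n. idem n t) = tl_one n"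
proof (rule act_vt_eqI)
  show "(\<Sum>t\<in>Std2 n. idem n t) \<in> TL n" "tl_one n \<in> TL n"
    by (auto intro!: word_alg_TL word_alg_sum idem_word word_alg_one)
  fix s b assume s: "s \<in> Std2 n"
  have "act n (\<Sum>t\<in>Std2 n. idem n t) (vt n s b) = (\<Sum>t\<in>Std2 n. if s = t then vt n s b else 0)"
    unfolding act_sum_left by (rule sum.cong) (auto simp: act_idem[OF s] zero_fun_def)
  then show "act n (\<Sum>t\<in>Std2 n. idem n t) (vt n s b) = act n (tl_one n) (vt n s b)"
    using s finite_Std2 by (simp add: act_one_vt sum.delta')
qed

section \<open>Half-diagrams\<close>

definition hstate :: "tableau \<Rightarrow> nat \<Rightarrow> nat set set \<times> nat list" where
  "hstate t m = fold (half_step t) [1..<m + 1] ({}, [])"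

lemma half_diagram_hstate: "half_diagram n t = hstate t n"
  by (simp add: half_diagram_def hstate_def)

lemma hstate_0 [simp]: "hstate t 0 = ({}, [])"
  by (simp add: hstate_def)

lemma hstate_Suc: "hstate t (Suc m) = half_step t (Suc m) (hstate t m)"
  by (simp add: hstate_def)

lemma snd_Std2:
  assumes "t \<in> Std2 n" "i \<in> {1..n}"
  shows "snd (t i) = 1 \<longleftrightarrow> i \<notin> col2 n t"
  by (subst Std2_eq_tab[OF assms(1)]) (use assms(2) in \<open>simp add: tab_def\<close>)

lemma hstate_step:
  assumes "t \<in> Std2 n" "m < n" "hstate t m = (A, V)"
  shows "hstate t (Suc m) = (if Suc m \<in> col2 n t then (insert {hd V, Suc m} A, tl V) else (A, Suc m # V))"
  using snd_Std2[OF assms(1), of "Suc m"] assms(2,3) by (simp add: hstate_Suc half_step_def)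

text \<open>With the ballot condition the length formula shows that a vacant line is left whenever
  an entry of the second column is read, so \<open>hd\<close> and \<open>tl\<close> never meet the
  empty list.\<close>

lemma hstate_props:
  assumes t: "t \<in> Std2 n" and "m \<le> n" "hstate t m = (A, V)"
  shows "length V + 2 * cin (Suc m) (col2 n t) = m" "set V \<subseteq> {1..m}" "\<Union>A \<subseteq> {1..m}"
  using assms(2,3)
proof (induction m arbitrary: A V)
  case (Suc m)
  {
    case 1
    obtain A' V' where s: "hstate t m = (A', V')" by force
    then show ?case
      using Suc.IH(1)[OF _ s] hstate_step[OF t _ s] 1 cin_Suc[of "Suc m" "col2 n t"]
        ballotD[OF Std2_ballot[OF t], of "Suc m"]
      by (cases V') (auto split: if_splits)
  next
    case 2
    obtain A' V' where s: "hstate t m = (A', V')" by force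
    then show ?case
      using Suc.IH(2)[OF _ s] hstate_step[OF t _ s] 2
      by (cases V') (auto split: if_splits)
  next
    case 3
    obtain A' V' where s: "hstate t m = (A', V')" by force
    have "V' \<noteq> []" if "Suc m \<in> col2 n t"
      using Suc.IH(1)[OF _ s] 3(1) that cin_Suc[of "Suc m" "col2 n t"]
        ballotD[OF Std2_ballot[OF t], of "Suc m"] by auto
    then show ?case
      using Suc.IH(2,3)[OF _ s] hstate_step[OF t _ s] 3
      by (cases V') (auto split: if_splits)
  }
qed simp_all

lemma hstate_cong:
  assumes "\<And>i. 1 \<le> i \<Longrightarrow> i \<le> m \<Longrightarrow> s i = t i"
  shows "hstate s m = hstate t m"
  using assms by (induction m) (simp_all add: hstate_Suc half_step_def)

text \<open>Effect on the half-diagram of moving the entry \<open>k\<close> from the second to the first column, in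
  exchange for \<open>k + 1\<close>; \<open>j\<close> is the partner of \<open>k\<close>.  The vacant line at \<open>k + 1\<close> is either still
  present or has been joined to \<open>z\<close>.\<close>

definition hrel :: "nat \<Rightarrow> nat \<Rightarrow> nat set set \<times> nat list \<Rightarrow> nat set set \<times> nat list \<Rightarrow> bool" where
  "hrel k j p q \<longleftrightarrow> j \<noteq> k \<and> j \<noteq> k + 1 \<and>
    ((\<exists>B P Q. p = (insert {j, k} B, P @ (k + 1) # Q) \<and> q = (insert {k, k + 1} B, P @ j # Q) \<and>
      k \<notin> \<Union>B \<union> set P \<union> set Q \<and> k + 1 \<notin> \<Union>B \<union> set P \<union> set Q) \<or>
    (\<exists>B z V. p = (insert {j, k} (insert {k + 1, z} B), V) \<and> q = (insert {k, k + 1} (insert {j, z} B), V) \<and>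
      z \<noteq> k \<and> z \<noteq> k + 1 \<and> k \<notin> \<Union>B \<union> set V \<and> k + 1 \<notin> \<Union>B \<union> set V))"

lemma hrelI1:
  "p = (insert {j, k} B, P @ (k + 1) # Q) \<Longrightarrow> q = (insert {k, k + 1} B, P @ j # Q) \<Longrightarrow>
    k \<notin> \<Union>B \<union> set P \<union> set Q \<Longrightarrow> k + 1 \<notin> \<Union>B \<union> set P \<union> set Q \<Longrightarrow>
    j \<noteq> k \<Longrightarrow> j \<noteq> k + 1 \<Longrightarrow> hrel k j p q"
  unfolding hrel_def by blast

lemma hrelI2:
  "p = (insert {j, k} (insert {k + 1, z} B), V) \<Longrightarrow> q = (insert {k, k + 1} (insert {j, z} B), V) \<Longrightarrow>
    k \<notin> \<Union>B \<union> set V \<Longrightarrow> k + 1 \<notin> \<Union>B \<union> set V \<Longrightarrow>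
    z \<noteq> k \<Longrightarrow> z \<noteq> k + 1 \<Longrightarrow> j \<noteq> k \<Longrightarrow> j \<noteq> k + 1 \<Longrightarrow> hrel k j p q"
  unfolding hrel_def by blast

lemma half_step_eq:
  "half_step t i (A, V) = (if snd (t i) = 1 then (A, i # V) else (insert {hd V, i} A, tl V))"
  by (simp add: half_step_def)

lemma hrel_step:
  assumes "hrel k j p q" "i \<noteq> k" "i \<noteq> k + 1" "s i = t i" "snd (s i) \<noteq> 1 \<Longrightarrow> snd p \<noteq> []"
  shows "hrel k j (half_step s i p) (half_step t i q)"
proof -
  have j: "j \<noteq> k" "j \<noteq> k + 1" using assms(1) by (auto simp: hrel_def)
  from assms(1) consider
    (1) B P Q where "p = (insert {j, k} B, P @ (k + 1) # Q)" "q = (insert {k, k + 1} B, P @ j # Q)"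
      "k \<notin> \<Union>B \<union> set P \<union> set Q" "k + 1 \<notin> \<Union>B \<union> set P \<union> set Q"
  | (2) B z V where "p = (insert {j, k} (insert {k + 1, z} B), V)"
      "q = (insert {k, k + 1} (insert {j, z} B), V)"
      "z \<noteq> k" "z \<noteq> k + 1" "k \<notin> \<Union>B \<union> set V" "k + 1 \<notin> \<Union>B \<union> set V"
    unfolding hrel_def by blast
  then show ?thesis
  proof cases
    case 1
    show ?thesis
    proof (cases "snd (s i) = 1")
      case True
      then have "half_step s i p = (insert {j, k} B, (i # P) @ (k + 1) # Q)"
        "half_step t i q = (insert {k, k + 1} B, (i # P) @ j # Q)"
        using 1 assms(4) by (simp_all add: half_step_eq)
      moreover have "k \<notin> \<Union>B \<union> set (i # P) \<union> set Q" "k + 1 \<notin> \<Union>B \<union> set (i # P) \<union> set Q"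
        using 1 assms(2,3) by auto
      ultimately show ?thesis by (rule hrelI1[OF _ _ _ _ j])
    next
      case False
      show ?thesis
      proof (cases P)
        \<comment> \<open>The line at \<open>k + 1\<close> in one state, and the one at
          \<open>j\<close> in the other, is now the nearest and gets joined to \<open>i\<close>: the
          relation passes to its second form with \<open>z = i\<close>.\<close>
        case Nil
        have "half_step s i p = (insert {j, k} (insert {k + 1, i} B), Q)"
          "half_step t i q = (insert {k, k + 1} (insert {j, i} B), Q)"
          using 1 assms(4) False Nil by (simp_all add: half_step_eq insert_commute)
        moreover have "k \<notin> \<Union>B \<union> set Q" "k + 1 \<notin> \<Union>B \<union> set Q" using 1 by auto
        ultimately show ?thesis by (rule hrelI2[OF _ _ _ _ assms(2,3) j])
      next
        case (Cons a P')
        have "half_step s i p = (insert {j, k} (insert {a, i} B), P' @ (k + 1) # Q)"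
          "half_step t i q = (insert {k, k + 1} (insert {a, i} B), P' @ j # Q)"
          using 1 assms(4) False Cons by (simp_all add: half_step_eq insert_commute)
        moreover have "k \<notin> \<Union>(insert {a, i} B) \<union> set P' \<union> set Q" "k + 1 \<notin> \<Union>(insert {a, i} B) \<union> set P' \<union> set Q"
          using 1 assms(2,3) Cons by auto
        ultimately show ?thesis by (rule hrelI1[OF _ _ _ _ j])
      qed
    qed
  next
    case 2
    show ?thesis
    proof (cases "snd (s i) = 1")
      case True
      then have "half_step s i p = (insert {j, k} (insert {k + 1, z} B), i # V)"
        "half_step t i q = (insert {k, k + 1} (insert {j, z} B), i # V)"
        using 2 assms(4) by (simp_all add: half_step_eq)
      moreover have "k \<notin> \<Union>B \<union> set (i # V)" "k + 1 \<notin> \<Union>B \<union> set (i # V)"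
        using 2 assms(2,3) by auto
      ultimately show ?thesis by (rule hrelI2[OF _ _ _ _ 2(3,4) j])
    next
      case False
      then have "V \<noteq> []" using assms(5) 2 by simp
      then obtain a V' where V: "V = a # V'" by (cases V) auto
      have "half_step s i p = (insert {j, k} (insert {k + 1, z} (insert {a, i} B)), V')"
        "half_step t i q = (insert {k, k + 1} (insert {j, z} (insert {a, i} B)), V')"
        using 2 assms(4) False V by (simp_all add: half_step_eq insert_commute)
      moreover have "k \<notin> \<Union>(insert {a, i} B) \<union> set V'" "k + 1 \<notin> \<Union>(insert {a, i} B) \<union> set V'"
        using 2 assms(2,3) V by auto
      ultimately show ?thesis by (rule hrelI2[OF _ _ _ _ 2(3,4) j])
    qed
  qed
qed

text \<open>In \<open>s\<close> the entry \<open>k\<close> is joined to \<open>j\<close> and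
  \<open>k + 1\<close> opens a line. After the exchange \<open>k\<close> opens a line that
  \<open>k + 1\<close> closes at once, and the line at \<open>j\<close> stays vacant in the place
  that \<open>k + 1\<close> holds for \<open>s\<close>. Later entries treat both alike.\<close>

lemma hrel_swap:
  assumes s: "s \<in> Std2 n" and s': "tab_swap s k \<in> Std2 n" and k: "1 \<le> k" "k < n"
    and kS: "k \<in> col2 n s" "Suc k \<notin> col2 n s"
  obtains j where "hrel k j (hstate s n) (hstate (tab_swap s k) n)"
proof -
  let ?t = "tab_swap s k"
  obtain m where m: "k = Suc m" using k by (cases k) auto
  obtain A V where AV: "hstate s m = (A, V)" by force
  have AV': "hstate ?t m = (A, V)"
    using hstate_cong[of m ?t s] AV m by (simp add: tab_swap_other)
  have "length V + 2 * cin k (col2 n s) = m"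
    using hstate_props(1)[OF s _ AV] k m by simp
  then have "V \<noteq> []"
    using ballotD[OF Std2_ballot[OF s], of k] k cin_Suc[OF k(1), of "col2 n s"] kS m by auto
  then obtain j V' where V: "V = j # V'" by (cases V) auto
  have sub: "set V \<subseteq> {1..m}" "\<Union>A \<subseteq> {1..m}" using hstate_props[OF s _ AV] k m by auto
  then have j: "j \<noteq> k" "j \<noteq> k + 1" using V m by auto
  have snds: "snd (s k) \<noteq> 1" "snd (s (Suc k)) = 1"
    using snd_Std2[OF s, of k] snd_Std2[OF s, of "Suc k"] kS k by auto
  have "hstate s (Suc k) = (insert {j, k} A, [] @ (k + 1) # V')"
    using AV snds V by (simp add: hstate_Suc m half_step_eq)
  moreover have "hstate ?t (Suc k) = (insert {k, k + 1} A, [] @ j # V')"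
  proof -
    have "snd (?t k) = 1" "snd (?t (Suc k)) \<noteq> 1" using snds by simp_all
    then show ?thesis using AV' V by (simp add: hstate_Suc m half_step_eq)
  qed
  moreover have "k \<notin> \<Union>A \<union> set [] \<union> set V'" "k + 1 \<notin> \<Union>A \<union> set [] \<union> set V'"
    using sub V m by auto
  ultimately have base: "hrel k j (hstate s (Suc k)) (hstate ?t (Suc k))"
    by (rule hrelI1[OF _ _ _ _ j])
  have "Suc k \<le> q \<Longrightarrow> q \<le> n \<Longrightarrow> hrel k j (hstate s q) (hstate ?t q)" for q
  proof (induction q rule: dec_induct)
    case base
    show ?case by (rule \<open>hrel k j (hstate s (Suc k)) (hstate ?t (Suc k))\<close>)
  next
    case (step q)
    show ?case
      unfolding hstate_Suc
    proof (rule hrel_step)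
      show "hrel k j (hstate s q) (hstate ?t q)" using step by simp
      show "s (Suc q) = ?t (Suc q)" using step by (simp add: tab_swap_other)
      show "snd (hstate s q) \<noteq> []" if "snd (s (Suc q)) \<noteq> 1"
      proof -
        obtain A V where AV: "hstate s q = (A, V)" by force
        have "Suc q \<in> col2 n s" using snd_Std2[OF s, of "Suc q"] that step by auto
        then show ?thesis
          using hstate_props(1)[OF s _ AV] AV step cin_Suc[of "Suc q" "col2 n s"]
            ballotD[OF Std2_ballot[OF s], of "Suc q"] by auto
      qed
    qed (use step in auto)
  qed
  from this[of n] show ?thesis using that k by simp
qed

section \<open>Cell diagrams\<close>

definition cell_of :: "nat set set \<times> nat list \<Rightarrow> nat set set \<times> nat list \<Rightarrow> diagram" where
  "cell_of p q = (`) (Pair 0) ` fst p \<union> (`) (Pair 1) ` fst q \<union>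
     {{(0, a), (1, b)} | a b. (a, b) \<in> set (zip (snd p) (snd q))}"

lemma cell_diagram_eq: "cell_diagram n s t = cell_of (hstate s n) (hstate t n)"
  by (simp add: cell_diagram_def cell_of_def half_diagram_hstate)

lemma cell_of_insert: "cell_of (insert {a, b} A, V) q = insert {(0, a), (0, b)} (cell_of (A, V) q)"
  by (auto simp: cell_of_def)

lemma cell_of_append:
  assumes "length P = length P'"
  shows "cell_of (A, P @ a # Q) (A', P' @ b # Q') = insert {(0, a), (1, b)} (cell_of (A, P @ Q) (A', P' @ Q'))"
  using assms by (auto simp: cell_of_def)

lemma cell_of_avoid:
  assumes "x \<notin> \<Union>A" "x \<notin> set V"
  shows "(0, x) \<notin> \<Union>(cell_of (A, V) q)"
  using assms by (auto simp: cell_of_def dest: set_zip_leftD)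

text \<open>\<open>hrel\<close> is surgery seen on one half of the diagram: \<open>j\<close> becomes
  joined to the former partner of \<open>k + 1\<close>, which may lie on the other half, at the end
  of a vertical line. So an exchange in the upper tableau is left multiplication by
  \<open>u_k\<close>.\<close>

lemma cell_surgery:
  assumes rel: "hrel k j p p'" and len: "length (snd p) = length (snd q)"
  shows "\<exists>x y. x \<noteq> (0, k + 1) \<and> {(0, k), x} \<in> cell_of p q \<and> {(0, k + 1), y} \<in> cell_of p q \<and>
    cell_of p' q = surgery k x y (cell_of p q)"
proof -
  have j: "j \<noteq> k" "j \<noteq> k + 1" using rel by (auto simp: hrel_def)
  obtain A' V' where q: "q = (A', V')" by force
  from rel consider
    (1) B P Q where "p = (insert {j, k} B, P @ (k + 1) # Q)" "p' = (insert {k, k + 1} B, P @ j # Q)"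
      "k \<notin> \<Union>B \<union> set P \<union> set Q" "k + 1 \<notin> \<Union>B \<union> set P \<union> set Q"
  | (2) B z V where "p = (insert {j, k} (insert {k + 1, z} B), V)"
      "p' = (insert {k, k + 1} (insert {j, z} B), V)"
      "z \<noteq> k" "z \<noteq> k + 1" "k \<notin> \<Union>B \<union> set V" "k + 1 \<notin> \<Union>B \<union> set V"
    unfolding hrel_def by blast
  then show ?thesis
  proof cases
    case 1
    have "length P < length V'" using len 1 q by simp
    then obtain P' b Q' where V': "V' = P' @ b # Q'" "length P = length P'"
      by (metis id_take_nth_drop length_take min.absorb4)
    define R where "R = cell_of (B, P @ Q) (A', P' @ Q')"
    have p: "cell_of p q = insert {(0, k), (0, j)} (insert {(0, k + 1), (1, b)} R)"
      using 1(1) q V' by (simp only: cell_of_insert cell_of_append R_def insert_commute[of "(0, j)"])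
    have p': "cell_of p' q = insert {(0, k), (0, k + 1)} (insert {(0, j), (1, b)} R)"
      using 1(2) q V' by (simp only: cell_of_insert cell_of_append R_def)
    have "(0, k) \<notin> \<Union>R" "(0, k + 1) \<notin> \<Union>R"
      unfolding R_def by (rule cell_of_avoid; use 1 in auto)+
    then have "{(0, k), (0, j)} \<notin> R" "{(0, k + 1), (1, b)} \<notin> R" by auto
    then have "cell_of p q - {{(0, k), (0, j)}, {(0, k + 1), (1, b)}} = R" using p by blast
    then have "cell_of p' q = surgery k (0, j) (1, b) (cell_of p q)"
      using p' by (simp add: surgery_def)
    then show ?thesis using p j by blast
  next
    case 2
    define R where "R = cell_of (B, V) q"
    have p: "cell_of p q = insert {(0, k), (0, j)} (insert {(0, k + 1), (0, z)} R)"
      using 2(1) by (simp only: cell_of_insert R_def insert_commute[of "(0, j)"])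
    have p': "cell_of p' q = insert {(0, k), (0, k + 1)} (insert {(0, j), (0, z)} R)"
      using 2(2) by (simp only: cell_of_insert R_def)
    have "(0, k) \<notin> \<Union>R" "(0, k + 1) \<notin> \<Union>R"
      unfolding R_def by (rule cell_of_avoid; use 2 in auto)+
    then have "{(0, k), (0, j)} \<notin> R" "{(0, k + 1), (0, z)} \<notin> R" by auto
    then have "cell_of p q - {{(0, k), (0, j)}, {(0, k + 1), (0, z)}} = R" using p by blast
    then have "cell_of p' q = surgery k (0, j) (0, z) (cell_of p q)"
      using p' by (simp add: surgery_def)
    then show ?thesis using p j by blast
  qed
qed

lemma length_hstate:
  assumes "s \<in> Std2 n"
  shows "length (snd (hstate s n)) + 2 * card (col2 n s) = n"
proof -
  obtain A V where "hstate s n = (A, V)" by force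
  moreover have "col2 n s \<subseteq> {1..n}" by (auto simp: col2_def)
  ultimately show ?thesis using hstate_props(1)[OF assms, of n A V] cin_full[of "col2 n s" n] by simp
qed

definition single :: "diagram \<Rightarrow> tl" where
  "single D = Poly_Mapping.single D 1"

lemma act_single_u:
  assumes D: "D \<in> words n" and k: "1 \<le> k" "k < n" and l: "loops (u_diag n k) D = 0"
  shows "act n (single (diag_comp (u_diag n k) D)) f = act n (tl_u n k) (act n (single D) f)"
proof -
  have "tl_u n k \<cdot> single D = single (diag_comp (u_diag n k) D)"
    using l by (simp add: tl_u_eq single_def tl_mult_def)
  then show ?thesis
    using act_mult[OF word_alg_u[OF k] word_alg_single[OF D], of 1 f] by (simp add: single_def)
qed

lemma cell_swap_left:
  assumes s: "s \<in> Std2 n" "tab_swap s k \<in> Std2 n" and a: "a \<in> Std2 n" "card (col2 n a) = card (col2 n s)"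
    and k: "1 \<le> k" "k < n" "k \<in> col2 n s" "Suc k \<notin> col2 n s" and w: "cell_diagram n s a \<in> words n"
  shows "cell_diagram n (tab_swap s k) a \<in> words n"
    "act n (single (cell_diagram n (tab_swap s k) a)) f = act n (tl_u n k) (act n (single (cell_diagram n s a)) f)"
proof -
  obtain j where j: "hrel k j (hstate s n) (hstate (tab_swap s k) n)"
    using hrel_swap[OF s k] .
  have "length (snd (hstate s n)) = length (snd (hstate a n))"
    using length_hstate[OF s(1)] length_hstate[OF a(1)] a(2) by simp
  from cell_surgery[OF j this] obtain x y where
    xy: "x \<noteq> (0, k + 1)" "{(0, k), x} \<in> cell_diagram n s a" "{(0, k + 1), y} \<in> cell_diagram n s a"
    and eq: "cell_diagram n (tab_swap s k) a = surgery k x y (cell_diagram n s a)"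
    unfolding cell_diagram_eq by blast
  interpret surgery_setup n k "cell_diagram n s a" x y
    by unfold_locales (use xy k w diagrams_perfect words_diagrams in auto)
  have eq': "cell_diagram n (tab_swap s k) a = diag_comp (u_diag n k) (cell_diagram n s a)"
    unfolding eq diag_comp_surgery(1) ..
  show "cell_diagram n (tab_swap s k) a \<in> words n"
    unfolding eq' by (rule words.step[OF w k(1,2)])
  show "act n (single (cell_diagram n (tab_swap s k) a)) f = act n (tl_u n k) (act n (single (cell_diagram n s a)) f)"
    unfolding eq' by (rule act_single_u[OF w k(1,2) diag_comp_surgery(2)])
qed

subsection \<open>Reflection\<close>

text \<open>Reflection transposes the matrix of a diagram and the matrix of \<open>u_k\<close> is
  symmetric; exchanges in the lower tableau thus become right multiplications by
  \<open>u_k\<close>.\<close>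

definition reflect :: "diagram \<Rightarrow> diagram" where
  "reflect D = (`) (map_prod (\<lambda>l. 1 - l) id) ` D"

lemma reflect_cell: "reflect (cell_diagram n s t) = cell_diagram n t s"
proof -
  let ?f = "map_prod (\<lambda>l. 1 - l) id :: point \<Rightarrow> point"
  obtain A V where s: "hstate s n = (A, V)" by force
  obtain A' V' where t: "hstate t n = (A', V')" by force
  have z: "(b, a) \<in> set (zip V' V) \<longleftrightarrow> (a, b) \<in> set (zip V V')" for a b
    by (auto simp: set_zip)
  have "(`) ?f ` (`) (Pair 0) ` A = (`) (Pair 1) ` A" "(`) ?f ` (`) (Pair 1) ` A' = (`) (Pair 0) ` A'"
    by (auto simp: image_image)
  moreover have "(`) ?f ` {{(0, a), (1, b)} | a b. (a, b) \<in> set (zip V V')} =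
      {{(0, a), (1, b)} | a b. (a, b) \<in> set (zip V' V)}"
  proof (intro equalityI subsetI)
    fix e assume "e \<in> (`) ?f ` {{(0, a), (1, b)} | a b. (a, b) \<in> set (zip V V')}"
    then obtain a b where ab: "(a, b) \<in> set (zip V V')" "e = ?f ` {(0, a), (1, b)}" by blast
    then have "e = {(0, b), (1, a)}" by (simp add: insert_commute)
    then show "e \<in> {{(0, a), (1, b)} | a b. (a, b) \<in> set (zip V' V)}" using z ab by blast
  next
    fix e assume "e \<in> {{(0::nat, a), (1, b)} | a b. (a, b) \<in> set (zip V' V)}"
    then obtain a b where ab: "(b, a) \<in> set (zip V V')" "e = {(0, a), (1, b)}" using z by blast
    then have "e = ?f ` {(0, b), (1, a)}" by (simp add: insert_commute)
    then show "e \<in> (`) ?f ` {{(0, a), (1, b)} | a b. (a, b) \<in> set (zip V V')}" using ab(1) by blast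
  qed
  ultimately show ?thesis
    unfolding reflect_def cell_diagram_eq cell_of_def s t by (auto simp: image_Un)
qed

lemma diagrams_levels: "perfect n D \<Longrightarrow> {p, q} \<in> D \<Longrightarrow> fst p \<le> 1"
proof -
  assume "perfect n D" "{p, q} \<in> D"
  then have "p \<in> points n" by (auto simp: perfect_def partition_on_def)
  then show ?thesis by (auto simp: points_def)
qed

lemma reflect_point: "fst p \<le> (1::nat) \<Longrightarrow> map_prod (\<lambda>l. 1 - l) id (map_prod (\<lambda>l. 1 - l) id p) = p"
  by (cases p) auto

lemma perfect_reflect:
  assumes D: "perfect n D" shows "perfect n (reflect D)"
proof -
  let ?f = "map_prod (\<lambda>l. 1 - l) id :: point \<Rightarrow> point"
  have bij: "bij_betw ?f (points n) (points n)"
    by (rule bij_betw_byWitness[where f' = ?f]) (auto simp: points_def)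
  have inj: "inj_on ?f (points n)" using bij by (rule bij_betw_imp_inj_on)
  have sub: "e \<subseteq> points n" if "e \<in> D" for e using D that by (auto simp: perfect_def partition_on_def)
  show ?thesis
    unfolding perfect_def partition_on_def
  proof (intro conjI)
    have "\<Union>(reflect D) = ?f ` \<Union>D" by (auto simp: reflect_def)
    also have "\<dots> = points n" using D bij by (simp add: perfect_def partition_on_def bij_betw_def)
    finally show "\<Union>(reflect D) = points n" .
    show "disjoint (reflect D)"
      unfolding reflect_def disjoint_def
    proof (intro ballI impI)
      fix a b assume "a \<in> (`) ?f ` D" "b \<in> (`) ?f ` D" "a \<noteq> b"
      then obtain e e' where e: "e \<in> D" "e' \<in> D" "a = ?f ` e" "b = ?f ` e'" "e \<noteq> e'" by blast
      then have "e \<inter> e' = {}" using D by (auto simp: perfect_def partition_on_def disjoint_def)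
      then show "a \<inter> b = {}"
        using inj_on_image_Int[OF inj sub[OF e(1)] sub[OF e(2)]] e by simp
    qed
    show "{} \<notin> reflect D" using D by (auto simp: reflect_def perfect_def partition_on_def)
    show "\<forall>e\<in>reflect D. card e = 2"
    proof
      fix e assume "e \<in> reflect D"
      then obtain e' where e': "e' \<in> D" "e = ?f ` e'" by (auto simp: reflect_def)
      then have "card e = card e'" using card_image[OF inj_on_subset[OF inj sub]] by simp
      then show "card e = 2" using D e' by (simp add: perfect_def)
    qed
  qed
qed

lemma coloured_reflect:
  assumes D: "perfect n D"
  shows "coloured (reflect D) X Y \<longleftrightarrow> coloured D Y X"
proof -
  let ?f = "map_prod (\<lambda>l. 1 - l) id :: point \<Rightarrow> point"
  have col: "colour X Y (?f p) = colour Y X p" if "fst p \<le> 1" for p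
    using that by (cases p) (auto simp: colour_def)
  have edge: "{?f p, ?f q} \<in> reflect D" if "{p, q} \<in> D" for p q
    unfolding reflect_def by (rule image_eqI[of _ _ "{p, q}"]) (simp_all add: that)
  have rr: "reflect (reflect D) = D"
  proof -
    have "?f ` ?f ` e = e" if "e \<in> D" for e
    proof -
      have "?f (?f p) = p" if "p \<in> e" for p
      proof -
        have "p \<in> \<Union>D" using that \<open>e \<in> D\<close> by blast
        then have "p \<in> points n" using D by (simp only: perfect_def partition_on_def)
        then show ?thesis by (intro reflect_point) (auto simp: points_def)
      qed
      then show ?thesis by (simp add: image_image)
    qed
    then show ?thesis by (simp add: reflect_def image_image)
  qed
  show ?thesis
  proof
    assume c: "coloured (reflect D) X Y"
    show "coloured D Y X"
      unfolding coloured_def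
    proof (intro allI impI)
      fix p q assume pq: "{p, q} \<in> D"
      then have "{q, p} \<in> D" by (simp add: insert_commute)
      then have "fst p \<le> 1" "fst q \<le> 1" using diagrams_levels[OF D] pq by blast+
      then show "colour Y X p = colour Y X q"
        using c edge[OF pq] col unfolding coloured_def by metis
    qed
  next
    assume c: "coloured D Y X"
    show "coloured (reflect D) X Y"
      unfolding coloured_def
    proof (intro allI impI)
      fix p q assume pq: "{p, q} \<in> reflect D"
      then have "{q, p} \<in> reflect D" by (simp add: insert_commute)
      then have l: "fst p \<le> 1" "fst q \<le> 1" using diagrams_levels[OF perfect_reflect[OF D]] pq by blast+
      have "?f ` {p, q} \<in> reflect (reflect D)" using pq unfolding reflect_def[of "reflect D"] by (rule imageI)
      then have "{?f p, ?f q} \<in> D" unfolding rr by simp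
      then have "colour Y X (?f p) = colour Y X (?f q)" using c unfolding coloured_def by blast
      moreover have "colour Y X (?f p) = colour X Y p" "colour Y X (?f q) = colour X Y q"
        using l by (cases p; cases q; auto simp: colour_def)+
      ultimately show "colour X Y p = colour X Y q" by simp
    qed
  qed
qed

lemma coloured_u_sym: "coloured (u_diag n k) X Y \<longleftrightarrow> coloured (u_diag n k) Y X"
  unfolding coloured_u by blast

lemma cell_swap_right:
  assumes s: "s \<in> Std2 n" "tab_swap s k \<in> Std2 n" and a: "a \<in> Std2 n" "card (col2 n a) = card (col2 n s)"
    and k: "1 \<le> k" "k < n" "k \<in> col2 n s" "Suc k \<notin> col2 n s"
    and w: "cell_diagram n a s \<in> words n"
  shows "cell_diagram n a (tab_swap s k) \<in> words n"
    "act n (single (cell_diagram n a (tab_swap s k))) f = act n (single (cell_diagram n a s)) (act n (tl_u n k) f)"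
proof -
  let ?C = "cell_diagram n s a" and ?C' = "cell_diagram n (tab_swap s k) a" and ?U = "u_diag n k"
  obtain j where j: "hrel k j (hstate s n) (hstate (tab_swap s k) n)"
    using hrel_swap[OF s k] .
  have "length (snd (hstate s n)) = length (snd (hstate a n))"
    using length_hstate[OF s(1)] length_hstate[OF a(1)] a(2) by simp
  from cell_surgery[OF j this] obtain x y where
    xy: "x \<noteq> (0, k + 1)" "{(0, k), x} \<in> ?C" "{(0, k + 1), y} \<in> ?C"
    and eq: "?C' = surgery k x y ?C"
    unfolding cell_diagram_eq by blast
  have "perfect n (cell_diagram n a s)" using w diagrams_perfect words_diagrams by blast
  then have C: "perfect n ?C" using perfect_reflect reflect_cell by metis
  interpret surgery_setup n k ?C x y
    by unfold_locales (use xy k C in auto)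
  have C': "perfect n ?C'" unfolding eq by (rule perfect_surgery)
  have R: "cell_diagram n a s = reflect ?C" "cell_diagram n a (tab_swap s k) = reflect ?C'"
    by (simp_all add: reflect_cell)
  have sum: "(\<Sum>Y\<in>Pow {1..n}. of_bool (coloured (cell_diagram n a s) X Y) * of_bool (coloured ?U Y Z)) =
      (1 * of_bool (coloured (cell_diagram n a (tab_swap s k)) X Z) :: rat)" if "Z \<subseteq> {1..n}" for X Z
  proof -
    have "(\<Sum>Y\<in>Pow {1..n}. of_bool (coloured (cell_diagram n a s) X Y) * of_bool (coloured ?U Y Z)) =
        (\<Sum>Y\<in>Pow {1..n}. of_bool (coloured ?U Z Y) * of_bool (coloured ?C Y X) :: rat)"
      unfolding R(1) coloured_reflect[OF C]
      by (rule sum.cong[OF refl]) (simp only: mult.commute coloured_u_sym[of n k _ Z])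
    also have "\<dots> = of_bool (coloured ?C' Z X)" unfolding eq by (rule surgery_sum[OF that])
    finally show ?thesis unfolding R(2) coloured_reflect[OF C'] by simp
  qed
  have U: "covers n ?U" using perfect_covers perfect_u k by blast
  note comp = diag_comp_eqI[where c = 1, OF perfect_covers U perfect_reflect[OF C', folded R(2)], of "cell_diagram n a s"]
  have CR: "perfect n (cell_diagram n a s)" unfolding R by (rule perfect_reflect[OF C])
  have eq': "diag_comp (cell_diagram n a s) ?U = cell_diagram n a (tab_swap s k)"
    by (rule comp[OF CR]) (simp, rule sum)
  have "2 ^ loops (cell_diagram n a s) ?U = (1 :: rat)"
    by (rule comp[OF CR]) (simp, rule sum)
  then have l: "loops (cell_diagram n a s) ?U = 0" by (rule two_power_eq_1D)
  show "cell_diagram n a (tab_swap s k) \<in> words n"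
    unfolding eq'[symmetric] by (rule words_diag_comp[OF w u_words[OF k(1,2)]])
  have "single (cell_diagram n a s) \<cdot> tl_u n k = single (cell_diagram n a (tab_swap s k))"
    using l eq' by (simp add: tl_u_eq single_def tl_mult_def)
  then show "act n (single (cell_diagram n a (tab_swap s k))) f = act n (single (cell_diagram n a s)) (act n (tl_u n k) f)"
    using act_mult[OF word_alg_single[OF w] word_alg_u[OF k(1,2)], of 1 f] by (simp add: single_def)
qed

subsection \<open>The most dominant tableau\<close>

text \<open>The second column of the tableau filled row by row.\<close>

definition evset :: "nat \<Rightarrow> nat set" where
  "evset l = {i. 1 \<le> i \<and> i \<le> 2 * l \<and> even i}"

lemma cin_evset: "cin (Suc m) (evset l) = min l (m div 2)"
proof (induction m)
  case (Suc m)
  have "Suc m \<in> evset l \<longleftrightarrow> odd m \<and> m div 2 < l" by (auto simp: evset_def elim!: oddE)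
  then show ?case using Suc cin_Suc[of "Suc m" "evset l"] by (cases "even m") auto
qed simp

lemma evset_subset: "2 * l \<le> n \<Longrightarrow> evset l \<subseteq> {1..n}"
  by (auto simp: evset_def)

lemma ballot_evset: "2 * l \<le> n \<Longrightarrow> ballot n (evset l)"
  unfolding ballot_iff cin_evset by (rule conjI, erule evset_subset) (auto simp: min_def)

lemma card_evset: "card (evset l) = l"
  using cin_full[of "evset l" "2 * l"] evset_subset[of l "2 * l"] cin_evset[of "2 * l" l] by simp

definition base :: "nat \<Rightarrow> nat \<Rightarrow> tableau" where
  "base n l = tab n (evset l)"

lemma base_Std2: "2 * l \<le> n \<Longrightarrow> base n l \<in> Std2 n"
  unfolding base_def by (intro tab_Std2 ballot_evset)

lemma col2_base: "2 * l \<le> n \<Longrightarrow> col2 n (base n l) = evset l"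
  unfolding base_def by (intro col2_tab evset_subset)

definition arcs :: "nat \<Rightarrow> nat set set" where
  "arcs m = (\<lambda>i. {2 * i - 1, 2 * i}) ` {1..m}"

lemma arcs_0 [simp]: "arcs 0 = {}" and arcs_Suc: "arcs (Suc m) = insert {2 * m + 1, 2 * m + 2} (arcs m)"
  by (simp_all add: arcs_def atLeastAtMostSuc_conv)

lemma hstate_base_low:
  assumes l: "2 * l \<le> n" and "m \<le> l"
  shows "hstate (base n l) (2 * m) = (arcs m, [])"
  using assms(2)
proof (induction m)
  case (Suc m)
  have n: "2 * m < n" "Suc (2 * m) < n" using Suc.prems l by auto
  have "Suc (2 * m) \<notin> evset l" "Suc (Suc (2 * m)) \<in> evset l"
    using Suc.prems by (auto simp: evset_def)
  moreover have "hstate (base n l) (2 * m) = (arcs m, [])" using Suc by simp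
  ultimately have "hstate (base n l) (Suc (Suc (2 * m))) = (insert {Suc (2 * m), Suc (Suc (2 * m))} (arcs m), [])"
    using hstate_step[OF base_Std2[OF l] n(1)] hstate_step[OF base_Std2[OF l] n(2)] col2_base[OF l] by simp
  then show ?case by (simp add: arcs_Suc)
qed simp

lemma hstate_base_high:
  assumes l: "2 * l \<le> n" and "2 * l \<le> m" "m \<le> n"
  shows "hstate (base n l) m = (arcs l, rev [2 * l + 1..<m + 1])"
  using assms(2,3)
proof (induction m rule: dec_induct)
  case base
  then show ?case using hstate_base_low[OF l, of l] by simp
next
  case (step m)
  have "Suc m \<notin> evset l" using step by (auto simp: evset_def)
  then show ?case using hstate_step[OF base_Std2[OF l], of m] step col2_base[OF l] by simp
qed

text \<open>The diagram of the word \<open>u_1 u_3 ... u_(2m-1)\<close>.\<close>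

definition base_diag :: "nat \<Rightarrow> nat \<Rightarrow> diagram" where
  "base_diag n m = cell_of (arcs m, []) (arcs m, []) \<union> {{(0, a), (1, a)} | a. a \<in> {2 * m + 1..n}}"

lemma cell_base:
  assumes l: "2 * l \<le> n"
  shows "cell_diagram n (base n l) (base n l) = base_diag n l"
proof -
  have "set (zip xs xs) = (\<lambda>x. (x, x)) ` set xs" for xs :: "nat list"
    by (simp add: zip_same_conv_map)
  then have "{{(0::nat, a), (1, b)} | a b. (a, b) \<in> set (zip xs xs)} = {{(0, a), (1, a)} | a. a \<in> set xs}"
    for xs :: "nat list" by auto
  moreover have "set (rev [2 * l + 1..<n + 1]) = {2 * l + 1..n}" by auto
  ultimately show ?thesis
    unfolding cell_diagram_eq hstate_base_high[OF l l order_refl] base_diag_def cell_of_def by simp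
qed

lemma base_diag_0: "base_diag n 0 = one_diag n"
  by (simp add: base_diag_def cell_of_def one_diag_def)

lemma cell_of_insert_bottom: "cell_of p (insert {a, b} A, V) = insert {(1, a), (1, b)} (cell_of p (A, V))"
  by (auto simp: cell_of_def)

lemma base_diag_step:
  assumes m: "2 * m + 2 \<le> n"
  shows "{(0, 2 * m + 1), (1, 2 * m + 1)} \<in> base_diag n m" "{(0, 2 * m + 2), (1, 2 * m + 2)} \<in> base_diag n m"
    "base_diag n (Suc m) = surgery (2 * m + 1) (1, 2 * m + 1) (1, 2 * m + 2) (base_diag n m)"
proof -
  define R where "R = cell_of (arcs m, []) (arcs m, []) \<union> {{(0, a), (1, a)} | a. a \<in> {2 * m + 3..n}}"
  have "{2 * m + 1..n} = insert (2 * m + 1) (insert (2 * m + 2) {2 * m + 3..n})" using m by auto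
  then have V: "{{(0::nat, a), (1, a)} | a. a \<in> {2 * m + 1..n}} = insert {(0, 2 * m + 1), (1, 2 * m + 1)}
      (insert {(0, 2 * m + 2), (1, 2 * m + 2)} {{(0, a), (1, a)} | a. a \<in> {2 * m + 3..n}})" by auto
  have D: "base_diag n m = insert {(0, 2 * m + 1), (1, 2 * m + 1)} (insert {(0, 2 * m + 2), (1, 2 * m + 2)} R)"
    unfolding base_diag_def V R_def by auto
  then show "{(0, 2 * m + 1), (1, 2 * m + 1)} \<in> base_diag n m" "{(0, 2 * m + 2), (1, 2 * m + 2)} \<in> base_diag n m"
    by simp_all
  have "{2 * Suc m + 1..n} = {2 * m + 3..n}" by auto
  then have D': "base_diag n (Suc m) = insert {(0, 2 * m + 1), (0, 2 * m + 2)} (insert {(1, 2 * m + 1), (1, 2 * m + 2)} R)"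
    by (simp only: base_diag_def arcs_Suc cell_of_insert cell_of_insert_bottom R_def Un_insert_left)
      (rule insert_commute)
  have "x \<notin> \<Union>(arcs m)" if "2 * m < x" for x using that by (auto simp: arcs_def)
  then have "(0, x) \<notin> \<Union>(cell_of (arcs m, []) (arcs m, []))" if "2 * m < x" for x
    using that by (intro cell_of_avoid) auto
  then have "(0, x) \<notin> \<Union>R" if "x = 2 * m + 1 \<or> x = 2 * m + 2" for x
    using that unfolding R_def by auto
  then have "{(0, 2 * m + 1), (1, 2 * m + 1)} \<notin> R" "{(0, 2 * m + 2), (1, 2 * m + 2)} \<notin> R" by blast+
  then have "base_diag n m - {{(0, 2 * m + 1), (1, 2 * m + 1)}, {(0, 2 * m + 2), (1, 2 * m + 2)}} = R"
    unfolding D by blast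
  then show "base_diag n (Suc m) = surgery (2 * m + 1) (1, 2 * m + 1) (1, 2 * m + 2) (base_diag n m)"
    unfolding surgery_def D' by simp
qed

lemma base_diag_words:
  "2 * m \<le> n \<Longrightarrow> base_diag n m \<in> words n"
  "2 * m + 2 \<le> n \<Longrightarrow> act n (single (base_diag n (Suc m))) f = act n (tl_u n (2 * m + 1)) (act n (single (base_diag n m)) f)"
proof -
  have step: "base_diag n (Suc m) = diag_comp (u_diag n (2 * m + 1)) (base_diag n m) \<and>
      loops (u_diag n (2 * m + 1)) (base_diag n m) = 0"
    if "2 * m + 2 \<le> n" "base_diag n m \<in> words n" for m
  proof -
    interpret surgery_setup n "2 * m + 1" "base_diag n m" "(1, 2 * m + 1)" "(1, 2 * m + 2)"
      using base_diag_step(1,2)[OF that(1)] that diagrams_perfect[OF words_diagrams[OF that(2)]]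
      by unfold_locales auto
    show ?thesis using diag_comp_surgery base_diag_step(3)[OF that(1)] by simp
  qed
  have w: "base_diag n m \<in> words n" if "2 * m \<le> n" for m
    using that
  proof (induction m)
    case 0
    then show ?case by (simp add: base_diag_0 words.one)
  next
    case (Suc m)
    then have "base_diag n m \<in> words n" by simp
    then show ?case using step[of m] words.step[of "base_diag n m" n "2 * m + 1"] Suc.prems by simp
  qed
  then show "2 * m \<le> n \<Longrightarrow> base_diag n m \<in> words n" .
  show "act n (single (base_diag n (Suc m))) f = act n (tl_u n (2 * m + 1)) (act n (single (base_diag n m)) f)"
    if m: "2 * m + 2 \<le> n"
  proof -
    have wm: "base_diag n m \<in> words n" using w m by simp
    note st = step[OF m wm]
    show ?thesis
      unfolding conjunct1[OF st] by (rule act_single_u[OF wm]) (use st m in auto)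
  qed
qed

text \<open>The next factor \<open>u_(2m+1)\<close> meets a tableau that starts as
  \<open>base\<close> does, so \<open>2 * m + 1\<close> is in the first column. If
  \<open>2 * m + 2\<close> stands next to it, the content difference is -1 and the eigenvalue
  \<open>1 - 1 / r\<close> is 2; if it stands below, the difference is 1 and the result is
  0.\<close>

lemma act_base_diag:
  assumes t: "t \<in> Std2 n" and "2 * m \<le> n"
  shows "act n (single (base_diag n m)) (vt n t c) =
    (if col2 n t \<inter> {1..2 * m} = evset m then (\<lambda>w. 2 ^ m * vt n t c w) else (\<lambda>w. 0))"
  using assms(2)
proof (induction m)
  case 0
  then show ?case by (simp add: base_diag_0 single_def act_one_vt evset_def flip: tl_one_eq)
next
  case (Suc m)
  let ?S = "col2 n t" and ?k = "2 * m + 1"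
  have k: "1 \<le> ?k" "?k < n" using Suc.prems by auto
  have m: "2 * m + 2 \<le> n" using Suc.prems by simp
  have IH: "act n (single (base_diag n m)) (vt n t c) =
    (if ?S \<inter> {1..2 * m} = evset m then (\<lambda>w. 2 ^ m * vt n t c w) else (\<lambda>w. 0))"
    using Suc by simp
  have ev: "evset (Suc m) = insert (2 * m + 2) (evset m)" by (auto simp: evset_def le_Suc_eq)
  show ?case
  proof (cases "?S \<inter> {1..2 * m} = evset m")
    case False
    have "?S \<inter> {1..2 * Suc m} \<noteq> evset (Suc m)"
    proof
      assume eq: "?S \<inter> {1..2 * Suc m} = evset (Suc m)"
      have "?S \<inter> {1..2 * m} = (?S \<inter> {1..2 * Suc m}) \<inter> {1..2 * m}" by auto
      also have "\<dots> = evset m" unfolding eq by (auto simp: evset_def)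
      finally show False using False by simp
    qed
    then show ?thesis using base_diag_words(2)[OF m] IH False act_zero_fun by simp
  next
    case True
    interpret sw: swap_setup n ?k t "content t ?k - content t (Suc ?k)"
      by unfold_locales (use t k in simp_all)
    have "{1..<?k} = {1..2 * m}" by auto
    then have "{1..<?k} \<inter> ?S = evset m" using True by (simp only: Int_commute)
    then have c: "cin ?k ?S = m" using card_evset[of m] by (simp add: cin_def)
    have kS: "?k \<notin> ?S"
      using ballotD[OF Std2_ballot[OF t], of ?k] cin_Suc[OF k(1), of ?S] c k by auto
    have split: "?S \<inter> {1..2 * Suc m} = (?S \<inter> {1..2 * m}) \<union> (?S \<inter> {2 * m + 2})"
      using kS by (auto simp: le_Suc_eq)
    have act: "act n (single (base_diag n (Suc m))) (vt n t c') =
        (\<lambda>w. 2 ^ m * ((1 - 1 / of_int (content t ?k - content t (Suc ?k))) * (vt n t c' w - vt n (tab_swap t ?k) c' w)))"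
      if "c' = c" for c'
    proof -
      have "act n (single (base_diag n m)) (vt n t c') = (\<lambda>w. 2 ^ m * vt n t c' w)"
        using IH True that by simp
      then show ?thesis using base_diag_words(2)[OF m] by (simp only: act_scale act_u_vt[OF t k refl])
    qed
    show ?thesis
    proof (cases "2 * m + 2 \<in> ?S")
      case in2: True
      have "content t ?k - content t (Suc ?k) = 2 * int sw.c - int ?k"
        by (rule sw.r_cases(4)) (use kS in2 in \<open>simp_all add: sw.S_def\<close>)
      also have "sw.c = m" using c by (simp only: sw.c_def sw.S_def)
      finally have "content t ?k - content t (Suc ?k) = -1" by simp
      moreover from this have "tab_swap t ?k \<notin> Std2 n" using sw.swap_Std2_iff by simp
      moreover have "?S \<inter> {1..2 * Suc m} = evset (Suc m)" unfolding split True ev using in2 by auto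
      ultimately show ?thesis using act[OF refl] by (simp add: vt_def fun_eq_iff)
    next
      case out: False
      then have "content t ?k - content t (Suc ?k) = 1"
        using sw.r_cases(2) kS by (simp add: sw.S_def)
      moreover have "?S \<inter> {1..2 * Suc m} \<noteq> evset (Suc m)" unfolding ev using out by auto
      ultimately show ?thesis using act[OF refl] by (simp add: fun_eq_iff)
    qed
  qed
qed

lemma Std2_eq_base:
  assumes t: "t \<in> Std2 n" and c: "card (col2 n t) = l"
  shows "col2 n t \<inter> {1..2 * l} = evset l \<longleftrightarrow> t = base n l"
proof -
  have l: "2 * l \<le> n" using ballot_card[OF Std2_ballot[OF t]] c by simp
  show ?thesis
  proof
    assume "col2 n t \<inter> {1..2 * l} = evset l"
    then have "evset l \<subseteq> col2 n t" by blast
    moreover have "finite (col2 n t)" by (simp add: col2_def)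
    ultimately have "evset l = col2 n t" using c card_evset by (metis card_subset_eq)
    then show "t = base n l" using Std2_eq_tab[OF t] by (simp add: base_def)
  next
    assume "t = base n l"
    then show "col2 n t \<inter> {1..2 * l} = evset l" using col2_base[OF l] by (auto simp: evset_def)
  qed
qed

text \<open>If no such exchange is standard, every first-column entry \<open>k\<close> followed by a
  second-column entry satisfies \<open>k = 2 * cin k + 1\<close>. Going through the second column in
  increasing order, this forces it to consist of \<open>2, 4, ..., 2 * l\<close>.\<close>

lemma Std2_move:
  assumes t: "t \<in> Std2 n" and ne: "t \<noteq> base n (card (col2 n t))"
  obtains k where "1 \<le> k" "k < n" "k \<notin> col2 n t" "Suc k \<in> col2 n t" "tab_swap t k \<in> Std2 n"
proof (rule ccontr)
  note obt = that
  let ?S = "col2 n t"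
  define l where "l = card ?S"
  assume no: "\<not> thesis"
  have bal: "ballot n ?S" by (rule Std2_ballot[OF t])
  have sub: "?S \<subseteq> {1..n}" using bal by (simp add: ballot_iff)
  have fin: "finite ?S" by (simp add: col2_def)
  have tight: "k = 2 * cin k ?S + 1" if k: "1 \<le> k" "k < n" "k \<notin> ?S" "Suc k \<in> ?S" for k
  proof -
    interpret sw: swap_setup n k t "content t k - content t (Suc k)"
      by unfold_locales (use t k in simp_all)
    have "tab_swap t k \<notin> Std2 n" using obt no k by blast
    then have "content t k - content t (Suc k) = -1"
      using sw.swap_Std2_iff sw.r_bounds(2) k by (simp add: sw.S_def)
    then show ?thesis using sw.r_cases(4) k by (simp add: sw.S_def sw.c_def)
  qed
  have "m \<le> l \<Longrightarrow> ?S \<inter> {1..2 * m} = evset m" for m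
  proof (induction m)
    case (Suc m)
    then have IH: "?S \<inter> {1..2 * m} = evset m" by simp
    have "card (?S \<inter> {1..2 * m}) = m" using IH card_evset by simp
    then have "?S \<noteq> ?S \<inter> {1..2 * m}" using Suc.prems l_def by auto
    then have ex: "\<exists>q. q \<in> ?S \<and> 2 * m < q" using sub by fastforce
    define q where "q = (LEAST q. q \<in> ?S \<and> 2 * m < q)"
    have q: "q \<in> ?S" "2 * m < q" using LeastI_ex[OF ex] by (auto simp: q_def)
    have below: "j \<notin> ?S" if "2 * m < j" "j < q" for j
      using not_less_Least[of j "\<lambda>q. q \<in> ?S \<and> 2 * m < q"] that by (auto simp: q_def)
    have "?S \<inter> {1..<q} = evset m"
      unfolding IH[symmetric] using below q by (auto simp: not_less) (metis not_less)
    then have cq: "cin q ?S = m" using card_evset[of m] by (simp add: cin_def Int_commute)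
    have qn: "q \<in> {1..n}" using q sub by blast
    have q2: "2 * m + 2 \<le> q" using ballotD[OF bal, of q] cin_Suc[of q ?S] cq q qn by simp
    obtain k where k: "q = Suc k" using q by (cases q) auto
    have kS: "k \<notin> ?S" using below[of k] q2 k by simp
    have "cin k ?S = m" using cq k cin_Suc[of k ?S] kS q2 by simp
    then have "k = 2 * m + 1" using tight[of k] k q2 qn q kS by simp
    then have q': "q = 2 * m + 2" using k by simp
    have "?S \<inter> {1..2 * Suc m} = insert (2 * m + 2) (?S \<inter> {1..2 * m})"
      using q q' below[of "2 * m + 1"] by (auto simp: le_Suc_eq)
    also have "\<dots> = evset (Suc m)" unfolding IH by (auto simp: evset_def le_Suc_eq)
    finally show ?case .
  qed (simp add: evset_def)
  then have "?S \<inter> {1..2 * l} = evset l" by simp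
  then show False using Std2_eq_base[OF t] ne l_def by blast
qed

text \<open>The measure is the sum of the second column: each exchange towards the most dominant
  tableau lowers it by 1.\<close>

lemma Std2_induct [consumes 1, case_names base swap]:
  assumes "t \<in> Std2 n"
    and "P (base n (card (col2 n t)))"
    and "\<And>s k. s \<in> Std2 n \<Longrightarrow> card (col2 n s) = card (col2 n t) \<Longrightarrow> 1 \<le> k \<Longrightarrow> k < n \<Longrightarrow>
      k \<in> col2 n s \<Longrightarrow> Suc k \<notin> col2 n s \<Longrightarrow> tab_swap s k \<in> Std2 n \<Longrightarrow> P s \<Longrightarrow> P (tab_swap s k)"
  shows "P t"
proof -
  have "u \<in> Std2 n \<Longrightarrow> card (col2 n u) = card (col2 n t) \<Longrightarrow> P u" for u
  proof (induction "\<Sum>(col2 n u)" arbitrary: u rule: less_induct)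
    case less
    show ?case
    proof (cases "u = base n (card (col2 n t))")
      case True
      then show ?thesis using assms(2) by simp
    next
      case False
      then obtain k where k: "1 \<le> k" "k < n" "k \<notin> col2 n u" "Suc k \<in> col2 n u" "tab_swap u k \<in> Std2 n"
        using Std2_move[OF less.prems(1)] less.prems(2) by metis
      interpret sw: swap_setup n k u "content u k - content u (Suc k)"
        by unfold_locales (use less.prems k in simp_all)
      have col: "col2 n (tab_swap u k) = swap_word k (col2 n u)" "card (swap_word k (col2 n u)) = card (col2 n u)"
        using sw.swap_Std2D[OF k(5)] by (simp_all add: sw.S_def)
      have fin: "finite (col2 n u)" by (simp add: col2_def)
      have "swap_word k (col2 n u) = insert k (col2 n u - {Suc k})"
      proof (rule set_eqI)
        fix i show "i \<in> swap_word k (col2 n u) \<longleftrightarrow> i \<in> insert k (col2 n u - {Suc k})"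
          using k by (cases "i = k \<or> i = Suc k") (auto simp: swap_word_other)
      qed
      then have "\<Sum>(swap_word k (col2 n u)) + 1 = \<Sum>(col2 n u)"
        using k fin sum.remove[OF fin k(4), of "\<lambda>x. x"] by simp
      then have "P (tab_swap u k)"
        using less.hyps[of "tab_swap u k"] k col less.prems by simp
      moreover have "k \<in> col2 n (tab_swap u k)" "Suc k \<notin> col2 n (tab_swap u k)"
        using col k by simp_all
      ultimately have "P (tab_swap (tab_swap u k) k)"
        using assms(3)[OF k(5) _ k(1,2)] col less.prems by simp
      then show ?thesis by simp
    qed
  qed
  then show ?thesis using assms(1) by blast
qed

section \<open>The action of the cell diagrams\<close>

definition comb :: "nat \<Rightarrow> (tableau \<Rightarrow> rat) \<Rightarrow> nat \<Rightarrow> nat set \<Rightarrow> rat" where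
  "comb n G c = (\<lambda>w. \<Sum>u\<in>Std2 n. G u * vt n u c w)"

definition cdiff :: "tableau \<Rightarrow> nat \<Rightarrow> rat" where
  "cdiff t k = of_int (content t k - content t (Suc k))"

lemma cdiff_swap: "cdiff (tab_swap t k) k = - cdiff t k"
  by (simp add: cdiff_def content_tab_swap)

lemma act_comb_sum:
  "finite U \<Longrightarrow> act n x (\<lambda>w. \<Sum>u\<in>U. G u * f u w) = (\<lambda>w. \<Sum>u\<in>U. G u * act n x (f u) w)"
proof (induction U rule: finite_induct)
  case (insert u U)
  have "(\<lambda>w. \<Sum>u\<in>insert u U. G u * f u w) = (\<lambda>w. G u * f u w + 1 * (\<Sum>u\<in>U. G u * f u w))"
    using insert by simp
  then show ?case using insert by (simp only: act_lin) simp
qed (simp add: act_zero_fun)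

lemma act_comb: "act n x (comb n G c) = (\<lambda>w. \<Sum>u\<in>Std2 n. G u * act n x (vt n u c) w)"
  unfolding comb_def by (rule act_comb_sum[OF finite_Std2])

text \<open>The coefficient at \<open>t\<close> also receives a contribution from the exchanged
  tableau, whose content difference is \<open>- cdiff t k\<close>; hence
  \<open>1 + 1 / cdiff t k\<close>.\<close>

definition u_coeff :: "nat \<Rightarrow> nat \<Rightarrow> (tableau \<Rightarrow> rat) \<Rightarrow> tableau \<Rightarrow> rat" where
  "u_coeff n k G t = (1 - 1 / cdiff t k) * G t -
     (if tab_swap t k \<in> Std2 n then (1 + 1 / cdiff t k) * G (tab_swap t k) else 0)"

lemma act_u_comb:
  assumes k: "1 \<le> k" "k < n"
  shows "act n (tl_u n k) (comb n G c) = comb n (u_coeff n k G) c"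
proof
  fix w
  let ?T = "{u \<in> Std2 n. tab_swap u k \<in> Std2 n}"
  have "act n (tl_u n k) (comb n G c) w =
      (\<Sum>u\<in>Std2 n. G u * ((1 - 1 / cdiff u k) * (vt n u c w - vt n (tab_swap u k) c w)))"
    unfolding act_comb by (rule sum.cong) (simp_all add: act_u_vt[OF _ k refl] cdiff_def)
  also have "\<dots> = (\<Sum>u\<in>Std2 n. (1 - 1 / cdiff u k) * G u * vt n u c w) -
      (\<Sum>u\<in>Std2 n. (1 - 1 / cdiff u k) * G u * vt n (tab_swap u k) c w)"
    unfolding sum_subtractf[symmetric] by (rule sum.cong) (simp_all add: algebra_simps)
  also have "(\<Sum>u\<in>Std2 n. (1 - 1 / cdiff u k) * G u * vt n (tab_swap u k) c w) =
      (\<Sum>u\<in>?T. (1 - 1 / cdiff u k) * G u * vt n (tab_swap u k) c w)"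
    by (rule sum.mono_neutral_right) (auto simp: finite_Std2 vt_def)
  also have "\<dots> = (\<Sum>u\<in>?T. (1 + 1 / cdiff u k) * G (tab_swap u k) * vt n u c w)"
    by (rule sum.reindex_bij_witness[of _ "\<lambda>u. tab_swap u k" "\<lambda>u. tab_swap u k"]) (auto simp: cdiff_swap)
  also have "\<dots> = (\<Sum>u\<in>Std2 n. (if tab_swap u k \<in> Std2 n then (1 + 1 / cdiff u k) * G (tab_swap u k) else 0) * vt n u c w)"
    by (rule sum.mono_neutral_cong_left) (auto simp: finite_Std2)
  finally show "act n (tl_u n k) (comb n G c) w = comb n (u_coeff n k G) c w"
    by (simp add: comb_def u_coeff_def left_diff_distrib sum_subtractf)
qed

text \<open>Dominance of \<open>s\<close> over \<open>t\<close>, read from the second columns: the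
  more of the first entries lie there, the more dominant the tableau.\<close>

definition dom :: "nat \<Rightarrow> tableau \<Rightarrow> tableau \<Rightarrow> bool" where
  "dom n s t \<longleftrightarrow> (\<forall>m. cin m (col2 n t) \<le> cin m (col2 n s))"

text \<open>The exchange lowers a single prefix count. The third part is the lifting property:
  applying \<open>u_k\<close> keeps a combination supported on tableaux that dominate the new
  one.\<close>

lemma dom_swap:
  assumes a: "a \<in> Std2 n" "tab_swap a k \<in> Std2 n" and k: "1 \<le> k" "k < n"
    and kS: "k \<in> col2 n a" "Suc k \<notin> col2 n a"
  shows "\<not> dom n (tab_swap a k) a" "dom n u a \<Longrightarrow> dom n u (tab_swap a k)"
    "u \<in> Std2 n \<Longrightarrow> tab_swap u k \<in> Std2 n \<Longrightarrow> dom n (tab_swap u k) a \<Longrightarrow> dom n u (tab_swap a k)"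
proof -
  have col: "col2 n (tab_swap u k) = swap_word k (col2 n u)" if "u \<in> Std2 n" "tab_swap u k \<in> Std2 n" for u
  proof -
    interpret sw: swap_setup n k u "content u k - content u (Suc k)"
      by unfold_locales (use that k in simp_all)
    show ?thesis using sw.swap_Std2D(2)[OF that(2)] by (simp add: sw.S_def)
  qed
  note ca = col[OF a]
  have other: "cin m (swap_word k S) = cin m S" if "m \<noteq> Suc k" for m S
    using cin_swap_word(1)[of m k S] that k by (cases "m \<le> k") auto
  have at: "cin (Suc k) (swap_word k (col2 n a)) = cin k (col2 n a)" "cin (Suc k) (col2 n a) = cin k (col2 n a) + 1"
    using cin_Suc[OF k(1)] kS other[of k] by simp_all
  have le: "cin m (col2 n (tab_swap a k)) \<le> cin m (col2 n a)" for m
    using other[of m "col2 n a"] at ca by (cases "m = Suc k") auto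
  show "\<not> dom n (tab_swap a k) a"
    unfolding dom_def ca using at by (metis Suc_eq_plus1 not_less_eq_eq order_refl)
  show "dom n u (tab_swap a k)" if "dom n u a"
    using that le unfolding dom_def by (meson le_trans)
  show "dom n u (tab_swap a k)" if u: "u \<in> Std2 n" "tab_swap u k \<in> Std2 n" and d: "dom n (tab_swap u k) a"
    unfolding dom_def
  proof
    fix m
    show "cin m (col2 n (tab_swap a k)) \<le> cin m (col2 n u)"
    proof (cases "m = Suc k")
      case True
      have "cin k (col2 n a) \<le> cin k (col2 n u)"
        using d other[of k "col2 n u"] unfolding dom_def col[OF u] by (metis n_not_Suc_n)
      then show ?thesis using True at(1) ca cin_mono[of k "Suc k" "col2 n u"] by simp
    next
      case False
      then show ?thesis using d other[of m "col2 n u"] other[of m "col2 n a"] ca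
        unfolding dom_def col[OF u] by metis
    qed
  qed
qed

lemma cdiff_ne:
  assumes "a \<in> Std2 n" "tab_swap a k \<in> Std2 n" "1 \<le> k" "k < n"
  shows "cdiff a k \<noteq> 0" "1 - 1 / cdiff a k \<noteq> 0" "1 + 1 / cdiff a k \<noteq> 0"
proof -
  interpret sw: swap_setup n k a "content a k - content a (Suc k)"
    by unfold_locales (use assms in simp_all)
  have "\<bar>content a k - content a (Suc k)\<bar> \<noteq> 1" using assms(2) sw.swap_Std2_iff by simp
  then have "content a k - content a (Suc k) \<noteq> 1" "content a k - content a (Suc k) \<noteq> -1" by linarith+
  then have "cdiff a k \<noteq> of_int 1" "cdiff a k \<noteq> of_int (-1)" unfolding cdiff_def of_int_eq_iff by blast+
  moreover have "cdiff a k \<noteq> of_int 0" unfolding cdiff_def of_int_eq_iff by (rule sw.r_bounds(3))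
  ultimately show "cdiff a k \<noteq> 0" "1 - 1 / cdiff a k \<noteq> 0" "1 + 1 / cdiff a k \<noteq> 0"
    by (auto simp: field_simps add_eq_0_iff)
qed

text \<open>Triangularity: the support stays among the tableaux dominating the upper one. The
  coefficient at the exchanged tableau comes only from that at \<open>s\<close>, with the factor
  \<open>1 - 1 / cdiff s k\<close> up to sign, which is nonzero because the exchange is
  standard.\<close>

lemma cell_left:
  assumes "s \<in> Std2 n"
  shows "\<exists>G. G s \<noteq> 0 \<and> (\<forall>u. G u \<noteq> 0 \<longrightarrow> dom n u s) \<and>
    cell_diagram n s (base n (card (col2 n s))) \<in> words n \<and>
    (\<forall>t\<in>Std2 n. card (col2 n t) = card (col2 n s) \<longrightarrow> (\<forall>c.
      act n (single (cell_diagram n s (base n (card (col2 n s))))) (vt n t c) =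
        (\<lambda>w. of_bool (t = base n (card (col2 n s))) * comb n G c w)))"
proof -
  define l where "l = card (col2 n s)"
  have l: "2 * l \<le> n" using ballot_card[OF Std2_ballot[OF assms]] by (simp add: l_def)
  let ?b = "base n l"
  have "\<exists>G. G s \<noteq> 0 \<and> (\<forall>u. G u \<noteq> 0 \<longrightarrow> dom n u s) \<and> cell_diagram n s ?b \<in> words n \<and>
    (\<forall>t\<in>Std2 n. card (col2 n t) = l \<longrightarrow> (\<forall>c. act n (single (cell_diagram n s ?b)) (vt n t c) =
        (\<lambda>w. of_bool (t = ?b) * comb n G c w)))"
    using assms
  proof (induction rule: Std2_induct)
    case base
    let ?G = "\<lambda>u. if u = ?b then 2 ^ l else 0"
    have comb: "comb n ?G c = (\<lambda>w. 2 ^ l * vt n ?b c w)" for c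
    proof
      fix w
      have "comb n ?G c w = (\<Sum>u\<in>Std2 n. if u = ?b then 2 ^ l * vt n u c w else 0)"
        unfolding comb_def by (rule sum.cong) auto
      then show "comb n ?G c w = 2 ^ l * vt n ?b c w" using finite_Std2 base_Std2[OF l] by simp
    qed
    have "act n (single (cell_diagram n ?b ?b)) (vt n t c) = (\<lambda>w. of_bool (t = ?b) * comb n ?G c w)"
      if "t \<in> Std2 n" "card (col2 n t) = l" for t c
      using act_base_diag[OF that(1) l, of c] Std2_eq_base[OF that] unfolding comb cell_base[OF l]
      by (cases "t = ?b") simp_all
    then show ?case
      unfolding l_def[symmetric] using base_diag_words(1)[OF l] cell_base[OF l]
      by (intro exI[of _ ?G]) (auto simp: dom_def)
  next
    case (swap s k)
    note k = swap(3-6)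
    obtain G where G: "G s \<noteq> 0" "\<And>u. G u \<noteq> 0 \<Longrightarrow> dom n u s" and w: "cell_diagram n s ?b \<in> words n"
      and act: "\<And>t c. t \<in> Std2 n \<Longrightarrow> card (col2 n t) = l \<Longrightarrow>
        act n (single (cell_diagram n s ?b)) (vt n t c) = (\<lambda>w. of_bool (t = ?b) * comb n G c w)"
      using swap.IH by metis
    let ?G = "\<lambda>u. if u \<in> Std2 n then u_coeff n k G u else 0"
    have cb: "card (col2 n ?b) = card (col2 n s)"
      using col2_base[OF l] card_evset swap(2) l_def by simp
    note cs = cell_swap_left[OF swap(1,7) base_Std2[OF l] cb k w]
    have "G (tab_swap s k) = 0"
      using G(2) dom_swap(1)[OF swap(1,7) k] by blast
    then have "?G (tab_swap s k) \<noteq> 0"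
      using G(1) swap(1,7) cdiff_ne(2)[OF swap(1,7) k(1,2)] by (simp add: u_coeff_def cdiff_swap)
    moreover have "dom n u (tab_swap s k)" if u: "?G u \<noteq> 0" for u
    proof -
      have "u \<in> Std2 n" "G u \<noteq> 0 \<or> (tab_swap u k \<in> Std2 n \<and> G (tab_swap u k) \<noteq> 0)"
        using u by (auto simp: u_coeff_def split: if_splits)
      then show ?thesis using dom_swap(2,3)[OF swap(1,7) k] G(2) by blast
    qed
    moreover have "act n (single (cell_diagram n (tab_swap s k) ?b)) (vt n t c) =
        (\<lambda>w. of_bool (t = ?b) * comb n ?G c w)" if "t \<in> Std2 n" "card (col2 n t) = l" for t c
    proof -
      have "comb n ?G c = comb n (u_coeff n k G) c" unfolding comb_def by (intro ext sum.cong) auto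
      then show ?thesis
        unfolding cs(2) act[OF that] act_scale act_u_comb[OF k(1,2)] by simp
    qed
    ultimately show ?case using cs(1) by (intro exI[of _ ?G]) blast
  qed
  then show ?thesis by (simp add: l_def)
qed

text \<open>On vectors of the same shape cell diagrams have rank one: the image depends on
  \<open>s\<close> and the functional on \<open>a\<close>. For the most dominant \<open>a\<close>
  this is \<open>cell_left\<close>; exchanges in \<open>a\<close> are right multiplications and
  change only the functional.\<close>

lemma cell_action:
  "\<exists>G H. (\<forall>s\<in>Std2 n. G s s \<noteq> 0 \<and> H s s \<noteq> 0) \<and>
    (\<forall>s\<in>Std2 n. \<forall>a\<in>Std2 n. card (col2 n a) = card (col2 n s) \<longrightarrow> cell_diagram n s a \<in> words n \<and>
      (\<forall>t\<in>Std2 n. card (col2 n t) = card (col2 n s) \<longrightarrow> (\<forall>c.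
        act n (single (cell_diagram n s a)) (vt n t c) = (\<lambda>w. H a t * comb n (G s) c w))))"
proof -
  from cell_left have "\<forall>s\<in>Std2 n. \<exists>G. G s \<noteq> 0 \<and>
    cell_diagram n s (base n (card (col2 n s))) \<in> words n \<and>
    (\<forall>t\<in>Std2 n. card (col2 n t) = card (col2 n s) \<longrightarrow> (\<forall>c.
      act n (single (cell_diagram n s (base n (card (col2 n s))))) (vt n t c) =
        (\<lambda>w. of_bool (t = base n (card (col2 n s))) * comb n G c w)))" by meson
  then obtain G where G: "\<And>s. s \<in> Std2 n \<Longrightarrow> G s s \<noteq> 0"
    and Gw: "\<And>s. s \<in> Std2 n \<Longrightarrow> cell_diagram n s (base n (card (col2 n s))) \<in> words n"
    and Gact: "\<And>s t c. s \<in> Std2 n \<Longrightarrow> t \<in> Std2 n \<Longrightarrow> card (col2 n t) = card (col2 n s) \<Longrightarrow>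
      act n (single (cell_diagram n s (base n (card (col2 n s))))) (vt n t c) =
        (\<lambda>w. of_bool (t = base n (card (col2 n s))) * comb n (G s) c w)"
    by metis
  have "\<forall>a\<in>Std2 n. \<exists>H. H a \<noteq> 0 \<and> (\<forall>s\<in>Std2 n. card (col2 n a) = card (col2 n s) \<longrightarrow>
      cell_diagram n s a \<in> words n \<and> (\<forall>t\<in>Std2 n. card (col2 n t) = card (col2 n s) \<longrightarrow> (\<forall>c.
        act n (single (cell_diagram n s a)) (vt n t c) = (\<lambda>w. H t * comb n (G s) c w))))"
  proof
    fix a assume a: "a \<in> Std2 n"
    define l where "l = card (col2 n a)"
    have l: "2 * l \<le> n" using ballot_card[OF Std2_ballot[OF a]] by (simp add: l_def)
    have "\<exists>H. H a \<noteq> 0 \<and> (\<forall>u. H u \<noteq> 0 \<longrightarrow> dom n u a) \<and> (\<forall>s\<in>Std2 n. card (col2 n s) = l \<longrightarrow>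
      cell_diagram n s a \<in> words n \<and> (\<forall>t\<in>Std2 n. card (col2 n t) = l \<longrightarrow> (\<forall>c.
        act n (single (cell_diagram n s a)) (vt n t c) = (\<lambda>w. H t * comb n (G s) c w))))"
      using a
    proof (induction rule: Std2_induct)
      case base
      show ?case
        unfolding l_def[symmetric]
        by (rule exI[of _ "\<lambda>t. of_bool (t = base n l)"]) (use Gw Gact in \<open>auto simp: dom_def\<close>)
    next
      case (swap a k)
      note k = swap(3-6)
      obtain H where H: "H a \<noteq> 0" "\<And>u. H u \<noteq> 0 \<Longrightarrow> dom n u a"
        and w: "\<And>s. s \<in> Std2 n \<Longrightarrow> card (col2 n s) = l \<Longrightarrow> cell_diagram n s a \<in> words n"
        and act: "\<And>s t c. s \<in> Std2 n \<Longrightarrow> card (col2 n s) = l \<Longrightarrow> t \<in> Std2 n \<Longrightarrow> card (col2 n t) = l \<Longrightarrow>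
          act n (single (cell_diagram n s a)) (vt n t c) = (\<lambda>w. H t * comb n (G s) c w)"
      proof -
      obtain H where H: "H a \<noteq> 0" "\<forall>u. H u \<noteq> 0 \<longrightarrow> dom n u a"
        "\<forall>s\<in>Std2 n. card (col2 n s) = l \<longrightarrow> cell_diagram n s a \<in> words n \<and>
          (\<forall>t\<in>Std2 n. card (col2 n t) = l \<longrightarrow> (\<forall>c.
            act n (single (cell_diagram n s a)) (vt n t c) = (\<lambda>w. H t * comb n (G s) c w)))"
        using swap.IH by (elim exE conjE) (rule that)
      show ?thesis by (rule that[of H]) (use H in blast)+
    qed
      \<comment> \<open>The old functional composed with \<open>u_k\<close>; both of its terms carry
        the factor \<open>1 - 1 / cdiff t k\<close> from \<open>act_u_vt\<close>.\<close>
      define H' where "H' t = (if t \<in> Std2 n then (1 - 1 / cdiff t k) *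
        (H t - (if tab_swap t k \<in> Std2 n then H (tab_swap t k) else 0)) else 0)" for t
      have "H (tab_swap a k) = 0" using H(2) dom_swap(1)[OF swap(1,7) k] by blast
      then have "H' (tab_swap a k) \<noteq> 0"
        using H(1) swap(1,7) cdiff_ne(3)[OF swap(1,7) k(1,2)] by (simp add: H'_def cdiff_swap)
      moreover have "dom n u (tab_swap a k)" if u: "H' u \<noteq> 0" for u
      proof -
        have "u \<in> Std2 n" "H u \<noteq> 0 \<or> (tab_swap u k \<in> Std2 n \<and> H (tab_swap u k) \<noteq> 0)"
          using u by (auto simp: H'_def split: if_splits)
        then show ?thesis using dom_swap(2,3)[OF swap(1,7) k] H(2) by blast
      qed
      moreover have "cell_diagram n s (tab_swap a k) \<in> words n \<and>
          act n (single (cell_diagram n s (tab_swap a k))) (vt n t c) = (\<lambda>w. H' t * comb n (G s) c w)"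
        if s: "s \<in> Std2 n" "card (col2 n s) = l" and t: "t \<in> Std2 n" "card (col2 n t) = l" for s t c
      proof -
        have "card (col2 n s) = card (col2 n a)" using s swap(2) l_def by simp
        note cs = cell_swap_right[OF swap(1,7) s(1) this k w[OF s]]
        have at: "act n (single (cell_diagram n s a)) (vt n (tab_swap t k) c) =
            (\<lambda>w. (if tab_swap t k \<in> Std2 n then H (tab_swap t k) else 0) * comb n (G s) c w)"
        proof (cases "tab_swap t k \<in> Std2 n")
          case True
          interpret sw: swap_setup n k t "content t k - content t (Suc k)"
            by unfold_locales (use t k in simp_all)
          have "card (col2 n (tab_swap t k)) = l" using sw.swap_Std2D[OF True] t(2) by (simp add: sw.S_def)
          then show ?thesis using act[OF s True] True by simp
        qed (simp add: vt_def act_zero_fun)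
        have "act n (tl_u n k) (vt n t c) =
            (\<lambda>w. (1 - 1 / cdiff t k) * vt n t c w + (- (1 - 1 / cdiff t k)) * vt n (tab_swap t k) c w)"
          unfolding act_u_vt[OF t(1) k(1,2) refl] cdiff_def by (simp add: fun_eq_iff algebra_simps)
        then have "act n (single (cell_diagram n s (tab_swap a k))) (vt n t c) = (\<lambda>w. H' t * comb n (G s) c w)"
          unfolding cs(2) using t(1) by (simp only: act_lin act[OF s t] at) (simp add: fun_eq_iff H'_def algebra_simps)
        then show ?thesis using cs(1) by blast
      qed
      ultimately show ?case using swap(1) by (intro exI[of _ H']) (metis)
    qed
    then show "\<exists>H. H a \<noteq> 0 \<and> (\<forall>s\<in>Std2 n. card (col2 n a) = card (col2 n s) \<longrightarrow>
      cell_diagram n s a \<in> words n \<and> (\<forall>t\<in>Std2 n. card (col2 n t) = card (col2 n s) \<longrightarrow> (\<forall>c.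
        act n (single (cell_diagram n s a)) (vt n t c) = (\<lambda>w. H t * comb n (G s) c w))))"
      unfolding l_def by (metis (no_types, lifting))
  qed
  then obtain H where H: "\<And>a. a \<in> Std2 n \<Longrightarrow> H a a \<noteq> 0"
    "\<And>a s. a \<in> Std2 n \<Longrightarrow> s \<in> Std2 n \<Longrightarrow> card (col2 n a) = card (col2 n s) \<Longrightarrow>
      cell_diagram n s a \<in> words n \<and> (\<forall>t\<in>Std2 n. card (col2 n t) = card (col2 n s) \<longrightarrow> (\<forall>c.
        act n (single (cell_diagram n s a)) (vt n t c) = (\<lambda>w. H a t * comb n (G s) c w)))"
    by metis
  show ?thesis
    by (rule exI[of _ G], rule exI[of _ H]) (use G H in blast)
qed

section \<open>The seminormal basis and the KLR elements\<close>

lemma act_uminus_left: "act n (- x) f = (\<lambda>w. - act n x f w)"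
  using act_diff_left[of n 0 x f] act_diff_left[of n 0 0 f] by (simp add: fun_eq_iff)

lemma sum_fun_apply: "sum f A w = (\<Sum>a\<in>A. f a w)"
  by (induct A rule: infinite_finite_induct) auto

definition sn_scalars :: "nat \<Rightarrow> (tableau \<Rightarrow> rat) \<Rightarrow> (tableau \<Rightarrow> rat) \<Rightarrow> bool" where
  "sn_scalars n g h \<longleftrightarrow> (\<forall>s\<in>Std2 n. g s \<noteq> 0 \<and> h s \<noteq> 0) \<and>
    (\<forall>s\<in>Std2 n. \<forall>a\<in>Std2 n. card (col2 n a) = card (col2 n s) \<longrightarrow> sn_basis n s a \<in> word_alg n \<and>
      (\<forall>t\<in>Std2 n. \<forall>c. act n (sn_basis n s a) (vt n t c) = (\<lambda>w. (if t = a then g s * h a else 0) * vt n s c w)))"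

text \<open>The outer idempotents cut the action of the cell diagram down to the diagonal
  coefficients \<open>G s s\<close> and \<open>H a a\<close>, which triangularity keeps nonzero. On
  vectors of another shape the right idempotent already gives 0.\<close>

lemma sn_scalars_exist: "\<exists>g h. sn_scalars n g h"
proof -
  obtain G H where GH: "\<And>s. s \<in> Std2 n \<Longrightarrow> G s s \<noteq> 0" "\<And>s. s \<in> Std2 n \<Longrightarrow> H s s \<noteq> (0::rat)"
    and cell: "\<And>s a. s \<in> Std2 n \<Longrightarrow> a \<in> Std2 n \<Longrightarrow> card (col2 n a) = card (col2 n s) \<Longrightarrow> cell_diagram n s a \<in> words n"
      "\<And>s a t c. s \<in> Std2 n \<Longrightarrow> a \<in> Std2 n \<Longrightarrow> card (col2 n a) = card (col2 n s) \<Longrightarrow> t \<in> Std2 n \<Longrightarrow>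
        card (col2 n t) = card (col2 n s) \<Longrightarrow>
        act n (single (cell_diagram n s a)) (vt n t c) = (\<lambda>w. H a t * comb n (G s) c w)"
    using cell_action[of n] by blast
  have "sn_scalars n (\<lambda>s. G s s) (\<lambda>s. H s s)"
    unfolding sn_scalars_def
  proof (intro conjI ballI impI allI)
    fix s a assume s: "s \<in> Std2 n" and a: "a \<in> Std2 n" and c: "card (col2 n a) = card (col2 n s)"
    have w: "Poly_Mapping.single (cell_diagram n s a) 1 \<in> word_alg n"
      using cell(1)[OF s a c] by (rule word_alg_single)
    note sn = sn_basis_def[of n s a]
    show "sn_basis n s a \<in> word_alg n" unfolding sn by (intro word_alg_mult idem_word w)
    fix t b assume t: "t \<in> Std2 n"
    have act: "act n (sn_basis n s a) f = act n (idem n s) (act n (single (cell_diagram n s a)) (act n (idem n a) f))" for f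
      unfolding sn single_def by (simp add: act_mult word_alg_mult idem_word w)
    show "act n (sn_basis n s a) (vt n t b) = (\<lambda>w. (if t = a then G s s * H a a else 0) * vt n s b w)"
    proof (cases "t = a")
      case True
      have "act n (idem n s) (comb n (G s) b) = (\<lambda>w. G s s * vt n s b w)"
      proof
        fix w
        have "act n (idem n s) (comb n (G s) b) w = (\<Sum>u\<in>Std2 n. if u = s then G s s * vt n s b w else 0)"
          unfolding act_comb by (rule sum.cong) (auto simp: act_idem s)
        then show "act n (idem n s) (comb n (G s) b) w = G s s * vt n s b w"
          using s finite_Std2 by simp
      qed
      then have "act n (idem n s) (\<lambda>w. H a a * comb n (G s) b w) = (\<lambda>w. H a a * (G s s * vt n s b w))"
        by (simp only: act_scale)
      then show ?thesis
        unfolding act True using act_idem[OF a a] cell(2)[OF s a c a c] by (simp add: mult_ac)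
    next
      case False
      then show ?thesis unfolding act using act_idem[OF t a] by (simp add: act_zero_fun)
    qed
  qed (use GH in auto)
  then show ?thesis by blast
qed

definition sn_g :: "nat \<Rightarrow> tableau \<Rightarrow> rat" where
  "sn_g n = (SOME g. \<exists>h. sn_scalars n g h)"

definition sn_h :: "nat \<Rightarrow> tableau \<Rightarrow> rat" where
  "sn_h n = (SOME h. sn_scalars n (sn_g n) h)"

lemma sn_scalars: "sn_scalars n (sn_g n) (sn_h n)"
proof -
  have "\<exists>h. sn_scalars n (sn_g n) h"
    unfolding sn_g_def using someI_ex[OF sn_scalars_exist[of n]] .
  then show ?thesis unfolding sn_h_def by (rule someI_ex[of "\<lambda>h. sn_scalars n (sn_g n) h"])
qed

lemma sn_nonzero: "s \<in> Std2 n \<Longrightarrow> sn_g n s \<noteq> 0" "s \<in> Std2 n \<Longrightarrow> sn_h n s \<noteq> 0"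
  using sn_scalars[of n] by (auto simp: sn_scalars_def)

lemma sn_basis_word:
  assumes "s \<in> Std2 n" "a \<in> Std2 n" "card (col2 n a) = card (col2 n s)"
  shows "sn_basis n s a \<in> word_alg n"
    "t \<in> Std2 n \<Longrightarrow> act n (sn_basis n s a) (vt n t c) =
      (\<lambda>w. (if t = a then sn_g n s * sn_h n a else 0) * vt n s c w)"
  using sn_scalars[of n] assms unfolding sn_scalars_def by blast+

text \<open>With this scaling \<open>sn_basis n s a\<close> takes \<open>vt n a\<close> to
  \<open>sn_h n a\<close> times \<open>vts n s\<close>, a factor independent of \<open>s\<close>.
  The prescribed left multiplication on the seminormal basis therefore becomes literally an action
  on the vectors \<open>vts\<close>.\<close>

definition vts :: "nat \<Rightarrow> tableau \<Rightarrow> nat \<Rightarrow> nat set \<Rightarrow> rat" where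
  "vts n t c = (\<lambda>w. sn_g n t * vt n t c w)"

lemma vts_nonstd: "t \<notin> Std2 n \<Longrightarrow> vts n t c = (\<lambda>w. 0)"
  by (simp add: vts_def vt_def)

lemma card_swap_Std2:
  assumes "s \<in> Std2 n" "tab_swap s k \<in> Std2 n" "1 \<le> k" "k < n"
  shows "card (col2 n (tab_swap s k)) = card (col2 n s)"
proof -
  interpret sw: swap_setup n k s "content s k - content s (Suc k)"
    by unfold_locales (use assms in simp_all)
  show ?thesis using sw.swap_Std2D[OF assms(2)] by (simp add: sw.S_def)
qed

text \<open>\<open>sn_basis n t s\<close> divided by \<open>sn_g n s * sn_h n s\<close> takes
  \<open>vts n s\<close> to \<open>vts n t\<close> and kills the vectors of other tableaux; the sum
  is the prescribed action written in these matrix units.\<close>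

definition psi_elem :: "nat \<Rightarrow> nat \<Rightarrow> nat \<Rightarrow> tl" where
  "psi_elem p n k = (\<Sum>s\<in>Std2 n.
     (if tab_swap s k \<in> Std2 n then (beta p (content s k - content s (Suc k)) / (sn_g n s * sn_h n s)) \<odot> sn_basis n (tab_swap s k) s else 0)
     - (delta p (content s k - content s (Suc k)) / (sn_g n s * sn_h n s)) \<odot> sn_basis n s s)"

lemma psi_elem_word: "1 \<le> k \<Longrightarrow> k < n \<Longrightarrow> psi_elem p n k \<in> word_alg n"
  unfolding psi_elem_def
  by (intro word_alg_sum word_alg_diff) (auto intro!: word_alg_scale sn_basis_word(1) simp: card_swap_Std2)

lemma act_psi_elem:
  assumes k: "1 \<le> k" "k < n" and s: "s \<in> Std2 n"
  shows "act n (psi_elem p n k) (vts n s c) = (\<lambda>w. beta p (content s k - content s (Suc k)) * vts n (tab_swap s k) c w -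
    delta p (content s k - content s (Suc k)) * vts n s c w)"
proof
  fix w
  let ?r = "content s k - content s (Suc k)" and ?gh = "sn_g n s * sn_h n s"
  define F where "F u = (if tab_swap u k \<in> Std2 n then (beta p (content u k - content u (Suc k)) / (sn_g n u * sn_h n u)) \<odot> sn_basis n (tab_swap u k) u else 0)
     - (delta p (content u k - content u (Suc k)) / (sn_g n u * sn_h n u)) \<odot> sn_basis n u u" for u
  have gh: "?gh \<noteq> 0" using sn_nonzero[OF s] by simp
  have F: "act n (F u) (vt n s c) w = (if u = s then
      (beta p ?r * sn_g n (tab_swap s k) * sn_h n s / ?gh) * vt n (tab_swap s k) c w - delta p ?r * vt n s c w else 0)"
    if u: "u \<in> Std2 n" for u
  proof (cases "tab_swap u k \<in> Std2 n")
    case True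
    note cu = card_swap_Std2[OF u True k]
    show ?thesis
      using sn_basis_word(2)[OF True u cu[symmetric] s, of c] sn_basis_word(2)[OF u u refl s, of c] gh
      by (auto simp: F_def True act_diff_left act_scale_left)
  next
    case False
    show ?thesis
      using sn_basis_word(2)[OF u u refl s, of c] gh False
      by (auto simp: F_def act_diff_left act_uminus_left act_scale_left vt_def)
  qed
  have "psi_elem p n k = (\<Sum>u\<in>Std2 n. F u)" by (simp add: psi_elem_def F_def)
  then have "act n (psi_elem p n k) (vt n s c) w = (\<Sum>u\<in>Std2 n. act n (F u) (vt n s c) w)"
    by (simp only: act_sum_left sum_fun_apply)
  also have "\<dots> = (\<Sum>u\<in>Std2 n. if u = s then
      (beta p ?r * sn_g n (tab_swap s k) * sn_h n s / ?gh) * vt n (tab_swap s k) c w - delta p ?r * vt n s c w else 0)"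
    by (rule sum.cong) (simp_all only: F)
  also have "\<dots> = (beta p ?r * sn_g n (tab_swap s k) * sn_h n s / ?gh) * vt n (tab_swap s k) c w - delta p ?r * vt n s c w"
    using s finite_Std2 by simp
  finally have "act n (psi_elem p n k) (vts n s c) w = sn_g n s *
      ((beta p ?r * sn_g n (tab_swap s k) * sn_h n s / ?gh) * vt n (tab_swap s k) c w - delta p ?r * vt n s c w)"
    by (simp only: vts_def act_scale)
  also have "\<dots> = beta p ?r * vts n (tab_swap s k) c w - delta p ?r * vts n s c w"
    using sn_nonzero[OF s] by (simp add: vts_def field_simps)
  finally show "act n (psi_elem p n k) (vts n s c) w = beta p ?r * vts n (tab_swap s k) c w - delta p ?r * vts n s c w" .
qed

lemma is_psi_elem:
  assumes k: "1 \<le> k" "k < n"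
  shows "is_psi p n k (psi_elem p n k)"
  unfolding is_psi_def
proof (intro conjI ballI)
  show "psi_elem p n k \<in> TL n" by (rule word_alg_TL[OF psi_elem_word[OF k]])
  fix \<nu> s a assume nu: "\<nu> \<in> Par2 n" and s: "s \<in> Std n \<nu>" and a: "a \<in> Std n \<nu>"
  have s2: "s \<in> Std2 n" and a2: "a \<in> Std2 n" and card: "card (col2 n a) = card (col2 n s)"
    using nu s a Std_iff[OF nu s] by (auto simp: Std2_def)
  have std: "tab_swap s k \<in> Std n \<nu> \<longleftrightarrow> tab_swap s k \<in> Std2 n"
    using Std_iff[OF nu s] card_swap_Std2[OF s2 _ k] by blast
  let ?r = "content s k - content s (Suc k)"
  let ?R = "(if tab_swap s k \<in> Std2 n then beta p ?r \<odot> sn_basis n (tab_swap s k) a else 0) - delta p ?r \<odot> sn_basis n s a"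
  have sw: "sn_basis n s a \<in> word_alg n" by (rule sn_basis_word(1)[OF s2 a2 card])
  have ca: "card (col2 n a) = card (col2 n (tab_swap s k))" if "tab_swap s k \<in> Std2 n"
    using card card_swap_Std2[OF s2 that k] by simp
  have tw: "sn_basis n (tab_swap s k) a \<in> word_alg n" if "tab_swap s k \<in> Std2 n"
    by (rule sn_basis_word(1)[OF that a2 ca[OF that]])
  have pw: "psi_elem p n k \<in> word_alg n" by (rule psi_elem_word[OF k])
  have "psi_elem p n k \<cdot> sn_basis n s a = ?R"
  proof (rule act_vt_eqI)
    show "psi_elem p n k \<cdot> sn_basis n s a \<in> TL n"
      by (intro word_alg_TL word_alg_mult pw sw)
    show "?R \<in> TL n"
      using tw sw by (intro word_alg_TL word_alg_diff) (auto intro: word_alg_scale)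
    fix t b assume t: "t \<in> Std2 n"
    let ?c = "if t = a then sn_h n a else 0"
    have e: "act n (sn_basis n s a) (vt n t b) = (\<lambda>w. ?c * vts n s b w)"
      using sn_basis_word(2)[OF s2 a2 card t, of b] by (simp add: vts_def mult_ac)
    have "act n (psi_elem p n k \<cdot> sn_basis n s a) (vt n t b) = (\<lambda>w. ?c * (beta p ?r * vts n (tab_swap s k) b w - delta p ?r * vts n s b w))"
      unfolding act_mult[OF pw sw] e act_scale act_psi_elem[OF k s2] ..
    also have "\<dots> = act n ?R (vt n t b)"
    proof (cases "tab_swap s k \<in> Std2 n")
      case True
      have "act n (sn_basis n (tab_swap s k) a) (vt n t b) = (\<lambda>w. ?c * vts n (tab_swap s k) b w)"
        using sn_basis_word(2)[OF True a2 ca[OF True] t, of b] by (simp add: vts_def mult_ac)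
      then show ?thesis using True e by (simp add: act_diff_left act_scale_left fun_eq_iff algebra_simps)
    next
      case False
      then show ?thesis using e vts_nonstd[OF False, of b] by (simp add: act_diff_left act_uminus_left act_scale_left fun_eq_iff algebra_simps)
    qed
    finally show "act n (psi_elem p n k \<cdot> sn_basis n s a) (vt n t b) = act n ?R (vt n t b)" .
  qed
  then show "psi_elem p n k \<cdot> sn_basis n s a =
      (if tab_swap s k \<in> Std n \<nu> then klr_beta p n k s \<odot> sn_basis n (tab_swap s k) a else 0)
      - (klr_delta p k s / of_int (content s k - content s (k + 1))) \<odot> sn_basis n s a"
    unfolding std klr_delta_eq klr_beta_eq[OF s2 k] .
qed

lemma tl_mult_scale_right: "x \<cdot> (c \<odot> y) = c \<odot> (x \<cdot> y)"
proof -
  let ?A = "Poly_Mapping.keys x" and ?B = "Poly_Mapping.keys y"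
  have "x \<cdot> (c \<odot> y) = (\<Sum>D1\<in>?A. \<Sum>D2\<in>?B. Poly_Mapping.single (diag_comp D1 D2)
        (Poly_Mapping.lookup x D1 * Poly_Mapping.lookup (c \<odot> y) D2 * 2 ^ loops D1 D2))"
    by (rule tl_mult_superset) (auto intro: keys_tl_scale[THEN subsetD])
  also have "\<dots> = c \<odot> (x \<cdot> y)"
    unfolding tl_mult_def
    by (rule poly_mapping_eqI) (auto simp: lookup_sum lookup_single when_def sum_distrib_left mult_ac intro!: sum.cong)
  finally show ?thesis .
qed

text \<open>\<open>sn_basis n s s\<close> is a nonzero multiple of \<open>idem n s\<close>, and
  these idempotents add up to 1. So left multiplication on the seminormal basis determines the
  element, as the definite description \<open>psi\<close> requires.\<close>

lemma is_psi_unique: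
  assumes x: "is_psi p n k x" and y: "is_psi p n k y"
  shows "x = y"
proof -
  have eq: "x \<cdot> idem n s = y \<cdot> idem n s" if s: "s \<in> Std2 n" for s
  proof -
    obtain \<nu> where nu: "\<nu> \<in> Par2 n" "s \<in> Std n \<nu>" using s by (auto simp: Std2_def)
    have "x \<cdot> sn_basis n s s = y \<cdot> sn_basis n s s"
      using x y nu unfolding is_psi_def by metis
    moreover have "sn_basis n s s = (sn_g n s * sn_h n s) \<odot> idem n s"
    proof (rule act_vt_eqI)
      show "sn_basis n s s \<in> TL n" "(sn_g n s * sn_h n s) \<odot> idem n s \<in> TL n"
        using sn_basis_word(1)[OF s s refl] by (auto intro: word_alg_TL word_alg_scale idem_word)
      show "act n (sn_basis n s s) (vt n t c) = act n ((sn_g n s * sn_h n s) \<odot> idem n s) (vt n t c)"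
        if t: "t \<in> Std2 n" for t c
        using sn_basis_word(2)[OF s s refl t, of c] act_idem[OF t s, of c] by (simp add: act_scale_left fun_eq_iff)
    qed
    ultimately have "(sn_g n s * sn_h n s) \<odot> (x \<cdot> idem n s) = (sn_g n s * sn_h n s) \<odot> (y \<cdot> idem n s)"
      by (simp only: tl_mult_scale_right)
    then have *: "Poly_Mapping.lookup ((sn_g n s * sn_h n s) \<odot> (x \<cdot> idem n s)) D =
        Poly_Mapping.lookup ((sn_g n s * sn_h n s) \<odot> (y \<cdot> idem n s)) D" for D by simp
    show ?thesis
      by (rule poly_mapping_eqI) (use * sn_nonzero[OF s] in simp)
  qed
  have "z = (\<Sum>s\<in>Std2 n. z \<cdot> idem n s)" if "z \<in> TL n" for z
    using tl_mult_one_right[OF that] by (simp flip: idem_sum add: tl_mult_sum_right)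
  then have "x = (\<Sum>s\<in>Std2 n. x \<cdot> idem n s)" "y = (\<Sum>s\<in>Std2 n. y \<cdot> idem n s)"
    using x y by (auto simp: is_psi_def)
  then show ?thesis using eq by simp
qed

lemma psi_eq:
  assumes "1 \<le> k" "k < n" shows "psi p n k = psi_elem p n k"
  unfolding psi_def using is_psi_elem[OF assms] is_psi_unique by blast

lemma psi_word: "1 \<le> k \<Longrightarrow> k < n \<Longrightarrow> psi p n k \<in> word_alg n"
  by (simp add: psi_eq psi_elem_word)

lemma act_psi:
  assumes "1 \<le> k" "k < n" "s \<in> Std2 n"
  shows "act n (psi p n k) (vts n s c) = (\<lambda>w. beta p (content s k - content s (Suc k)) * vts n (tab_swap s k) c w -
    delta p (content s k - content s (Suc k)) * vts n s c w)"
  unfolding psi_eq[OF assms(1,2)] by (rule act_psi_elem[OF assms])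

section \<open>Products of distant KLR elements\<close>

text \<open>For sparse \<open>X\<close> this is the product of the disjoint transpositions
  \<open>(k, k + 1)\<close> with \<open>k\<close> in \<open>X\<close>.\<close>

definition swp :: "nat set \<Rightarrow> nat \<Rightarrow> nat" where
  "swp X i = (if i \<in> X then Suc i else if 1 \<le> i \<and> i - 1 \<in> X then i - 1 else i)"

definition sparse :: "nat set \<Rightarrow> bool" where
  "sparse X \<longleftrightarrow> (\<forall>i\<in>X. Suc i \<notin> X)"

lemma sparse_subset: "sparse X \<Longrightarrow> Y \<subseteq> X \<Longrightarrow> sparse Y"
  by (auto simp: sparse_def)

lemma swp_empty [simp]: "swp {} = id"
  by (auto simp: swp_def fun_eq_iff)

lemma swp_insert:
  assumes "sparse (insert k X)" "k \<notin> X"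
  shows "tab_swap (s \<circ> swp X) k = s \<circ> swp (insert k X)"
    "swp X k = k" "swp X (Suc k) = Suc k"
proof -
  have k: "Suc k \<notin> X" "\<And>i. i \<in> X \<Longrightarrow> Suc i \<noteq> k" using assms by (auto simp: sparse_def)
  show a: "swp X k = k" "swp X (Suc k) = Suc k"
    using k assms(2) by (cases k; auto simp: swp_def)+
  show "tab_swap (s \<circ> swp X) k = s \<circ> swp (insert k X)"
  proof
    fix i
    consider "i = k" | "i = Suc k" | "i \<noteq> k" "i \<noteq> Suc k" by blast
    then show "tab_swap (s \<circ> swp X) k i = (s \<circ> swp (insert k X)) i"
    proof cases
      case 1
      then show ?thesis using a by (simp add: swp_def)
    next
      case 2
      then show ?thesis using a k by (simp add: swp_def)
    next
      case 3
      then show ?thesis by (auto simp: tab_swap_other swp_def)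
    qed
  qed
qed

lemma content_comp: "content (s \<circ> f) i = content s (f i)"
  by (simp add: content_def)

lemma swp_Std2:
  assumes "finite X" "sparse X" "s \<in> Std2 n"
    and "\<And>k. k \<in> X \<Longrightarrow> 1 \<le> k \<and> k < n \<and> \<bar>content s k - content s (Suc k)\<bar> \<noteq> 1"
  shows "s \<circ> swp X \<in> Std2 n"
  using assms
proof (induction X rule: finite_induct)
  case (insert k X)
  have IH: "s \<circ> swp X \<in> Std2 n"
    by (rule insert.IH) (use insert.prems sparse_subset[OF insert.prems(1), of X] in auto)
  note sw = swp_insert[OF insert.prems(1) insert.hyps(2)]
  interpret sw: swap_setup n k "s \<circ> swp X" "content s k - content s (Suc k)"
    by unfold_locales (use IH insert.prems sw(2,3) in \<open>simp_all add: content_comp\<close>)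
  have "tab_swap (s \<circ> swp X) k \<in> Std2 n"
    using sw.swap_Std2_iff insert.prems(3)[of k] by simp
  then show ?case unfolding sw(1) .
qed simp

lemma sum_Pow_insert:
  assumes "finite K" "k \<notin> K"
  shows "(\<Sum>X\<in>Pow (insert k K). F X) = (\<Sum>X\<in>Pow K. F X + F (insert k X))"
proof -
  have "inj_on (insert k) (Pow K)" using assms(2) by (auto simp: inj_on_def)
  moreover have "Pow K \<inter> insert k ` Pow K = {}" using assms(2) by auto
  ultimately show ?thesis
    using assms(1) by (simp add: Pow_insert sum.union_disjoint sum.reindex sum.distrib)
qed

text \<open>Sparse positions do not touch each other's entries. So every factor sees the contents of
  the original \<open>s\<close>, and either exchanges, with coefficient \<open>\<beta>\<close>, or
  keeps, with \<open>- \<delta>\<close>.\<close>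

lemma act_psi_prod:
  assumes s: "s \<in> Std2 n" and "distinct ks" "sparse (set ks)" "\<And>k. k \<in> set ks \<Longrightarrow> 1 \<le> k \<and> k < n"
  shows "act n (tl_prod n (map (psi p n) ks)) (vts n s c) = (\<lambda>w. \<Sum>X\<in>Pow (set ks).
    ((\<Prod>k\<in>X. beta p (content s k - content s (Suc k))) *
     (\<Prod>k\<in>set ks - X. - delta p (content s k - content s (Suc k)))) * vts n (s \<circ> swp X) c w)"
  using assms(2-)
proof (induction ks)
  case Nil
  have "act n (tl_one n) (vts n s c) = vts n s c"
    by (rule act_one) (simp add: vts_def vt_outside)
  then show ?case by (simp add: tl_prod_def)
next
  case (Cons k ks)
  define b where "b k = beta p (content s k - content s (Suc k))" for k
  define d where "d k = - delta p (content s k - content s (Suc k))" for k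
  let ?K = "set ks"
  have k: "1 \<le> k" "k < n" "k \<notin> ?K" using Cons.prems by auto
  have sp: "sparse ?K" using Cons.prems(2) by (rule sparse_subset) auto
  have w1: "psi p n k \<in> word_alg n" "tl_prod n (map (psi p n) ks) \<in> word_alg n"
    using k Cons.prems by (auto intro!: word_alg_prod psi_word)
  have IH: "act n (tl_prod n (map (psi p n) ks)) (vts n s c) =
      (\<lambda>w. \<Sum>X\<in>Pow ?K. ((\<Prod>k\<in>X. b k) * (\<Prod>k\<in>?K - X. d k)) * vts n (s \<circ> swp X) c w)"
    unfolding b_def d_def by (rule Cons.IH) (use Cons.prems sp in auto)
  have step: "((\<Prod>k\<in>X. b k) * (\<Prod>k\<in>?K - X. d k)) * act n (psi p n k) (vts n (s \<circ> swp X) c) w =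
      ((\<Prod>j\<in>X. b j) * (\<Prod>j\<in>insert k ?K - X. d j)) * vts n (s \<circ> swp X) c w +
      ((\<Prod>j\<in>insert k X. b j) * (\<Prod>j\<in>insert k ?K - insert k X. d j)) * vts n (s \<circ> swp (insert k X)) c w"
    if X: "X \<in> Pow ?K" for X w
  proof -
    have fin: "finite X" using X by (auto intro: finite_subset)
    have kX: "k \<notin> X" using X k by auto
    have spX: "sparse (insert k X)" using Cons.prems(2) by (rule sparse_subset) (use X in auto)
    note sw = swp_insert[OF spX kX]
    have p1: "(\<Prod>j\<in>insert k X. b j) = b k * (\<Prod>j\<in>X. b j)" using fin kX by simp
    have "insert k ?K - X = insert k (?K - X)" using kX by auto
    then have p2: "(\<Prod>j\<in>insert k ?K - X. d j) = d k * (\<Prod>j\<in>?K - X. d j)" using k(3) by simp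
    have p3: "insert k ?K - insert k X = ?K - X" using k(3) by auto
    show ?thesis
    proof (cases "\<forall>j\<in>X. \<bar>content s j - content s (Suc j)\<bar> \<noteq> 1")
      case True
      have "s \<circ> swp X \<in> Std2 n"
        by (rule swp_Std2[OF fin _ s]) (use True X Cons.prems sparse_subset[OF spX] in auto)
      then have "act n (psi p n k) (vts n (s \<circ> swp X) c) =
          (\<lambda>w. b k * vts n (s \<circ> swp (insert k X)) c w + d k * vts n (s \<circ> swp X) c w)"
        using act_psi[OF k(1,2)] sw unfolding b_def d_def by (simp add: content_comp)
      then show ?thesis unfolding p1 p2 p3 by (simp add: algebra_simps)
    next
      \<comment> \<open>The intermediate tableau may fail to be standard. Then some exchange in
        \<open>X\<close> has content difference 1 or -1, its \<open>\<beta>\<close> is 0, and both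
        sides vanish.\<close>
      case False
      then obtain j where "j \<in> X" "\<bar>content s j - content s (Suc j)\<bar> = 1" by blast
      then have "b j = 0" by (simp add: b_def beta_def)
      then have "(\<Prod>j\<in>X. b j) = 0" using fin \<open>j \<in> X\<close> by (auto intro: prod_zero)
      then show ?thesis unfolding p1 by simp
    qed
  qed
  have "act n (tl_prod n (map (psi p n) (k # ks))) (vts n s c) =
      act n (psi p n k) (act n (tl_prod n (map (psi p n) ks)) (vts n s c))"
    using act_mult[OF w1] by (simp add: tl_prod_def)
  also have "\<dots> = (\<lambda>w. \<Sum>X\<in>Pow ?K. ((\<Prod>k\<in>X. b k) * (\<Prod>k\<in>?K - X. d k)) * act n (psi p n k) (vts n (s \<circ> swp X) c) w)"
    unfolding IH by (rule act_comb_sum) simp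
  also have "\<dots> = (\<lambda>w. \<Sum>X\<in>Pow (insert k ?K). ((\<Prod>k\<in>X. b k) * (\<Prod>k\<in>insert k ?K - X. d k)) * vts n (s \<circ> swp X) c w)"
    unfolding sum_Pow_insert[OF finite_set k(3)] by (intro ext sum.cong refl) (rule step)
  finally show ?case by (simp only: list.set b_def d_def)
qed

lemma act_psi_prod_free:
  assumes s: "s \<in> Std2 n" and ks: "distinct ks" "sparse (set ks)" "\<And>k. k \<in> set ks \<Longrightarrow> 1 \<le> k \<and> k < n"
    and d: "\<And>k. k \<in> set ks \<Longrightarrow> delta p (content s k - content s (Suc k)) = 0"
  shows "act n (tl_prod n (map (psi p n) ks)) (vts n s c) =
    (\<lambda>w. (\<Prod>k\<in>set ks. beta p (content s k - content s (Suc k))) * vts n (s \<circ> swp (set ks)) c w)"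
proof
  fix w
  let ?K = "set ks"
  let ?F = "\<lambda>X. ((\<Prod>k\<in>X. beta p (content s k - content s (Suc k))) *
     (\<Prod>k\<in>?K - X. - delta p (content s k - content s (Suc k)))) * vts n (s \<circ> swp X) c w"
  have "(\<Sum>X\<in>Pow ?K. ?F X) = (\<Sum>X\<in>{?K}. ?F X)"
  proof (rule sum.mono_neutral_right)
    show "\<forall>X\<in>Pow ?K - {?K}. ?F X = 0"
    proof
      fix X assume X: "X \<in> Pow ?K - {?K}"
      then obtain k where "k \<in> ?K - X" by auto
      then have "(\<Prod>k\<in>?K - X. - delta p (content s k - content s (Suc k))) = 0"
        using d by (intro prod_zero) auto
      then show "?F X = 0" by simp
    qed
  qed auto
  also have "(\<Sum>X\<in>{?K}. ?F X) = (\<Prod>k\<in>?K. beta p (content s k - content s (Suc k))) * vts n (s \<circ> swp ?K) c w"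
    by (simp only: sum.insert finite.emptyI empty_iff not_False_eq_True sum.empty Diff_cancel prod.empty mult_1_right add_0_right)
  finally show "act n (tl_prod n (map (psi p n) ks)) (vts n s c) w =
      (\<Prod>k\<in>?K. beta p (content s k - content s (Suc k))) * vts n (s \<circ> swp ?K) c w"
    by (subst act_psi_prod[OF s ks(1,2)]) (use ks(3) in simp_all)
qed

section \<open>Products of the coefficients\<close>

text \<open>The normalisation \<open>(r^2 - 1) / r^2\<close> enters exactly once, whatever the sign
  of \<open>r\<close>, and the other factors cancel against it according to the residue of
  \<open>r\<close>. For \<open>p >= 3\<close> the residues 0, 1 and -1 are distinct.\<close>

lemma beta_pair:
  assumes p: "3 \<le> p" and r: "\<bar>r\<bar> \<noteq> 1" "r \<noteq> 0"
  shows "beta p r * beta p (- r) = (if int p dvd r then - 1 / (of_int r)\<^sup>2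
    else if int p dvd r - 1 then 1 - of_int r else if int p dvd r + 1 then of_int r + 1 else 1)"
proof -
  define x :: rat where "x = of_int r"
  have "x \<noteq> of_int 0" "x \<noteq> of_int 1" "x \<noteq> of_int (-1)"
    unfolding x_def of_int_eq_iff using r by auto
  then have x: "x \<noteq> 0" "1 - x \<noteq> 0" "1 + x \<noteq> 0" by (auto simp: add_eq_0_iff)
  have cong: "[r = 0] (mod int p) \<longleftrightarrow> int p dvd r" "[r = 1] (mod int p) \<longleftrightarrow> int p dvd r - 1"
    "[- r = 0] (mod int p) \<longleftrightarrow> int p dvd r" "[- r = 1] (mod int p) \<longleftrightarrow> int p dvd r + 1"
    using dvd_minus_iff[of "int p" "r + 1"] by (simp_all add: cong_iff_dvd_diff)
  have not1: "\<not> int p dvd 1" "\<not> int p dvd 2" using p zdvd_imp_le[of "int p" 1] zdvd_imp_le[of "int p" 2] by auto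
  have e1: "\<not> int p dvd r - 1 \<and> \<not> int p dvd r + 1" if "int p dvd r"
    using that not1(1) dvd_add_right_iff[of "int p" r 1] dvd_diff_right_iff[of "int p" r 1] by auto
  have e2: "\<not> int p dvd r + 1" if "int p dvd r - 1"
    using dvd_diff[of "int p" "r + 1" "r - 1"] that not1(2) by auto
  define g where "g = (x\<^sup>2 - 1) / x\<^sup>2"
  define b1 where "b1 y D0 D1 = (if D0 then 1 / (1 - y) else if D1 then y else y / (1 - y))"
    for y :: rat and D0 D1
  have b: "beta p r = (if 0 < r then 1 else g) * b1 x (int p dvd r) (int p dvd r - 1)"
    "beta p (- r) = (if 0 < r then g else 1) * b1 (- x) (int p dvd r) (int p dvd r + 1)"
    using r by (auto simp: beta_def b1_def g_def cong x_def)
  have prod: "beta p r * beta p (- r) = g * (b1 x (int p dvd r) (int p dvd r - 1) * b1 (- x) (int p dvd r) (int p dvd r + 1))"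
    unfolding b by simp
  have g: "g = - ((1 - x) * (1 + x)) / x\<^sup>2" by (simp add: g_def algebra_simps power2_eq_square)
  show ?thesis
  proof (cases "int p dvd r")
    case True
    have "- (u * v) / z * (1 / u * (1 / v)) = - 1 / z" if "u \<noteq> 0" "v \<noteq> 0" for u v z :: rat
      using that by simp
    from this[OF x(2,3), of "x\<^sup>2"] show ?thesis
      unfolding prod g using True by (simp add: b1_def x_def)
  next
    case n0: False
    show ?thesis
    proof (cases "int p dvd r - 1")
      case True
      then show ?thesis
        unfolding b using x n0 e2[OF True] by (simp add: b1_def g x_def[symmetric] divide_simps power2_eq_square)
    next
      case n1: False
      then show ?thesis
        unfolding b using x n0 by (simp add: b1_def g x_def[symmetric] divide_simps power2_eq_square)
    qed
  qed
qed

text \<open>The content difference of the pairs exchanged in \<open>\<Psi>_j\<close> when the two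
  blocks differ by \<open>\<rho>\<close> in the small tableau. It is \<open>j\<close> modulo
  \<open>p\<close>.\<close>

definition rdiff :: "nat \<Rightarrow> int \<Rightarrow> nat \<Rightarrow> int" where
  "rdiff p \<rho> j = int p * (\<rho> - 1) + int j"

lemma rdiff_dvd:
  assumes p: "3 \<le> p" and j: "1 \<le> j" "j < p"
  shows "\<not> int p dvd rdiff p \<rho> j" "int p dvd rdiff p \<rho> j - 1 \<longleftrightarrow> j = 1" "int p dvd rdiff p \<rho> j + 1 \<longleftrightarrow> j = p - 1"
proof -
  have *: "int p dvd rdiff p \<rho> j + a \<longleftrightarrow> int p dvd int j + a" for a
    unfolding rdiff_def using dvd_add_right_iff[of "int p" "int p * (\<rho> - 1)" "int j + a"] by (simp add: add.assoc)
  show "\<not> int p dvd rdiff p \<rho> j"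
    using *[of 0] j by (auto dest!: zdvd_imp_le)
  show "int p dvd rdiff p \<rho> j - 1 \<longleftrightarrow> j = 1"
    using *[of "-1"] j by (auto dest!: zdvd_imp_le)
  show "int p dvd rdiff p \<rho> j + 1 \<longleftrightarrow> j = p - 1"
    using *[of 1] j by (auto dest!: zdvd_imp_le)
qed

lemma rdiff_unit:
  assumes p: "3 \<le> p" and j: "1 \<le> j" "j < p" and rho: "\<rho> \<noteq> 0" "\<rho> \<noteq> 1"
  shows "\<bar>rdiff p \<rho> j\<bar> \<noteq> 1" "rdiff p \<rho> j \<noteq> 0"
proof -
  have "rdiff p \<rho> j \<noteq> 1"
  proof
    assume a: "rdiff p \<rho> j = 1"
    then have "j = 1" using rdiff_dvd(2)[OF p j, of \<rho>] by simp
    then show False using a p rho by (simp add: rdiff_def)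
  qed
  moreover have "rdiff p \<rho> j \<noteq> -1"
  proof
    assume a: "rdiff p \<rho> j = -1"
    then have "j = p - 1" using rdiff_dvd(3)[OF p j, of \<rho>] by simp
    then have "int p * \<rho> = 0" using a p by (simp add: rdiff_def of_nat_diff algebra_simps)
    then show False using p rho by simp
  qed
  ultimately show "\<bar>rdiff p \<rho> j\<bar> \<noteq> 1" by linarith
  show "rdiff p \<rho> j \<noteq> 0" using rdiff_dvd(1)[OF p j, of \<rho>] by auto
qed

text \<open>\<open>\<Psi>_j\<close> has \<open>j\<close> factors and is passed on the way up and on
  the way down. By \<open>beta_pair\<close> only \<open>j = 1\<close>, where
  \<open>1 - r = p * (1 - \<rho>)\<close>, and \<open>j = p - 1\<close>, where
  \<open>r + 1 = p * \<rho>\<close>, contribute.\<close>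

lemma beta_prod:
  assumes p: "3 \<le> p" and rho: "\<rho> \<noteq> 0" "\<rho> \<noteq> 1"
  shows "(\<Prod>j\<in>{1..<p}. beta p (rdiff p \<rho> j) ^ j) * (\<Prod>j\<in>{1..<p}. beta p (- rdiff p \<rho> j) ^ j) =
    of_nat p * (1 - of_int \<rho>) * (of_nat p * of_int \<rho>) ^ (p - 1)"
proof -
  let ?A = "of_nat p * (1 - of_int \<rho>) :: rat" and ?B = "of_nat p * of_int \<rho> :: rat"
  have "(\<Prod>j\<in>{1..<p}. beta p (rdiff p \<rho> j) ^ j) * (\<Prod>j\<in>{1..<p}. beta p (- rdiff p \<rho> j) ^ j) =
      (\<Prod>j\<in>{1..<p}. (if j = 1 then ?A else 1) * (if j = p - 1 then ?B ^ (p - 1) else 1))"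
    unfolding prod.distrib[symmetric]
  proof (rule prod.cong[OF refl])
    fix j assume "j \<in> {1..<p}"
    then have j: "1 \<le> j" "j < p" by auto
    have "beta p (rdiff p \<rho> j) * beta p (- rdiff p \<rho> j) = (if j = 1 then 1 - of_int (rdiff p \<rho> j)
        else if j = p - 1 then of_int (rdiff p \<rho> j) + 1 else 1)"
      unfolding beta_pair[OF p rdiff_unit[OF p j rho]] using rdiff_dvd[OF p j, of \<rho>] by simp
    also have "\<dots> = (if j = 1 then ?A else if j = p - 1 then ?B else 1)"
      using p by (auto simp: rdiff_def algebra_simps of_nat_diff)
    finally have "(beta p (rdiff p \<rho> j) * beta p (- rdiff p \<rho> j)) ^ j = (if j = 1 then ?A else if j = p - 1 then ?B else 1) ^ j"
      by simp
    then show "beta p (rdiff p \<rho> j) ^ j * beta p (- rdiff p \<rho> j) ^ j =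
        (if j = 1 then ?A else 1) * (if j = p - 1 then ?B ^ (p - 1) else 1)"
      using p by (auto simp: power_mult_distrib)
  qed
  also have "\<dots> = ?A * ?B ^ (p - 1)"
    unfolding prod.distrib using p by (simp add: prod.delta)
  finally show ?thesis .
qed

text \<open>This is the path on which \<open>\<Psi>_p\<close> keeps all pairs. Its \<open>p\<close>
  factors \<open>- 1 / (p * \<rho>)\<close> cancel the power in \<open>beta_prod\<close> up to one
  factor, and odd \<open>p\<close> leaves one minus sign.\<close>

lemma diagonal_coeff:
  assumes p: "3 \<le> p" "odd p" and rho: "\<rho> \<noteq> 0" "\<rho> \<noteq> 1"
  shows "(- delta p (int p * \<rho>)) ^ p * ((\<Prod>j\<in>{1..<p}. beta p (rdiff p \<rho> j) ^ j) * (\<Prod>j\<in>{1..<p}. beta p (- rdiff p \<rho> j) ^ j)) =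
    1 - 1 / of_int \<rho>"
proof -
  define B :: rat where "B = of_nat p * of_int \<rho>"
  have B: "B \<noteq> 0" using p rho by (simp add: B_def)
  have "delta p (int p * \<rho>) = 1 / B" by (simp add: delta_def cong_iff_dvd_diff B_def)
  then have "(- delta p (int p * \<rho>)) ^ p = - (1 / B ^ p)"
    using p(2) by (simp add: power_minus_odd power_divide)
  moreover have "B ^ p = B * B ^ (p - 1)" using p by (metis not_numeral_le_zero power_eq_if)
  ultimately have "(- delta p (int p * \<rho>)) ^ p * ((\<Prod>j\<in>{1..<p}. beta p (rdiff p \<rho> j) ^ j) * (\<Prod>j\<in>{1..<p}. beta p (- rdiff p \<rho> j) ^ j)) =
      - (of_nat p * (1 - of_int \<rho>)) / B"
    unfolding beta_prod[OF p(1) rho] B_def[symmetric] using B by simp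
  also have "\<dots> = 1 - 1 / of_int \<rho>" using p rho by (simp add: B_def field_simps)
  finally show ?thesis .
qed

text \<open>The coefficient of the path on which \<open>\<Psi>_p\<close> exchanges all pairs. The
  way down then belongs to the exchanged blocks, whose difference is
  \<open>- \<rho>\<close>.\<close>

definition offdiag :: "nat \<Rightarrow> int \<Rightarrow> rat" where
  "offdiag p \<rho> = beta p (int p * \<rho>) ^ p *
    ((\<Prod>j\<in>{1..<p}. beta p (rdiff p \<rho> j) ^ j) * (\<Prod>j\<in>{1..<p}. beta p (- rdiff p (- \<rho>) j) ^ j))"

text \<open>The way up of each factor combines with the way down of the other into the instances of
  \<open>beta_prod\<close> for \<open>\<rho>\<close> and \<open>- \<rho>\<close>; the middle is
  \<open>beta_pair\<close> at \<open>p * \<rho>\<close>.\<close>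

lemma offdiag_prod:
  assumes p: "3 \<le> p" "odd p" and rho: "\<rho> \<noteq> 0" "\<rho> \<noteq> 1" "\<rho> \<noteq> -1"
  shows "offdiag p \<rho> * offdiag p (- \<rho>) = 1 - 1 / (of_int \<rho>)\<^sup>2"
proof -
  define B :: rat where "B = of_nat p * of_int \<rho>"
  have B: "B \<noteq> 0" using p rho by (simp add: B_def)
  have "\<bar>int p * \<rho>\<bar> \<noteq> 1" "int p * \<rho> \<noteq> 0" using p rho by (auto simp: abs_mult zmult_eq_1_iff)
  from beta_pair[OF p(1) this] have mid: "beta p (int p * \<rho>) * beta p (- (int p * \<rho>)) = - 1 / B\<^sup>2"
    by (simp add: B_def)
  have "offdiag p \<rho> * offdiag p (- \<rho>) = (beta p (int p * \<rho>) * beta p (- (int p * \<rho>))) ^ p *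
      ((\<Prod>j\<in>{1..<p}. beta p (rdiff p \<rho> j) ^ j) * (\<Prod>j\<in>{1..<p}. beta p (- rdiff p \<rho> j) ^ j)) *
      ((\<Prod>j\<in>{1..<p}. beta p (rdiff p (- \<rho>) j) ^ j) * (\<Prod>j\<in>{1..<p}. beta p (- rdiff p (- \<rho>) j) ^ j))"
    unfolding offdiag_def power_mult_distrib by (simp add: mult_ac)
  also have "\<dots> = (- 1 / B\<^sup>2) ^ p * (of_nat p * (1 - of_int \<rho>) * B ^ (p - 1)) * (of_nat p * (1 + of_int \<rho>) * (- B) ^ (p - 1))"
  proof -
    have "- \<rho> \<noteq> 0" "- \<rho> \<noteq> 1" using rho by auto
    from beta_prod[OF p(1) this] beta_prod[OF p(1) rho(1,2)] mid show ?thesis by (simp add: B_def)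
  qed
  also have "(- B) ^ (p - 1) = B ^ (p - 1)" using p by simp
  also have "(- 1 / B\<^sup>2) ^ p = - (1 / (B ^ p * B ^ p))"
  proof -
    have "(- 1 / B\<^sup>2) ^ p = (- (1 / B\<^sup>2)) ^ p" by simp
    also have "\<dots> = - ((1 / B\<^sup>2) ^ p)" using p(2) by (rule power_minus_odd)
    finally show ?thesis by (simp add: power_divide power2_eq_square power_mult_distrib)
  qed
  also have "B ^ p = B * B ^ (p - 1)" using p by (metis not_numeral_le_zero power_eq_if)
  also have "- (1 / (B * B ^ (p - 1) * (B * B ^ (p - 1)))) * (of_nat p * (1 - of_int \<rho>) * B ^ (p - 1)) *
      (of_nat p * (1 + of_int \<rho>) * B ^ (p - 1)) = - (of_nat p * (1 - of_int \<rho>) * (of_nat p * (1 + of_int \<rho>))) / (B * B)"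
    using B by (simp add: divide_simps)
  also have "\<dots> = 1 - 1 / (of_int \<rho>)\<^sup>2"
    using p rho by (simp add: B_def field_simps power2_eq_square)
  finally show ?thesis .
qed

section \<open>Exchanging two blocks\<close>

text \<open>\<open>riffle c p j x\<close> is the original position of the entry found at position \<open>x\<close> after the first
  \<open>j - 1\<close> of the products \<open>\<Psi>\<close> have exchanged the neighbouring entries of the blocks starting at \<open>c\<close>
  and \<open>c + p\<close>.\<close>

definition riffle :: "nat \<Rightarrow> nat \<Rightarrow> nat \<Rightarrow> nat \<Rightarrow> nat" where
  "riffle c p j x = (if x < c + p - j \<or> c + p + j \<le> x then x
     else if even (x - (c + p - j)) then c + p - j + (x - (c + p - j)) div 2
     else c + p + (x - (c + p - j)) div 2)"

text \<open>For \<open>c = i * p\<close> these are the indices \<open>I - j + 1 + 2 * m\<close> with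
  \<open>I = (i + 1) * p - 1\<close>.\<close>

definition psi_pos :: "nat \<Rightarrow> nat \<Rightarrow> nat \<Rightarrow> nat list" where
  "psi_pos c p j = map (\<lambda>m. c + p - j + 2 * m) [0..<j]"

definition block_swap :: "nat \<Rightarrow> nat \<Rightarrow> nat \<Rightarrow> nat" where
  "block_swap c p x = (if c \<le> x \<and> x < c + p then x + p else if c + p \<le> x \<and> x < c + 2 * p then x - p else x)"

lemma set_psi_pos: "set (psi_pos c p j) = (\<lambda>m. c + p - j + 2 * m) ` {..<j}"
  by (auto simp: psi_pos_def)

lemma distinct_psi_pos: "distinct (psi_pos c p j)"
  by (auto simp: psi_pos_def distinct_map inj_on_def)

lemma sparse_psi_pos: "sparse (set (psi_pos c p j))"
proof -
  have "a + 2 * m \<noteq> Suc (a + 2 * m')" for a m m' :: nat by presburger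
  then show ?thesis unfolding sparse_def set_psi_pos by (intro ballI notI) (elim imageE, metis)
qed

lemma card_psi_pos: "card (set (psi_pos c p j)) = j"
  using distinct_card[OF distinct_psi_pos[of c p j]] by (simp add: psi_pos_def)

lemma riffle_simps:
  assumes "j \<le> p"
  shows "m < j \<Longrightarrow> riffle c p j (c + p - j + 2 * m) = c + p - j + m"
    "m < j \<Longrightarrow> riffle c p j (Suc (c + p - j + 2 * m)) = c + p + m"
    "x < c + p - j \<or> c + p + j \<le> x \<Longrightarrow> riffle c p j x = x"
  using assms by (auto simp: riffle_def)

lemma riffle_1: "riffle c p (Suc 0) = id"
proof
  fix x show "riffle c p (Suc 0) x = id x"
  proof (cases "x < c + p - 1 \<or> c + p + 1 \<le> x")
    case False
    then have "x = c + p - 1 \<or> x = c + p" by auto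
    then show ?thesis by (auto simp: riffle_def)
  qed (auto simp: riffle_def)
qed

lemma psi_pos_cases:
  obtains m where "m < j" "x = c + p - j + 2 * m" | m where "m < j" "x = Suc (c + p - j + 2 * m)"
  | "x < c + p - j \<or> c + p - j + 2 * j \<le> x"
proof (cases "x < c + p - j \<or> c + p - j + 2 * j \<le> x")
  case False
  define d where "d = x - (c + p - j)"
  have x: "x = c + p - j + d" "d < 2 * j" using False by (auto simp: d_def)
  show ?thesis
  proof (cases "even d")
    case True
    then obtain m where "d = 2 * m" by (elim evenE)
    then show ?thesis using that(1)[of m] x by simp
  next
    case False
    then obtain m where "d = 2 * m + 1" by (elim oddE)
    then show ?thesis using that(2)[of m] x by simp
  qed
qed (use that in blast)

lemma swp_psi_pos:
  "m < j \<Longrightarrow> swp (set (psi_pos c p j)) (c + p - j + 2 * m) = Suc (c + p - j + 2 * m)"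
  "m < j \<Longrightarrow> swp (set (psi_pos c p j)) (Suc (c + p - j + 2 * m)) = c + p - j + 2 * m"
  "x < c + p - j \<or> c + p - j + 2 * j \<le> x \<Longrightarrow> swp (set (psi_pos c p j)) x = x"
proof -
  let ?K = "set (psi_pos c p j)"
  have in_K: "c + p - j + 2 * m \<in> ?K" if "m < j" for m using that by (auto simp: set_psi_pos)
  show "swp ?K (c + p - j + 2 * m) = Suc (c + p - j + 2 * m)" if "m < j"
    using in_K[OF that] by (simp add: swp_def)
  show "swp ?K (Suc (c + p - j + 2 * m)) = c + p - j + 2 * m" if "m < j"
    using in_K[OF that] sparse_psi_pos[of c p j] by (auto simp: swp_def sparse_def)
  show "swp ?K x = x" if "x < c + p - j \<or> c + p - j + 2 * j \<le> x"
  proof -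
    have "x \<notin> ?K" using that by (auto simp: set_psi_pos)
    moreover have "x - 1 \<notin> ?K" if "1 \<le> x"
      using that \<open>x < c + p - j \<or> c + p - j + 2 * j \<le> x\<close> by (auto simp: set_psi_pos)
    ultimately show ?thesis unfolding swp_def by presburger
  qed
qed

text \<open>The window holds the last \<open>j\<close> entries of the lower block and the first
  \<open>j\<close> of the upper one, alternating. Exchanging its neighbouring pairs reverses the
  alternation, so that one more entry of either block fits on at the ends.\<close>

lemma riffle_swp:
  assumes j: "1 \<le> j" "j < p"
  shows "riffle c p j \<circ> swp (set (psi_pos c p j)) = riffle c p (Suc j)"
proof
  fix x
  have a: "c + p - Suc j = c + p - j - 1" "1 \<le> c + p - j" using j by auto
  show "(riffle c p j \<circ> swp (set (psi_pos c p j))) x = riffle c p (Suc j) x"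
  proof (cases rule: psi_pos_cases[of j x c p])
    case (1 m)
    have "x = Suc (c + p - Suc j + 2 * m)" using 1 a by simp
    then have "riffle c p (Suc j) x = c + p + m" using riffle_simps(2)[of "Suc j" p m c] 1 j by simp
    then show ?thesis using 1 swp_psi_pos(1)[of m j c p] riffle_simps(2)[of j p m c] j by simp
  next
    case (2 m)
    have "x = c + p - Suc j + 2 * (Suc m)" using 2 a by simp
    then have "riffle c p (Suc j) x = c + p - Suc j + Suc m"
      using riffle_simps(1)[of "Suc j" p "Suc m" c] 2(1) j by (simp only: Suc_less_eq Suc_leI)
    also have "\<dots> = c + p - j + m" using a by linarith
    also have "\<dots> = riffle c p j (c + p - j + 2 * m)" using riffle_simps(1)[of j p m c] 2(1) j by simp
    also have "c + p - j + 2 * m = swp (set (psi_pos c p j)) x"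
      unfolding 2(2) using swp_psi_pos(2)[OF 2(1), of c p] ..
    finally show ?thesis unfolding comp_apply ..
  next
    case 3
    then have "(riffle c p j \<circ> swp (set (psi_pos c p j))) x = x"
      using swp_psi_pos(3)[of x c p j] riffle_simps(3)[of j p x c] j by auto
    moreover have "riffle c p (Suc j) x = x"
    proof -
      consider "x = c + p - Suc j + 2 * 0" | "x = Suc (c + p - Suc j + 2 * j)" | "x < c + p - Suc j \<or> c + p + Suc j \<le> x"
        using 3 a j by linarith
      then show ?thesis
      proof cases
        case 1
        then show ?thesis using riffle_simps(1)[of "Suc j" p 0 c] j by simp
      next
        case 2
        then have "riffle c p (Suc j) x = c + p + j" using riffle_simps(2)[of "Suc j" p j c] j by (simp only: lessI Suc_leI)
        also have "\<dots> = x" using 2 j by linarith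
        finally show ?thesis .
      qed (use riffle_simps(3)[of "Suc j" p x c] j in auto)
    qed
    ultimately show ?thesis by simp
  qed
qed

lemma swp_psi_pos_involution: "swp (set (psi_pos c p j)) \<circ> swp (set (psi_pos c p j)) = id"
proof
  fix x show "(swp (set (psi_pos c p j)) \<circ> swp (set (psi_pos c p j))) x = id x"
    by (cases rule: psi_pos_cases[of j x c p]) (simp_all add: swp_psi_pos)
qed

text \<open>Exchanging all pairs of the complete riffle gives the complete riffle of the exchanged
  blocks, so the descent after \<open>\<Psi>_p\<close> ends in the tableau with exchanged
  blocks.\<close>

lemma riffle_swp_last: "riffle c p p \<circ> swp (set (psi_pos c p p)) = block_swap c p \<circ> riffle c p p"
proof
  fix x
  show "(riffle c p p \<circ> swp (set (psi_pos c p p))) x = (block_swap c p \<circ> riffle c p p) x"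
  proof (cases rule: psi_pos_cases[of p x c p])
    case (1 m)
    then show ?thesis using swp_psi_pos(1)[of m p c p] riffle_simps(1,2)[of p p m c] by (simp add: block_swap_def)
  next
    case (2 m)
    then show ?thesis using swp_psi_pos(2)[of m p c p] riffle_simps(1,2)[of p p m c] by (simp add: block_swap_def)
  next
    case 3
    then show ?thesis using swp_psi_pos(3)[of x c p p] riffle_simps(3)[of p p x c] by (auto simp: block_swap_def)
  qed
qed

section \<open>Products acting factor by factor\<close>

lemma act_prod_append:
  assumes "\<And>x. x \<in> set (xs @ ys) \<Longrightarrow> x \<in> word_alg n"
  shows "act n (tl_prod n (xs @ ys)) f = act n (tl_prod n xs) (act n (tl_prod n ys) f)"
  using assms
proof (induction xs)
  case Nil
  have "act n (tl_one n) (act n (tl_prod n ys) f) = act n (tl_prod n ys) f"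
    by (rule act_one) (rule act_outside)
  then show ?case by (simp add: tl_prod_def)
next
  case (Cons x xs)
  have w: "x \<in> word_alg n" "tl_prod n (xs @ ys) \<in> word_alg n" "tl_prod n xs \<in> word_alg n"
    using Cons.prems by (auto intro!: word_alg_prod)
  have c: "tl_prod n (x # zs) = x \<cdot> tl_prod n zs" for zs by (simp add: tl_prod_def)
  show ?case
    unfolding append_Cons c act_mult[OF w(1,2)] act_mult[OF w(1,3)] using Cons by simp
qed

lemma act_prod_Cons:
  assumes "\<And>y. y \<in> set (x # xs) \<Longrightarrow> y \<in> word_alg n"
  shows "act n (tl_prod n (x # xs)) f = act n x (act n (tl_prod n xs) f)"
proof -
  have w: "x \<in> word_alg n" "tl_prod n xs \<in> word_alg n" using assms by (auto intro!: word_alg_prod)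
  show ?thesis using act_mult[OF w] by (simp add: tl_prod_def)
qed

lemma act_prod_single:
  assumes "x \<in> word_alg n" shows "act n (tl_prod n [x]) f = act n x f"
proof -
  have "act n (tl_prod n [x]) f = act n x (act n (tl_one n) f)"
    using act_mult[OF assms word_alg_one] by (simp add: tl_prod_def)
  also have "act n (tl_one n) f = perm_act n id f" using represents_id by (simp add: represents_def)
  also have "act n x (perm_act n id f) = act n x f"
    unfolding act_def by (auto simp: perm_act_def fun_eq_iff intro!: sum.cong)
  finally show ?thesis .
qed

text \<open>Of the class only the contents on the two blocks enter, in the form supplied later by
  \<open>content_block\<close>; \<open>x\<close> and \<open>y\<close> will be the contents of the
  corresponding entries of the small tableau.\<close>

locale block_pair =
  fixes n p c :: nat and x y :: int and t :: tableau
  assumes p: "3 \<le> p" and c: "1 \<le> c" "c + 2 * p \<le> n + 1"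
    and low: "\<And>m. m < p \<Longrightarrow> content t (c + m) = 1 - int m + int p * (x - 1)"
    and high: "\<And>m. m < p \<Longrightarrow> content t (c + p + m) = 1 - int m + int p * (y - 1)"
begin

definition "\<rho> = x - y"
definition "T j = t \<circ> riffle c p j"
definition "P j = tl_prod n (map (psi p n) (psi_pos c p j))"

lemma T_1: "T (Suc 0) = t"
  by (simp add: T_def riffle_1)

lemma T_Suc:
  assumes "1 \<le> j" "j < p"
  shows "T j \<circ> swp (set (psi_pos c p j)) = T (Suc j)" "T (Suc j) \<circ> swp (set (psi_pos c p j)) = T j"
proof -
  show *: "T j \<circ> swp (set (psi_pos c p j)) = T (Suc j)"
    unfolding T_def comp_assoc riffle_swp[OF assms] ..
  show "T (Suc j) \<circ> swp (set (psi_pos c p j)) = T j"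
    unfolding *[symmetric] comp_assoc swp_psi_pos_involution by simp
qed

lemma T_last: "T p \<circ> swp (set (psi_pos c p p)) = (t \<circ> block_swap c p) \<circ> riffle c p p"
  unfolding T_def comp_assoc riffle_swp_last ..

lemma psi_pos_range:
  assumes "j \<le> p" "k \<in> set (psi_pos c p j)" shows "1 \<le> k \<and> k < n"
  using assms c p by (auto simp: set_psi_pos)

lemma P_word: "j \<le> p \<Longrightarrow> P j \<in> word_alg n"
  unfolding P_def using psi_pos_range by (auto intro!: word_alg_prod psi_word)

lemma content_T:
  assumes j: "1 \<le> j" "j \<le> p" and k: "k \<in> set (psi_pos c p j)"
  shows "content (T j) k - content (T j) (Suc k) = rdiff p \<rho> j"
proof -
  obtain m where m: "m < j" "k = c + p - j + 2 * m" using k by (auto simp: set_psi_pos)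
  have "c + p - j + m = c + (p - j + m)" using j by simp
  then have "content (T j) k = 1 - int (p - j + m) + int p * (x - 1)"
    using riffle_simps(1)[of j p m c] m j low[of "p - j + m"] by (simp add: T_def content_comp)
  moreover have "content (T j) (Suc k) = 1 - int m + int p * (y - 1)"
    using riffle_simps(2)[of j p m c] m j high[of m] by (simp add: T_def content_comp)
  ultimately show ?thesis
    using j by (simp add: rdiff_def \<rho>_def of_nat_diff algebra_simps)
qed

lemma content_T':
  assumes j: "1 \<le> j" "j < p" and k: "k \<in> set (psi_pos c p j)"
  shows "content (T (Suc j)) k - content (T (Suc j)) (Suc k) = - rdiff p \<rho> j"
proof -
  obtain m where m: "m < j" "k = c + p - j + 2 * m" using k by (auto simp: set_psi_pos)
  have "content (T (Suc j)) k = content (T j) (Suc k)" "content (T (Suc j)) (Suc k) = content (T j) k"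
    unfolding T_Suc(1)[OF j, symmetric] content_comp using swp_psi_pos(1,2)[OF m(1), of c p] m by simp_all
  then show ?thesis using content_T[OF _ _ k] j by simp
qed

lemma delta_rdiff: "1 \<le> j \<Longrightarrow> j < p \<Longrightarrow> delta p (rdiff p \<rho>' j) = 0" "1 \<le> j \<Longrightarrow> j < p \<Longrightarrow> delta p (- rdiff p \<rho>' j) = 0"
  using rdiff_dvd(1)[OF p, of j \<rho>'] by (simp_all add: delta_def cong_iff_dvd_diff)

text \<open>The differences are \<open>j\<close> modulo \<open>p\<close> with
  \<open>0 < j < p\<close>, so no \<open>\<delta>\<close> occurs and a single tableau
  remains.\<close>

lemma act_P:
  assumes j: "1 \<le> j" "j < p" and std: "T j \<in> Std2 n"
  shows "act n (P j) (vts n (T j) b) = (\<lambda>w. beta p (rdiff p \<rho> j) ^ j * vts n (T (Suc j)) b w)"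
proof -
  have k: "1 \<le> k \<and> k < n" if "k \<in> set (psi_pos c p j)" for k using psi_pos_range[OF _ that] j by simp
  have d: "delta p (content (T j) k - content (T j) (Suc k)) = 0" if "k \<in> set (psi_pos c p j)" for k
    using content_T[OF j(1) _ that] j delta_rdiff by simp
  have "(\<Prod>k\<in>set (psi_pos c p j). beta p (content (T j) k - content (T j) (Suc k))) = beta p (rdiff p \<rho> j) ^ j"
    using content_T[OF j(1)] j by (simp add: card_psi_pos)
  then show ?thesis
    unfolding P_def using act_psi_prod_free[OF std distinct_psi_pos sparse_psi_pos k d] T_Suc(1)[OF j] by simp
qed

lemma act_P_back:
  assumes j: "1 \<le> j" "j < p" and std: "T (Suc j) \<in> Std2 n"
  shows "act n (P j) (vts n (T (Suc j)) b) = (\<lambda>w. beta p (- rdiff p \<rho> j) ^ j * vts n (T j) b w)"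
proof -
  have k: "1 \<le> k \<and> k < n" if "k \<in> set (psi_pos c p j)" for k using psi_pos_range[OF _ that] j by simp
  have d: "delta p (content (T (Suc j)) k - content (T (Suc j)) (Suc k)) = 0" if "k \<in> set (psi_pos c p j)" for k
    using content_T'[OF j that] j delta_rdiff by simp
  have "(\<Prod>k\<in>set (psi_pos c p j). beta p (content (T (Suc j)) k - content (T (Suc j)) (Suc k))) = beta p (- rdiff p \<rho> j) ^ j"
    using content_T'[OF j] by (simp add: card_psi_pos)
  then show ?thesis
    unfolding P_def using act_psi_prod_free[OF std distinct_psi_pos sparse_psi_pos k d] T_Suc(2)[OF j] by simp
qed

lemma act_P_up:
  assumes "1 \<le> j" "j \<le> p" "\<And>m. 1 \<le> m \<Longrightarrow> m < j \<Longrightarrow> T m \<in> Std2 n"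
  shows "act n (tl_prod n (map P (rev [1..<j]))) (vts n t b) =
    (\<lambda>w. (\<Prod>m\<in>{1..<j}. beta p (rdiff p \<rho> m) ^ m) * vts n (T j) b w)"
  using assms
proof (induction j rule: dec_induct)
  case base
  have "act n (tl_one n) (vts n t b) = vts n t b" by (rule act_one) (simp add: vts_def vt_outside)
  then show ?case by (simp add: tl_prod_def T_1)
next
  case (step j)
  have w: "u \<in> word_alg n" if "u \<in> set (P j # map P (rev [1..<j]))" for u
    using that step P_word by auto
  have "map P (rev [1..<Suc j]) = P j # map P (rev [1..<j])" using step by simp
  then have "act n (tl_prod n (map P (rev [1..<Suc j]))) (vts n t b) = act n (P j) (act n (tl_prod n (map P (rev [1..<j]))) (vts n t b))"
    using act_prod_Cons[of "P j" "map P (rev [1..<j])"] w by metis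
  also have "\<dots> = (\<lambda>w. (\<Prod>m\<in>{1..<j}. beta p (rdiff p \<rho> m) ^ m) * (beta p (rdiff p \<rho> j) ^ j * vts n (T (Suc j)) b w))"
    using step act_P[of j b] by (simp add: act_scale)
  finally show ?case using step by (simp add: mult_ac)
qed

lemma act_P_down:
  assumes "1 \<le> j" "j \<le> p" "\<And>m. 1 \<le> m \<Longrightarrow> m < j \<Longrightarrow> T (Suc m) \<in> Std2 n"
  shows "act n (tl_prod n (map P [1..<j])) (vts n (T j) b) =
    (\<lambda>w. (\<Prod>m\<in>{1..<j}. beta p (- rdiff p \<rho> m) ^ m) * vts n t b w)"
  using assms
proof (induction j rule: dec_induct)
  case base
  have "act n (tl_one n) (vts n t b) = vts n t b" by (rule act_one) (simp add: vts_def vt_outside)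
  then show ?case by (simp add: tl_prod_def T_1)
next
  case (step j)
  have w: "u \<in> word_alg n" if "u \<in> set (map P [1..<j] @ [P j])" for u
    using that step P_word by auto
  have "map P [1..<Suc j] = map P [1..<j] @ [P j]" using step by simp
  then have "act n (tl_prod n (map P [1..<Suc j])) (vts n (T (Suc j)) b) =
      act n (tl_prod n (map P [1..<j])) (act n (P j) (vts n (T (Suc j)) b))"
    using act_prod_append[of "map P [1..<j]" "[P j]" n, OF w] act_prod_single[OF P_word[of j]] step.hyps step.prems(1)
    by (simp only: Suc_leD)
  also have "\<dots> = (\<lambda>w. beta p (- rdiff p \<rho> j) ^ j * ((\<Prod>m\<in>{1..<j}. beta p (- rdiff p \<rho> m) ^ m) * vts n t b w))"
    using step act_P_back[of j b] by (simp add: act_scale)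
  finally show ?case using step by (simp add: mult_ac)
qed

text \<open>After a proper nonempty subset of the exchanges in \<open>\<Psi>\<^sub>p\<close>, two neighbouring entries of one block
  are adjacent, and \<open>\<Psi>\<^bsub>p-1\<^esub>\<close> annihilates the tableau.\<close>

lemma act_P_mixed:
  assumes std: "T p \<circ> swp X \<in> Std2 n" and X: "X \<subseteq> set (psi_pos c p p)" "X \<noteq> {}" "X \<noteq> set (psi_pos c p p)"
  shows "act n (P (p - 1)) (vts n (T p \<circ> swp X) b) = (\<lambda>w. 0)"
proof -
  let ?K = "set (psi_pos c p (p - 1))" and ?s = "T p \<circ> swp X"
  have pos: "set (psi_pos c p p) = (\<lambda>m. c + 2 * m) ` {..<p}" by (auto simp: set_psi_pos)
  have cT: "content (T p) (c + 2 * m) = 1 - int m + int p * (x - 1)"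
    "content (T p) (Suc (c + 2 * m)) = 1 - int m + int p * (y - 1)" if "m < p" for m
    using riffle_simps(1,2)[of p p m c] that low[of m] high[of m] by (simp_all add: T_def content_comp)
  have c_even: "content ?s (c + 2 * m) = 1 - int m + int p * ((if c + 2 * m \<in> X then y else x) - 1)" if m: "m < p" for m
  proof -
    have "c + 2 * m - 1 \<notin> X" if "1 \<le> c + 2 * m"
    proof
      assume "c + 2 * m - 1 \<in> X"
      then obtain m' where "c + 2 * m - 1 = c + 2 * m'" using X pos by auto
      then show False using that by presburger
    qed
    then have "swp X (c + 2 * m) = (if c + 2 * m \<in> X then Suc (c + 2 * m) else c + 2 * m)"
      unfolding swp_def by presburger
    then show ?thesis using cT[OF m] by (simp add: content_comp)
  qed
  have c_odd: "content ?s (Suc (c + 2 * m)) = 1 - int m + int p * ((if c + 2 * m \<in> X then x else y) - 1)" if m: "m < p" for m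
  proof -
    have "Suc (c + 2 * m) \<notin> X"
    proof
      assume "Suc (c + 2 * m) \<in> X"
      then obtain m' where "Suc (c + 2 * m) = c + 2 * m'" using X pos by auto
      then show False by presburger
    qed
    then have "swp X (Suc (c + 2 * m)) = (if c + 2 * m \<in> X then c + 2 * m else Suc (c + 2 * m))"
      unfolding swp_def by simp
    then show ?thesis using cT[OF m] by (simp add: content_comp)
  qed
  \<comment> \<open>\<open>\<Psi>_(p-1)\<close> exchanges the second entry of one pair with the
    first of the next. Their difference is 1 modulo \<open>p\<close>, and exactly 1 if just one of
    the two pairs has been exchanged.\<close>
  have diff: "content ?s (Suc (c + 2 * m)) - content ?s (Suc (Suc (c + 2 * m))) =
      1 + int p * ((if c + 2 * m \<in> X then x else y) - (if c + 2 * Suc m \<in> X then y else x))" if "Suc m < p" for m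
    using c_odd[of m] c_even[of "Suc m"] that by (simp add: algebra_simps)
  have K: "?K = (\<lambda>m. Suc (c + 2 * m)) ` {..<p - 1}" using p by (auto simp: set_psi_pos)
  have ex: "\<exists>m. Suc m < p \<and> (c + 2 * m \<in> X) \<noteq> (c + 2 * Suc m \<in> X)"
  proof (rule ccontr)
    assume "\<not> ?thesis"
    then have same: "(c + 2 * Suc m \<in> X) = (c + 2 * m \<in> X)" if "Suc m < p" for m using that by blast
    have all: "m < p \<longrightarrow> (c + 2 * m \<in> X) = (c \<in> X)" for m
    proof (induction m)
      case (Suc m)
      then show ?case using same[of m] by auto
    qed simp
    show False
    proof (cases "c \<in> X")
      case True
      then have "set (psi_pos c p p) \<subseteq> X" unfolding pos using all by auto
      then show False using X by blast
    next
      case False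
      then have "X = {}" using X(1) all unfolding pos by auto
      then show False using X by blast
    qed
  qed
  then obtain m where m: "Suc m < p" "(c + 2 * m \<in> X) \<noteq> (c + 2 * Suc m \<in> X)" by blast
  then have "content ?s (Suc (c + 2 * m)) - content ?s (Suc (Suc (c + 2 * m))) = 1" using diff[of m] by auto
  then have "beta p (content ?s (Suc (c + 2 * m)) - content ?s (Suc (Suc (c + 2 * m)))) = 0" by (simp add: beta_def)
  moreover have "Suc (c + 2 * m) \<in> ?K" unfolding K using m by auto
  ultimately have zero: "(\<Prod>k\<in>?K. beta p (content ?s k - content ?s (Suc k))) = 0" by (auto intro!: prod_zero)
  have d: "delta p (content ?s k - content ?s (Suc k)) = 0" if "k \<in> ?K" for k
  proof -
    obtain m where m: "m < p - 1" "k = Suc (c + 2 * m)" using \<open>k \<in> ?K\<close> unfolding K by auto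
    obtain z where z: "content ?s k - content ?s (Suc k) = 1 + int p * z"
      using diff[of m] m by auto
    have "\<not> int p dvd 1 + int p * z"
    proof
      assume "int p dvd 1 + int p * z"
      then have "int p dvd 1" using dvd_add_left_iff[of "int p" "int p * z" 1] by simp
      then show False using p by auto
    qed
    then show ?thesis unfolding z by (simp add: delta_def cong_iff_dvd_diff)
  qed
  have k: "1 \<le> k \<and> k < n" if "k \<in> ?K" for k using that psi_pos_range[of "p - 1" k] by simp
  have "act n (P (p - 1)) (vts n ?s b) =
      (\<lambda>w. (\<Prod>k\<in>?K. beta p (content ?s k - content ?s (Suc k))) * vts n (?s \<circ> swp ?K) b w)"
    unfolding P_def by (rule act_psi_prod_free[OF std distinct_psi_pos sparse_psi_pos]) (use k d in blast)+
  then show ?thesis unfolding zero by (simp only: mult_zero_left)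
qed

text \<open>\<open>\<Psi>_p\<close> is taken together with the following
  \<open>\<Psi>_(p-1)\<close>, which removes the mixed subsets; of the sum over subsets the empty
  and the full one remain.\<close>

lemma act_P_last:
  assumes std: "T p \<in> Std2 n" and rho: "\<rho> \<noteq> 0"
  shows "act n (P (p - 1)) (act n (P p) (vts n (T p) b)) =
    (\<lambda>w. (- delta p (int p * \<rho>)) ^ p * act n (P (p - 1)) (vts n (T p) b) w +
      beta p (int p * \<rho>) ^ p * act n (P (p - 1)) (vts n (T p \<circ> swp (set (psi_pos c p p))) b) w)"
proof
  fix w
  let ?K = "set (psi_pos c p p)"
  let ?b = "beta p (int p * \<rho>)" and ?d = "- delta p (int p * \<rho>)"
  have r: "content (T p) k - content (T p) (Suc k) = int p * \<rho>" if "k \<in> ?K" for k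
    using content_T[OF _ _ that] p by (simp add: rdiff_def algebra_simps)
  have k: "1 \<le> k \<and> k < n" if "k \<in> ?K" for k using that psi_pos_range[of p k] by simp
  have abs: "\<bar>int p * \<rho>\<bar> \<noteq> 1" using p rho by (auto simp: abs_mult zmult_eq_1_iff)
  let ?F = "\<lambda>X. ((\<Prod>k\<in>X. ?b) * (\<Prod>k\<in>?K - X. ?d))"
  have "act n (P p) (vts n (T p) b) = (\<lambda>w. \<Sum>X\<in>Pow ?K.
      ((\<Prod>k\<in>X. beta p (content (T p) k - content (T p) (Suc k))) *
       (\<Prod>k\<in>?K - X. - delta p (content (T p) k - content (T p) (Suc k)))) * vts n (T p \<circ> swp X) b w)"
    unfolding P_def by (rule act_psi_prod[OF std distinct_psi_pos sparse_psi_pos]) (rule k)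
  also have "\<dots> = (\<lambda>w. \<Sum>X\<in>Pow ?K. ?F X * vts n (T p \<circ> swp X) b w)"
  proof (rule ext, rule sum.cong[OF refl])
    fix w X assume X: "X \<in> Pow ?K"
    have "(\<Prod>k\<in>X. beta p (content (T p) k - content (T p) (Suc k))) = (\<Prod>k\<in>X. ?b)"
      by (rule prod.cong) (use X r in auto)
    moreover have "(\<Prod>k\<in>?K - X. - delta p (content (T p) k - content (T p) (Suc k))) = (\<Prod>k\<in>?K - X. ?d)"
      by (rule prod.cong) (use r in auto)
    ultimately show "((\<Prod>k\<in>X. beta p (content (T p) k - content (T p) (Suc k))) *
       (\<Prod>k\<in>?K - X. - delta p (content (T p) k - content (T p) (Suc k)))) * vts n (T p \<circ> swp X) b w =
       ?F X * vts n (T p \<circ> swp X) b w" by (simp only:)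
  qed
  finally have "act n (P (p - 1)) (act n (P p) (vts n (T p) b)) w =
      (\<Sum>X\<in>Pow ?K. ?F X * act n (P (p - 1)) (vts n (T p \<circ> swp X) b) w)"
    using act_comb_sum[of "Pow ?K" n "P (p - 1)" ?F "\<lambda>X. vts n (T p \<circ> swp X) b"] by simp
  also have "\<dots> = (\<Sum>X\<in>{{}, ?K}. ?F X * act n (P (p - 1)) (vts n (T p \<circ> swp X) b) w)"
  proof (rule sum.mono_neutral_right)
    show "\<forall>X\<in>Pow ?K - {{}, ?K}. ?F X * act n (P (p - 1)) (vts n (T p \<circ> swp X) b) w = 0"
    proof
      fix X assume X: "X \<in> Pow ?K - {{}, ?K}"
      have "T p \<circ> swp X \<in> Std2 n"
      proof (rule swp_Std2[OF _ _ std])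
        show "finite X" using X by (auto intro: finite_subset)
        show "sparse X" using sparse_psi_pos by (rule sparse_subset) (use X in auto)
        show "1 \<le> k \<and> k < n \<and> \<bar>content (T p) k - content (T p) (Suc k)\<bar> \<noteq> 1" if "k \<in> X" for k
          using r[of k] k[of k] abs that X by auto
      qed
      then show "?F X * act n (P (p - 1)) (vts n (T p \<circ> swp X) b) w = 0"
        using act_P_mixed[of X b] X by auto
    qed
  qed auto
  also have "\<dots> = ?F {} * act n (P (p - 1)) (vts n (T p) b) w + ?F ?K * act n (P (p - 1)) (vts n (T p \<circ> swp ?K) b) w"
  proof -
    have "{} \<noteq> ?K" using p by (auto simp: set_psi_pos lessThan_empty_iff)
    then show ?thesis by simp
  qed
  also have "?F {} = ?d ^ p" by (simp add: card_psi_pos)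
  also have "?F ?K = ?b ^ p" by (simp add: card_psi_pos)
  finally show "act n (P (p - 1)) (act n (P p) (vts n (T p) b)) w =
      ?d ^ p * act n (P (p - 1)) (vts n (T p) b) w + ?b ^ p * act n (P (p - 1)) (vts n (T p \<circ> swp ?K) b) w" .
qed

text \<open>Standardness can only break at a difference 1 or -1. Among the numbers
  \<open>p * (\<rho> - 1) + j\<close> with \<open>0 < j < p\<close> the value 1 forces
  \<open>\<rho> = 1\<close>, and -1 forces \<open>\<rho> = 0\<close>.\<close>

lemma T_Std2:
  assumes t: "t \<in> Std2 n" and rho: "\<rho> \<noteq> 0" "\<rho> \<noteq> 1" and j: "1 \<le> j" "j \<le> p"
  shows "T j \<in> Std2 n"
  using j
proof (induction j rule: dec_induct)
  case base
  then show ?case using t by (simp add: T_1)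
next
  case (step j)
  have "T j \<circ> swp (set (psi_pos c p j)) \<in> Std2 n"
  proof (rule swp_Std2[OF _ sparse_psi_pos])
    show "T j \<in> Std2 n" using step by simp
    show "1 \<le> k \<and> k < n \<and> \<bar>content (T j) k - content (T j) (Suc k)\<bar> \<noteq> 1" if "k \<in> set (psi_pos c p j)" for k
      using content_T[OF _ _ that] psi_pos_range[OF _ that] step rdiff_unit[OF p _ _ rho, of j] by simp
  qed simp
  then show ?case using T_Suc(1)[of j] step by simp
qed

end

section \<open>The tableau with exchanged blocks\<close>

context block_pair begin

interpretation sw: block_pair n p c y x "t \<circ> block_swap c p"
proof
  show "content (t \<circ> block_swap c p) (c + m) = 1 - int m + int p * (y - 1)" if "m < p" for m
    using high[OF that] that by (simp add: content_comp block_swap_def add_ac)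
  show "content (t \<circ> block_swap c p) (c + p + m) = 1 - int m + int p * (x - 1)" if "m < p" for m
    using low[OF that] that by (simp add: content_comp block_swap_def)
qed (use p c in auto)

text \<open>Standardness is carried down from the complete riffle and not up from the exchanged
  tableau, because for \<open>\<rho> = -1\<close> the last step, from level 2 to level 1, has a
  difference of absolute value 1; only that step is affected.\<close>

lemma swap_T_Std2:
  assumes t: "t \<in> Std2 n" and rho: "\<rho> \<noteq> 0" "\<rho> \<noteq> 1" and j: "1 \<le> j" "j \<le> p" "j = 1 \<longrightarrow> \<rho> \<noteq> -1"
  shows "(t \<circ> block_swap c p) \<circ> riffle c p j \<in> Std2 n"
proof -
  have rho': "sw.\<rho> = - \<rho>" by (simp add: sw.\<rho>_def \<rho>_def)
  have "sw.T p \<in> Std2 n"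
  proof -
    have "T p \<circ> swp (set (psi_pos c p p)) \<in> Std2 n"
    proof (rule swp_Std2[OF _ sparse_psi_pos])
      show "T p \<in> Std2 n" using T_Std2[OF t rho] p by simp
      fix k assume k: "k \<in> set (psi_pos c p p)"
      have "content (T p) k - content (T p) (Suc k) = int p * \<rho>"
        using content_T[OF _ _ k] p by (simp add: rdiff_def algebra_simps)
      moreover have "\<bar>int p * \<rho>\<bar> \<noteq> 1" using p rho by (auto simp: abs_mult zmult_eq_1_iff)
      ultimately show "1 \<le> k \<and> k < n \<and> \<bar>content (T p) k - content (T p) (Suc k)\<bar> \<noteq> 1"
        using psi_pos_range[OF _ k] by simp
    qed simp
    then show ?thesis unfolding T_last sw.T_def .
  qed
  moreover have "q \<le> p - j \<Longrightarrow> sw.T p \<in> Std2 n \<Longrightarrow> sw.T (p - q) \<in> Std2 n" for q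
  proof (induction q)
    case (Suc q)
    define i where "i = p - Suc q"
    have i: "1 \<le> i" "i < p" "p - q = Suc i" using Suc.prems j by (auto simp: i_def)
    have "sw.T (Suc i) \<circ> swp (set (psi_pos c p i)) \<in> Std2 n"
    proof (rule swp_Std2[OF _ sparse_psi_pos])
      have "sw.T (p - q) \<in> Std2 n"
        by (rule Suc.IH) (use Suc.prems(1) in simp, rule Suc.prems(2))
      then show "sw.T (Suc i) \<in> Std2 n" unfolding i(3) .
      fix k assume k: "k \<in> set (psi_pos c p i)"
      have "\<bar>rdiff p (- \<rho>) i\<bar> \<noteq> 1"
      proof (cases "\<rho> = -1")
        case False
        then show ?thesis using rdiff_unit(1)[OF p i(1,2), of "- \<rho>"] rho by simp
      next
        case True
        then have "i \<noteq> 1" using j Suc.prems i by (auto simp: i_def)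
        then show ?thesis using True i by (simp add: rdiff_def)
      qed
      then show "1 \<le> k \<and> k < n \<and> \<bar>content (sw.T (Suc i)) k - content (sw.T (Suc i)) (Suc k)\<bar> \<noteq> 1"
        using sw.content_T'[OF i(1,2) k] psi_pos_range[OF _ k] i rho' by simp
    qed simp
    then have "sw.T i \<in> Std2 n" unfolding sw.T_Suc(2)[OF i(1,2)] .
    then show ?case unfolding i_def .
  qed simp
  ultimately have "sw.T (p - (p - j)) \<in> Std2 n" by blast
  then show ?thesis using j by (simp add: sw.T_def)
qed

text \<open>The factors act from the right: up through the riffles of \<open>t\<close>, across at
  \<open>\<Psi>_p\<close>, and down again through the riffles of \<open>t\<close> or of the
  exchanged tableau.\<close>

lemma act_exchange:
  assumes t: "t \<in> Std2 n" and rho: "\<rho> \<noteq> 0" "\<rho> \<noteq> 1" and odd: "odd p"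
  shows "act n (tl_prod n (map P ([1..<p + 1] @ rev [1..<p]))) (vts n t b) =
    (\<lambda>w. (1 - 1 / of_int \<rho>) * vts n t b w + offdiag p \<rho> * vts n (t \<circ> block_swap c p) b w)"
proof -
  let ?t' = "t \<circ> block_swap c p"
  have rho': "sw.\<rho> = - \<rho>" by (simp add: sw.\<rho>_def \<rho>_def)
  let ?up = "\<Prod>m\<in>{1..<p}. beta p (rdiff p \<rho> m) ^ m"
  have p1: "[1..<p + 1] = [1..<p] @ [p]" "[1..<p] = [1..<p - 1] @ [p - 1]"
    using p upt_Suc_append[of 1 "p - 1"] by auto
  have w: "u \<in> word_alg n" if "u \<in> set (map P js)" "set js \<subseteq> {..p}" for u js
    using that P_word by auto
  have std: "T m \<in> Std2 n" if "1 \<le> m" "m \<le> p" for m using T_Std2[OF t rho that] .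
  have "act n (tl_prod n (map P ([1..<p + 1] @ rev [1..<p]))) (vts n t b) =
      act n (tl_prod n (map P [1..<p + 1])) (act n (tl_prod n (map P (rev [1..<p]))) (vts n t b))"
    unfolding map_append by (rule act_prod_append) (use P_word in auto)
  also have "act n (tl_prod n (map P (rev [1..<p]))) (vts n t b) = (\<lambda>w. ?up * vts n (T p) b w)"
    by (rule act_P_up) (use p std in auto)
  also have "act n (tl_prod n (map P [1..<p + 1])) (\<lambda>w. ?up * vts n (T p) b w) =
      (\<lambda>w. ?up * act n (tl_prod n (map P [1..<p + 1])) (vts n (T p) b) w)"
    by (rule act_scale)
  also have "act n (tl_prod n (map P [1..<p + 1])) (vts n (T p) b) =
      act n (tl_prod n (map P [1..<p])) (act n (P p) (vts n (T p) b))"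
  proof -
    have "act n (tl_prod n (map P [1..<p] @ [P p])) f = act n (tl_prod n (map P [1..<p])) (act n (tl_prod n [P p]) f)" for f
      by (rule act_prod_append) (use P_word in auto)
    then show ?thesis unfolding p1(1) using act_prod_single[OF P_word[OF order_refl]] by simp
  qed
  also have "\<dots> = act n (tl_prod n (map P [1..<p])) (\<lambda>w. (- delta p (int p * \<rho>)) ^ p * vts n (T p) b w +
      beta p (int p * \<rho>) ^ p * vts n (sw.T p) b w)"
  proof -
    \<comment> \<open>One \<open>\<Psi>_(p-1)\<close> is split off the descent to dispose of the
      mixed subsets and is then put back.\<close>
    have split: "act n (tl_prod n (map P [1..<p])) f = act n (tl_prod n (map P [1..<p - 1])) (act n (P (p - 1)) f)" for f
    proof -
      have "act n (tl_prod n (map P [1..<p - 1] @ [P (p - 1)])) f =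
          act n (tl_prod n (map P [1..<p - 1])) (act n (tl_prod n [P (p - 1)]) f)"
        by (rule act_prod_append) (use P_word in auto)
      then show ?thesis by (subst p1(2)) (simp add: act_prod_single[OF P_word])
    qed
    have "T p \<circ> swp (set (psi_pos c p p)) = sw.T p" unfolding T_last sw.T_def ..
    then show ?thesis
      unfolding split act_lin using act_P_last[OF std rho(1), of b] p by (simp add: act_lin)
  qed
  also have "\<dots> = (\<lambda>w. (- delta p (int p * \<rho>)) ^ p * ((\<Prod>m\<in>{1..<p}. beta p (- rdiff p \<rho> m) ^ m) * vts n t b w) +
      beta p (int p * \<rho>) ^ p * ((\<Prod>m\<in>{1..<p}. beta p (- rdiff p (- \<rho>) m) ^ m) * vts n ?t' b w))"
  proof -
    have "act n (tl_prod n (map P [1..<p])) (vts n (T p) b) = (\<lambda>w. (\<Prod>m\<in>{1..<p}. beta p (- rdiff p \<rho> m) ^ m) * vts n t b w)"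
      by (rule act_P_down) (use p std in auto)
    moreover have "act n (tl_prod n (map P [1..<p])) (vts n (sw.T p) b) = (\<lambda>w. (\<Prod>m\<in>{1..<p}. beta p (- rdiff p (- \<rho>) m) ^ m) * vts n ?t' b w)"
    proof -
      have "sw.T (Suc m) \<in> Std2 n" if "1 \<le> m" "m < p" for m
        unfolding sw.T_def by (rule swap_T_Std2[OF t rho]) (use that in auto)
      then show ?thesis using sw.act_P_down[of p b] p unfolding rho' by simp
    qed
    ultimately show ?thesis unfolding act_lin by simp
  qed
  finally have eq: "act n (tl_prod n (map P ([1..<p + 1] @ rev [1..<p]))) (vts n t b) =
    (\<lambda>w. ?up * ((- delta p (int p * \<rho>)) ^ p * ((\<Prod>m\<in>{1..<p}. beta p (- rdiff p \<rho> m) ^ m) * vts n t b w) +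
      beta p (int p * \<rho>) ^ p * ((\<Prod>m\<in>{1..<p}. beta p (- rdiff p (- \<rho>) m) ^ m) * vts n ?t' b w)))" .
  show ?thesis
    unfolding eq diagonal_coeff[OF p odd rho, symmetric] offdiag_def by (simp add: fun_eq_iff algebra_simps)
qed

text \<open>The very first exchange has difference \<open>rdiff p 1 1 = 1\<close>, so its
  \<open>\<beta>\<close> is 0. Then \<open>U_i\<close> acts as 0 and \<open>U_i - e\<close> as -1,
  in accordance with \<open>- 1 / \<rho>\<close>.\<close>

lemma act_exchange_trivial:
  assumes t: "t \<in> Std2 n" and rho: "\<rho> = 1"
  shows "act n (tl_prod n (map P ([1..<p + 1] @ rev [1..<p]))) (vts n t b) = (\<lambda>w. 0)"
proof -
  have p1: "[1..<p] = 1 # [2..<p]" using p upt_conv_Cons[of 1 p] by (simp add: numeral_2_eq_2)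
  have "P 1 \<in> word_alg n" using P_word[of 1] p by simp
  have "act n (tl_prod n (map P ([1..<p + 1] @ rev [2..<p]) @ [P 1])) (vts n t b) =
      act n (tl_prod n (map P ([1..<p + 1] @ rev [2..<p]))) (act n (tl_prod n [P 1]) (vts n t b))"
    by (rule act_prod_append) (use P_word p in auto)
  moreover have "map P ([1..<p + 1] @ rev [1..<p]) = map P ([1..<p + 1] @ rev [2..<p]) @ [P 1]"
    by (subst p1) simp
  moreover have "act n (tl_prod n [P 1]) (vts n t b) = (\<lambda>w. 0)"
    using act_prod_single[OF \<open>P 1 \<in> word_alg n\<close>] act_P[of 1 b] p t rho
    by (simp add: T_1 rdiff_def beta_def)
  ultimately show ?thesis by (simp only: act_zero_fun)
qed

end

section \<open>The class of the one-column tableau\<close>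

lemma cin_constant:
  assumes "1 \<le> a" "\<And>m. m < k \<Longrightarrow> a + m \<in> S \<longleftrightarrow> Q"
  shows "cin (a + k) S = cin a S + k * of_bool Q"
  using assms(2)
proof (induction k)
  case (Suc k)
  have "cin (a + Suc k) S = cin (a + k) S + of_bool (a + k \<in> S)"
    using cin_Suc[of "a + k" S] assms(1) by simp
  then show ?case using Suc.IH Suc.prems by simp
qed simp

lemma n2_bound:
  assumes n: "p \<le> n" shows "p - 1 + p * n2 p n \<le> n"
proof -
  have "p * n2 p n \<le> n - (p - 1)" unfolding n2_def by simp
  then show ?thesis using n by linarith
qed

locale class_tableau =
  fixes p n :: nat and t :: tableau
  assumes p: "3 \<le> p" and n: "p \<le> n" and t: "t \<in> tab_class p n"
begin

definition "S = col2 n t"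
definition "T = {j \<in> {1..n2 p n}. j * p \<in> S}"

lemma Std2: "t \<in> Std2 n"
  using t by (simp add: tab_class_def)

lemmas size = n2_bound[OF n]

lemma position:
  assumes "1 \<le> j" "j \<le> n2 p n" "m < p" shows "j * p + m \<in> {1..n}"
proof -
  have "j * p \<le> p * n2 p n" using assms(2) by (simp add: mult.commute)
  moreover have "1 \<le> j * p" using assms(1) p by simp
  ultimately show ?thesis using size assms(3) p unfolding atLeastAtMost_iff by linarith
qed

lemma content_class: "i \<in> {1..n} \<Longrightarrow> [content t i = 1 - int i] (mod int p)"
  using t by (auto simp: tab_class_def content_def one_col_def)

lemma cin_class:
  assumes "i \<in> {1..n}"
  shows "i \<in> S \<Longrightarrow> int p dvd int i - int (cin i S)" "i \<notin> S \<Longrightarrow> int p dvd int (cin i S)"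
  using content_class[OF assms] content_Std2[OF Std2 assms] by (simp_all add: S_def cong_iff_dvd_diff)

text \<open>If \<open>i\<close> and \<open>i + 1\<close> lay in different columns, the two
  congruences for the number of earlier second-column entries would add up to \<open>p\<close>
  dividing \<open>i + 1\<close>.\<close>

lemma same_column:
  assumes "1 \<le> i" "i < n" "\<not> p dvd Suc i" shows "Suc i \<in> S \<longleftrightarrow> i \<in> S"
proof (rule ccontr)
  assume ne: "\<not> ?thesis"
  have i: "i \<in> {1..n}" "Suc i \<in> {1..n}" using assms by auto
  note c = cin_class[OF i(1)] cin_class[OF i(2)] cin_Suc[OF assms(1), of S]
  have "int p dvd int (Suc i)"
  proof (cases "i \<in> S")
    case True
    then have "int p dvd int i - int (cin i S)" "int p dvd 1 + int (cin i S)" using c ne by auto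
    then have "int p dvd (int i - int (cin i S)) + (1 + int (cin i S))" by (rule dvd_add)
    then show ?thesis by (simp add: algebra_simps)
  next
    case False
    then have "int p dvd int (cin i S)" "int p dvd int (Suc i) - int (cin i S)" using c ne by auto
    then have "int p dvd int (cin i S) + (int (Suc i) - int (cin i S))" by (rule dvd_add)
    then show ?thesis by simp
  qed
  then show False using assms(3) by (simp only: int_dvd_int_iff)
qed

lemma block_column:
  assumes "1 \<le> j" "j \<le> n2 p n" "m < p" shows "j * p + m \<in> S \<longleftrightarrow> j \<in> T"
  using assms(3)
proof (induction m)
  case 0
  then show ?case using assms by (simp add: T_def)
next
  case (Suc m)
  have "\<not> p dvd Suc (j * p + m)"
    using Suc.prems dvd_add_right_iff[of p "j * p" "Suc m"] by (auto dest: dvd_imp_le)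
  then have "Suc (j * p + m) \<in> S \<longleftrightarrow> j * p + m \<in> S"
    using same_column[of "j * p + m"] position[OF assms(1,2), of m] position[OF assms(1,2), of "Suc m"] Suc.prems
    by simp
  then show ?case using Suc by simp
qed

text \<open>These \<open>p - 1\<close> entries precede all the blocks \<open>B_j\<close>; they
  follow the entry 1 into the first column.\<close>

lemma first_block: assumes "1 \<le> i" "i < p" shows "i \<notin> S"
  using assms
proof (induction i rule: dec_induct)
  case base
  then show ?case
    using ballotD[OF Std2_ballot[OF Std2], of 1] n cin_Suc[of 1 S] by (auto simp: S_def)
next
  case (step i)
  have "\<not> p dvd Suc i" using step by (auto dest: dvd_imp_le)
  then show ?case using same_column[of i] step n by simp
qed

lemma cin_block: "1 \<le> j \<Longrightarrow> j \<le> Suc (n2 p n) \<Longrightarrow> cin (j * p) S = p * cin j T"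
proof (induction j rule: dec_induct)
  case base
  have "cin (1 + (p - 1)) S = cin 1 S + (p - 1) * of_bool False"
    by (rule cin_constant) (use first_block in auto)
  then show ?case using p by simp
next
  case (step j)
  have "cin (j * p + p) S = cin (j * p) S + p * of_bool (j \<in> T)"
    by (rule cin_constant) (use block_column step p in auto)
  then show ?case using step cin_Suc[of j T] by (simp add: algebra_simps)
qed

lemma ballot_T: "ballot (n2 p n) T"
  unfolding ballot_iff
proof (intro conjI allI impI)
  show "T \<subseteq> {1..n2 p n}" by (auto simp: T_def)
  fix m assume m: "m \<le> n2 p n"
  have "Suc m * p - 1 \<le> n"
  proof -
    have "m * p \<le> p * n2 p n" using m by (simp add: mult.commute)
    moreover have "Suc m * p = m * p + p" by simp
    ultimately show ?thesis using size p by linarith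
  qed
  from ballotD[OF Std2_ballot[OF Std2] this] have "2 * cin (Suc m * p) S \<le> Suc m * p - 1"
    using p by (simp add: S_def)
  \<comment> \<open>The prefix ends just before a multiple of \<open>p\<close>, so the inequality is
    strict; divided by \<open>p\<close> it still yields the bound \<open>m\<close> instead of
    \<open>m + 1\<close>.\<close>
  then have "p * (2 * cin (Suc m) T) < p * Suc m"
    using cin_block[of "Suc m"] m p by (simp add: algebra_simps)
  then have "2 * cin (Suc m) T < Suc m" by (simp only: mult_less_cancel1)
  then show "2 * cin (Suc m) T \<le> m" by simp
qed

lemma f_tab_eq: "f_tab p n t = tab (n2 p n) T"
  unfolding f_tab_def
proof (rule the_equality)
  let ?N = "n2 p n"
  have blk: "(\<forall>b\<in>block p j. snd (t b) = 1) \<longleftrightarrow> j \<notin> T" if j: "j \<in> {1..?N}" for j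
  proof -
    have "block p j = (\<lambda>m. j * p + m) ` {..<p}"
    proof (intro equalityI subsetI)
      fix b assume "b \<in> block p j"
      then have "j * p \<le> b" "b - j * p < p" using p by (auto simp: block_def)
      then show "b \<in> (\<lambda>m. j * p + m) ` {..<p}" by (intro image_eqI[of _ _ "b - j * p"]) auto
    qed (use p in \<open>auto simp: block_def\<close>)
    moreover have "snd (t (j * p + m)) = 1 \<longleftrightarrow> j \<notin> T" if "m < p" for m
      using snd_Std2[OF Std2 position[of j m]] block_column[of j m] j that by (simp add: S_def)
    ultimately show ?thesis using p by (auto intro: exI[of _ 0])
  qed
  have col: "col2 ?N (tab ?N T) = T" by (rule col2_tab) (auto simp: T_def)
  show "tab ?N T \<in> Std2 ?N \<and> (\<forall>j\<in>{1..?N}. snd (tab ?N T j) = 1 \<longleftrightarrow> (\<forall>b\<in>block p j. snd (t b) = 1))"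
    using tab_Std2[OF ballot_T] snd_Std2[OF tab_Std2[OF ballot_T]] col blk by simp
  fix u assume u: "u \<in> Std2 ?N \<and> (\<forall>j\<in>{1..?N}. snd (u j) = 1 \<longleftrightarrow> (\<forall>b\<in>block p j. snd (t b) = 1))"
  have "j \<in> col2 ?N u \<longleftrightarrow> j \<in> T" for j
  proof (cases "j \<in> {1..?N}")
    case True
    then show ?thesis using u blk snd_Std2[of u ?N j] by blast
  qed (auto simp: col2_def T_def)
  then have "col2 ?N u = T" by blast
  then show "u = tab ?N T" using Std2_eq_tab u by metis
qed

lemma f_tab_Std2: "f_tab p n t \<in> Std2 (n2 p n)"
  unfolding f_tab_eq by (rule tab_Std2[OF ballot_T])

text \<open>A block fills consecutive rows of one column, so contents fall by 1 along it. Its first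
  content is \<open>1 + p * (content - 1)\<close> in either column: the second column starts with
  content 1, and in the first one the initial \<open>p - 1\<close> entries shift the start from 0 to
  \<open>1 - p\<close>.\<close>

lemma content_block:
  assumes "1 \<le> j" "j \<le> n2 p n" "m < p"
  shows "content t (j * p + m) = 1 - int m + int p * (content (f_tab p n t) j - 1)"
proof -
  have c: "cin (j * p + m) S = p * cin j T + m * of_bool (j \<in> T)"
    using cin_constant[of "j * p" m S "j \<in> T"] cin_block[of j] block_column[OF assms(1,2)] assms p by simp
  have "content (f_tab p n t) j = (if j \<in> T then 1 - int (cin j T) else int (cin j T) + 1 - int j)"
    unfolding f_tab_eq by (rule content_tab) (use assms in simp)
  then show ?thesis
    using content_Std2[OF Std2 position[OF assms]] block_column[OF assms] c
    by (simp add: S_def[symmetric] algebra_simps)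
qed

lemma rho_nonzero:
  assumes "1 \<le> i" "i < n2 p n"
  shows "content (f_tab p n t) i - content (f_tab p n t) (Suc i) \<noteq> 0"
proof -
  interpret sw: swap_setup "n2 p n" i "f_tab p n t" "content (f_tab p n t) i - content (f_tab p n t) (Suc i)"
    by unfold_locales (use assms f_tab_Std2 in simp_all)
  show ?thesis by (rule sw.r_bounds(3))
qed

lemma block_pair:
  assumes "1 \<le> i" "i < n2 p n"
  shows "block_pair n p (i * p) (content (f_tab p n t) i) (content (f_tab p n t) (Suc i)) t"
proof
  show "1 \<le> i * p" using assms p by simp
  have "Suc i * p \<le> p * n2 p n" using assms(2) by (metis Suc_leI mult.commute mult_le_mono2)
  then show "i * p + 2 * p \<le> n + 1" using size p by simp
  show "content t (i * p + m) = 1 - int m + int p * (content (f_tab p n t) i - 1)" if "m < p" for m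
    using content_block[of i m] assms that by simp
  show "content t (i * p + p + m) = 1 - int m + int p * (content (f_tab p n t) (Suc i) - 1)" if "m < p" for m
    using content_block[of "Suc i" m] assms that by (simp add: add.commute)
qed (rule p)

lemma block_swap_mult: "0 < p \<Longrightarrow> block_swap (i * p) p (j * p) = transpose i (Suc i) j * p"
proof -
  assume q: "0 < p"
  have "i * p \<le> j * p \<longleftrightarrow> i \<le> j" "j * p < Suc i * p \<longleftrightarrow> j < Suc i" "Suc i * p \<le> j * p \<longleftrightarrow> Suc i \<le> j"
    "j * p < Suc (Suc i) * p \<longleftrightarrow> j < Suc (Suc i)"
    using q by (simp_all only: mult_le_cancel2 mult_less_cancel2 simp_thms)
  moreover have "Suc i * p = i * p + p" "Suc (Suc i) * p = i * p + 2 * p" by simp_all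
  ultimately have "block_swap (i * p) p (j * p) = (if j = i then j * p + p else if j = Suc i then j * p - p else j * p)"
    unfolding block_swap_def by auto
  then show ?thesis by (simp add: transpose_def)
qed

text \<open>Standardness is the case \<open>j = 1\<close> of \<open>swap_T_Std2\<close>. Entries
  move by \<open>p\<close> or not at all, so the residues of the contents persist.\<close>

lemma exchange_class:
  assumes i: "1 \<le> i" "i < n2 p n"
    and rho: "\<rho> = content (f_tab p n t) i - content (f_tab p n t) (Suc i)" "\<rho> \<noteq> 1" "\<rho> \<noteq> -1"
  shows "t \<circ> block_swap (i * p) p \<in> tab_class p n"
proof -
  interpret bp: block_pair n p "i * p" "content (f_tab p n t) i" "content (f_tab p n t) (Suc i)" t
    by (rule block_pair[OF i])
  have r: "bp.\<rho> = \<rho>" by (simp add: bp.\<rho>_def rho)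
  have "(t \<circ> block_swap (i * p) p) \<circ> riffle (i * p) p 1 \<in> Std2 n"
    by (rule bp.swap_T_Std2[OF Std2]) (use rho_nonzero[OF i] rho p in \<open>simp_all add: r\<close>)
  then have std: "t \<circ> block_swap (i * p) p \<in> Std2 n" by (simp add: riffle_1)
  have "[content (t \<circ> block_swap (i * p) p) k = 1 - int k] (mod int p)" if k: "k \<in> {1..n}" for k
  proof -
    let ?k = "block_swap (i * p) p k"
    have "block_swap a p k \<in> {1..n}" if "1 \<le> a" "a + 2 * p \<le> n + 1" for a
      using that k by (auto simp: block_swap_def)
    from this[OF bp.c] have "?k \<in> {1..n}" .
    then have "[content t ?k = 1 - int ?k] (mod int p)" by (rule content_class)
    moreover have "[1 - int ?k = 1 - int k] (mod int p)"
      by (auto simp: block_swap_def cong_iff_dvd_diff of_nat_diff)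
    ultimately show ?thesis unfolding content_comp by (rule cong_trans)
  qed
  then show ?thesis using std by (auto simp: tab_class_def content_def one_col_def)
qed

end

lemma content_exchange:
  assumes t: "class_tableau p n t" and t': "class_tableau p n (t \<circ> block_swap (i * p) p)"
    and i: "1 \<le> i" "i < n2 p n" and j: "1 \<le> j" "j \<le> n2 p n"
  shows "content (f_tab p n (t \<circ> block_swap (i * p) p)) j = content (f_tab p n t) (transpose i (Suc i) j)"
proof -
  have p: "0 < p" using class_tableau.p[OF t] by simp
  let ?j = "transpose i (Suc i) j"
  have j': "1 \<le> ?j" "?j \<le> n2 p n" using i j by (auto simp: transpose_def)
  have "content (t \<circ> block_swap (i * p) p) (j * p) = content t (?j * p)"
    unfolding content_comp class_tableau.block_swap_mult[OF t p] ..
  then show ?thesis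
    using class_tableau.content_block[OF t' j, of 0] class_tableau.content_block[OF t j', of 0] p by simp
qed

section \<open>The embedded Jucys--Murphy elements\<close>

lemma e_class_word: "e_class p n \<in> word_alg n"
  unfolding e_class_def by (intro word_alg_sum idem_word)

lemma act_e_class:
  assumes s: "s \<in> Std2 n"
  shows "act n (e_class p n) (vts n s b) = (if s \<in> tab_class p n then vts n s b else (\<lambda>w. 0))"
proof
  fix w
  have sub: "tab_class p n \<subseteq> Std2 n" by (auto simp: tab_class_def)
  have "act n (e_class p n) (vt n s b) w = (\<Sum>t\<in>tab_class p n. act n (idem n t) (vt n s b) w)"
    unfolding e_class_def act_sum_left sum_fun_apply ..
  also have "\<dots> = (\<Sum>t\<in>tab_class p n. if s = t then vt n s b w else 0)"
    by (rule sum.cong[OF refl], subst act_idem[OF s]) (use sub in auto)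
  also have "\<dots> = (if s \<in> tab_class p n then vt n s b w else 0)"
    using finite_subset[OF sub finite_Std2] by simp
  finally show "act n (e_class p n) (vts n s b) w = (if s \<in> tab_class p n then vts n s b else (\<lambda>w. 0)) w"
    by (simp add: vts_def act_scale)
qed

text \<open>The index formulas differ in the order of truncated subtractions; \<open>1 <= i\<close>
  makes \<open>(i + 1) * p - 1\<close> large enough that nothing is cut off.\<close>

lemma Psi_eq:
  assumes "1 \<le> i" "j \<le> p"
  shows "Psi p n i j = tl_prod n (map (psi p n) (psi_pos (i * p) p j))"
proof -
  have "(i + 1) * p - 1 - j + 1 + 2 * m = i * p + p - j + 2 * m" if "m < j" for m
  proof -
    have "p \<le> i * p" using assms(1) by simp
    moreover have "(i + 1) * p = i * p + p" by simp
    ultimately have "(i + 1) * p - 1 - j + 1 = i * p + p - j" using assms(2) that by linarith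
    then show ?thesis by simp
  qed
  then have "map (\<lambda>m. psi p n ((i + 1) * p - 1 - j + 1 + 2 * m)) [0..<j] = map (psi p n) (psi_pos (i * p) p j)"
    unfolding psi_pos_def map_map by (intro map_cong) auto
  then show ?thesis unfolding Psi_def Let_def by (simp only:)
qed

locale klr_class =
  fixes p n :: nat
  assumes p: "3 \<le> p" and odd: "odd p" and n: "p \<le> n"
begin

lemma class_tableau: "t \<in> tab_class p n \<Longrightarrow> class_tableau p n t"
  using p n by unfold_locales

definition "cc t j = content (f_tab p n t) j"

definition "xprod i = tl_prod n (map (Psi p n i) ([1..<p + 1] @ rev [1..<p]))"

lemma klr_U_eq: "klr_U p n i = e_class p n \<cdot> xprod i \<cdot> e_class p n"
  by (simp only: klr_U_def xprod_def)

lemmas size = n2_bound[OF n]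

lemma xprod_word:
  assumes "1 \<le> i" "i < n2 p n" shows "xprod i \<in> word_alg n"
  unfolding xprod_def
proof (rule word_alg_prod)
  fix x assume "x \<in> set (map (Psi p n i) ([1..<p + 1] @ rev [1..<p]))"
  then obtain j where "j \<in> set ([1..<p + 1] @ rev [1..<p])" and x: "x = Psi p n i j"
    unfolding set_map by blast
  then have j: "j \<le> p" by auto
  have "Suc i * p \<le> p * n2 p n" using assms(2) by (metis Suc_leI mult.commute mult_le_mono2)
  moreover have "p \<le> i * p" using assms(1) by simp
  moreover have "1 \<le> k \<and> k < n" if "k \<in> set (psi_pos a p j)" "p \<le> a" "a + 2 * p \<le> n + 1" for a k
    using that j p by (auto simp: set_psi_pos)
  ultimately have "1 \<le> k \<and> k < n" if "k \<in> set (psi_pos (i * p) p j)" for k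
    using that size by simp
  then show "x \<in> word_alg n"
    unfolding x Psi_eq[OF assms(1) j] by (auto intro!: word_alg_prod psi_word)
qed

lemma klr_U_word: "1 \<le> i \<Longrightarrow> i < n2 p n \<Longrightarrow> klr_U p n i \<in> word_alg n"
  unfolding klr_U_eq by (intro word_alg_mult e_class_word xprod_word)

lemma act_klr_U:
  "1 \<le> i \<Longrightarrow> i < n2 p n \<Longrightarrow> act n (klr_U p n i) f = act n (e_class p n) (act n (xprod i) (act n (e_class p n) f))"
  unfolding klr_U_eq by (simp add: act_mult word_alg_mult e_class_word xprod_word)

text \<open>The left factor \<open>e\<close> matters only for the exchanged tableau. For
  \<open>\<rho>\<close> other than 1 and -1 this lies in the class; for \<open>\<rho> = 1\<close>
  the whole product acts as 0, and for \<open>\<rho> = -1\<close> the coefficient contains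
  \<open>beta p (-1) = 0\<close>.\<close>

lemma act_klr_reflection:
  assumes i: "1 \<le> i" "i < n2 p n" and t: "t \<in> tab_class p n" and rho: "\<rho> = cc t i - cc t (Suc i)"
  shows "act n (klr_U p n i - e_class p n) (vts n t b) =
    (\<lambda>w. (- 1 / of_int \<rho>) * vts n t b w + (if \<rho> = 1 then 0 else offdiag p \<rho>) * vts n (t \<circ> block_swap (i * p) p) b w)"
proof -
  interpret ct: class_tableau p n t by (rule class_tableau[OF t])
  interpret bp: block_pair n p "i * p" "content (f_tab p n t) i" "content (f_tab p n t) (Suc i)" t
    by (rule ct.block_pair[OF i])
  let ?t' = "t \<circ> block_swap (i * p) p"
  have r: "bp.\<rho> = \<rho>" by (simp add: bp.\<rho>_def rho cc_def)
  have r0: "\<rho> \<noteq> 0" using ct.rho_nonzero[OF i] by (simp add: rho cc_def)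
  have "map (Psi p n i) ([1..<p + 1] @ rev [1..<p]) = map bp.P ([1..<p + 1] @ rev [1..<p])"
    by (rule map_cong[OF refl], subst Psi_eq[OF i(1)]) (auto simp: bp.P_def)
  then have x: "xprod i = tl_prod n (map bp.P ([1..<p + 1] @ rev [1..<p]))" by (simp only: xprod_def)
  have e: "act n (e_class p n) (vts n t b) = vts n t b" using act_e_class[OF ct.Std2] t by simp
  have U: "act n (klr_U p n i) (vts n t b) = act n (e_class p n) (act n (xprod i) (vts n t b))"
    using act_klr_U[OF i] e by simp
  show ?thesis
  proof (cases "\<rho> = 1")
    case True
    have X: "act n (xprod i) (vts n t b) = (\<lambda>w. 0)"
      unfolding x using bp.act_exchange_trivial[OF ct.Std2] True r by simp
    then show ?thesis unfolding act_diff_left U e X act_zero_fun using True by (simp add: fun_eq_iff)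
  next
    case False
    have "act n (xprod i) (vts n t b) = (\<lambda>w. (1 - 1 / of_int \<rho>) * vts n t b w + offdiag p \<rho> * vts n ?t' b w)"
      unfolding x using bp.act_exchange[OF ct.Std2 _ _ odd] r0 False unfolding r by blast
    then have "act n (klr_U p n i) (vts n t b) =
        (\<lambda>w. (1 - 1 / of_int \<rho>) * vts n t b w + offdiag p \<rho> * act n (e_class p n) (vts n ?t' b) w)"
      unfolding U using e by (simp only: act_lin)
    moreover have "offdiag p \<rho> * act n (e_class p n) (vts n ?t' b) w = offdiag p \<rho> * vts n ?t' b w" for w
    proof (cases "\<rho> = -1")
      case True
      have "beta p (- rdiff p (- \<rho>) 1) = 0" by (simp add: True rdiff_def beta_def)
      then have "(\<Prod>j\<in>{1..<p}. beta p (- rdiff p (- \<rho>) j) ^ j) = 0"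
        using p by (intro prod_zero bexI[of _ 1]) auto
      then have "offdiag p \<rho> = 0" by (simp only: offdiag_def mult_zero_right)
      then show ?thesis by (simp only: mult_zero_left)
    next
      case rm: False
      have "?t' \<in> tab_class p n"
        by (rule ct.exchange_class[OF i _ False rm]) (simp add: rho cc_def)
      then show ?thesis
        using act_e_class[of ?t' n p b] by (auto simp: tab_class_def)
    qed
    ultimately show ?thesis unfolding act_diff_left e using False by (simp add: fun_eq_iff algebra_simps)
  qed
qed

lemma block_swap_involution: "t \<circ> block_swap c p \<circ> block_swap c p = t"
  by (auto simp: fun_eq_iff block_swap_def)

text \<open>Outside the class both \<open>U_i\<close> and \<open>e\<close> act as 0; recording this
  gives the eigenvalues on a whole basis, as the comparison of elements by their action requires.
  For \<open>\<rho> = 1\<close> and \<open>\<rho> = -1\<close> the off-diagonal coefficient vanishes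
  and \<open>jm_step\<close> is used in its one-dimensional case.\<close>

lemma klr_jm_action:
  assumes "1 \<le> i" "i \<le> n2 p n"
  shows "klr_jm p n i \<in> word_alg n \<and>
    (\<forall>t\<in>Std2 n. \<forall>b. act n (klr_jm p n i) (vts n t b) = (\<lambda>w. (if t \<in> tab_class p n then of_int (cc t i) else 0) * vts n t b w))"
  using assms
proof (induction i rule: dec_induct)
  case base
  have "cc t 1 = 0" if "t \<in> tab_class p n" for t
    unfolding cc_def by (rule content_first[OF class_tableau.f_tab_Std2[OF class_tableau[OF that]]]) (use base in simp)
  then show ?case by (auto simp: act_zero_left)
next
  case (step i)
  let ?L = "klr_jm p n i" and ?S = "klr_U p n i - e_class p n"
  have i: "1 \<le> i" "i < n2 p n" using step by auto
  have L: "?L \<in> word_alg n"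
    "\<And>t b. t \<in> Std2 n \<Longrightarrow> act n ?L (vts n t b) = (\<lambda>w. (if t \<in> tab_class p n then of_int (cc t i) else 0) * vts n t b w)"
    using step.IH i by auto
  have S: "?S \<in> word_alg n" by (intro word_alg_diff klr_U_word[OF i] e_class_word)
  have eq: "klr_jm p n (Suc i) = ?S \<cdot> ?L \<cdot> ?S + ?S"
    using i by (cases i) simp_all
  show ?case
    unfolding eq
  proof (intro conjI ballI allI)
    show "?S \<cdot> ?L \<cdot> ?S + ?S \<in> word_alg n" by (intro word_alg_add word_alg_mult S L(1))
    fix t b assume t: "t \<in> Std2 n"
    show "act n (?S \<cdot> ?L \<cdot> ?S + ?S) (vts n t b) =
      (\<lambda>w. (if t \<in> tab_class p n then of_int (cc t (Suc i)) else 0) * vts n t b w)"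
    proof (cases "t \<in> tab_class p n")
      case False
      have e: "act n (e_class p n) (vts n t b) = (\<lambda>w. 0)" using act_e_class[OF t] False by simp
      have "act n ?S (vts n t b) = (\<lambda>w. 0)"
        unfolding act_diff_left act_klr_U[OF i] e by (simp add: act_zero_fun zero_fun_def)
      then have "act n (?S \<cdot> ?L \<cdot> ?S + ?S) (vts n t b) = (\<lambda>w. 0)"
        by (simp add: act_add_left act_mult[OF word_alg_mult[OF S L(1)] S] act_zero_fun zero_fun_def)
      then show ?thesis using False by simp
    next
      case True
      define \<rho> where "\<rho> = cc t i - cc t (Suc i)"
      let ?t' = "t \<circ> block_swap (i * p) p"
      have r0: "\<rho> \<noteq> 0"
        unfolding \<rho>_def cc_def by (rule class_tableau.rho_nonzero[OF class_tableau[OF True] i])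
      have "act n (?S \<cdot> ?L \<cdot> ?S + ?S) (vts n t b) = (\<lambda>w. of_int (cc t (Suc i)) * vts n t b w)"
      proof (rule jm_step[OF S L(1) act_klr_reflection[OF i True \<rho>_def]])
        show "act n ?L (vts n t b) = (\<lambda>w. of_int (cc t i) * vts n t b w)" using L(2)[OF t] True by simp
        show "of_int \<rho> = of_int (cc t i) - (of_int (cc t (Suc i)) :: rat)" by (simp add: \<rho>_def)
        show "(of_int \<rho> :: rat) \<noteq> 0" using r0 by simp
        show "((if \<rho> = 1 then 0 else offdiag p \<rho>) = 0 \<and> (of_int \<rho> :: rat)\<^sup>2 = 1) \<or>
          (act n ?S (vts n ?t' b) = (\<lambda>w. (1 / of_int \<rho>) * vts n ?t' b w + offdiag p (- \<rho>) * vts n t b w) \<and>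
           act n ?L (vts n ?t' b) = (\<lambda>w. of_int (cc t (Suc i)) * vts n ?t' b w) \<and>
           (if \<rho> = 1 then 0 else offdiag p \<rho>) * offdiag p (- \<rho>) = 1 - 1 / (of_int \<rho>)\<^sup>2)"
        proof (cases "\<rho> = 1 \<or> \<rho> = -1")
          case r: True
          have "offdiag p (-1) = 0"
          proof -
            have "beta p (- rdiff p 1 1) = 0" by (simp add: rdiff_def beta_def)
            then have "(\<Prod>j\<in>{1..<p}. beta p (- rdiff p 1 j) ^ j) = 0"
              using p by (intro prod_zero bexI[of _ 1]) auto
            then show ?thesis by (simp add: offdiag_def)
          qed
          then show ?thesis using r by auto
        next
          case False
          then have r: "\<rho> \<noteq> 1" "\<rho> \<noteq> -1" by auto
          have t': "?t' \<in> tab_class p n"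
            by (rule class_tableau.exchange_class[OF class_tableau[OF True] i _ r]) (simp add: \<rho>_def cc_def)
          have c: "cc ?t' i = cc t (Suc i)" "cc ?t' (Suc i) = cc t i"
            unfolding cc_def using content_exchange[OF class_tableau[OF True] class_tableau[OF t'] i, of i]
              content_exchange[OF class_tableau[OF True] class_tableau[OF t'] i, of "Suc i"] i by simp_all
          have "- \<rho> = cc ?t' i - cc ?t' (Suc i)" using c by (simp add: \<rho>_def)
          from act_klr_reflection[OF i t' this, of b]
          have "act n ?S (vts n ?t' b) = (\<lambda>w. (1 / of_int \<rho>) * vts n ?t' b w + offdiag p (- \<rho>) * vts n t b w)"
            unfolding block_swap_involution using r(2) by (simp add: minus_equation_iff[of \<rho>] del: comp_apply)
          moreover have "act n ?L (vts n ?t' b) = (\<lambda>w. of_int (cc t (Suc i)) * vts n ?t' b w)"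
            using L(2)[of ?t' b] t' c(1) by (simp add: tab_class_def)
          moreover have "(if \<rho> = 1 then 0 else offdiag p \<rho>) * offdiag p (- \<rho>) = 1 - 1 / (of_int \<rho>)\<^sup>2"
            using offdiag_prod[OF p odd r0 r] r(1) by simp
          ultimately show ?thesis by blast
        qed
      qed
      then show ?thesis using True by simp
    qed
  qed
qed

end

theorem corollary6p9:
  fixes p n i :: nat and \<tt> \<ss> :: tableau
  assumes "prime p" and "odd p" and "p \<le> n" and "1 < n2 p n"
    and "\<tt> \<in> tab_class p n"
    and "\<ss> = f_tab p n \<tt>"
    and "i \<in> {1..n2 p n}"
  shows "klr_jm p n i \<cdot> idem n \<tt> = idem n \<tt> \<cdot> klr_jm p n i \<and>
         idem n \<tt> \<cdot> klr_jm p n i = of_int (content \<ss> i) \<odot> idem n \<tt>"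
proof -
  have "p \<noteq> 2" using assms(2) by auto
  then have p: "3 \<le> p" using prime_ge_2_nat[OF assms(1)] by simp
  interpret klr_class p n using p assms(2,3) by unfold_locales
  let ?L = "klr_jm p n i" and ?E = "idem n \<tt>" and ?c = "of_int (content \<ss> i) :: rat"
  have t: "\<tt> \<in> Std2 n" using assms(5) by (simp add: tab_class_def)
  have L: "?L \<in> word_alg n" using klr_jm_action[of i] assms(7) by simp
  \<comment> \<open>Eigenvalues do not depend on the normalisation, so the rescaling can be
    undone.\<close>
  obtain d where d: "\<And>s b. s \<in> Std2 n \<Longrightarrow> act n ?L (vt n s b) = (\<lambda>w. d s * vt n s b w)" "d \<tt> = ?c"
  proof
    let ?d = "\<lambda>s. if s \<in> tab_class p n then of_int (cc s i) else 0 :: rat"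
    show "?d \<tt> = ?c" using assms(5,6) by (simp add: cc_def)
    fix s b assume s: "s \<in> Std2 n"
    have "vt n s b = (\<lambda>w. 1 / sn_g n s * vts n s b w)" using sn_nonzero(1)[OF s] by (simp add: vts_def)
    moreover have "act n ?L (vts n s b) = (\<lambda>w. ?d s * vts n s b w)"
      using klr_jm_action[of i] assms(7) s by simp
    ultimately show "act n ?L (vt n s b) = (\<lambda>w. ?d s * vt n s b w)"
      by (simp only: act_scale) (simp add: mult_ac)
  qed
  have TL: "?L \<cdot> ?E \<in> TL n" "?E \<cdot> ?L \<in> TL n" "?c \<odot> ?E \<in> TL n"
    by (intro word_alg_TL word_alg_mult word_alg_scale idem_word L)+
  \<comment> \<open>Both products are diagonal on the vectors \<open>vt n s b\<close>, with value 0
    unless \<open>s\<close> is the given tableau; equality on all of them is equality of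
    elements.\<close>
  have "act n (?L \<cdot> ?E) (vt n s b) = act n (?c \<odot> ?E) (vt n s b)"
    "act n (?E \<cdot> ?L) (vt n s b) = act n (?c \<odot> ?E) (vt n s b)" if s: "s \<in> Std2 n" for s b
    using act_idem[OF s t, of b] d(1)[OF s, of b] d(1)[OF t, of b] d(2)
    by (simp_all add: act_mult[OF L idem_word] act_mult[OF idem_word L] act_scale_left act_scale act_zero_fun)
  then have "?L \<cdot> ?E = ?c \<odot> ?E" "?E \<cdot> ?L = ?c \<odot> ?E"
    using act_vt_eqI[OF TL(1,3)] act_vt_eqI[OF TL(2,3)] by blast+
  then show ?thesis by simp
qed

end
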